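(* Let $A$ be a basic finite-dimensional algebra over a field $\mathbb{K}$, $E$ a basic generating-cogenerating $A$-module, and $\Gamma\cong\operatorname{End}_A(E)^{\mathrm{op}}$, and let $0<k<\operatorname{domdim}\Gamma$. Let $T_k,C^k$ be the $k$-shifted and $k$-coshifted modules of $\Gamma$, let $B_k,B^k$ be the corresponding $k$-shifted and $k$-coshifted algebras, and denote by $c_k$ and $c^k$ the intermediate extension functors from $A$-modules to $B_k$-modules and to $B^k$-modules respectively. Then $$c_k(E)\cong DT_k,\qquad c^k(E)\cong DC^k$$ as $B_k$-modules and $B^k$-modules respectively.
   Context: Modules are finitely generated left modules; morphisms are composed right-to-left; $D=\operatorname{Hom}_{\mathbb{K}}(-,\mathbb{K})$. $E$ is generating-cogenerating if $A\in\operatorname{add}E$ and $DA\in\operatorname{add}E$; then $\operatorname{domdim}\Gamma\geq2$. Dominant dimension: $\operatorname{domdim}\Gamma\geq k$ if ${}_\Gamma\Gamma$ has an injective resolution whose first $k$ terms are projective-injective. For $k\geq0$, a $\Gamma$-module $T$ is $k$-tilting if $\operatorname{pdim}T\leq k$, $\operatorname{Ext}^i_\Gamma(T,T)=0$ for $i>0$, and there is an exact sequence $0\to\Gamma\to t_0\to\cdots\to t_k\to0$ with all $t_j\in\operatorname{add}T$ ( * ). It is $P$-special, for $P$ projective, if $P\in\operatorname{add}T$ and there is a sequence ( * ) with $t_j\in\operatorname{add}P$ for $0\leq j\leq k-1$. Dually, $C$ is $k$-cotilting if $\operatorname{idim}C\leq k$, $\operatorname{Ext}^i_\Gamma(C,C)=0$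 for $i>0$, and there is an exact sequence $0\to c^k\to\cdots\to c^0\to D\Gamma\to0$ with all $c^j\in\operatorname{add}C$ ( ** ). It is $I$-special, for $I$ injective, if $I\in\operatorname{add}C$ and there is a sequence ( ** ) with $c^j\in\operatorname{add}I$ for $0\leq j\leq k-1$. Let $\Pi$ be the maximal projective-injective summand of the basic algebra $\Gamma$. For $0\leq k\leq\operatorname{domdim}\Gamma$ there are, unique up to isomorphism, a basic $\Pi$-special $k$-tilting module $T_k$ and a basic $\Pi$-special $k$-cotilting module $C^k$, called the $k$-shifted and $k$-coshifted modules; each has $\Pi$ as a summand. Put $B_k=\operatorname{End}_\Gamma(T_k)^{\mathrm{op}}$, $B^k=\operatorname{End}_\Gamma(C^k)^{\mathrm{op}}$. Let $e_k\in B_k$, $e^k\in B^k$ be the idempotents given by projection onto $\Pi$. By the Morita--Tachikawa correspondence we may identify $A=\operatorname{End}_\Gamma(\Pi)^{\mathrm{op}}$ and $E=D\Pi$, so $e_kB_ke_k\cong A\cong e^kB^ke^k$. Intermediate extension: for a finite-dimensional algebra $B$, an idempotent $e\in B$ and $A=eBe$, the functor $M\mapsto eM$ from $B$-modules to $A$-modules has left adjoint $\ell=Be\otimes_A-$ and right adjoint $r=\operatorname{Hom}_A(eB,-)$. There is a canonical natural map $\zeta_M:\ell M\to rM$ corresponding to $\mathrm{id}_M$ under $\operatorname{Hom}_B(\ell M,rM)\cong\operatorname{Hom}_A(M,M)$ (explicitly $be\otimes m\mapsto(eb'\mapsto eb'be\cdot m)$). The intermediate extension functor is $c(M)=\operatorname{im}\zeta_M$.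 The functors $c_k$ and $c^k$ are those for $(B,e)=(B_k,e_k)$ and $(B,e)=(B^k,e^k)$. *)

theory Defs
  imports "HOL-Algebra.Module" "HOL-Algebra.QuotRing" "HOL-Algebra.Free_Abelian_Groups"
    "HOL-Library.Extended_Nat"
begin

text \<open>
  A \<open>K\<close>-algebra \<open>A\<close> is a record of type \<open>('k, 'a) module\<close>, where \<open>smult\<close> is the action of \<open>K\<close>;
  an \<open>A\<close>-module is a record of type \<open>('a, 'm) module\<close>, whose fields \<open>mult\<close> and \<open>one\<close> are
  irrelevant. The library locales \<open>module\<close> and \<open>algebra\<close> require commutative rings.
  Right \<open>A\<close>-modules are left modules over \<open>op_alg A\<close>.
\<close>

locale left_module = R?: ring R + M?: abelian_group M
  for R :: "('a, 'r) ring_scheme" (structure) and M :: "('a, 'm, 't) module_scheme" (structure) +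
  assumes smult_closed:
      "\<lbrakk>a \<in> carrier R; x \<in> carrier M\<rbrakk> \<Longrightarrow> a \<odot>\<^bsub>M\<^esub> x \<in> carrier M"
    and smult_l_distr:
      "\<lbrakk>a \<in> carrier R; b \<in> carrier R; x \<in> carrier M\<rbrakk>
        \<Longrightarrow> (a \<oplus> b) \<odot>\<^bsub>M\<^esub> x = a \<odot>\<^bsub>M\<^esub> x \<oplus>\<^bsub>M\<^esub> b \<odot>\<^bsub>M\<^esub> x"
    and smult_r_distr:
      "\<lbrakk>a \<in> carrier R; x \<in> carrier M; y \<in> carrier M\<rbrakk>
        \<Longrightarrow> a \<odot>\<^bsub>M\<^esub> (x \<oplus>\<^bsub>M\<^esub> y) = a \<odot>\<^bsub>M\<^esub> x \<oplus>\<^bsub>M\<^esub> a \<odot>\<^bsub>M\<^esub> y"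
    and smult_assoc1:
      "\<lbrakk>a \<in> carrier R; b \<in> carrier R; x \<in> carrier M\<rbrakk>
        \<Longrightarrow> (a \<otimes> b) \<odot>\<^bsub>M\<^esub> x = a \<odot>\<^bsub>M\<^esub> (b \<odot>\<^bsub>M\<^esub> x)"
    and smult_one:
      "x \<in> carrier M \<Longrightarrow> \<one> \<odot>\<^bsub>M\<^esub> x = x"

definition fin_gen :: "('r, 's) ring_scheme \<Rightarrow> ('r, 'm, 't) module_scheme \<Rightarrow> bool" where
  "fin_gen R M \<longleftrightarrow> (\<exists>S. finite S \<and> S \<subseteq> carrier M \<and>
     (\<forall>m \<in> carrier M. \<exists>c \<in> S \<rightarrow> carrier R. m = (\<Oplus>\<^bsub>M\<^esub>s\<in>S. c s \<odot>\<^bsub>M\<^esub> s)))"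

definition fg_module :: "('r, 's) ring_scheme \<Rightarrow> ('r, 'm, 't) module_scheme \<Rightarrow> bool" where
  "fg_module R M \<longleftrightarrow> left_module R M \<and> fin_gen R M"

locale fd_algebra = K: field K + A: ring A + Module.module K A
  for K :: "'k ring" and A :: "('k, 'a) module" +
  assumes smult_mult_left:
      "\<lbrakk>c \<in> carrier K; x \<in> carrier A; y \<in> carrier A\<rbrakk>
        \<Longrightarrow> c \<odot>\<^bsub>A\<^esub> (x \<otimes>\<^bsub>A\<^esub> y) = (c \<odot>\<^bsub>A\<^esub> x) \<otimes>\<^bsub>A\<^esub> y"
    and smult_mult_right:
      "\<lbrakk>c \<in> carrier K; x \<in> carrier A; y \<in> carrier A\<rbrakk>
        \<Longrightarrow> c \<odot>\<^bsub>A\<^esub> (x \<otimes>\<^bsub>A\<^esub> y) = x \<otimes>\<^bsub>A\<^esub> (c \<odot>\<^bsub>A\<^esub> y)"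
    and finite_dim: "fin_gen K A"

definition alg_iso :: "'k ring \<Rightarrow> ('k, 'a) module \<Rightarrow> ('k, 'b) module \<Rightarrow> ('a \<Rightarrow> 'b) set" where
  "alg_iso K A B = {h \<in> ring_iso A B.
     \<forall>c \<in> carrier K. \<forall>a \<in> carrier A. h (c \<odot>\<^bsub>A\<^esub> a) = c \<odot>\<^bsub>B\<^esub> h a}"

definition op_alg :: "('k, 'a) module \<Rightarrow> ('k, 'a) module" where
  "op_alg A = A\<lparr>monoid.mult := \<lambda>a b. b \<otimes>\<^bsub>A\<^esub> a\<rparr>"

definition regular :: "('r, 's) ring_scheme \<Rightarrow> ('r, 'r) module" where
  "regular R = \<lparr>carrier = carrier R, monoid.mult = monoid.mult R, monoid.one = monoid.one R,
     ring.zero = ring.zero R, ring.add = ring.add R, smult = monoid.mult R\<rparr>"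

text \<open>Homomorphisms are extensional functions, so that equality in Hom-sets is equality in HOL.\<close>

definition mod_hom :: "('r, 's) ring_scheme \<Rightarrow> ('r, 'm, 't) module_scheme \<Rightarrow>
    ('r, 'n, 'u) module_scheme \<Rightarrow> ('m \<Rightarrow> 'n) set" where
  "mod_hom R M N = {f \<in> carrier M \<rightarrow>\<^sub>E carrier N.
     (\<forall>x \<in> carrier M. \<forall>y \<in> carrier M. f (x \<oplus>\<^bsub>M\<^esub> y) = f x \<oplus>\<^bsub>N\<^esub> f y) \<and>
     (\<forall>a \<in> carrier R. \<forall>x \<in> carrier M. f (a \<odot>\<^bsub>M\<^esub> x) = a \<odot>\<^bsub>N\<^esub> f x)}"

definition mod_iso :: "('r, 's) ring_scheme \<Rightarrow> ('r, 'm, 't) module_scheme \<Rightarrow>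
    ('r, 'n, 'u) module_scheme \<Rightarrow> bool" where
  "mod_iso R M N \<longleftrightarrow> (\<exists>f \<in> mod_hom R M N. bij_betw f (carrier M) (carrier N))"

definition trivial_module :: "('r, 'm) module \<Rightarrow> bool" where
  "trivial_module M \<longleftrightarrow> carrier M = {\<zero>\<^bsub>M\<^esub>}"

definition restrict_scalars :: "('s \<Rightarrow> 'r) \<Rightarrow> ('r, 'm) module \<Rightarrow> ('s, 'm) module" where
  "restrict_scalars h M = \<lparr>carrier = carrier M, monoid.mult = monoid.mult M, monoid.one = monoid.one M,
     ring.zero = ring.zero M,
     ring.add = ring.add M, smult = \<lambda>s x. h s \<odot>\<^bsub>M\<^esub> x\<rparr>"

definition underlying_space :: "('k, 'a) module \<Rightarrow> ('a, 'm) module \<Rightarrow> ('k, 'm) module" where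
  "underlying_space A M = restrict_scalars (\<lambda>c. c \<odot>\<^bsub>A\<^esub> \<one>\<^bsub>A\<^esub>) M"

text \<open>
  The \<open>K\<close>-dual of a left \<open>A\<close>-module \<open>M\<close>, with action \<open>(a f)(m) = f (a m)\<close>; it is a left module
  over \<open>op_alg A\<close>. Since \<open>op_alg (op_alg A) = A\<close>, the dual of a right \<open>A\<close>-module \<open>N\<close> is the left
  \<open>A\<close>-module \<open>dual K (op_alg A) N\<close>.
\<close>

definition dual :: "'k ring \<Rightarrow> ('k, 'a) module \<Rightarrow> ('a, 'm) module \<Rightarrow> ('a, 'm \<Rightarrow> 'k) module" where
  "dual K A M = \<lparr>carrier = mod_hom K (underlying_space A M) (regular K),
     monoid.mult = undefined, monoid.one = undefined,
     ring.zero = (\<lambda>m \<in> carrier M. \<zero>\<^bsub>K\<^esub>),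
     ring.add = (\<lambda>f g. \<lambda>m \<in> carrier M. f m \<oplus>\<^bsub>K\<^esub> g m),
     smult = (\<lambda>a f. \<lambda>m \<in> carrier M. f (a \<odot>\<^bsub>M\<^esub> m))\<rparr>"

text \<open>The left \<open>A\<close>-module \<open>DA\<close>, i.e. the dual of the right regular module.\<close>

definition dual_regular :: "'k ring \<Rightarrow> ('k, 'a) module \<Rightarrow> ('a, 'a \<Rightarrow> 'k) module" where
  "dual_regular K A = dual K (op_alg A) (regular (op_alg A))"

text \<open>The \<open>K\<close>-algebra \<open>End\<^sub>A(M)\<^sup>o\<^sup>p\<close>: the product of \<open>f\<close> and \<open>g\<close> is \<open>g \<circ> f\<close>.\<close>

definition end_op :: "('k, 'a) module \<Rightarrow> ('a, 'm) module \<Rightarrow> ('k, 'm \<Rightarrow> 'm) module" where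
  "end_op A M = \<lparr>carrier = mod_hom A M M,
     monoid.mult = (\<lambda>f g. compose (carrier M) g f),
     monoid.one = (\<lambda>m \<in> carrier M. m),
     ring.zero = (\<lambda>m \<in> carrier M. \<zero>\<^bsub>M\<^esub>),
     ring.add = (\<lambda>f g. \<lambda>m \<in> carrier M. f m \<oplus>\<^bsub>M\<^esub> g m),
     smult = (\<lambda>c f. \<lambda>m \<in> carrier M. (c \<odot>\<^bsub>A\<^esub> \<one>\<^bsub>A\<^esub>) \<odot>\<^bsub>M\<^esub> f m)\<rparr>"

text \<open>
  \<open>M\<close> with the evaluation action of its endomorphisms: a left \<open>End\<^sub>A(M)\<close>-module, i.e. a right
  \<open>end_op A M\<close>-module. Its dual is a left \<open>end_op A M\<close>-module.
\<close>

definition eval_module :: "('a, 'm) module \<Rightarrow> ('m \<Rightarrow> 'm, 'm) module" where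
  "eval_module M = \<lparr>carrier = carrier M, monoid.mult = monoid.mult M, monoid.one = monoid.one M,
     ring.zero = ring.zero M,
     ring.add = ring.add M, smult = (\<lambda>f x. f x)\<rparr>"

definition dual_over_end :: "'k ring \<Rightarrow> ('k, 'a) module \<Rightarrow> ('a, 'm) module \<Rightarrow>
    ('m \<Rightarrow> 'm, 'm \<Rightarrow> 'k) module" where
  "dual_over_end K A M = dual K (op_alg (end_op A M)) (eval_module M)"

definition splitting :: "('k, 'a) module \<Rightarrow> ('a, 'x) module \<Rightarrow> ('a, 'm) module \<Rightarrow>
    ('x \<Rightarrow> 'm) \<Rightarrow> ('m \<Rightarrow> 'x) \<Rightarrow> bool" where
  "splitting A X M i p \<longleftrightarrow> i \<in> mod_hom A X M \<and> p \<in> mod_hom A M X \<and> (\<forall>x \<in> carrier X. p (i x) = x)"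

definition is_summand :: "('k, 'a) module \<Rightarrow> ('a, 'x) module \<Rightarrow> ('a, 'm) module \<Rightarrow> bool" where
  "is_summand A X M \<longleftrightarrow> (\<exists>i p. splitting A X M i p)"

definition direct_sum :: "nat \<Rightarrow> (nat \<Rightarrow> ('a, 'm) module) \<Rightarrow> ('a, nat \<Rightarrow> 'm) module" where
  "direct_sum n M = \<lparr>carrier = (\<Pi>\<^sub>E i\<in>{..<n}. carrier (M i)),
     monoid.mult = undefined, monoid.one = undefined,
     ring.zero = (\<lambda>i \<in> {..<n}. \<zero>\<^bsub>M i\<^esub>),
     ring.add = (\<lambda>x y. \<lambda>i \<in> {..<n}. x i \<oplus>\<^bsub>M i\<^esub> y i),
     smult = (\<lambda>a x. \<lambda>i \<in> {..<n}. a \<odot>\<^bsub>M i\<^esub> x i)\<rparr>"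

definition in_add :: "('k, 'a) module \<Rightarrow> ('a, 'x) module \<Rightarrow> ('a, 'm) module \<Rightarrow> bool" where
  "in_add A X M \<longleftrightarrow> (\<exists>n. is_summand A X (direct_sum n (\<lambda>_. M)))"

definition indecomposable :: "('k, 'a) module \<Rightarrow> ('a, 'm) module \<Rightarrow> bool" where
  "indecomposable A M \<longleftrightarrow> \<not> trivial_module M \<and>
     (\<forall>X Y. submodule X A M \<and> submodule Y A M \<and> X \<inter> Y = {\<zero>\<^bsub>M\<^esub>} \<and> X <+>\<^bsub>M\<^esub> Y = carrier M
        \<longrightarrow> X = {\<zero>\<^bsub>M\<^esub>} \<or> Y = {\<zero>\<^bsub>M\<^esub>})"

text \<open>
  The indecomposable summands may be taken on the type of \<open>M\<close>, because they embed in \<open>M\<close>.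
\<close>

definition basic_module :: "('k, 'a) module \<Rightarrow> ('a, 'm) module \<Rightarrow> bool" where
  "basic_module A M \<longleftrightarrow> (\<exists>n (X :: nat \<Rightarrow> ('a, 'm) module).
     (\<forall>i<n. fg_module A (X i) \<and> indecomposable A (X i)) \<and>
     (\<forall>i<n. \<forall>j<n. i \<noteq> j \<longrightarrow> \<not> mod_iso A (X i) (X j)) \<and>
     mod_iso A M (direct_sum n X))"

definition basic_algebra :: "('k, 'a) module \<Rightarrow> bool" where
  "basic_algebra A \<longleftrightarrow> basic_module A (regular A)"

definition generating_cogenerating :: "'k ring \<Rightarrow> ('k, 'a) module \<Rightarrow> ('a, 'm) module \<Rightarrow> bool" where
  "generating_cogenerating K A E \<longleftrightarrow> in_add A (regular A) E \<and> in_add A (dual_regular K A) E"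

text \<open>
  Quantification over all finitely generated \<open>A\<close>-modules is over those with carrier in
  \<open>nat \<Rightarrow> 'k\<close>: over a finite-dimensional \<open>K\<close>-algebra every finitely generated module is, as
  a vector space, isomorphic to some \<open>K\<^sup>n\<close>, so it has an isomorphic copy on this type.
\<close>

type_synonym ('k, 'a) umodule = "('a, nat \<Rightarrow> 'k) module"

definition projective :: "('k, 'a) module \<Rightarrow> ('a, 'm) module \<Rightarrow> bool" where
  "projective A P \<longleftrightarrow> (\<forall>(X :: ('k, 'a) umodule) (Y :: ('k, 'a) umodule).
     \<forall>g \<in> mod_hom A X Y. \<forall>f \<in> mod_hom A P Y.
     fg_module A X \<and> fg_module A Y \<and> g ` carrier X = carrier Y \<longrightarrow>
     (\<exists>h \<in> mod_hom A P X. \<forall>x \<in> carrier P. g (h x) = f x))"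

definition injective :: "('k, 'a) module \<Rightarrow> ('a, 'm) module \<Rightarrow> bool" where
  "injective A I \<longleftrightarrow> (\<forall>(X :: ('k, 'a) umodule) (Y :: ('k, 'a) umodule).
     \<forall>g \<in> mod_hom A X Y. \<forall>f \<in> mod_hom A X I.
     fg_module A X \<and> fg_module A Y \<and> inj_on g (carrier X) \<longrightarrow>
     (\<exists>h \<in> mod_hom A Y I. \<forall>x \<in> carrier X. h (g x) = f x))"

text \<open>Exact sequences \<open>\<dots> \<rightarrow> X 1 \<rightarrow> X 0 \<rightarrow> M \<rightarrow> 0\<close> with \<open>d n : X (n + 1) \<rightarrow> X n\<close>.\<close>

definition left_resolution :: "('k, 'a) module \<Rightarrow> ('a, 'm) module \<Rightarrow> (nat \<Rightarrow> ('k, 'a) umodule) \<Rightarrow>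
    (nat \<Rightarrow> (nat \<Rightarrow> 'k) \<Rightarrow> (nat \<Rightarrow> 'k)) \<Rightarrow> ((nat \<Rightarrow> 'k) \<Rightarrow> 'm) \<Rightarrow> bool" where
  "left_resolution A M X d h \<longleftrightarrow>
     (\<forall>n. fg_module A (X n)) \<and>
     (\<forall>n. d n \<in> mod_hom A (X (Suc n)) (X n)) \<and>
     h \<in> mod_hom A (X 0) M \<and>
     h ` carrier (X 0) = carrier M \<and>
     d 0 ` carrier (X 1) = a_kernel (X 0) M h \<and>
     (\<forall>n. d (Suc n) ` carrier (X (Suc (Suc n))) = a_kernel (X (Suc n)) (X n) (d n))"

text \<open>Exact sequences \<open>0 \<rightarrow> M \<rightarrow> X 0 \<rightarrow> X 1 \<rightarrow> \<dots>\<close> with \<open>d n : X n \<rightarrow> X (n + 1)\<close>.\<close>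

definition right_resolution :: "('k, 'a) module \<Rightarrow> ('a, 'm) module \<Rightarrow> (nat \<Rightarrow> ('k, 'a) umodule) \<Rightarrow>
    (nat \<Rightarrow> (nat \<Rightarrow> 'k) \<Rightarrow> (nat \<Rightarrow> 'k)) \<Rightarrow> ('m \<Rightarrow> (nat \<Rightarrow> 'k)) \<Rightarrow> bool" where
  "right_resolution A M X d h \<longleftrightarrow>
     (\<forall>n. fg_module A (X n)) \<and>
     (\<forall>n. d n \<in> mod_hom A (X n) (X (Suc n))) \<and>
     h \<in> mod_hom A M (X 0) \<and>
     inj_on h (carrier M) \<and>
     h ` carrier M = a_kernel (X 0) (X 1) (d 0) \<and>
     (\<forall>n. d n ` carrier (X n) = a_kernel (X (Suc n)) (X (Suc (Suc n))) (d (Suc n)))"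

definition projective_resolution where
  "projective_resolution A M X d h \<longleftrightarrow> left_resolution A M X d h \<and> (\<forall>n. projective A (X n))"

definition injective_resolution where
  "injective_resolution A M X d h \<longleftrightarrow> right_resolution A M X d h \<and> (\<forall>n. injective A (X n))"

definition pdim_le :: "('k, 'a) module \<Rightarrow> ('a, 'm) module \<Rightarrow> nat \<Rightarrow> bool" where
  "pdim_le A M k \<longleftrightarrow>
     (\<exists>X d h. projective_resolution A M X d h \<and> (\<forall>n>k. trivial_module (X n)))"

definition idim_le :: "('k, 'a) module \<Rightarrow> ('a, 'm) module \<Rightarrow> nat \<Rightarrow> bool" where
  "idim_le A M k \<longleftrightarrow>
     (\<exists>X d h. injective_resolution A M X d h \<and> (\<forall>n>k. trivial_module (X n)))"

text \<open>
  \<open>Ext\<^sup>i\<^sup>+\<^sup>1(M, N) = 0\<close>: for projective resolutions \<open>X\<close> of \<open>M\<close>, each cocycle in \<open>Hom(X (i + 1), N)\<close>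
  is a coboundary.
\<close>

definition ext_Suc_vanishes :: "('k, 'a) module \<Rightarrow> nat \<Rightarrow> ('a, 'm) module \<Rightarrow> ('a, 'n) module \<Rightarrow> bool" where
  "ext_Suc_vanishes A i M N \<longleftrightarrow>
     (\<forall>X d h. projective_resolution A M X d h \<longrightarrow>
       {f \<in> mod_hom A (X (Suc i)) N. \<forall>x \<in> carrier (X (Suc (Suc i))). f (d (Suc i) x) = \<zero>\<^bsub>N\<^esub>} =
       {compose (carrier (X (Suc i))) g (d i) | g. g \<in> mod_hom A (X i) N})"

definition domdim_ge :: "('k, 'a) module \<Rightarrow> nat \<Rightarrow> bool" where
  "domdim_ge A k \<longleftrightarrow>
     (\<exists>X d h. injective_resolution A (regular A) X d h \<and> (\<forall>n<k. projective A (X n)))"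

definition domdim :: "('k, 'a) module \<Rightarrow> enat" where
  "domdim A = Sup {enat k | k. domdim_ge A k}"

definition tilting_sequence where
  "tilting_sequence A k T X d h \<longleftrightarrow> right_resolution A (regular A) X d h \<and>
     (\<forall>n\<le>k. in_add A (X n) T) \<and> (\<forall>n>k. trivial_module (X n))"

definition k_tilting :: "('k, 'a) module \<Rightarrow> nat \<Rightarrow> ('a, 'm) module \<Rightarrow> bool" where
  "k_tilting A k T \<longleftrightarrow> fg_module A T \<and> pdim_le A T k \<and> (\<forall>i. ext_Suc_vanishes A i T T) \<and>
     (\<exists>X d h. tilting_sequence A k T X d h)"

definition special_tilting :: "('k, 'a) module \<Rightarrow> nat \<Rightarrow> ('a, 'p) module \<Rightarrow> ('a, 'm) module \<Rightarrow> bool" where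
  "special_tilting A k P T \<longleftrightarrow> k_tilting A k T \<and> in_add A P T \<and>
     (\<exists>X d h. tilting_sequence A k T X d h \<and> (\<forall>n<k. in_add A (X n) P))"

definition cotilting_sequence where
  "cotilting_sequence K A k C X d h \<longleftrightarrow> left_resolution A (dual_regular K A) X d h \<and>
     (\<forall>n\<le>k. in_add A (X n) C) \<and> (\<forall>n>k. trivial_module (X n))"

definition k_cotilting :: "'k ring \<Rightarrow> ('k, 'a) module \<Rightarrow> nat \<Rightarrow> ('a, 'm) module \<Rightarrow> bool" where
  "k_cotilting K A k C \<longleftrightarrow> fg_module A C \<and> idim_le A C k \<and> (\<forall>i. ext_Suc_vanishes A i C C) \<and>
     (\<exists>X d h. cotilting_sequence K A k C X d h)"

definition special_cotilting :: "'k ring \<Rightarrow> ('k, 'a) module \<Rightarrow> nat \<Rightarrow> ('a, 'p) module \<Rightarrow> ('a, 'm) module \<Rightarrow> bool" where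
  "special_cotilting K A k I C \<longleftrightarrow> k_cotilting K A k C \<and> in_add A I C \<and>
     (\<exists>X d h. cotilting_sequence K A k C X d h \<and> (\<forall>n<k. in_add A (X n) I))"

text \<open>
  \<open>P\<close> is the greatest projective-injective direct summand of the regular module. Summands of
  \<open>regular A\<close> have copies on the type of \<open>A\<close>.
\<close>

definition maximal_proj_inj_summand :: "('k, 'a) module \<Rightarrow> ('a, 'p) module \<Rightarrow> bool" where
  "maximal_proj_inj_summand A P \<longleftrightarrow> fg_module A P \<and>
     is_summand A P (regular A) \<and> projective A P \<and> injective A P \<and>
     (\<forall>X :: ('a, 'a) module. fg_module A X \<and> is_summand A X (regular A) \<and>
        projective A X \<and> injective A X \<longrightarrow> is_summand A X P)"

definition shifted_module :: "('k, 'a) module \<Rightarrow> nat \<Rightarrow> ('a, 'p) module \<Rightarrow> ('a, 'm) module \<Rightarrow> bool" where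
  "shifted_module A k P T \<longleftrightarrow> basic_module A T \<and> special_tilting A k P T"

definition coshifted_module :: "'k ring \<Rightarrow> ('k, 'a) module \<Rightarrow> nat \<Rightarrow> ('a, 'p) module \<Rightarrow> ('a, 'm) module \<Rightarrow> bool" where
  "coshifted_module K A k P C \<longleftrightarrow> basic_module A C \<and> special_cotilting K A k P C"

definition corner :: "('k, 'b) module \<Rightarrow> 'b \<Rightarrow> ('k, 'b) module" where
  "corner B e = B\<lparr>carrier := (\<lambda>b. e \<otimes>\<^bsub>B\<^esub> b \<otimes>\<^bsub>B\<^esub> e) ` carrier B, monoid.one := e\<rparr>"

definition left_ideal_of :: "('k, 'b) module \<Rightarrow> 'b \<Rightarrow> 'b set" where
  "left_ideal_of B e = (\<lambda>b. b \<otimes>\<^bsub>B\<^esub> e) ` carrier B"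

definition right_ideal_of :: "('k, 'b) module \<Rightarrow> 'b \<Rightarrow> 'b set" where
  "right_ideal_of B e = (\<lambda>b. e \<otimes>\<^bsub>B\<^esub> b) ` carrier B"

text \<open>
  The tensor product over \<open>R\<close> of a right module \<open>X\<close> (with \<open>a \<odot>\<^bsub>X\<^esub> x\<close> standing for \<open>x a\<close>) and a left
  module \<open>M\<close>, as the quotient of the free abelian group on pairs by the bilinearity relations.
\<close>

definition tensor_free :: "('r, 'x) module \<Rightarrow> ('r, 'm) module \<Rightarrow> ('x \<times> 'm \<Rightarrow>\<^sub>0 int) monoid" where
  "tensor_free X M = free_Abelian_group (carrier X \<times> carrier M)"

definition tensor_relations :: "('r, 's) ring_scheme \<Rightarrow> ('r, 'x) module \<Rightarrow> ('r, 'm) module \<Rightarrow>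
    ('x \<times> 'm \<Rightarrow>\<^sub>0 int) set" where
  "tensor_relations R X M = generate (tensor_free X M)
    ({frag_of (x \<oplus>\<^bsub>X\<^esub> y, m) - frag_of (x, m) - frag_of (y, m) | x y m.
        x \<in> carrier X \<and> y \<in> carrier X \<and> m \<in> carrier M} \<union>
     {frag_of (x, m \<oplus>\<^bsub>M\<^esub> n) - frag_of (x, m) - frag_of (x, n) | x m n.
        x \<in> carrier X \<and> m \<in> carrier M \<and> n \<in> carrier M} \<union>
     {frag_of (a \<odot>\<^bsub>X\<^esub> x, m) - frag_of (x, a \<odot>\<^bsub>M\<^esub> m) | a x m.
        a \<in> carrier R \<and> x \<in> carrier X \<and> m \<in> carrier M})"

text \<open>\<open>\<ell>(M) = Be \<otimes>\<^bsub>eBe\<^esub> M\<close> and \<open>r(M) = Hom\<^bsub>eBe\<^esub>(eB, M)\<close>, for a module \<open>M\<close> over \<open>corner B e\<close>.\<close>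

definition Be_right :: "('k, 'b) module \<Rightarrow> 'b \<Rightarrow> ('b, 'b) module" where
  "Be_right B e = (regular (op_alg B))\<lparr>carrier := left_ideal_of B e\<rparr>"

definition eB_left :: "('k, 'b) module \<Rightarrow> 'b \<Rightarrow> ('b, 'b) module" where
  "eB_left B e = (regular B)\<lparr>carrier := right_ideal_of B e\<rparr>"

definition ext_l :: "('k, 'b) module \<Rightarrow> 'b \<Rightarrow> ('b, 'm) module \<Rightarrow> ('b, ('b \<times> 'm \<Rightarrow>\<^sub>0 int) set) module" where
  "ext_l B e M =
     (let F = tensor_free (Be_right B e) M;
          H = tensor_relations (corner B e) (Be_right B e) M
      in \<lparr>carrier = rcosets\<^bsub>F\<^esub> H, monoid.mult = undefined, monoid.one = undefined,
          ring.zero = H, ring.add = set_mult F,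
          smult = (\<lambda>b Z. H <#>\<^bsub>F\<^esub> (frag_extend (\<lambda>(x, m). frag_of (b \<otimes>\<^bsub>B\<^esub> x, m)) ` Z))\<rparr>)"

definition ext_r :: "('k, 'b) module \<Rightarrow> 'b \<Rightarrow> ('b, 'm) module \<Rightarrow> ('b, 'b \<Rightarrow> 'm) module" where
  "ext_r B e M = \<lparr>carrier = mod_hom (corner B e) (eB_left B e) M,
     monoid.mult = undefined, monoid.one = undefined,
     ring.zero = (\<lambda>x \<in> right_ideal_of B e. \<zero>\<^bsub>M\<^esub>),
     ring.add = (\<lambda>f g. \<lambda>x \<in> right_ideal_of B e. f x \<oplus>\<^bsub>M\<^esub> g x),
     smult = (\<lambda>b f. \<lambda>x \<in> right_ideal_of B e. f (x \<otimes>\<^bsub>B\<^esub> b))\<rparr>"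

text \<open>
  \<open>\<zeta>(x \<otimes> m) = (y \<mapsto> (y x) m)\<close>: first on the free abelian group, then on cosets, where its value
  is the common value on representatives.
\<close>

definition zeta_free :: "('k, 'b) module \<Rightarrow> 'b \<Rightarrow> ('b, 'm) module \<Rightarrow> ('b \<times> 'm \<Rightarrow>\<^sub>0 int) \<Rightarrow> 'b \<Rightarrow> 'm" where
  "zeta_free B e M z = (\<Oplus>\<^bsub>ext_r B e M\<^esub>q \<in> Poly_Mapping.keys z.
     [Poly_Mapping.lookup z q] \<cdot>\<^bsub>ext_r B e M\<^esub>
       (\<lambda>y \<in> right_ideal_of B e. (y \<otimes>\<^bsub>B\<^esub> fst q) \<odot>\<^bsub>M\<^esub> snd q))"

definition zeta :: "('k, 'b) module \<Rightarrow> 'b \<Rightarrow> ('b, 'm) module \<Rightarrow> ('b \<times> 'm \<Rightarrow>\<^sub>0 int) set \<Rightarrow> 'b \<Rightarrow> 'm" where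
  "zeta B e M Z = the_elem (zeta_free B e M ` Z)"

definition intermediate_extension :: "('k, 'b) module \<Rightarrow> 'b \<Rightarrow> ('b, 'm) module \<Rightarrow> ('b, 'b \<Rightarrow> 'm) module" where
  "intermediate_extension B e M =
     (ext_r B e M)\<lparr>carrier := zeta B e M ` carrier (ext_l B e M)\<rparr>"

text \<open>
  \<open>\<phi>\<close> identifies \<open>End\<^sub>\<Gamma>(P)\<^sup>o\<^sup>p\<close> with \<open>A\<close> in such a way that the module \<open>DP\<close> becomes \<open>E\<close>.
\<close>

definition morita_tachikawa_identification :: "'k ring \<Rightarrow> ('k, 'g) module \<Rightarrow> ('g, 'p) module \<Rightarrow>
    ('k, 'a) module \<Rightarrow> ('a, 'e) module \<Rightarrow> (('p \<Rightarrow> 'p) \<Rightarrow> 'a) \<Rightarrow> bool" where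
  "morita_tachikawa_identification K \<Gamma> P A E \<phi> \<longleftrightarrow>
     \<phi> \<in> alg_iso K (end_op \<Gamma> P) A \<and>
     mod_iso (end_op \<Gamma> P) (restrict_scalars \<phi> E) (dual_over_end K \<Gamma> P)"

text \<open>
  For \<open>P\<close> a summand of \<open>T\<close> via \<open>i : P \<rightarrow> T\<close> and \<open>p : T \<rightarrow> P\<close>, the projection onto \<open>P\<close> is the idempotent
  \<open>e = i \<circ> p\<close> of \<open>B = end_op \<Gamma> T\<close>, and \<open>b \<mapsto> p \<circ> b \<circ> i\<close> is the isomorphism from \<open>eBe\<close> to
  \<open>end_op \<Gamma> P\<close>. Composed with \<open>\<phi>\<close>, it makes \<open>A\<close>-modules into \<open>eBe\<close>-modules.
\<close>

definition projection_idempotent :: "('g, 't) module \<Rightarrow> ('p \<Rightarrow> 't) \<Rightarrow> ('t \<Rightarrow> 'p) \<Rightarrow> 't \<Rightarrow> 't" where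
  "projection_idempotent T i p = compose (carrier T) i p"

definition as_corner_module :: "('g, 'p) module \<Rightarrow> ('p \<Rightarrow> 't) \<Rightarrow> ('t \<Rightarrow> 'p) \<Rightarrow>
    (('p \<Rightarrow> 'p) \<Rightarrow> 'a) \<Rightarrow> ('a, 'e) module \<Rightarrow> ('t \<Rightarrow> 't, 'e) module" where
  "as_corner_module P i p \<phi> E =
     restrict_scalars (\<lambda>b. \<phi> (compose (carrier P) p (compose (carrier P) b i))) E"

definition shifted_extension :: "('k, 'g) module \<Rightarrow> ('g, 'p) module \<Rightarrow> ('g, 't) module \<Rightarrow>
    ('p \<Rightarrow> 't) \<Rightarrow> ('t \<Rightarrow> 'p) \<Rightarrow> (('p \<Rightarrow> 'p) \<Rightarrow> 'a) \<Rightarrow> ('a, 'e) module \<Rightarrow>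
    ('t \<Rightarrow> 't, ('t \<Rightarrow> 't) \<Rightarrow> 'e) module" where
  "shifted_extension \<Gamma> P T i p \<phi> E =
     intermediate_extension (end_op \<Gamma> T) (projection_idempotent T i p) (as_corner_module P i p \<phi> E)"

end

theory Submission
  imports Defs
begin

text \<open>
  Write \<open>P\<close> for \<open>\<Pi>\<close>. Under \<open>E = DP\<close> the functor \<open>c\<close> for \<open>B = End(T)\<^sup>o\<^sup>p\<close> sends \<open>E\<close> to the image of
  \<open>\<zeta> : Be \<otimes> DP \<rightarrow> Hom(eB, DP)\<close>, and this image is \<open>DT\<close> as soon as \<open>T\<close> is generated by \<open>P\<close> and every map from \<open>T\<close>
  to \<open>D\<Gamma>\<close> factors through \<open>add P\<close>. Both hold for the special tilting and cotilting modules: since \<open>k < domdim \<Gamma>\<close>, the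
  vanishing of \<open>Ext\<close> and the bounds on the homological dimensions let one extend maps from \<open>\<Gamma>\<close> over the first term of the
  special tilting sequence, and lift maps to \<open>D\<Gamma>\<close> through the last term of the special cotilting sequence.
  An identification \<open>E = DP\<close> exists because the \<open>\<Gamma>\<close>-module \<open>H = DE\<close> is projective-injective with \<open>End(H)\<^sup>o\<^sup>p = A\<close>:
  as \<open>A\<close> and \<open>E\<close> are basic, Krull--Schmidt arguments make each of \<open>H\<close> and \<open>P\<close> a summand of the other.
\<close>

text \<open>Extending maps over the first term helps because an element \<open>y\<close> of
  \<open>T\<close> is the value at \<open>1\<close> of a map from \<Gamma>: if that map extends to
  the first term, which lies in \<open>add P\<close> as \<open>k > 0\<close>, then \<open>y\<close>
  lies in the image of a map from \<open>add P\<close>. The cases of \<open>T\<close> and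
  \<open>C\<close> are not deduced from each other by duality, since they rest on different
  hypotheses: a projective dimension, an injective dimension, or a vanishing \<open>Ext\<close>. The
  strict bound \<open>k < domdim\<close> is spent on \<open>C\<close>: its injective resolution has
  length \<open>k\<close>, and the homotopy lifts through terms of index up to \<open>k\<close>,
  which have to be projective. Two choices of form recur. Projectivity and injectivity are tested on
  modules carried by \<open>nat \<Rightarrow> 'k\<close> only, so \<open>proj_lift\<close> and
  \<open>inj_ext\<close> transport lifting problems from arbitrary types. Membership in
  \<open>add M\<close> is used as an identity map written as a finite sum of maps through
  \<open>M\<close>. This sees a module only up to multiplicities, and the Krull--Schmidt part is
  what recovers an isomorphism from it.\<close>

section \<open>Linear maps between modules over a ring\<close>

definition lin :: "('r, 's) ring_scheme \<Rightarrow> ('r, 'm, 't) module_scheme \<Rightarrow> ('r, 'n, 'u) module_scheme \<Rightarrow> ('m \<Rightarrow> 'n) \<Rightarrow> bool" where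
  "lin R M N f \<longleftrightarrow> f \<in> carrier M \<rightarrow> carrier N \<and>
     (\<forall>x \<in> carrier M. \<forall>y \<in> carrier M. f (x \<oplus>\<^bsub>M\<^esub> y) = f x \<oplus>\<^bsub>N\<^esub> f y) \<and>
     (\<forall>a \<in> carrier R. \<forall>x \<in> carrier M. f (a \<odot>\<^bsub>M\<^esub> x) = a \<odot>\<^bsub>N\<^esub> f x)"

lemma linI:
  assumes "\<And>x. x \<in> carrier M \<Longrightarrow> f x \<in> carrier N"
    and "\<And>x y. x \<in> carrier M \<Longrightarrow> y \<in> carrier M \<Longrightarrow> f (x \<oplus>\<^bsub>M\<^esub> y) = f x \<oplus>\<^bsub>N\<^esub> f y"
    and "\<And>a x. a \<in> carrier R \<Longrightarrow> x \<in> carrier M \<Longrightarrow> f (a \<odot>\<^bsub>M\<^esub> x) = a \<odot>\<^bsub>N\<^esub> f x"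
  shows "lin R M N f"
  using assms by (auto simp: lin_def)

lemma lin_closed: "lin R M N f \<Longrightarrow> x \<in> carrier M \<Longrightarrow> f x \<in> carrier N"
  by (auto simp: lin_def)

lemma lin_add: "lin R M N f \<Longrightarrow> x \<in> carrier M \<Longrightarrow> y \<in> carrier M \<Longrightarrow> f (x \<oplus>\<^bsub>M\<^esub> y) = f x \<oplus>\<^bsub>N\<^esub> f y"
  by (auto simp: lin_def)

lemma lin_smult: "lin R M N f \<Longrightarrow> a \<in> carrier R \<Longrightarrow> x \<in> carrier M \<Longrightarrow> f (a \<odot>\<^bsub>M\<^esub> x) = a \<odot>\<^bsub>N\<^esub> f x"
  by (auto simp: lin_def)

lemma lin_of_mod_hom: "f \<in> mod_hom R M N \<Longrightarrow> lin R M N f"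
  by (auto simp: lin_def mod_hom_def)

lemma mod_hom_iff: "f \<in> mod_hom R M N \<longleftrightarrow> lin R M N f \<and> f \<in> extensional (carrier M)"
  unfolding lin_def mod_hom_def PiE_def by auto

text \<open>Composites, sums and differences are formed with \<open>lin\<close> as plain
  abstractions; extensionality is imposed only here, when an element of a Hom-set is
  required.\<close>

lemma (in left_module) restrict_mod_hom:
  "lin R M N f \<Longrightarrow> restrict f (carrier M) \<in> mod_hom R M N"
  by (auto simp: lin_def mod_hom_def smult_closed)

lemma (in left_module) lin_cong:
  "lin R M N f \<Longrightarrow> (\<And>x. x \<in> carrier M \<Longrightarrow> f x = g x) \<Longrightarrow> lin R M N g"
  by (auto simp: lin_def smult_closed Pi_iff)

lemma mod_hom_ext:
  "f \<in> mod_hom R M N \<Longrightarrow> g \<in> mod_hom R M N \<Longrightarrow> (\<And>x. x \<in> carrier M \<Longrightarrow> f x = g x) \<Longrightarrow> f = g"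
  by (rule extensionalityI[of _ "carrier M"]) (auto simp: mod_hom_iff)

lemma lin_id: "lin R M M (\<lambda>x. x)"
  by (auto simp: lin_def)

lemma lin_comp: "lin R M N f \<Longrightarrow> lin R N L g \<Longrightarrow> lin R M L (\<lambda>x. g (f x))"
  by (auto simp: lin_def Pi_iff)

lemma left_moduleI:
  assumes "ring R" "abelian_group M"
    and "\<And>a x. a \<in> carrier R \<Longrightarrow> x \<in> carrier M \<Longrightarrow> a \<odot>\<^bsub>M\<^esub> x \<in> carrier M"
    and "\<And>a b x. a \<in> carrier R \<Longrightarrow> b \<in> carrier R \<Longrightarrow> x \<in> carrier M \<Longrightarrow>
        (a \<oplus>\<^bsub>R\<^esub> b) \<odot>\<^bsub>M\<^esub> x = a \<odot>\<^bsub>M\<^esub> x \<oplus>\<^bsub>M\<^esub> b \<odot>\<^bsub>M\<^esub> x"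
    and "\<And>a x y. a \<in> carrier R \<Longrightarrow> x \<in> carrier M \<Longrightarrow> y \<in> carrier M \<Longrightarrow>
        a \<odot>\<^bsub>M\<^esub> (x \<oplus>\<^bsub>M\<^esub> y) = a \<odot>\<^bsub>M\<^esub> x \<oplus>\<^bsub>M\<^esub> a \<odot>\<^bsub>M\<^esub> y"
    and "\<And>a b x. a \<in> carrier R \<Longrightarrow> b \<in> carrier R \<Longrightarrow> x \<in> carrier M \<Longrightarrow>
        (a \<otimes>\<^bsub>R\<^esub> b) \<odot>\<^bsub>M\<^esub> x = a \<odot>\<^bsub>M\<^esub> (b \<odot>\<^bsub>M\<^esub> x)"
    and "\<And>x. x \<in> carrier M \<Longrightarrow> \<one>\<^bsub>R\<^esub> \<odot>\<^bsub>M\<^esub> x = x"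
  shows "left_module R M"
  by (intro left_module.intro left_module_axioms.intro) (use assms in auto)

context left_module
begin

lemma R_ring: "ring R" and M_group: "abelian_group M"
  by unfold_locales

lemma smult_r_null: "a \<in> carrier R \<Longrightarrow> a \<odot>\<^bsub>M\<^esub> \<zero>\<^bsub>M\<^esub> = \<zero>\<^bsub>M\<^esub>"
proof -
  assume a: "a \<in> carrier R"
  have "a \<odot>\<^bsub>M\<^esub> \<zero>\<^bsub>M\<^esub> \<oplus>\<^bsub>M\<^esub> a \<odot>\<^bsub>M\<^esub> \<zero>\<^bsub>M\<^esub> = a \<odot>\<^bsub>M\<^esub> (\<zero>\<^bsub>M\<^esub> \<oplus>\<^bsub>M\<^esub> \<zero>\<^bsub>M\<^esub>)"
    using a by (subst smult_r_distr) auto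
  then show ?thesis using a smult_closed[OF a M.zero_closed]
    by (metis M.add.l_cancel_one' M.zero_closed M.r_zero)
qed

lemma smult_l_null: "x \<in> carrier M \<Longrightarrow> \<zero> \<odot>\<^bsub>M\<^esub> x = \<zero>\<^bsub>M\<^esub>"
proof -
  assume x: "x \<in> carrier M"
  have "\<zero> \<odot>\<^bsub>M\<^esub> x \<oplus>\<^bsub>M\<^esub> \<zero> \<odot>\<^bsub>M\<^esub> x = (\<zero> \<oplus> \<zero>) \<odot>\<^bsub>M\<^esub> x"
    using x by (subst smult_l_distr) auto
  then show ?thesis using x smult_closed[OF R.zero_closed x]
    by (metis M.add.l_cancel_one' R.zero_closed R.r_zero)
qed

lemma smult_r_minus: "a \<in> carrier R \<Longrightarrow> x \<in> carrier M \<Longrightarrow> a \<odot>\<^bsub>M\<^esub> (\<ominus>\<^bsub>M\<^esub> x) = \<ominus>\<^bsub>M\<^esub> (a \<odot>\<^bsub>M\<^esub> x)"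
  by (metis M.a_inv_closed M.minus_equality M.l_neg smult_closed smult_r_distr smult_r_null)

lemma smult_l_minus: "a \<in> carrier R \<Longrightarrow> x \<in> carrier M \<Longrightarrow> (\<ominus> a) \<odot>\<^bsub>M\<^esub> x = \<ominus>\<^bsub>M\<^esub> (a \<odot>\<^bsub>M\<^esub> x)"
  by (metis R.a_inv_closed M.minus_equality R.l_neg smult_closed smult_l_distr smult_l_null)

lemma minus_as_smult: "x \<in> carrier M \<Longrightarrow> (\<ominus> \<one>) \<odot>\<^bsub>M\<^esub> x = \<ominus>\<^bsub>M\<^esub> x"
  by (simp add: smult_l_minus smult_one)

lemma smult_finsum:
  assumes "a \<in> carrier R" "f \<in> S \<rightarrow> carrier M"
  shows "a \<odot>\<^bsub>M\<^esub> (\<Oplus>\<^bsub>M\<^esub>s\<in>S. f s) = (\<Oplus>\<^bsub>M\<^esub>s\<in>S. a \<odot>\<^bsub>M\<^esub> f s)"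
  using assms
proof (induction S rule: infinite_finite_induct)
  case (insert x F)
  then have "f x \<in> carrier M" "f \<in> F \<rightarrow> carrier M" by auto
  moreover have "(\<lambda>s. a \<odot>\<^bsub>M\<^esub> f s) \<in> F \<rightarrow> carrier M" "a \<odot>\<^bsub>M\<^esub> f x \<in> carrier M"
    using insert by (auto intro!: smult_closed)
  ultimately show ?case using insert by (simp add: smult_r_distr)
qed (auto simp: smult_r_null)

lemma lin_const_zero: "left_module R N \<Longrightarrow> lin R N M (\<lambda>x. \<zero>\<^bsub>M\<^esub>)"
  by (auto simp: lin_def smult_r_null)

lemma lin_plus: "lin R N M f \<Longrightarrow> lin R N M g \<Longrightarrow> lin R N M (\<lambda>x. f x \<oplus>\<^bsub>M\<^esub> g x)"
  by (auto simp: lin_def Pi_iff smult_r_distr M.a_ac)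

lemma lin_uminus: "lin R N M f \<Longrightarrow> lin R N M (\<lambda>x. \<ominus>\<^bsub>M\<^esub> f x)"
  by (auto simp: lin_def Pi_iff smult_r_minus M.minus_add)

lemma lin_diff: "lin R N M f \<Longrightarrow> lin R N M g \<Longrightarrow> lin R N M (\<lambda>x. f x \<ominus>\<^bsub>M\<^esub> g x)"
  unfolding a_minus_def by (intro lin_plus lin_uminus)

lemma lin_finsum:
  assumes "left_module R N" "\<And>s. s \<in> S \<Longrightarrow> lin R N M (f s)"
  shows "lin R N M (\<lambda>x. \<Oplus>\<^bsub>M\<^esub>s\<in>S. f s x)"
proof (rule linI)
  interpret N: left_module R N by fact
  fix x assume x: "x \<in> carrier N"
  show "(\<Oplus>\<^bsub>M\<^esub>s\<in>S. f s x) \<in> carrier M"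
    using x by (intro M.finsum_closed) (auto intro!: lin_closed[OF assms(2)])
  fix y assume y: "y \<in> carrier N"
  have "(\<Oplus>\<^bsub>M\<^esub>s\<in>S. f s (x \<oplus>\<^bsub>N\<^esub> y)) = (\<Oplus>\<^bsub>M\<^esub>s\<in>S. f s x \<oplus>\<^bsub>M\<^esub> f s y)"
    using x y
    by (intro M.finsum_cong') (auto simp: lin_add[OF assms(2)] intro!: M.a_closed lin_closed[OF assms(2)])
  also have "\<dots> = (\<Oplus>\<^bsub>M\<^esub>s\<in>S. f s x) \<oplus>\<^bsub>M\<^esub> (\<Oplus>\<^bsub>M\<^esub>s\<in>S. f s y)"
    using x y by (intro M.finsum_addf) (auto intro!: lin_closed[OF assms(2)])
  finally show "(\<Oplus>\<^bsub>M\<^esub>s\<in>S. f s (x \<oplus>\<^bsub>N\<^esub> y)) = (\<Oplus>\<^bsub>M\<^esub>s\<in>S. f s x) \<oplus>\<^bsub>M\<^esub> (\<Oplus>\<^bsub>M\<^esub>s\<in>S. f s y)" .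
next
  interpret N: left_module R N by fact
  fix a x assume a: "a \<in> carrier R" and x: "x \<in> carrier N"
  have "(\<Oplus>\<^bsub>M\<^esub>s\<in>S. f s (a \<odot>\<^bsub>N\<^esub> x)) = (\<Oplus>\<^bsub>M\<^esub>s\<in>S. a \<odot>\<^bsub>M\<^esub> f s x)"
    using x a
    by (intro M.finsum_cong') (auto intro!: smult_closed lin_closed[OF assms(2)] simp: lin_smult[OF assms(2)])
  also have "\<dots> = a \<odot>\<^bsub>M\<^esub> (\<Oplus>\<^bsub>M\<^esub>s\<in>S. f s x)"
    using x a by (intro smult_finsum[symmetric]) (auto intro!: lin_closed[OF assms(2)])
  finally show "(\<Oplus>\<^bsub>M\<^esub>s\<in>S. f s (a \<odot>\<^bsub>N\<^esub> x)) = a \<odot>\<^bsub>M\<^esub> (\<Oplus>\<^bsub>M\<^esub>s\<in>S. f s x)" .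
qed

end

lemma lin_zero:
  assumes "left_module R M" "left_module R N" "lin R M N f"
  shows "f \<zero>\<^bsub>M\<^esub> = \<zero>\<^bsub>N\<^esub>"
proof -
  interpret M: left_module R M by fact
  interpret N: left_module R N by fact
  have "f \<zero>\<^bsub>M\<^esub> \<oplus>\<^bsub>N\<^esub> f \<zero>\<^bsub>M\<^esub> = f \<zero>\<^bsub>M\<^esub>"
    using lin_add[OF assms(3), of "\<zero>\<^bsub>M\<^esub>" "\<zero>\<^bsub>M\<^esub>"] by simp
  then show ?thesis
    by (metis N.M.add.l_cancel_one' N.M.zero_closed assms(3) lin_closed M.M.zero_closed)
qed

lemma lin_minus:
  assumes "left_module R M" "left_module R N" "lin R M N f" "x \<in> carrier M"
  shows "f (\<ominus>\<^bsub>M\<^esub> x) = \<ominus>\<^bsub>N\<^esub> f x"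
proof -
  interpret M: left_module R M by fact
  interpret N: left_module R N by fact
  have "f (\<ominus>\<^bsub>M\<^esub> x) \<oplus>\<^bsub>N\<^esub> f x = \<zero>\<^bsub>N\<^esub>"
    using lin_add[OF assms(3), of "\<ominus>\<^bsub>M\<^esub> x" x] assms by (simp add: M.M.l_neg lin_zero)
  then show ?thesis
    using N.M.minus_equality[of "f (\<ominus>\<^bsub>M\<^esub> x)" "f x"] lin_closed[OF assms(3)] assms(4) by simp
qed

lemma lin_sub:
  assumes "left_module R M" "left_module R N" "lin R M N f" "x \<in> carrier M" "y \<in> carrier M"
  shows "f (x \<ominus>\<^bsub>M\<^esub> y) = f x \<ominus>\<^bsub>N\<^esub> f y"
proof -
  interpret M: left_module R M by fact
  show ?thesis using assms by (simp add: a_minus_def lin_add lin_minus)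
qed

lemma lin_of_finsum:
  assumes "left_module R M" "left_module R N" "lin R M N f" "g \<in> S \<rightarrow> carrier M"
  shows "f (\<Oplus>\<^bsub>M\<^esub>s\<in>S. g s) = (\<Oplus>\<^bsub>N\<^esub>s\<in>S. f (g s))"
proof -
  interpret M: left_module R M by fact
  interpret N: left_module R N by fact
  show ?thesis using assms(4)
  proof (induction S rule: infinite_finite_induct)
    case (insert x F)
    then have "g x \<in> carrier M" "g \<in> F \<rightarrow> carrier M" by auto
    moreover have "(\<lambda>s. f (g s)) \<in> F \<rightarrow> carrier N" "f (g x) \<in> carrier N"
      using insert assms by (auto intro: lin_closed)
    ultimately show ?case using insert assms by (simp add: lin_add[OF assms(3)])
  qed (auto simp: lin_zero[OF assms(1-3)])
qed

lemma (in abelian_group) diff_add_cancel: "x \<in> carrier G \<Longrightarrow> y \<in> carrier G \<Longrightarrow> (x \<ominus> y) \<oplus> y = x"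
  by (simp add: a_minus_def a_assoc l_neg)

lemma (in abelian_group) diff_eq_zeroD: "x \<in> carrier G \<Longrightarrow> y \<in> carrier G \<Longrightarrow> x \<ominus> y = \<zero> \<Longrightarrow> x = y"
  using diff_add_cancel[of x y] by simp

lemma (in abelian_group) diff_self: "x \<in> carrier G \<Longrightarrow> x \<ominus> x = \<zero>"
  by (simp add: a_minus_def r_neg)

lemma lin_inj_onI:
  assumes "left_module R M" "left_module R N" "lin R M N f"
    and "\<And>x. x \<in> carrier M \<Longrightarrow> f x = \<zero>\<^bsub>N\<^esub> \<Longrightarrow> x = \<zero>\<^bsub>M\<^esub>"
  shows "inj_on f (carrier M)"
proof (rule inj_onI)
  interpret M: left_module R M by fact
  interpret N: left_module R N by fact
  fix x y assume xy: "x \<in> carrier M" "y \<in> carrier M" "f x = f y"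
  then have "f (x \<ominus>\<^bsub>M\<^esub> y) = \<zero>\<^bsub>N\<^esub>"
    using lin_sub[OF assms(1-3) xy(1,2)] lin_closed[OF assms(3) xy(1)] lin_closed[OF assms(3) xy(2)]
    by (simp add: N.M.r_neg a_minus_def)
  then show "x = y" using M.M.diff_eq_zeroD[OF xy(1,2)] assms(4) M.M.minus_closed[OF xy(1,2)] by blast
qed

text \<open>Only closure of \<open>M\<close> under its operations is assumed, because the lemma is
  later applied with the source \<open>dual_over_end\<close>, for which no module axioms are at
  hand.\<close>

lemma lin_inv_into_closed:
  assumes cl: "\<And>x y. x \<in> carrier M \<Longrightarrow> y \<in> carrier M \<Longrightarrow> x \<oplus>\<^bsub>M\<^esub> y \<in> carrier M"
    "\<And>a x. a \<in> carrier R \<Longrightarrow> x \<in> carrier M \<Longrightarrow> a \<odot>\<^bsub>M\<^esub> x \<in> carrier M"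
    and f: "lin R M N f" "bij_betw f (carrier M) (carrier N)"
  shows "lin R N M (inv_into (carrier M) f)"
proof -
  let ?g = "inv_into (carrier M) f"
  have g: "?g y \<in> carrier M" "f (?g y) = y" if "y \<in> carrier N" for y
    using f(2) that by (auto simp: bij_betw_def inv_into_into f_inv_into_f)
  have gf: "?g (f x) = x" if "x \<in> carrier M" for x
    using f(2) that by (auto simp: bij_betw_def)
  show ?thesis
  proof (rule linI)
    fix x y assume xy: "x \<in> carrier N" "y \<in> carrier N"
    then have "x \<oplus>\<^bsub>N\<^esub> y = f (?g x \<oplus>\<^bsub>M\<^esub> ?g y)" using g f(1) by (simp add: lin_add)
    then show "?g (x \<oplus>\<^bsub>N\<^esub> y) = ?g x \<oplus>\<^bsub>M\<^esub> ?g y" using gf cl(1) g xy by simp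
  next
    fix a x assume ax: "a \<in> carrier R" "x \<in> carrier N"
    then have "a \<odot>\<^bsub>N\<^esub> x = f (a \<odot>\<^bsub>M\<^esub> ?g x)" using g f(1) by (simp add: lin_smult)
    then show "?g (a \<odot>\<^bsub>N\<^esub> x) = a \<odot>\<^bsub>M\<^esub> ?g x" using gf g ax cl(2) by simp
  qed (use g in auto)
qed

lemma lin_inv_into:
  assumes "left_module R M" "lin R M N f" "bij_betw f (carrier M) (carrier N)"
  shows "lin R N M (inv_into (carrier M) f)"
proof -
  interpret M: left_module R M by fact
  show ?thesis by (rule lin_inv_into_closed) (use assms M.smult_closed in auto)
qed

lemma mod_isoI:
  assumes "left_module R M" "lin R M N f" "bij_betw f (carrier M) (carrier N)"
  shows "mod_iso R M N"
proof -
  interpret M: left_module R M by fact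
  show ?thesis unfolding mod_iso_def
    by (rule bexI[OF _ M.restrict_mod_hom[OF assms(2)]]) (use assms(3) in \<open>simp add: bij_betw_restrict_eq\<close>)
qed

section \<open>Submodules\<close>

text \<open>Negatives come from the scalar \<open>\<ominus> \<one>\<close>, see
  \<open>is_sub_minus\<close>.\<close>

definition is_sub :: "('r, 's) ring_scheme \<Rightarrow> ('r, 'm, 't) module_scheme \<Rightarrow> 'm set \<Rightarrow> bool" where
  "is_sub R M N \<longleftrightarrow> N \<subseteq> carrier M \<and> \<zero>\<^bsub>M\<^esub> \<in> N \<and> (\<forall>x\<in>N. \<forall>y\<in>N. x \<oplus>\<^bsub>M\<^esub> y \<in> N) \<and>
     (\<forall>a\<in>carrier R. \<forall>x\<in>N. a \<odot>\<^bsub>M\<^esub> x \<in> N)"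

context left_module
begin

lemma is_sub_minus: "is_sub R M N \<Longrightarrow> x \<in> N \<Longrightarrow> \<ominus>\<^bsub>M\<^esub> x \<in> N"
  unfolding is_sub_def by (metis R.a_inv_closed R.one_closed minus_as_smult subset_iff)

lemma is_sub_diff: "is_sub R M N \<Longrightarrow> x \<in> N \<Longrightarrow> y \<in> N \<Longrightarrow> x \<ominus>\<^bsub>M\<^esub> y \<in> N"
  unfolding a_minus_def using is_sub_minus[of N y] by (simp add: is_sub_def)

lemma is_sub_carrier: "is_sub R M (carrier M)"
  by (simp add: is_sub_def smult_closed)

lemma is_sub_zero: "is_sub R M {\<zero>\<^bsub>M\<^esub>}"
  by (simp add: is_sub_def smult_r_null)

lemma is_sub_vimage:
  assumes "left_module R N" "lin R M N f" "is_sub R N S"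
  shows "is_sub R M {x \<in> carrier M. f x \<in> S}"
  using assms(3) lin_zero[OF left_module_axioms assms(1,2)] unfolding is_sub_def
  by (auto simp: lin_add[OF assms(2)] lin_smult[OF assms(2)] smult_closed)

lemma is_sub_kernel:
  assumes "left_module R N" "lin R M N f"
  shows "is_sub R M {x \<in> carrier M. f x = \<zero>\<^bsub>N\<^esub>}"
  using is_sub_vimage[OF assms left_module.is_sub_zero[OF assms(1)]] by simp

lemma is_sub_image:
  assumes "left_module R N" "lin R N M f" "is_sub R N S"
  shows "is_sub R M (f ` S)"
proof -
  have S: "S \<subseteq> carrier N" using assms(3) by (simp add: is_sub_def)
  show ?thesis
    unfolding is_sub_def
  proof (intro conjI ballI)
    show "f ` S \<subseteq> carrier M" using S assms(2) by (auto intro: lin_closed)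
    show "\<zero>\<^bsub>M\<^esub> \<in> f ` S"
      using assms(3) lin_zero[OF assms(1) left_module_axioms assms(2)]
      by (intro image_eqI[of _ _ "\<zero>\<^bsub>N\<^esub>"]) (auto simp: is_sub_def)
    fix x y assume "x \<in> f ` S" "y \<in> f ` S"
    then obtain u v where "x = f u" "y = f v" "u \<in> S" "v \<in> S" by auto
    then show "x \<oplus>\<^bsub>M\<^esub> y \<in> f ` S"
      using assms S by (intro image_eqI[of _ _ "u \<oplus>\<^bsub>N\<^esub> v"]) (auto simp: is_sub_def lin_add[OF assms(2)] subset_iff)
  next
    fix a x assume "a \<in> carrier R" "x \<in> f ` S"
    then obtain u where "x = f u" "u \<in> S" by auto
    then show "a \<odot>\<^bsub>M\<^esub> x \<in> f ` S"
      using assms S \<open>a \<in> carrier R\<close>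
      by (intro image_eqI[of _ _ "a \<odot>\<^bsub>N\<^esub> u"]) (auto simp: is_sub_def lin_smult[OF assms(2)] subset_iff)
  qed
qed

lemma left_module_sub:
  assumes "is_sub R M N"
  shows "left_module R (M\<lparr>carrier := N\<rparr>)"
proof (rule left_moduleI)
  have N: "N \<subseteq> carrier M" using assms by (simp add: is_sub_def)
  show "abelian_group (M\<lparr>carrier := N\<rparr>)"
  proof (rule abelian_groupI)
    fix x assume x: "x \<in> carrier (M\<lparr>carrier := N\<rparr>)"
    then show "\<exists>y\<in>carrier (M\<lparr>carrier := N\<rparr>). y \<oplus>\<^bsub>M\<lparr>carrier := N\<rparr>\<^esub> x = \<zero>\<^bsub>M\<lparr>carrier := N\<rparr>\<^esub>"
      using is_sub_minus[OF assms, of x] N by (intro bexI[of _ "\<ominus>\<^bsub>M\<^esub> x"]) (auto simp: M.l_neg)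
  qed (use assms N in \<open>auto simp: is_sub_def subset_iff intro: M.a_comm M.a_assoc\<close>)
qed (use assms in \<open>auto simp: is_sub_def smult_l_distr smult_r_distr smult_assoc1 smult_one R.ring_axioms subset_iff\<close>)

end

lemma lin_sub_cod:
  "lin R M (N\<lparr>carrier := S\<rparr>) f \<longleftrightarrow> lin R M N f \<and> f ` carrier M \<subseteq> S" if "S \<subseteq> carrier N"
  using that by (auto simp: lin_def)

lemma lin_sub_dom: "lin R M N f \<Longrightarrow> S \<subseteq> carrier M \<Longrightarrow> lin R (M\<lparr>carrier := S\<rparr>) N f"
  by (auto simp: lin_def subset_iff)

lemma is_sub_sub:
  "is_sub R M N \<Longrightarrow> is_sub R (M\<lparr>carrier := N\<rparr>) S \<longleftrightarrow> is_sub R M S \<and> S \<subseteq> N"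
  by (auto simp: is_sub_def)

section \<open>Spans and finite generation\<close>

definition sp :: "('r, 's) ring_scheme \<Rightarrow> ('r, 'm, 't) module_scheme \<Rightarrow> 'm set \<Rightarrow> 'm set" where
  "sp R M S = \<Inter>{N. is_sub R M N \<and> S \<subseteq> N}"

lemma sp_subset: "is_sub R M N \<Longrightarrow> S \<subseteq> N \<Longrightarrow> sp R M S \<subseteq> N"
  by (auto simp: sp_def)

lemma subset_sp: "S \<subseteq> sp R M S"
  by (auto simp: sp_def)

lemma (in left_module) is_sub_sp: "S \<subseteq> carrier M \<Longrightarrow> is_sub R M (sp R M S)"
  using is_sub_carrier unfolding sp_def is_sub_def by auto

text \<open>The set of linear combinations of \<open>S\<close> is itself a submodule containing
  \<open>S\<close>. From here on generation is an argument about submodules, and explicit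
  coefficients disappear.\<close>

lemma (in left_module) fin_gen_iff:
  "fin_gen R M \<longleftrightarrow> (\<exists>S. finite S \<and> S \<subseteq> carrier M \<and> sp R M S = carrier M)"
proof
  assume "fin_gen R M"
  then obtain S where S: "finite S" "S \<subseteq> carrier M"
    and gen: "\<And>m. m \<in> carrier M \<Longrightarrow> \<exists>c \<in> S \<rightarrow> carrier R. m = (\<Oplus>\<^bsub>M\<^esub>s\<in>S. c s \<odot>\<^bsub>M\<^esub> s)"
    unfolding fin_gen_def by blast
  have "m \<in> N" if "m \<in> carrier M" and N: "is_sub R M N" "S \<subseteq> N" for m N
  proof -
    obtain c where c: "c \<in> S \<rightarrow> carrier R" "m = (\<Oplus>\<^bsub>M\<^esub>s\<in>S. c s \<odot>\<^bsub>M\<^esub> s)" using gen \<open>m \<in> _\<close> by blast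
    have "(\<Oplus>\<^bsub>M\<^esub>s\<in>F. c s \<odot>\<^bsub>M\<^esub> s) \<in> N" if "finite F" "F \<subseteq> S" for F
      using that
    proof (induction F)
      case empty then show ?case using N by (simp add: is_sub_def)
    next
      case (insert x F)
      have "(\<lambda>s. c s \<odot>\<^bsub>M\<^esub> s) \<in> F \<rightarrow> carrier M" "c x \<odot>\<^bsub>M\<^esub> x \<in> carrier M"
        using insert.prems S(2) c by (auto intro!: smult_closed)
      moreover have "c x \<in> carrier R" "x \<in> N" using N c insert.prems by auto
      then have "c x \<odot>\<^bsub>M\<^esub> x \<in> N" using N by (auto simp: is_sub_def)
      ultimately show ?case using insert N by (simp add: is_sub_def)
    qed
    then show ?thesis using S c by simp
  qed
  then have "sp R M S = carrier M"
    using sp_subset[OF is_sub_carrier S(2)] by (auto simp: sp_def)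
  then show "\<exists>S. finite S \<and> S \<subseteq> carrier M \<and> sp R M S = carrier M" using S by blast
next
  assume "\<exists>S. finite S \<and> S \<subseteq> carrier M \<and> sp R M S = carrier M"
  then obtain S where S: "finite S" "S \<subseteq> carrier M" "sp R M S = carrier M" by blast
  define N where "N = {m. \<exists>c \<in> S \<rightarrow> carrier R. m = (\<Oplus>\<^bsub>M\<^esub>s\<in>S. c s \<odot>\<^bsub>M\<^esub> s)}"
  have cl: "(\<lambda>s. c s \<odot>\<^bsub>M\<^esub> s) \<in> S \<rightarrow> carrier M" if "c \<in> S \<rightarrow> carrier R" for c
    using that S(2) by (auto intro!: smult_closed)
  have "is_sub R M N"
    unfolding is_sub_def
  proof (intro conjI ballI)
    show "N \<subseteq> carrier M" using cl by (auto simp: N_def intro!: M.finsum_closed)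
    have "(\<Oplus>\<^bsub>M\<^esub>s\<in>S. \<zero> \<odot>\<^bsub>M\<^esub> s) = \<zero>\<^bsub>M\<^esub>"
      using S(2) by (subst M.finsum_cong'[where g = "\<lambda>_. \<zero>\<^bsub>M\<^esub>" and B = S]) (auto simp: smult_l_null)
    then show "\<zero>\<^bsub>M\<^esub> \<in> N" unfolding N_def
      by (auto intro!: bexI[of _ "\<lambda>_. \<zero>"])
    fix x y assume "x \<in> N" "y \<in> N"
    then obtain c d where c: "c \<in> S \<rightarrow> carrier R" "x = (\<Oplus>\<^bsub>M\<^esub>s\<in>S. c s \<odot>\<^bsub>M\<^esub> s)"
      and d: "d \<in> S \<rightarrow> carrier R" "y = (\<Oplus>\<^bsub>M\<^esub>s\<in>S. d s \<odot>\<^bsub>M\<^esub> s)" by (auto simp: N_def)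
    have "(\<Oplus>\<^bsub>M\<^esub>s\<in>S. (c s \<oplus> d s) \<odot>\<^bsub>M\<^esub> s) = (\<Oplus>\<^bsub>M\<^esub>s\<in>S. c s \<odot>\<^bsub>M\<^esub> s \<oplus>\<^bsub>M\<^esub> d s \<odot>\<^bsub>M\<^esub> s)"
      using c d by (intro M.finsum_cong') (auto simp: subsetD[OF S(2)] Pi_iff intro!: smult_closed smult_l_distr M.a_closed)
    also have "\<dots> = x \<oplus>\<^bsub>M\<^esub> y"
      unfolding c(2) d(2) using cl c d by (intro M.finsum_addf) auto
    finally show "x \<oplus>\<^bsub>M\<^esub> y \<in> N" unfolding N_def
      using c d by (auto intro!: bexI[of _ "\<lambda>s. c s \<oplus> d s"])
  next
    fix a x assume a: "a \<in> carrier R" "x \<in> N"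
    then obtain c where c: "c \<in> S \<rightarrow> carrier R" "x = (\<Oplus>\<^bsub>M\<^esub>s\<in>S. c s \<odot>\<^bsub>M\<^esub> s)" by (auto simp: N_def)
    have "(\<Oplus>\<^bsub>M\<^esub>s\<in>S. (a \<otimes> c s) \<odot>\<^bsub>M\<^esub> s) = (\<Oplus>\<^bsub>M\<^esub>s\<in>S. a \<odot>\<^bsub>M\<^esub> (c s \<odot>\<^bsub>M\<^esub> s))"
      using c a S(2) by (intro M.finsum_cong') (auto simp: Pi_iff subset_iff intro!: smult_assoc1 smult_closed)
    also have "\<dots> = a \<odot>\<^bsub>M\<^esub> x"
      unfolding c(2) using cl c a by (intro smult_finsum[symmetric]) auto
    finally show "a \<odot>\<^bsub>M\<^esub> x \<in> N" unfolding N_def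
      using c a by (auto intro!: bexI[of _ "\<lambda>s. a \<otimes> c s"])
  qed
  moreover have "S \<subseteq> N"
  proof
    fix s assume s: "s \<in> S"
    have "(\<Oplus>\<^bsub>M\<^esub>t\<in>S. (if s = t then \<one> else \<zero>) \<odot>\<^bsub>M\<^esub> t) = (\<Oplus>\<^bsub>M\<^esub>t\<in>S. (if s = t then t else \<zero>\<^bsub>M\<^esub>))"
      using S(2) by (intro M.finsum_cong') (auto simp: smult_one smult_l_null)
    also have "\<dots> = s" using s S by (intro M.finsum_singleton) auto
    finally show "s \<in> N" unfolding N_def
      by (auto intro!: bexI[of _ "\<lambda>t. if s = t then \<one> else \<zero>"])
  qed
  ultimately have "carrier M \<subseteq> N" using S(3) sp_subset by blast
  then show "fin_gen R M" unfolding fin_gen_def N_def using S(1,2) by blast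
qed

text \<open>A submodule of \<open>N\<close> that contains the images of the generators pulls back to
  a submodule of \<open>M\<close> that contains the generators, hence to all of
  \<open>M\<close>.\<close>

lemma fg_module_image:
  assumes "fg_module R M" "left_module R N" "lin R M N f" "f ` carrier M = carrier N"
  shows "fg_module R N"
proof -
  interpret M: left_module R M using assms by (simp add: fg_module_def)
  interpret N: left_module R N by fact
  obtain S where S: "finite S" "S \<subseteq> carrier M" "sp R M S = carrier M"
    using assms(1) M.fin_gen_iff by (auto simp: fg_module_def)
  have "sp R N (f ` S) = carrier N"
  proof
    show "sp R N (f ` S) \<subseteq> carrier N"
      using S assms by (intro sp_subset N.is_sub_carrier) auto
    show "carrier N \<subseteq> sp R N (f ` S)"
      unfolding sp_def
    proof clarsimp
      fix y L assume y: "y \<in> carrier N" and L: "is_sub R N L" "f ` S \<subseteq> L"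
      have "sp R M S \<subseteq> {x \<in> carrier M. f x \<in> L}"
        by (rule sp_subset[OF M.is_sub_vimage[OF assms(2,3) L(1)]]) (use S(2) L(2) in blast)
      moreover obtain x where "x \<in> carrier M" "y = f x" using y assms(4) by blast
      ultimately show "y \<in> L" using S(3) by blast
    qed
  qed
  then show ?thesis unfolding fg_module_def N.fin_gen_iff
    using S assms(2,4) by (intro conjI exI[of _ "f ` S"]) blast+
qed

section \<open>Copies, products and finite direct sums\<close>

text \<open>Transport of structure along an injective function. It moves finitely generated modules
  onto the type of the test modules in \<open>projective\<close> and
  \<open>injective\<close>.\<close>

definition copy_mod :: "('m \<Rightarrow> 'n) \<Rightarrow> ('r, 'm) module \<Rightarrow> ('r, 'n) module" where
  "copy_mod j M = \<lparr>carrier = j ` carrier M, monoid.mult = undefined, monoid.one = undefined,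
     ring.zero = j \<zero>\<^bsub>M\<^esub>,
     ring.add = (\<lambda>x y. j (inv_into (carrier M) j x \<oplus>\<^bsub>M\<^esub> inv_into (carrier M) j y)),
     smult = (\<lambda>a x. j (a \<odot>\<^bsub>M\<^esub> inv_into (carrier M) j x))\<rparr>"

lemma lin_copy_mod:
  assumes "left_module R M" "inj_on j (carrier M)"
  shows "left_module R (copy_mod j M)" "lin R M (copy_mod j M) j"
    "bij_betw j (carrier M) (carrier (copy_mod j M))"
proof -
  interpret M: left_module R M by fact
  let ?C = "copy_mod j M"
  have inv: "inv_into (carrier M) j (j x) = x" if "x \<in> carrier M" for x
    using assms(2) that by simp
  have c: "carrier ?C = j ` carrier M" "\<zero>\<^bsub>?C\<^esub> = j \<zero>\<^bsub>M\<^esub>" by (simp_all add: copy_mod_def)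
  have op: "u \<in> carrier M \<Longrightarrow> v \<in> carrier M \<Longrightarrow> j u \<oplus>\<^bsub>?C\<^esub> j v = j (u \<oplus>\<^bsub>M\<^esub> v)"
    "u \<in> carrier M \<Longrightarrow> a \<odot>\<^bsub>?C\<^esub> j u = j (a \<odot>\<^bsub>M\<^esub> u)" for a u v
    by (simp_all add: copy_mod_def inv)
  show "left_module R ?C"
  proof (intro left_moduleI abelian_groupI M.R_ring)
    fix x assume "x \<in> carrier ?C"
    then obtain u where "u \<in> carrier M" "x = j u" by (auto simp: c)
    then show "\<exists>y\<in>carrier ?C. y \<oplus>\<^bsub>?C\<^esub> x = \<zero>\<^bsub>?C\<^esub>"
      by (intro bexI[of _ "j (\<ominus>\<^bsub>M\<^esub> u)"]) (simp_all add: op c M.M.l_neg)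
  qed (auto simp: c op M.M.a_ac M.smult_closed M.smult_l_distr M.smult_r_distr M.smult_assoc1 M.smult_one)
  show "lin R M ?C j" by (rule linI) (auto simp: c op)
  show "bij_betw j (carrier M) (carrier (copy_mod j M))"
    using assms(2) by (simp add: copy_mod_def bij_betw_def)
qed

text \<open>The summands of \<open>direct_sum\<close> share one type; here the two factors may live
  on different types, as they do in \<open>cover_finite\<close>.\<close>

definition prod_mod :: "('r, 'm) module \<Rightarrow> ('r, 'n) module \<Rightarrow> ('r, 'm \<times> 'n) module" where
  "prod_mod M N = \<lparr>carrier = carrier M \<times> carrier N, monoid.mult = undefined, monoid.one = undefined,
     ring.zero = (\<zero>\<^bsub>M\<^esub>, \<zero>\<^bsub>N\<^esub>), ring.add = (\<lambda>x y. (fst x \<oplus>\<^bsub>M\<^esub> fst y, snd x \<oplus>\<^bsub>N\<^esub> snd y)),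
     smult = (\<lambda>a x. (a \<odot>\<^bsub>M\<^esub> fst x, a \<odot>\<^bsub>N\<^esub> snd x))\<rparr>"

lemma left_module_prod:
  assumes "left_module R M" "left_module R N"
  shows "left_module R (prod_mod M N)"
proof -
  interpret M: left_module R M by fact
  interpret N: left_module R N by fact
  show ?thesis
  proof (rule left_moduleI)
    show "abelian_group (prod_mod M N)"
    proof (rule abelian_groupI)
      fix x assume "x \<in> carrier (prod_mod M N)"
      then show "\<exists>y\<in>carrier (prod_mod M N). y \<oplus>\<^bsub>prod_mod M N\<^esub> x = \<zero>\<^bsub>prod_mod M N\<^esub>"
        by (intro bexI[of _ "(\<ominus>\<^bsub>M\<^esub> fst x, \<ominus>\<^bsub>N\<^esub> snd x)"]) (auto simp: prod_mod_def M.M.l_neg N.M.l_neg)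
    qed (auto simp: prod_mod_def intro: M.M.a_assoc N.M.a_assoc M.M.a_comm N.M.a_comm)
  qed (auto simp: prod_mod_def M.smult_closed N.smult_closed M.smult_l_distr N.smult_l_distr
      M.smult_r_distr N.smult_r_distr M.smult_assoc1 N.smult_assoc1 M.smult_one N.smult_one M.R_ring)
qed

lemma lin_fst: "lin R (prod_mod M N) M fst" and lin_snd: "lin R (prod_mod M N) N snd"
  by (auto simp: lin_def prod_mod_def)

lemma lin_pair: "lin R L M f \<Longrightarrow> lin R L N g \<Longrightarrow> lin R L (prod_mod M N) (\<lambda>x. (f x, g x))"
  by (auto simp: lin_def prod_mod_def)

lemma left_module_direct_sum:
  assumes "ring R" "\<And>i. i < n \<Longrightarrow> left_module R (M i)"
  shows "left_module R (direct_sum n M)"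
proof -
  let ?D = "direct_sum n M"
  note m = assms(2)
  note g = left_module.M_group[OF m]
  note gm = abelian_group.axioms(1)[OF g]
  have s: "carrier ?D = (\<Pi>\<^sub>E i\<in>{..<n}. carrier (M i))" "\<zero>\<^bsub>?D\<^esub> = (\<lambda>i\<in>{..<n}. \<zero>\<^bsub>M i\<^esub>)"
    "x \<oplus>\<^bsub>?D\<^esub> y = (\<lambda>i\<in>{..<n}. x i \<oplus>\<^bsub>M i\<^esub> y i)" "a \<odot>\<^bsub>?D\<^esub> x = (\<lambda>i\<in>{..<n}. a \<odot>\<^bsub>M i\<^esub> x i)" for a x y
    by (simp_all add: direct_sum_def)
  show ?thesis
  proof (intro left_moduleI abelian_groupI assms(1))
    fix x assume "x \<in> carrier ?D"
    then show "\<exists>y\<in>carrier ?D. y \<oplus>\<^bsub>?D\<^esub> x = \<zero>\<^bsub>?D\<^esub>"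
      by (intro bexI[of _ "\<lambda>i\<in>{..<n}. \<ominus>\<^bsub>M i\<^esub> x i"])
        (auto simp: s PiE_iff abelian_group.l_neg[OF g] abelian_group.a_inv_closed[OF g] cong: restrict_cong)
  qed (simp_all add: s PiE_iff extensional_restrict abelian_groupE(1,2)[OF g] abelian_monoid.a_ac[OF gm] abelian_monoid.l_zero[OF gm]
      abelian_monoid.r_zero[OF gm] left_module.smult_closed[OF m]
      left_module.smult_l_distr[OF m] left_module.smult_r_distr[OF m] left_module.smult_assoc1[OF m] left_module.smult_one[OF m]
      cong: restrict_cong)
qed

definition dsum_inj :: "nat \<Rightarrow> (nat \<Rightarrow> ('a, 'm) module) \<Rightarrow> nat \<Rightarrow> 'm \<Rightarrow> nat \<Rightarrow> 'm" where
  "dsum_inj n M i x = (\<lambda>j\<in>{..<n}. if j = i then x else \<zero>\<^bsub>M j\<^esub>)"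

lemma lin_dsum_proj: "i < n \<Longrightarrow> lin R (direct_sum n M) (M i) (\<lambda>x. x i)"
  by (rule linI) (auto simp: direct_sum_def)

lemma lin_dsum_inj:
  assumes "\<And>i. i < n \<Longrightarrow> left_module R (M i)" "i < n"
  shows "lin R (M i) (direct_sum n M) (dsum_inj n M i)"
proof (rule linI)
  have g: "abelian_group (M i)" if "i < n" for i
    using assms(1)[OF that] by (rule left_module.M_group)
  fix x y assume "x \<in> carrier (M i)" "y \<in> carrier (M i)"
  then show "dsum_inj n M i x \<in> carrier (direct_sum n M)"
    "dsum_inj n M i (x \<oplus>\<^bsub>M i\<^esub> y) = dsum_inj n M i x \<oplus>\<^bsub>direct_sum n M\<^esub> dsum_inj n M i y"
    using g by (auto simp: direct_sum_def dsum_inj_def fun_eq_iff abelian_groupE(2) abelian_groupE(5))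
next
  fix a x assume "a \<in> carrier R" "x \<in> carrier (M i)"
  then show "dsum_inj n M i (a \<odot>\<^bsub>M i\<^esub> x) = a \<odot>\<^bsub>direct_sum n M\<^esub> dsum_inj n M i x"
    by (auto simp: direct_sum_def dsum_inj_def fun_eq_iff left_module.smult_r_null[OF assms(1)])
qed

lemma dsum_decomp:
  assumes "ring R" "\<And>i. i < n \<Longrightarrow> left_module R (M i)" "x \<in> carrier (direct_sum n M)"
  shows "x = (\<Oplus>\<^bsub>direct_sum n M\<^esub>i\<in>{..<n}. dsum_inj n M i (x i))"
proof -
  interpret D: left_module R "direct_sum n M" by (rule left_module_direct_sum) (use assms in auto)
  have g: "abelian_group (M i)" if "i < n" for i
    using assms(2)[OF that] by (rule left_module.M_group)
  have x: "x i \<in> carrier (M i)" if "i < n" for i using assms(3) that by (auto simp: direct_sum_def)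
  \<comment> \<open>The induction is over partial sums, whose value is known coordinatewise: the
    first \<open>m\<close> coordinates are filled in, the others are still zero.\<close>
  have "(\<Oplus>\<^bsub>direct_sum n M\<^esub>i\<in>{..<m}. dsum_inj n M i (x i)) = (\<lambda>j\<in>{..<n}. if j < m then x j else \<zero>\<^bsub>M j\<^esub>)"
    if "m \<le> n" for m
    using that
  proof (induction m)
    case 0
    have "\<zero>\<^bsub>direct_sum n M\<^esub> = (\<lambda>j\<in>{..<n}. \<zero>\<^bsub>M j\<^esub>)" by (simp add: direct_sum_def)
    then show ?case by simp
  next
    case (Suc m)
    have cl: "dsum_inj n M i (x i) \<in> carrier (direct_sum n M)" if "i < n" for i
      using lin_closed[OF lin_dsum_inj[OF assms(2)]] that x by auto
    have "(\<Oplus>\<^bsub>direct_sum n M\<^esub>i\<in>{..<Suc m}. dsum_inj n M i (x i)) =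
       dsum_inj n M m (x m) \<oplus>\<^bsub>direct_sum n M\<^esub> (\<Oplus>\<^bsub>direct_sum n M\<^esub>i\<in>{..<m}. dsum_inj n M i (x i))"
      unfolding lessThan_Suc using Suc.prems cl by (subst D.M.finsum_insert) auto
    also have "\<dots> = dsum_inj n M m (x m) \<oplus>\<^bsub>direct_sum n M\<^esub> (\<lambda>j\<in>{..<n}. if j < m then x j else \<zero>\<^bsub>M j\<^esub>)"
      using Suc.IH Suc.prems by (simp only:)
    also have "\<dots> = (\<lambda>j\<in>{..<n}. if j < Suc m then x j else \<zero>\<^bsub>M j\<^esub>)"
      using x by (auto simp: direct_sum_def dsum_inj_def fun_eq_iff less_Suc_eq
          abelian_groupE(2)[OF g] abelian_groupE(5)[OF g] abelian_monoid.r_zero[OF abelian_group.axioms(1)[OF g]])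
    finally show ?case .
  qed
  from this[of n] show ?thesis using assms(3)
    by (auto simp: direct_sum_def fun_eq_iff PiE_iff extensional_def)
qed

section \<open>Linear algebra over a field\<close>

lemma regular_simps [simp]:
  "carrier (regular R) = carrier R" "ring.zero (regular R) = \<zero>\<^bsub>R\<^esub>"
  "ring.add (regular R) = ring.add R" "smult (regular R) = monoid.mult R"
  by (simp_all add: regular_def)

lemma left_module_regular: "ring R \<Longrightarrow> left_module R (regular R)"
proof (rule left_moduleI)
  assume "ring R"
  then interpret R: ring R .
  show "abelian_group (regular R)"
    by (rule abelian_groupI) (auto intro: R.a_assoc R.a_comm intro!: bexI[of _ "\<ominus>\<^bsub>R\<^esub> _"] R.l_neg)
qed (auto simp: ring.ring_simprules)

lemma (in left_module) sp_insert:
  assumes "S \<subseteq> carrier M" "s \<in> carrier M"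
  shows "sp R M (insert s S) = {w \<oplus>\<^bsub>M\<^esub> c \<odot>\<^bsub>M\<^esub> s | w c. w \<in> sp R M S \<and> c \<in> carrier R}" (is "_ = ?W")
proof
  note W = is_sub_sp[OF assms(1)]
  have Wc: "\<And>w. w \<in> sp R M S \<Longrightarrow> w \<in> carrier M" using W by (auto simp: is_sub_def)
  have "is_sub R M ?W"
    unfolding is_sub_def
  proof (intro conjI ballI)
    show "?W \<subseteq> carrier M" using Wc assms(2) by (auto intro!: M.a_closed smult_closed)
    show "\<zero>\<^bsub>M\<^esub> \<in> ?W"
      using W assms(2) by (auto simp: is_sub_def smult_l_null intro!: exI[of _ "\<zero>\<^bsub>M\<^esub>"] exI[of _ \<zero>])
    fix x y assume "x \<in> ?W" "y \<in> ?W"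
    then obtain w c v d where x: "x = w \<oplus>\<^bsub>M\<^esub> c \<odot>\<^bsub>M\<^esub> s" "w \<in> sp R M S" "c \<in> carrier R"
      and y: "y = v \<oplus>\<^bsub>M\<^esub> d \<odot>\<^bsub>M\<^esub> s" "v \<in> sp R M S" "d \<in> carrier R" by blast
    have "c \<odot>\<^bsub>M\<^esub> s \<in> carrier M" "d \<odot>\<^bsub>M\<^esub> s \<in> carrier M"
      using x(3) y(3) assms(2) by (auto intro: smult_closed)
    then have "x \<oplus>\<^bsub>M\<^esub> y = (w \<oplus>\<^bsub>M\<^esub> v) \<oplus>\<^bsub>M\<^esub> (c \<oplus> d) \<odot>\<^bsub>M\<^esub> s"
      using x y Wc assms(2) by (simp add: smult_l_distr M.a_ac)
    then show "x \<oplus>\<^bsub>M\<^esub> y \<in> ?W" using W x y unfolding is_sub_def by blast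
  next
    fix a x assume a: "a \<in> carrier R" and "x \<in> ?W"
    then obtain w c where x: "x = w \<oplus>\<^bsub>M\<^esub> c \<odot>\<^bsub>M\<^esub> s" "w \<in> sp R M S" "c \<in> carrier R" by blast
    then have "a \<odot>\<^bsub>M\<^esub> x = a \<odot>\<^bsub>M\<^esub> w \<oplus>\<^bsub>M\<^esub> (a \<otimes> c) \<odot>\<^bsub>M\<^esub> s"
      using a Wc assms(2) by (simp add: smult_r_distr smult_closed smult_assoc1)
    then show "a \<odot>\<^bsub>M\<^esub> x \<in> ?W" using W a x unfolding is_sub_def by blast
  qed
  moreover have "insert s S \<subseteq> ?W"
  proof
    fix t assume "t \<in> insert s S"
    then consider "t = s" | "t \<in> S" by blast
    then show "t \<in> ?W"
    proof cases
      case 1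
      then have "t = \<zero>\<^bsub>M\<^esub> \<oplus>\<^bsub>M\<^esub> \<one> \<odot>\<^bsub>M\<^esub> s" using assms(2) by (simp add: smult_one)
      then show ?thesis using W unfolding is_sub_def by blast
    next
      case 2
      then have "t = t \<oplus>\<^bsub>M\<^esub> \<zero> \<odot>\<^bsub>M\<^esub> s" "t \<in> sp R M S"
        using assms subset_sp[of S R M] by (auto simp: smult_l_null)
      then show ?thesis by blast
    qed
  qed
  ultimately show "sp R M (insert s S) \<subseteq> ?W" by (rule sp_subset)
  have T: "is_sub R M (sp R M (insert s S))" using assms by (intro is_sub_sp) auto
  have "sp R M S \<subseteq> sp R M (insert s S)"
    using subset_sp[of "insert s S" R M] by (intro sp_subset[OF T]) auto
  moreover have "s \<in> sp R M (insert s S)" using subset_sp[of "insert s S" R M] by auto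
  ultimately show "?W \<subseteq> sp R M (insert s S)"
    using T unfolding is_sub_def by blast
qed

lemma (in left_module) sp_of_sub: "is_sub R M W \<Longrightarrow> sp R M W = W"
  using sp_subset[of R M W W] subset_sp[of W R M] by auto

lemma (in left_module) sp_absorb:
  assumes "S \<subseteq> carrier M" "s \<in> sp R M S"
  shows "sp R M (insert s S) = sp R M S"
proof
  have T: "is_sub R M (sp R M S)" using assms by (intro is_sub_sp) auto
  then show "sp R M (insert s S) \<subseteq> sp R M S" using subset_sp[of S R M] assms by (intro sp_subset) auto
  have "s \<in> carrier M" using T assms by (auto simp: is_sub_def)
  then have T': "is_sub R M (sp R M (insert s S))" using assms by (intro is_sub_sp) auto
  show "sp R M S \<subseteq> sp R M (insert s S)"
    using subset_sp[of "insert s S" R M] by (intro sp_subset[OF T']) auto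
qed

lemma (in left_module) sp_empty: "sp R M {} = {\<zero>\<^bsub>M\<^esub>}"
  using sp_subset[OF is_sub_zero, of "{}"] is_sub_sp[of "{}"] by (auto simp: is_sub_def)

section \<open>Vector spaces: adding one vector at a time\<close>

locale vspace = field K + left_module K V for K :: "('k, 's) ring_scheme" and V :: "('k, 'm, 't) module_scheme"
begin

lemma smult_inv: "c \<in> carrier K \<Longrightarrow> c \<noteq> \<zero>\<^bsub>K\<^esub> \<Longrightarrow> x \<in> carrier V \<Longrightarrow> inv\<^bsub>K\<^esub> c \<odot>\<^bsub>V\<^esub> (c \<odot>\<^bsub>V\<^esub> x) = x"
  by (simp add: smult_assoc1[symmetric] field_Units smult_one)

lemma inv_carrier: "c \<in> carrier K \<Longrightarrow> c \<noteq> \<zero>\<^bsub>K\<^esub> \<Longrightarrow> inv\<^bsub>K\<^esub> c \<in> carrier K"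
  by (simp add: field_Units)

text \<open>Otherwise a nonzero multiple of \<open>s\<close> lies in \<open>W\<close>, and dividing
  by its coefficient puts \<open>s\<close> itself into \<open>W\<close>.\<close>

lemma hyper_unique:
  assumes W: "is_sub K V W" and s: "s \<in> carrier V" "s \<notin> W"
    and "w \<in> W" "c \<in> carrier K" "w' \<in> W" "c' \<in> carrier K"
    and eq: "w \<oplus>\<^bsub>V\<^esub> c \<odot>\<^bsub>V\<^esub> s = w' \<oplus>\<^bsub>V\<^esub> c' \<odot>\<^bsub>V\<^esub> s"
  shows "c = c' \<and> w = w'"
proof -
  have wc: "w \<in> carrier V" "w' \<in> carrier V" "c \<odot>\<^bsub>V\<^esub> s \<in> carrier V" "c' \<odot>\<^bsub>V\<^esub> s \<in> carrier V"
    using assms by (auto simp: is_sub_def smult_closed)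
  have "w \<ominus>\<^bsub>V\<^esub> w' = (w \<oplus>\<^bsub>V\<^esub> c \<odot>\<^bsub>V\<^esub> s) \<ominus>\<^bsub>V\<^esub> (w' \<oplus>\<^bsub>V\<^esub> c \<odot>\<^bsub>V\<^esub> s)"
    using wc by (simp add: a_minus_def M.minus_add M.a_ac M.r_neg2 M.r_neg)
  also have "\<dots> = (w' \<oplus>\<^bsub>V\<^esub> c' \<odot>\<^bsub>V\<^esub> s) \<ominus>\<^bsub>V\<^esub> (w' \<oplus>\<^bsub>V\<^esub> c \<odot>\<^bsub>V\<^esub> s)" by (simp add: eq)
  also have "\<dots> = c' \<odot>\<^bsub>V\<^esub> s \<ominus>\<^bsub>V\<^esub> c \<odot>\<^bsub>V\<^esub> s"
    using wc by (simp add: a_minus_def M.minus_add M.a_ac M.r_neg2 M.r_neg)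
  also have "\<dots> = (c' \<ominus>\<^bsub>K\<^esub> c) \<odot>\<^bsub>V\<^esub> s"
    using assms by (simp add: a_minus_def smult_l_distr smult_l_minus)
  finally have e: "w \<ominus>\<^bsub>V\<^esub> w' = (c' \<ominus>\<^bsub>K\<^esub> c) \<odot>\<^bsub>V\<^esub> s" .
  have d: "c' \<ominus>\<^bsub>K\<^esub> c \<in> carrier K" using assms by simp
  have dW: "(c' \<ominus>\<^bsub>K\<^esub> c) \<odot>\<^bsub>V\<^esub> s \<in> W" using is_sub_diff[OF W assms(4,6)] e by simp
  have "c' \<ominus>\<^bsub>K\<^esub> c = \<zero>\<^bsub>K\<^esub>"
  proof (rule ccontr)
    assume n: "c' \<ominus>\<^bsub>K\<^esub> c \<noteq> \<zero>\<^bsub>K\<^esub>"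
    have "inv\<^bsub>K\<^esub> (c' \<ominus>\<^bsub>K\<^esub> c) \<odot>\<^bsub>V\<^esub> ((c' \<ominus>\<^bsub>K\<^esub> c) \<odot>\<^bsub>V\<^esub> s) \<in> W"
      using W dW inv_carrier[OF d n] by (auto simp: is_sub_def)
    then show False using smult_inv[OF d n s(1)] s by simp
  qed
  moreover from this have "w \<ominus>\<^bsub>V\<^esub> w' = \<zero>\<^bsub>V\<^esub>" using e s by (simp add: smult_l_null)
  ultimately show ?thesis using wc assms abelian_group.diff_eq_zeroD[OF ring.is_abelian_group[OF R_ring], of c' c] M.diff_eq_zeroD[of w w'] by simp
qed

text \<open>The coordinates are picked by choice and have arbitrary values off
  \<open>W + K s\<close>. Their linearity is read off from the value equations at each use.\<close>

lemma hyper_coords: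
  assumes W: "is_sub K V W" and s: "s \<in> carrier V" "s \<notin> W"
  obtains cf wf where "\<And>w c. w \<in> W \<Longrightarrow> c \<in> carrier K \<Longrightarrow> cf (w \<oplus>\<^bsub>V\<^esub> c \<odot>\<^bsub>V\<^esub> s) = c \<and> wf (w \<oplus>\<^bsub>V\<^esub> c \<odot>\<^bsub>V\<^esub> s) = w"
proof -
  define P where "P x p \<longleftrightarrow> fst p \<in> carrier K \<and> snd p \<in> W \<and> x = snd p \<oplus>\<^bsub>V\<^esub> fst p \<odot>\<^bsub>V\<^esub> s" for x p
  have "(SOME p. P (w \<oplus>\<^bsub>V\<^esub> c \<odot>\<^bsub>V\<^esub> s) p) = (c, w)" if "w \<in> W" "c \<in> carrier K" for w c
  proof (rule some_equality)
    show "P (w \<oplus>\<^bsub>V\<^esub> c \<odot>\<^bsub>V\<^esub> s) (c, w)" using that by (simp add: P_def)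
    fix p assume "P (w \<oplus>\<^bsub>V\<^esub> c \<odot>\<^bsub>V\<^esub> s) p"
    then show "p = (c, w)" using hyper_unique[OF W s that, of "snd p" "fst p"]
      by (auto simp: P_def prod_eq_iff)
  qed
  then show thesis
    using that[of "\<lambda>x. fst (SOME p. P x p)" "\<lambda>x. snd (SOME p. P x p)"] by simp
qed

lemma sum_smult_add:
  assumes "x \<in> carrier V" "y \<in> carrier V" "s \<in> carrier V" "c \<in> carrier K" "d \<in> carrier K" "a \<in> carrier K"
  shows "(x \<oplus>\<^bsub>V\<^esub> c \<odot>\<^bsub>V\<^esub> s) \<oplus>\<^bsub>V\<^esub> (y \<oplus>\<^bsub>V\<^esub> d \<odot>\<^bsub>V\<^esub> s) = (x \<oplus>\<^bsub>V\<^esub> y) \<oplus>\<^bsub>V\<^esub> (c \<oplus>\<^bsub>K\<^esub> d) \<odot>\<^bsub>V\<^esub> s"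
    "a \<odot>\<^bsub>V\<^esub> (x \<oplus>\<^bsub>V\<^esub> c \<odot>\<^bsub>V\<^esub> s) = a \<odot>\<^bsub>V\<^esub> x \<oplus>\<^bsub>V\<^esub> (a \<otimes>\<^bsub>K\<^esub> c) \<odot>\<^bsub>V\<^esub> s"
  using assms smult_closed[OF assms(4,3)] smult_closed[OF assms(5,3)]
  by (simp_all add: smult_l_distr M.a_ac smult_r_distr smult_assoc1)

text \<open>Linear independence is never mentioned; the coordinate functionals take its place. A
  spanning vector already in the span is skipped. A new one contributes its own coordinate, and the
  earlier functionals are composed with the projection to the old span.\<close>

lemma dual_basis:
  assumes "finite S" "S \<subseteq> carrier V"
  shows "\<exists>B st. finite B \<and> B \<subseteq> sp K V S \<and> (\<forall>b\<in>B. lin K (V\<lparr>carrier := sp K V S\<rparr>) (regular K) (st b)) \<and>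
     (\<forall>x\<in>sp K V S. x = (\<Oplus>\<^bsub>V\<^esub>b\<in>B. st b x \<odot>\<^bsub>V\<^esub> b))"
  using assms
proof (induction S)
  case empty
  then show ?case by (intro exI[of _ "{}"]) (auto simp: sp_empty)
next
  case (insert s S)
  let ?W = "sp K V S" and ?W' = "sp K V (insert s S)"
  have S: "S \<subseteq> carrier V" "s \<in> carrier V" using insert by auto
  obtain B st where B: "finite B" "B \<subseteq> ?W" "\<forall>b\<in>B. lin K (V\<lparr>carrier := ?W\<rparr>) (regular K) (st b)"
    "\<forall>x\<in>?W. x = (\<Oplus>\<^bsub>V\<^esub>b\<in>B. st b x \<odot>\<^bsub>V\<^esub> b)"
    using insert.IH[OF S(1)] by (elim exE conjE) (rule that)
  note B3 = B(3)[rule_format] and B4 = B(4)[rule_format]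
  show ?case
  proof (cases "s \<in> ?W")
    case True
    show ?thesis unfolding sp_absorb[OF S(1) True] using B by (intro exI[of _ B] exI[of _ st] conjI)
  next
    case False
    note W = is_sub_sp[OF S(1)]
    have Wc: "\<And>w. w \<in> ?W \<Longrightarrow> w \<in> carrier V" using W by (auto simp: is_sub_def)
    obtain cf wf where cw: "\<And>w c. w \<in> ?W \<Longrightarrow> c \<in> carrier K \<Longrightarrow> cf (w \<oplus>\<^bsub>V\<^esub> c \<odot>\<^bsub>V\<^esub> s) = c \<and> wf (w \<oplus>\<^bsub>V\<^esub> c \<odot>\<^bsub>V\<^esub> s) = w"
      using hyper_coords[OF W S(2) False] by metis
    have el: "\<exists>w c. x = w \<oplus>\<^bsub>V\<^esub> c \<odot>\<^bsub>V\<^esub> s \<and> w \<in> ?W \<and> c \<in> carrier K" if "x \<in> ?W'" for x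
      using that unfolding sp_insert[OF S] by blast
    have Wadd: "u \<oplus>\<^bsub>V\<^esub> w \<in> ?W" "a \<odot>\<^bsub>V\<^esub> u \<in> ?W" if "u \<in> ?W" "w \<in> ?W" "a \<in> carrier K" for u w a
      using W that by (auto simp: is_sub_def)
    have lcf: "lin K (V\<lparr>carrier := ?W'\<rparr>) (regular K) cf" and lwf: "lin K (V\<lparr>carrier := ?W'\<rparr>) (V\<lparr>carrier := ?W\<rparr>) wf"
      unfolding lin_def
      using cw Wadd Wc S(2) by (auto dest!: el simp: sum_smult_add)
    define st' where "st' b = (if b = s then cf else (\<lambda>x. st b (wf x)))" for b
    have sB: "s \<notin> B" using B(2) False by auto
    have "lin K (V\<lparr>carrier := ?W'\<rparr>) (regular K) (st' b)" if "b \<in> insert s B" for b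
      using that lcf lin_comp[OF lwf B3] sB by (auto simp: st'_def)
    moreover have "x = (\<Oplus>\<^bsub>V\<^esub>b\<in>insert s B. st' b x \<odot>\<^bsub>V\<^esub> b)" if x: "x \<in> ?W'" for x
    proof -
      obtain w c where wc: "x = w \<oplus>\<^bsub>V\<^esub> c \<odot>\<^bsub>V\<^esub> s" "w \<in> ?W" "c \<in> carrier K" using el[OF x] by blast
      have stw: "st b w \<in> carrier K" if "b \<in> B" for b using lin_closed[OF B3[OF that]] wc by simp
      have "(\<Oplus>\<^bsub>V\<^esub>b\<in>insert s B. st' b x \<odot>\<^bsub>V\<^esub> b) = st' s x \<odot>\<^bsub>V\<^esub> s \<oplus>\<^bsub>V\<^esub> (\<Oplus>\<^bsub>V\<^esub>b\<in>B. st' b x \<odot>\<^bsub>V\<^esub> b)"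
        using B Wc S sB wc cw stw
        by (intro M.finsum_insert) (auto simp: st'_def intro!: smult_closed)
      also have "(\<Oplus>\<^bsub>V\<^esub>b\<in>B. st' b x \<odot>\<^bsub>V\<^esub> b) = (\<Oplus>\<^bsub>V\<^esub>b\<in>B. st b w \<odot>\<^bsub>V\<^esub> b)"
        using B(2) Wc sB wc cw stw by (intro M.finsum_cong') (auto simp: st'_def intro!: smult_closed)
      also have "\<dots> = w" using B4[OF wc(2)] by (rule sym)
      finally show ?thesis using wc cw Wc S(2) smult_closed[of c s] by (simp add: st'_def M.a_comm)
    qed
    moreover have "insert s B \<subseteq> ?W'"
      using B(2) subset_sp[of "insert s S" K V] sp_subset[of K V ?W' S] is_sub_sp[of "insert s S"] S by auto
    ultimately show ?thesis using B(1) by (intro exI[of _ "insert s B"] exI[of _ st']) auto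
  qed
qed

text \<open>A vector \<open>w0\<close> of \<open>W\<close> outside the span \<open>U\<close> of
  \<open>S\<close> involves \<open>s\<close> with a nonzero coefficient. Subtracting multiples of
  \<open>w0\<close> therefore reduces \<open>W\<close> to \<open>W \<inter> U\<close>, to which the
  induction hypothesis applies.\<close>

lemma subspace_card:
  assumes "finite S" "S \<subseteq> carrier V" "is_sub K V W" "W \<subseteq> sp K V S"
  shows "\<exists>S'. finite S' \<and> S' \<subseteq> W \<and> sp K V S' = W \<and> card S' \<le> card S \<and> (W \<noteq> sp K V S \<longrightarrow> card S' < card S)"
  using assms
proof (induction S arbitrary: W)
  case empty
  then have "W = {\<zero>\<^bsub>V\<^esub>}" by (auto simp: sp_empty is_sub_def)
  then show ?case by (intro exI[of _ "{}"]) (auto simp: sp_empty)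
next
  case (insert s S)
  have S: "S \<subseteq> carrier V" "s \<in> carrier V" using insert by auto
  let ?U = "sp K V S"
  note U = is_sub_sp[OF S(1)]
  have Uc: "\<And>w. w \<in> ?U \<Longrightarrow> w \<in> carrier V" using U by (auto simp: is_sub_def)
  have W: "is_sub K V W" by fact
  show ?case
  proof (cases "W \<subseteq> ?U")
    case True
    then obtain S' where "finite S'" "S' \<subseteq> W" "sp K V S' = W" "card S' \<le> card S"
      using insert.IH[OF S(1) W True] by blast
    then show ?thesis using insert.hyps by (intro exI[of _ S']) auto
  next
    case False
    then obtain w0 where w0: "w0 \<in> W" "w0 \<notin> ?U" by blast
    then obtain u c where uc: "w0 = u \<oplus>\<^bsub>V\<^esub> c \<odot>\<^bsub>V\<^esub> s" "u \<in> ?U" "c \<in> carrier K"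
      using insert.prems(3) unfolding sp_insert[OF S] by blast
    have c: "c \<noteq> \<zero>\<^bsub>K\<^esub>" using uc w0 S by (auto simp: smult_l_null Uc)
    have w0c: "w0 \<in> carrier V" using W w0 by (auto simp: is_sub_def)
    have WU: "is_sub K V (W \<inter> ?U)" using W U by (auto simp: is_sub_def)
    then obtain S' where S': "finite S'" "S' \<subseteq> W \<inter> ?U" "sp K V S' = W \<inter> ?U" "card S' \<le> card S"
      "W \<inter> ?U \<noteq> ?U \<Longrightarrow> card S' < card S"
      using insert.IH[OF S(1) WU] by auto
    have S'c: "S' \<subseteq> carrier V" using S'(2) Uc by auto
    have "sp K V (insert w0 S') = W"
    proof
      show "sp K V (insert w0 S') \<subseteq> W" using S'(2) w0 by (intro sp_subset[OF W]) auto
      show "W \<subseteq> sp K V (insert w0 S')"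
      proof
        fix w assume w: "w \<in> W"
        then obtain v d where vd: "w = v \<oplus>\<^bsub>V\<^esub> d \<odot>\<^bsub>V\<^esub> s" "v \<in> ?U" "d \<in> carrier K"
          using insert.prems(3) unfolding sp_insert[OF S] by blast
        define a where "a = d \<otimes>\<^bsub>K\<^esub> inv\<^bsub>K\<^esub> c"
        have a: "a \<in> carrier K" "a \<otimes>\<^bsub>K\<^esub> c = d"
          using vd(3) uc(3) c inv_carrier by (auto simp: a_def m_assoc field_Units)
        have aw: "a \<odot>\<^bsub>V\<^esub> w0 \<in> W" using W w0 a by (auto simp: is_sub_def)
        have au: "a \<odot>\<^bsub>V\<^esub> u \<in> ?U" using U uc a by (auto simp: is_sub_def)
        have "a \<odot>\<^bsub>V\<^esub> w0 = a \<odot>\<^bsub>V\<^esub> u \<oplus>\<^bsub>V\<^esub> d \<odot>\<^bsub>V\<^esub> s"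
          using uc a S(2) Uc sum_smult_add(2)[of u u s c c a] by simp
        then have "w \<ominus>\<^bsub>V\<^esub> a \<odot>\<^bsub>V\<^esub> w0 = v \<ominus>\<^bsub>V\<^esub> a \<odot>\<^bsub>V\<^esub> u"
          using vd Uc[OF au] Uc[OF vd(2)] S(2) smult_closed[OF vd(3) S(2)]
          by (simp add: a_minus_def M.minus_add M.a_ac M.r_neg2 M.r_neg1 M.r_neg)
        then have "w \<ominus>\<^bsub>V\<^esub> a \<odot>\<^bsub>V\<^esub> w0 \<in> W \<inter> ?U"
          using is_sub_diff[OF W w aw] is_sub_diff[OF U vd(2) au] by simp
        moreover have "w = (w \<ominus>\<^bsub>V\<^esub> a \<odot>\<^bsub>V\<^esub> w0) \<oplus>\<^bsub>V\<^esub> a \<odot>\<^bsub>V\<^esub> w0"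
          using w aw W M.diff_add_cancel[of w "a \<odot>\<^bsub>V\<^esub> w0"] unfolding is_sub_def by (simp add: subset_iff)
        ultimately show "w \<in> sp K V (insert w0 S')"
          unfolding sp_insert[OF S'c w0c] S'(3) using a(1) by blast
      qed
    qed
    moreover have "card (insert w0 S') \<le> card (insert s S)"
      using S' insert.hyps by (simp add: card_insert_if)
    moreover have "card (insert w0 S') < card (insert s S)" if ne: "W \<noteq> sp K V (insert s S)"
    proof -
      \<comment> \<open>If \<open>W\<close> contained the old span, then \<open>w0\<close> would
        produce \<open>s\<close>, and \<open>W\<close> would be the whole new span.\<close>
      have "W \<inter> ?U \<noteq> ?U"
      proof
        assume e: "W \<inter> ?U = ?U"
        then have "u \<in> W" using uc by auto
        then have "w0 \<ominus>\<^bsub>V\<^esub> u \<in> W" using is_sub_diff[OF W w0(1)] by simp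
        moreover have "w0 \<ominus>\<^bsub>V\<^esub> u = c \<odot>\<^bsub>V\<^esub> s"
          using uc Uc S smult_closed[of c s] by (simp add: a_minus_def M.a_ac M.r_neg1 M.r_neg2 M.r_neg)
        ultimately have "inv\<^bsub>K\<^esub> c \<odot>\<^bsub>V\<^esub> (c \<odot>\<^bsub>V\<^esub> s) \<in> W" using W inv_carrier[OF uc(3) c] by (auto simp: is_sub_def)
        then have "s \<in> W" using smult_inv[OF uc(3) c S(2)] by simp
        moreover have "S \<subseteq> W" using e subset_sp[of S K V] by auto
        ultimately have "sp K V (insert s S) \<subseteq> W" by (intro sp_subset[OF W]) auto
        then show False using ne insert.prems(3) by auto
      qed
      then show ?thesis using S' insert.hyps by (simp add: card_insert_if)
    qed
    ultimately show ?thesis using S'(1,2) w0(1) by (intro exI[of _ "insert w0 S'"]) auto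
  qed
qed

end

section \<open>Dimension, extension of linear maps and Fitting's lemma\<close>

text \<open>Dimension as the least size of a spanning set. What is used of it is attainment,
  minimality and strict growth along proper inclusions, the latter from
  \<open>subspace_card\<close>.\<close>

definition fdim :: "('k, 's) ring_scheme \<Rightarrow> ('k, 'm, 't) module_scheme \<Rightarrow> 'm set \<Rightarrow> nat" where
  "fdim K V W = (LEAST n. \<exists>S. finite S \<and> S \<subseteq> W \<and> sp K V S = W \<and> card S = n)"

locale fd_vspace = vspace +
  assumes fin: "fin_gen K V"
begin

lemma spanning: obtains S where "finite S" "S \<subseteq> carrier V" "sp K V S = carrier V"
  using fin fin_gen_iff by blast

lemma fdim_basis:
  assumes "is_sub K V W"
  obtains S where "finite S" "S \<subseteq> W" "sp K V S = W" "card S = fdim K V W"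
proof -
  obtain S where S: "finite S" "S \<subseteq> carrier V" "sp K V S = carrier V" by (rule spanning)
  obtain S' where "finite S'" "S' \<subseteq> W" "sp K V S' = W"
    using subspace_card[OF S(1,2) assms] S(3) assms by (auto simp: is_sub_def)
  then have "\<exists>n S. finite S \<and> S \<subseteq> W \<and> sp K V S = W \<and> card S = n" by blast
  then have "\<exists>S. finite S \<and> S \<subseteq> W \<and> sp K V S = W \<and> card S = fdim K V W"
    unfolding fdim_def by (rule LeastI_ex)
  then show thesis using that by blast
qed

lemma fdim_le: "finite S \<Longrightarrow> S \<subseteq> W \<Longrightarrow> sp K V S = W \<Longrightarrow> fdim K V W \<le> card S"
  unfolding fdim_def by (rule Least_le) blast

lemma fdim_strict:
  assumes "is_sub K V W" "is_sub K V W'" "W \<subset> W'"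
  shows "fdim K V W < fdim K V W'"
proof -
  obtain S where S: "finite S" "S \<subseteq> W'" "sp K V S = W'" "card S = fdim K V W'"
    using fdim_basis[OF assms(2)] by blast
  have "S \<subseteq> carrier V" using S assms by (auto simp: is_sub_def)
  then obtain S' where "finite S'" "S' \<subseteq> W" "sp K V S' = W" "card S' < card S"
    using subspace_card[OF S(1) _ assms(1)] S(3) assms(3) by blast
  then show ?thesis using fdim_le[of S' W] S(4) by simp
qed

lemma fg_sub: "is_sub K V W \<Longrightarrow> fin_gen K (V\<lparr>carrier := W\<rparr>)"
proof -
  assume W: "is_sub K V W"
  obtain S where S: "finite S" "S \<subseteq> W" "sp K V S = W" "card S = fdim K V W" by (rule fdim_basis[OF W])
  interpret VW: left_module K "V\<lparr>carrier := W\<rparr>" by (rule left_module_sub[OF W])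
  have "sp K (V\<lparr>carrier := W\<rparr>) S = W"
  proof
    show "sp K (V\<lparr>carrier := W\<rparr>) S \<subseteq> W" using sp_subset[OF VW.is_sub_carrier, of S] S by simp
    show "W \<subseteq> sp K (V\<lparr>carrier := W\<rparr>) S"
      using S(3) W by (auto simp: sp_def is_sub_sub)
  qed
  then show ?thesis unfolding VW.fin_gen_iff using S by auto
qed

text \<open>A smallest spanning set of the image pulls back along \<open>f\<close> to a spanning set
  of \<open>V\<close> of the same size, so the image cannot have smaller dimension than
  \<open>V\<close>.\<close>

lemma inj_endo_surj:
  assumes f: "lin K V V f" "inj_on f (carrier V)"
  shows "f ` carrier V = carrier V"
proof (rule ccontr)
  assume ne: "f ` carrier V \<noteq> carrier V"
  have I: "is_sub K V (f ` carrier V)" by (rule is_sub_image[OF left_module_axioms f(1) is_sub_carrier])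
  obtain S where S: "finite S" "S \<subseteq> f ` carrier V" "sp K V S = f ` carrier V" "card S = fdim K V (f ` carrier V)"
    using fdim_basis[OF I] by blast
  obtain T where T: "T \<subseteq> carrier V" "S = f ` T" using S(2) by (auto simp: subset_image_iff)
  have fT: "finite T" using S(1) T f(2) by (metis finite_imageD inj_on_subset)
  have T': "is_sub K V (sp K V T)" by (rule is_sub_sp[OF T(1)])
  have "f ` carrier V \<subseteq> f ` sp K V T"
    unfolding S(3)[symmetric]
    using is_sub_image[OF left_module_axioms f(1) T'] subset_sp[of T K V] T(2)
    by (intro sp_subset) auto
  then have "carrier V \<subseteq> sp K V T"
    using T' f(2) unfolding is_sub_def by (auto simp: subset_iff inj_on_def image_iff)
  then have "sp K V T = carrier V" using T' by (auto simp: is_sub_def)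
  then have "fdim K V (carrier V) \<le> card T" using fdim_le[OF fT T(1)] by simp
  also have "\<dots> = card S" using T f(2) by (metis card_image inj_on_subset)
  finally show False
    using fdim_strict[OF I is_sub_carrier] ne S(4) I by (auto simp: is_sub_def)
qed

text \<open>Spanning vectors are added one by one, and each new vector is sent to zero by composing
  with the projection \<open>wf\<close>.\<close>

lemma extend_functional:
  assumes N: "left_module K N" and W: "is_sub K V W" and l: "lin K (V\<lparr>carrier := W\<rparr>) N l"
  shows "\<exists>L. lin K V N L \<and> (\<forall>x\<in>W. L x = l x)"
proof -
  interpret N: left_module K N by fact
  obtain S where S: "finite S" "S \<subseteq> carrier V" "sp K V S = carrier V" by (rule spanning)
  have "\<exists>W' L. is_sub K V W' \<and> W \<subseteq> W' \<and> F \<subseteq> W' \<and> lin K (V\<lparr>carrier := W'\<rparr>) N L \<and> (\<forall>x\<in>W. L x = l x)"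
    if "finite F" "F \<subseteq> carrier V" for F
    using that
  proof (induction F)
    case empty
    then show ?case using W l by blast
  next
    case (insert s F)
    then obtain W' L where L: "is_sub K V W'" "W \<subseteq> W'" "F \<subseteq> W'" "lin K (V\<lparr>carrier := W'\<rparr>) N L" "\<And>x. x\<in>W \<Longrightarrow> L x = l x"
      by auto
    have s: "s \<in> carrier V" using insert by simp
    show ?case
    proof (cases "s \<in> W'")
      case True
      then show ?thesis using L by blast
    next
      case False
      obtain cf wf where cw: "\<And>w c. w \<in> W' \<Longrightarrow> c \<in> carrier K \<Longrightarrow> cf (w \<oplus>\<^bsub>V\<^esub> c \<odot>\<^bsub>V\<^esub> s) = c \<and> wf (w \<oplus>\<^bsub>V\<^esub> c \<odot>\<^bsub>V\<^esub> s) = w"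
        using hyper_coords[OF L(1) s False] by metis
      have W'c: "W' \<subseteq> carrier V" using L(1) by (simp add: is_sub_def)
      then have Wc: "\<And>w. w \<in> W' \<Longrightarrow> w \<in> carrier V" by auto
      let ?W = "sp K V (insert s W')"
      have W1: "is_sub K V ?W" using W'c s by (intro is_sub_sp) auto
      have el: "\<exists>w c. x = w \<oplus>\<^bsub>V\<^esub> c \<odot>\<^bsub>V\<^esub> s \<and> w \<in> W' \<and> c \<in> carrier K" if "x \<in> ?W" for x
        using that unfolding sp_insert[OF W'c s] sp_of_sub[OF L(1)] by blast
      have Wadd: "u \<oplus>\<^bsub>V\<^esub> w \<in> W'" "a \<odot>\<^bsub>V\<^esub> u \<in> W'" if "u \<in> W'" "w \<in> W'" "a \<in> carrier K" for u w a
        using L(1) that by (auto simp: is_sub_def)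
      have "lin K (V\<lparr>carrier := ?W\<rparr>) (V\<lparr>carrier := W'\<rparr>) wf"
        unfolding lin_def
        using cw Wadd Wc s by (auto dest!: el simp: sum_smult_add)
      then have "lin K (V\<lparr>carrier := ?W\<rparr>) N (\<lambda>x. L (wf x))" using L(4) by (rule lin_comp)
      moreover have "L (wf x) = l x" if "x \<in> W" for x
      proof -
        have "x = x \<oplus>\<^bsub>V\<^esub> \<zero>\<^bsub>K\<^esub> \<odot>\<^bsub>V\<^esub> s" using that L(2) W'c s by (auto simp: smult_l_null)
        then have "wf x = x" using cw[of x "\<zero>\<^bsub>K\<^esub>"] that L(2) by auto
        then show ?thesis using L(5) that by simp
      qed
      moreover have "insert s W' \<subseteq> ?W" by (rule subset_sp)
      ultimately show ?thesis using W1 L(2,3) by (intro exI[of _ ?W] exI[of _ "\<lambda>x. L (wf x)"]) auto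
    qed
  qed
  from this[OF S(1,2)] obtain W' L where L: "is_sub K V W'" "S \<subseteq> W'" "lin K (V\<lparr>carrier := W'\<rparr>) N L" "\<forall>x\<in>W. L x = l x"
    by blast
  have "carrier V \<subseteq> W'" using sp_subset[OF L(1,2)] S(3) by simp
  then have "W' = carrier V" using L(1) by (auto simp: is_sub_def)
  then show ?thesis using L by auto
qed

lemma lin_funpow: "lin K V V f \<Longrightarrow> lin K V V (f ^^ n)"
proof (induction n)
  case 0 then show ?case by (simp add: lin_def)
next
  case (Suc n) then show ?case using lin_comp[OF Suc.IH[OF Suc.prems] Suc.prems] by (simp add: comp_def)
qed

text \<open>Once the kernels of the powers stop growing, \<open>f ^^ n\<close> is injective on its
  own image, hence bijective there. The second conjunct is the decomposition into kernel plus image,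
  written as a correction of \<open>x\<close> by an element of the image.\<close>

lemma fitting:
  assumes f: "lin K V V f"
  shows "\<exists>n>0. {x \<in> carrier V. (f ^^ n) x = \<zero>\<^bsub>V\<^esub>} \<inter> (f ^^ n) ` carrier V = {\<zero>\<^bsub>V\<^esub>} \<and>
     (\<forall>x\<in>carrier V. \<exists>y\<in>carrier V. (f ^^ n) (x \<ominus>\<^bsub>V\<^esub> (f ^^ n) y) = \<zero>\<^bsub>V\<^esub>)"
proof -
  define k where "k n = {x \<in> carrier V. (f ^^ n) x = \<zero>\<^bsub>V\<^esub>}" for n
  have sub: "is_sub K V (k n)" for n
    unfolding k_def by (rule is_sub_kernel[OF left_module_axioms lin_funpow[OF f]])
  have f0: "f \<zero>\<^bsub>V\<^esub> = \<zero>\<^bsub>V\<^esub>" by (rule lin_zero[OF left_module_axioms left_module_axioms f])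
  have kS: "k n \<subseteq> k (n + m)" for n m
  proof (induction m)
    case (Suc m) then show ?case using f0 by (auto simp: k_def)
  qed simp
  have bd: "fdim K V (k n) \<le> fdim K V (carrier V)" for n
  proof (cases "k n = carrier V")
    case False
    then show ?thesis using fdim_strict[OF sub[of n] is_sub_carrier] sub[of n] unfolding is_sub_def by (simp add: psubset_eq)
  qed simp
  \<comment> \<open>The kernel dimensions are bounded, so one of them is largest. Looking only at
    \<open>Suc m\<close> keeps the exponent positive; for a positive exponent the kernel of
    \<open>f\<close> is contained in that of the power.\<close>
  obtain n0 where n0: "\<And>m. fdim K V (k (Suc m)) \<le> fdim K V (k (Suc n0))"
  proof -
    let ?R = "range (\<lambda>m. fdim K V (k (Suc m)))"
    have fin: "finite ?R"
      by (rule finite_subset[OF _ finite_atMost[of "fdim K V (carrier V)"]]) (simp only: image_subset_iff atMost_iff bd ball_UNIV simp_thms)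
    then have "Max ?R \<in> ?R" by (intro Max_in) auto
    then obtain n where "Max ?R = fdim K V (k (Suc n))" by auto
    then have "fdim K V (k (Suc m)) \<le> fdim K V (k (Suc n))" for m
      using Max_ge[OF fin, of "fdim K V (k (Suc m))"] by simp
    then show thesis by (rule that)
  qed
  define n where "n = Suc n0"
  have kk: "k (n + n) = k n"
    using fdim_strict[OF sub[of n] sub[of "n + n"]] n0[of "n0 + n"] kS[of n n] unfolding n_def by force
  define g where "g = f ^^ n"
  have g: "lin K V V g" unfolding g_def by (rule lin_funpow[OF f])
  have gg: "g (g x) = (f ^^ (n + n)) x" for x by (simp add: g_def funpow_add)
  have g2: "g x = \<zero>\<^bsub>V\<^esub>" if "x \<in> carrier V" "g (g x) = \<zero>\<^bsub>V\<^esub>" for x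
    using kk that unfolding gg by (auto simp: k_def g_def)
  have g0: "g \<zero>\<^bsub>V\<^esub> = \<zero>\<^bsub>V\<^esub>" by (rule lin_zero[OF left_module_axioms left_module_axioms g])
  have I: "is_sub K V (g ` carrier V)" by (rule is_sub_image[OF left_module_axioms g is_sub_carrier])
  let ?I = "V\<lparr>carrier := g ` carrier V\<rparr>"
  interpret I: fd_vspace K ?I
    by (intro fd_vspace.intro vspace.intro fd_vspace_axioms.intro field_axioms left_module_sub[OF I] fg_sub[OF I])
  have gI: "lin K ?I ?I g"
  proof -
    have gc: "g ` carrier V \<subseteq> carrier V" using I by (simp add: is_sub_def)
    show ?thesis unfolding lin_sub_cod[OF gc] using lin_sub_dom[OF g gc] gc by auto
  qed
  have "inj_on g (carrier ?I)"
    by (rule lin_inj_onI[OF left_module_sub[OF I] left_module_sub[OF I] gI]) (use g2 in auto)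
  then have "g ` g ` carrier V = g ` carrier V" using I.inj_endo_surj[OF gI] by simp
  then have "\<exists>y\<in>carrier V. g (x \<ominus>\<^bsub>V\<^esub> g y) = \<zero>\<^bsub>V\<^esub>" if x: "x \<in> carrier V" for x
  proof -
    have "g x \<in> g ` g ` carrier V" using \<open>g ` g ` carrier V = _\<close> x by blast
    then obtain y where y: "y \<in> carrier V" "g x = g (g y)" by blast
    have "g (x \<ominus>\<^bsub>V\<^esub> g y) = g x \<ominus>\<^bsub>V\<^esub> g (g y)"
      using x y lin_closed[OF g] by (intro lin_sub[OF left_module_axioms left_module_axioms g]) auto
    then show ?thesis using y x lin_closed[OF g x] M.diff_self[of "g x"] by auto
  qed
  moreover have "{x \<in> carrier V. g x = \<zero>\<^bsub>V\<^esub>} \<inter> g ` carrier V = {\<zero>\<^bsub>V\<^esub>}"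
    using g2 g0 by (auto intro: image_eqI[of _ _ "\<zero>\<^bsub>V\<^esub>"])
  moreover have "0 < n" by (simp add: n_def)
  ultimately show ?thesis unfolding g_def by blast
qed

end

section \<open>Finitely generated modules over a finite-dimensional algebra\<close>

lemma underlying_space_simps [simp]:
  "carrier (underlying_space A M) = carrier M" "ring.zero (underlying_space A M) = \<zero>\<^bsub>M\<^esub>"
  "ring.add (underlying_space A M) = ring.add M"
  "c \<odot>\<^bsub>underlying_space A M\<^esub> x = (c \<odot>\<^bsub>A\<^esub> \<one>\<^bsub>A\<^esub>) \<odot>\<^bsub>M\<^esub> x"
  by (simp_all add: underlying_space_def restrict_scalars_def)

text \<open>Used between records that share the additive group and differ in the scalar
  action.\<close>

lemma abelian_group_cong:
  assumes "abelian_group M" "carrier N = carrier M" "ring.zero N = ring.zero M" "ring.add N = ring.add M"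
  shows "abelian_group N"
proof -
  interpret M: abelian_group M by fact
  show ?thesis
    by (rule abelian_groupI) (use assms M.l_neg M.a_inv_closed in \<open>auto intro: M.a_assoc M.a_comm\<close>)
qed

lemma (in left_module) is_sub_finsum:
  assumes "is_sub R M N" "f \<in> S \<rightarrow> N"
  shows "(\<Oplus>\<^bsub>M\<^esub>s\<in>S. f s) \<in> N"
  using assms(2)
proof (induction S rule: infinite_finite_induct)
  case (insert x F)
  then have "f x \<in> N" "f \<in> F \<rightarrow> N" by auto
  moreover from this have "f x \<in> carrier M" "f \<in> F \<rightarrow> carrier M" using assms(1) by (auto simp: is_sub_def)
  ultimately show ?case using insert assms(1) by (simp add: is_sub_def)
qed (use assms(1) in \<open>auto simp: is_sub_def\<close>)

section \<open>Summands of powers without direct sums\<close>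

text \<open>This is \<open>X \<in> add M\<close>: the maps \<open>i\<close> and \<open>p\<close> are
  the components of an inclusion into, and a retraction from, a power of \<open>M\<close>. In this
  form lifting and extension problems are solved for each \<open>m\<close> and then added
  up.\<close>

definition factors :: "('k, 'a) module \<Rightarrow> ('a, 'x) module \<Rightarrow> ('a, 'm) module \<Rightarrow> bool" where
  "factors A X M \<longleftrightarrow> (\<exists>n i p. (\<forall>m<n. lin A X M (i m) \<and> lin A M X (p m)) \<and>
     (\<forall>x\<in>carrier X. x = (\<Oplus>\<^bsub>X\<^esub>m\<in>{..<n::nat}. p m (i m x))))"

lemma factorsE:
  assumes "factors A X M"
  obtains n i p where "\<And>m. m < n \<Longrightarrow> lin A X M (i m)" "\<And>m. m < n \<Longrightarrow> lin A M X (p m)"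
    "\<And>x. x \<in> carrier X \<Longrightarrow> (\<Oplus>\<^bsub>X\<^esub>m\<in>{..<n::nat}. p m (i m x)) = x"
  using assms unfolding factors_def by metis

lemma factorsI:
  assumes "\<And>m. m < n \<Longrightarrow> lin A X M (i m)" "\<And>m. m < n \<Longrightarrow> lin A M X (p m)"
    "\<And>x. x \<in> carrier X \<Longrightarrow> (\<Oplus>\<^bsub>X\<^esub>m\<in>{..<n::nat}. p m (i m x)) = x"
  shows "factors A X M"
  unfolding factors_def
  by (intro exI[of _ n] exI[of _ i] exI[of _ p] conjI allI impI ballI assms assms(3)[symmetric])

lemma factors_retract:
  assumes "left_module A X" "lin A X M i" "lin A M X p" "\<And>x. x \<in> carrier X \<Longrightarrow> p (i x) = x"
  shows "factors A X M"
proof (rule factorsI[where n = 1 and i = "\<lambda>_. i" and p = "\<lambda>_. p"])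
  interpret X: left_module A X by fact
  fix x assume "x \<in> carrier X"
  then show "(\<Oplus>\<^bsub>X\<^esub>m\<in>{..<1::nat}. p (i x)) = x" using assms(4) by (simp add: lessThan_Suc)
qed (use assms in auto)

lemma factors_direct_sum:
  assumes "left_module A M"
  shows "factors A (direct_sum n (\<lambda>_. M)) M"
proof (rule factorsI[where n = n])
  interpret M: left_module A M by fact
  show "lin A (direct_sum n (\<lambda>_. M)) M (\<lambda>x. x m)" if "m < n" for m
    using lin_dsum_proj[of m n A "\<lambda>_. M"] that by simp
  show "lin A M (direct_sum n (\<lambda>_. M)) (dsum_inj n (\<lambda>_. M) m)" if "m < n" for m
    using lin_dsum_inj[of n A "\<lambda>_. M" m] that assms by simp
  show "(\<Oplus>\<^bsub>direct_sum n (\<lambda>_. M)\<^esub>m\<in>{..<n}. dsum_inj n (\<lambda>_. M) m (x m)) = x"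
    if "x \<in> carrier (direct_sum n (\<lambda>_. M))" for x
    using dsum_decomp[OF M.R_ring, of n "\<lambda>_. M" x] assms that by simp
qed

lemma factors_trans_retract:
  assumes X: "left_module A X" and Y: "left_module A Y" and M: "left_module A M"
    and i: "lin A X Y i" and p: "lin A Y X p" and pi: "\<And>x. x \<in> carrier X \<Longrightarrow> p (i x) = x" and f: "factors A Y M"
  shows "factors A X M"
proof -
  interpret Y: left_module A Y by fact
  obtain n j q where j: "\<And>m. m < n \<Longrightarrow> lin A Y M (j m)" and q: "\<And>m. m < n \<Longrightarrow> lin A M Y (q m)"
    and s: "\<And>x. x \<in> carrier Y \<Longrightarrow> (\<Oplus>\<^bsub>Y\<^esub>m\<in>{..<n::nat}. q m (j m x)) = x" by (rule factorsE[OF f]) (rule that)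
  show ?thesis
  proof (rule factorsI)
    show "lin A X M (\<lambda>x. j m (i x))" if "m < n" for m using i j[OF that] by (rule lin_comp)
    show "lin A M X (\<lambda>x. p (q m x))" if "m < n" for m using q[OF that] p by (rule lin_comp)
    fix x assume x: "x \<in> carrier X"
    have ix: "i x \<in> carrier Y" using lin_closed[OF i x] .
    have "(\<Oplus>\<^bsub>X\<^esub>m\<in>{..<n}. p (q m (j m (i x)))) = p (\<Oplus>\<^bsub>Y\<^esub>m\<in>{..<n}. q m (j m (i x)))"
      using lin_closed[OF q lin_closed[OF j ix]] by (intro lin_of_finsum[OF Y X p, symmetric]) auto
    then show "(\<Oplus>\<^bsub>X\<^esub>m\<in>{..<n}. p (q m (j m (i x)))) = x" using s[OF ix] pi[OF x] by simp
  qed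
qed

lemma factors_of_in_add:
  assumes "left_module A X" "left_module A M" "in_add A X M"
  shows "factors A X M"
proof -
  interpret M: left_module A M by fact
  obtain n i p where "splitting A X (direct_sum n (\<lambda>_. M)) i p"
    using assms(3) by (auto simp: in_add_def is_summand_def)
  then show ?thesis
    using factors_trans_retract[OF assms(1) left_module_direct_sum[OF M.R_ring] assms(2) _ _ _ factors_direct_sum[OF assms(2)], of n i p] assms(2)
    by (auto simp: splitting_def lin_of_mod_hom)
qed

lemma factors_prod:
  assumes F: "left_module A F" and U: "left_module A U" and f: "factors A F U"
  shows "factors A (prod_mod F U) U"
proof -
  interpret F: left_module A F by fact
  interpret U: left_module A U by fact
  interpret FU: left_module A "prod_mod F U" by (rule left_module_prod[OF F U])
  obtain n j q where j: "\<And>m. m < n \<Longrightarrow> lin A F U (j m)" and q: "\<And>m. m < n \<Longrightarrow> lin A U F (q m)"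
    and s: "\<And>x. x \<in> carrier F \<Longrightarrow> (\<Oplus>\<^bsub>F\<^esub>m\<in>{..<n::nat}. q m (j m x)) = x" by (rule factorsE[OF f]) (rule that)
  \<comment> \<open>Indices below \<open>n\<close> serve the first factor; the extra index
    \<open>n\<close> carries the identity of \<open>U\<close>.\<close>
  let ?j = "\<lambda>m x. if m < n then j m (fst x) else snd x"
  let ?q = "\<lambda>m u. if m < n then (q m u, \<zero>\<^bsub>U\<^esub>) else (\<zero>\<^bsub>F\<^esub>, u)"
  have inl: "lin A F (prod_mod F U) (\<lambda>x. (x, \<zero>\<^bsub>U\<^esub>))"
    by (intro lin_pair lin_id U.lin_const_zero F)
  show ?thesis
  proof (rule factorsI[where n = "Suc n"])
    show "lin A (prod_mod F U) U (?j m)" for m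
      using lin_comp[OF lin_fst j] lin_snd by (cases "m < n") auto
    show "lin A U (prod_mod F U) (?q m)" for m
      using lin_comp[OF q inl] lin_pair[OF F.lin_const_zero[OF U] lin_id] by (cases "m < n") auto
    fix x assume "x \<in> carrier (prod_mod F U)"
    then obtain a u where x: "x = (a, u)" "a \<in> carrier F" "u \<in> carrier U" by (auto simp: prod_mod_def)
    have c: "(\<lambda>m. (q m (j m a), \<zero>\<^bsub>U\<^esub>)) \<in> {..<n} \<rightarrow> carrier (prod_mod F U)"
      using lin_closed[OF inl lin_closed[OF q lin_closed[OF j x(2)]]] by auto
    have xu: "(\<zero>\<^bsub>F\<^esub>, u) \<in> carrier (prod_mod F U)" using x by (simp add: prod_mod_def)
    have "(\<Oplus>\<^bsub>prod_mod F U\<^esub>m\<in>{..<Suc n}. ?q m (?j m x)) =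
        (\<zero>\<^bsub>F\<^esub>, u) \<oplus>\<^bsub>prod_mod F U\<^esub> (\<Oplus>\<^bsub>prod_mod F U\<^esub>m\<in>{..<n}. ?q m (?j m x))"
      unfolding lessThan_Suc using c xu x by (subst FU.M.finsum_insert) (auto simp: Pi_iff)
    also have "(\<Oplus>\<^bsub>prod_mod F U\<^esub>m\<in>{..<n}. ?q m (?j m x)) = (\<Oplus>\<^bsub>prod_mod F U\<^esub>m\<in>{..<n}. (q m (j m a), \<zero>\<^bsub>U\<^esub>))"
      using c x by (intro FU.M.finsum_cong') auto
    also have "\<dots> = ((\<Oplus>\<^bsub>F\<^esub>m\<in>{..<n}. q m (j m a)), \<zero>\<^bsub>U\<^esub>)"
      using lin_closed[OF q lin_closed[OF j x(2)]] by (intro lin_of_finsum[OF F FU.left_module_axioms inl, symmetric]) auto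
    finally show "(\<Oplus>\<^bsub>prod_mod F U\<^esub>m\<in>{..<Suc n}. ?q m (?j m x)) = x"
      using s x by (simp add: prod_mod_def)
  qed
qed

section \<open>Finite generation and finite dimension\<close>

context fd_algebra
begin

lemma A_ring: "ring A" by unfold_locales

lemma sc_closed: "c \<in> carrier K \<Longrightarrow> c \<odot>\<^bsub>A\<^esub> \<one>\<^bsub>A\<^esub> \<in> carrier A"
  by (simp add: smult_closed)

lemma left_module_US:
  assumes "left_module A M"
  shows "left_module K (underlying_space A M)"
proof -
  interpret M: left_module A M by fact
  have mm: "(c \<otimes>\<^bsub>K\<^esub> d) \<odot>\<^bsub>A\<^esub> \<one>\<^bsub>A\<^esub> = (c \<odot>\<^bsub>A\<^esub> \<one>\<^bsub>A\<^esub>) \<otimes>\<^bsub>A\<^esub> (d \<odot>\<^bsub>A\<^esub> \<one>\<^bsub>A\<^esub>)"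
    if "c \<in> carrier K" "d \<in> carrier K" for c d
    using that smult_mult_left[of c "\<one>\<^bsub>A\<^esub>" "d \<odot>\<^bsub>A\<^esub> \<one>\<^bsub>A\<^esub>"] by (simp add: smult_assoc1 sc_closed)
  show ?thesis
  proof (rule left_moduleI)
    show "abelian_group (underlying_space A M)"
      by (rule abelian_group_cong[OF M.M_group]) simp_all
  qed (auto simp: sc_closed M.smult_closed smult_l_distr M.smult_l_distr M.smult_r_distr mm M.smult_assoc1
      M.smult_one K.ring_axioms)
qed

lemma lin_US: "lin A M N f \<Longrightarrow> lin K (underlying_space A M) (underlying_space A N) f"
  by (auto simp: lin_def sc_closed)

lemma is_sub_US: "is_sub A M N \<Longrightarrow> is_sub K (underlying_space A M) N"
  by (auto simp: is_sub_def sc_closed)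

lemma US_sub: "underlying_space A (M\<lparr>carrier := N\<rparr>) = (underlying_space A M)\<lparr>carrier := N\<rparr>"
  by (simp add: underlying_space_def restrict_scalars_def)

lemma left_module_KA: "left_module K A"
  by (intro left_moduleI) (auto simp: smult_l_distr smult_r_distr smult_assoc1 K.ring_axioms A.is_abelian_group)

lemma fg_of_US:
  assumes "left_module A M" "fin_gen K (underlying_space A M)"
  shows "fg_module A M"
proof -
  interpret M: left_module A M by fact
  interpret U: left_module K "underlying_space A M" by (rule left_module_US) fact
  obtain S where S: "finite S" "S \<subseteq> carrier M" "sp K (underlying_space A M) S = carrier M"
    using assms(2) U.fin_gen_iff by auto
  have "carrier M \<subseteq> sp A M S"
    using S(3) sp_subset[OF is_sub_US[OF M.is_sub_sp[OF S(2)]] subset_sp] by simp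
  then have "sp A M S = carrier M" using sp_subset[OF M.is_sub_carrier S(2)] by auto
  then show ?thesis using S assms(1) unfolding fg_module_def M.fin_gen_iff by blast
qed

text \<open>Products of a spanning set of \<open>A\<close> with generators of \<open>M\<close> span
  \<open>M\<close> over \<open>K\<close>. Their \<open>K\<close>-span \<open>N\<close> is not
  visibly an \<open>A\<close>-submodule, so the argument uses the elements \<open>x\<close> with
  \<open>A x\<close> inside \<open>N\<close>, which do form one and include the generators.\<close>

lemma fin_gen_US:
  assumes "fg_module A M"
  shows "fin_gen K (underlying_space A M)"
proof -
  interpret M: left_module A M using assms by (simp add: fg_module_def)
  interpret U: left_module K "underlying_space A M" by (rule left_module_US) unfold_locales
  interpret KA: left_module K A by (rule left_module_KA)
  obtain S where S: "finite S" "S \<subseteq> carrier M" "sp A M S = carrier M"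
    using assms M.fin_gen_iff by (auto simp: fg_module_def)
  obtain T where T: "finite T" "T \<subseteq> carrier A" "sp K A T = carrier A"
    using finite_dim KA.fin_gen_iff by auto
  let ?TS = "(\<lambda>(t, s). t \<odot>\<^bsub>M\<^esub> s) ` (T \<times> S)"
  have TSc: "?TS \<subseteq> carrier M" using S T by (auto intro!: M.smult_closed)
  let ?N = "sp K (underlying_space A M) ?TS"
  have N: "is_sub K (underlying_space A M) ?N" using TSc by (intro U.is_sub_sp) simp
  have sm: "a \<odot>\<^bsub>M\<^esub> s \<in> ?N" if "a \<in> carrier A" "s \<in> S" for a s
  proof -
    have s: "s \<in> carrier M" using that S by auto
    have "lin K A (underlying_space A M) (\<lambda>a. a \<odot>\<^bsub>M\<^esub> s)"
    proof (rule linI)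
      fix c a assume ca: "c \<in> carrier K" "a \<in> carrier A"
      have "c \<odot>\<^bsub>A\<^esub> a = (c \<odot>\<^bsub>A\<^esub> \<one>\<^bsub>A\<^esub>) \<otimes>\<^bsub>A\<^esub> a" using ca smult_mult_left[of c "\<one>\<^bsub>A\<^esub>" a] by simp
      then show "(c \<odot>\<^bsub>A\<^esub> a) \<odot>\<^bsub>M\<^esub> s = c \<odot>\<^bsub>underlying_space A M\<^esub> (a \<odot>\<^bsub>M\<^esub> s)"
        using ca s by (simp add: M.smult_assoc1 sc_closed)
    qed (use s in \<open>auto simp: M.smult_closed M.smult_l_distr\<close>)
    then have "is_sub K A {a \<in> carrier A. a \<odot>\<^bsub>M\<^esub> s \<in> ?N}"
      by (rule KA.is_sub_vimage[OF U.left_module_axioms _ N])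
    moreover have "T \<subseteq> {a \<in> carrier A. a \<odot>\<^bsub>M\<^esub> s \<in> ?N}"
    proof
      fix t assume t: "t \<in> T"
      then have "t \<odot>\<^bsub>M\<^esub> s \<in> ?TS" using that by force
      then show "t \<in> {a \<in> carrier A. a \<odot>\<^bsub>M\<^esub> s \<in> ?N}"
        using t T(2) subset_sp[of ?TS K "underlying_space A M"] by blast
    qed
    ultimately have "carrier A \<subseteq> {a \<in> carrier A. a \<odot>\<^bsub>M\<^esub> s \<in> ?N}"
      unfolding T(3)[symmetric] by (rule sp_subset)
    then show ?thesis using that by auto
  qed
  have "is_sub A M {x \<in> carrier M. \<forall>a\<in>carrier A. a \<odot>\<^bsub>M\<^esub> x \<in> ?N}"
    (is "is_sub A M ?L")
  proof -
    have N0: "\<zero>\<^bsub>M\<^esub> \<in> ?N" and Na: "\<And>x y. x \<in> ?N \<Longrightarrow> y \<in> ?N \<Longrightarrow> x \<oplus>\<^bsub>M\<^esub> y \<in> ?N"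
      using N by (simp_all add: is_sub_def)
    show ?thesis
      unfolding is_sub_def
    proof (intro conjI ballI)
      show "\<zero>\<^bsub>M\<^esub> \<in> ?L" using N0 by (simp add: M.smult_r_null)
    next
      fix x y assume "x \<in> ?L" "y \<in> ?L"
      then show "x \<oplus>\<^bsub>M\<^esub> y \<in> ?L" using Na by (simp add: M.smult_r_distr)
    next
      fix a x assume a: "a \<in> carrier A" and x: "x \<in> ?L"
      have "b \<odot>\<^bsub>M\<^esub> (a \<odot>\<^bsub>M\<^esub> x) \<in> ?N" if b: "b \<in> carrier A" for b
      proof -
        have "b \<odot>\<^bsub>M\<^esub> (a \<odot>\<^bsub>M\<^esub> x) = (b \<otimes>\<^bsub>A\<^esub> a) \<odot>\<^bsub>M\<^esub> x" using a b x M.smult_assoc1[of b a x] by simp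
        then show ?thesis using a b x by simp
      qed
      then show "a \<odot>\<^bsub>M\<^esub> x \<in> ?L" using a x M.smult_closed[of a x] by simp
    qed blast
  qed
  moreover have "S \<subseteq> {x \<in> carrier M. \<forall>a\<in>carrier A. a \<odot>\<^bsub>M\<^esub> x \<in> ?N}" using sm S(2) by auto
  ultimately have "sp A M S \<subseteq> ?L" by (rule sp_subset)
  then have "\<And>x. x \<in> carrier M \<Longrightarrow> \<one>\<^bsub>A\<^esub> \<odot>\<^bsub>M\<^esub> x \<in> ?N" unfolding S(3) using A.one_closed by blast
  then have "carrier M \<subseteq> ?N" by (simp add: M.smult_one subset_iff)
  then have "?N = carrier M" using N by (auto simp: is_sub_def)
  moreover have "finite ?TS" using S T by auto
  ultimately show ?thesis unfolding U.fin_gen_iff using TSc by (intro exI[of _ ?TS]) simp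
qed

lemma fd_vspace_US: "fg_module A M \<Longrightarrow> fd_vspace K (underlying_space A M)"
  by (intro fd_vspace.intro vspace.intro fd_vspace_axioms.intro K.field_axioms left_module_US fin_gen_US)
    (auto simp: fg_module_def)

lemma fg_left_module: "fg_module A M \<Longrightarrow> left_module A M"
  by (simp add: fg_module_def)

text \<open>Submodules inherit finite generation through finite dimension over
  \<open>K\<close>.\<close>

lemma fg_sub:
  fixes M :: "('a, 'm) module"
  assumes "fg_module A M" "is_sub A M N"
  shows "fg_module A (M\<lparr>carrier := N\<rparr>)"
proof (rule fg_of_US)
  show "left_module A (M\<lparr>carrier := N\<rparr>)"
    using assms by (intro left_module.left_module_sub) (auto simp: fg_module_def)
  show "fin_gen K (underlying_space A (M\<lparr>carrier := N\<rparr>))"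
    unfolding US_sub using fd_vspace.fg_sub[OF fd_vspace_US is_sub_US] assms by blast
qed

lemma fg_regular: "fg_module A (regular A)"
proof (rule fg_of_US)
  show "left_module A (regular A)" by (rule left_module_regular[OF A_ring])
  then interpret U: left_module K "underlying_space A (regular A)" by (rule left_module_US)
  interpret KA: left_module K A by (rule left_module_KA)
  obtain T where T: "finite T" "T \<subseteq> carrier A" "sp K A T = carrier A"
    using finite_dim KA.fin_gen_iff by auto
  have "(c \<odot>\<^bsub>A\<^esub> \<one>\<^bsub>A\<^esub>) \<otimes>\<^bsub>A\<^esub> x = c \<odot>\<^bsub>A\<^esub> x" if "c \<in> carrier K" "x \<in> carrier A" for c x
    using that smult_mult_left[of c "\<one>\<^bsub>A\<^esub>" x] by simp
  then have "is_sub K (underlying_space A (regular A)) N = is_sub K A N" for N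
    by (auto simp: is_sub_def subset_iff)
  then have "sp K (underlying_space A (regular A)) T = carrier A" using T(3) by (simp add: sp_def)
  then show "fin_gen K (underlying_space A (regular A))" unfolding U.fin_gen_iff using T by auto
qed

lemma fg_prod:
  assumes "fg_module A M" "fg_module A N"
  shows "fg_module A (prod_mod M N)"
proof -
  interpret M: left_module A M using assms by (simp add: fg_module_def)
  interpret N: left_module A N using assms by (simp add: fg_module_def)
  interpret P: left_module A "prod_mod M N" by (rule left_module_prod) unfold_locales
  obtain S where S: "finite S" "S \<subseteq> carrier M" "sp A M S = carrier M"
    using assms M.fin_gen_iff by (auto simp: fg_module_def)
  obtain T where T: "finite T" "T \<subseteq> carrier N" "sp A N T = carrier N"
    using assms N.fin_gen_iff by (auto simp: fg_module_def)
  let ?i = "\<lambda>x. (x, \<zero>\<^bsub>N\<^esub>)" and ?j = "\<lambda>y. (\<zero>\<^bsub>M\<^esub>, y)"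
  have i: "lin A M (prod_mod M N) ?i" and j: "lin A N (prod_mod M N) ?j"
    by (intro lin_pair lin_id N.lin_const_zero M.lin_const_zero M.left_module_axioms N.left_module_axioms)+
  let ?G = "?i ` S \<union> ?j ` T"
  have Gc: "?G \<subseteq> carrier (prod_mod M N)" using lin_closed[OF i] lin_closed[OF j] S(2) T(2) by blast
  note sub = P.is_sub_sp[OF Gc]
  have 1: "carrier M \<subseteq> {x \<in> carrier M. ?i x \<in> sp A (prod_mod M N) ?G}"
    unfolding S(3)[symmetric]
    by (rule sp_subset[OF M.is_sub_vimage[OF P.left_module_axioms i sub, unfolded S(3)[symmetric]]])
      (use S subset_sp[of ?G A "prod_mod M N"] in auto)
  have 2: "carrier N \<subseteq> {x \<in> carrier N. ?j x \<in> sp A (prod_mod M N) ?G}"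
    unfolding T(3)[symmetric]
    by (rule sp_subset[OF N.is_sub_vimage[OF P.left_module_axioms j sub, unfolded T(3)[symmetric]]])
      (use T subset_sp[of ?G A "prod_mod M N"] in auto)
  have "carrier (prod_mod M N) \<subseteq> sp A (prod_mod M N) ?G"
  proof
    fix z assume "z \<in> carrier (prod_mod M N)"
    then obtain x y where z: "z = (x, y)" "x \<in> carrier M" "y \<in> carrier N" by (auto simp: prod_mod_def)
    then have "z = ?i x \<oplus>\<^bsub>prod_mod M N\<^esub> ?j y" by (simp add: prod_mod_def)
    then show "z \<in> sp A (prod_mod M N) ?G" using 1 2 z sub unfolding is_sub_def by blast
  qed
  then have "sp A (prod_mod M N) ?G = carrier (prod_mod M N)" using sub by (auto simp: is_sub_def)
  then show ?thesis unfolding fg_module_def P.fin_gen_iff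
    using S(1) T(1) Gc P.left_module_axioms by (intro conjI exI[of _ ?G]) auto
qed

lemma fg_direct_sum:
  assumes "\<And>i. i < n \<Longrightarrow> fg_module A (M i)"
  shows "fg_module A (direct_sum n M)"
proof -
  have lm: "left_module A (M i)" if "i < n" for i using assms[OF that] by (rule fg_left_module)
  interpret P: left_module A "direct_sum n M" by (rule left_module_direct_sum[OF A_ring lm])
  have "\<exists>S. finite S \<and> S \<subseteq> carrier (M i) \<and> sp A (M i) S = carrier (M i)" if "i < n" for i
    using assms[OF that] left_module.fin_gen_iff[OF lm[OF that]] by (auto simp: fg_module_def)
  then obtain S where S: "\<And>i. i < n \<Longrightarrow> finite (S i)" "\<And>i. i < n \<Longrightarrow> S i \<subseteq> carrier (M i)"
    "\<And>i. i < n \<Longrightarrow> sp A (M i) (S i) = carrier (M i)" by metis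
  let ?G = "\<Union>i<n. dsum_inj n M i ` S i"
  have inj: "lin A (M i) (direct_sum n M) (dsum_inj n M i)" if "i < n" for i
    by (rule lin_dsum_inj[OF lm that])
  have Gc: "?G \<subseteq> carrier (direct_sum n M)" using lin_closed[OF inj] S(2) by blast
  note sub = P.is_sub_sp[OF Gc]
  have 1: "dsum_inj n M i x \<in> sp A (direct_sum n M) ?G" if "i < n" "x \<in> carrier (M i)" for i x
  proof -
    have "sp A (M i) (S i) \<subseteq> {x \<in> carrier (M i). dsum_inj n M i x \<in> sp A (direct_sum n M) ?G}"
      by (rule sp_subset[OF left_module.is_sub_vimage[OF lm[OF that(1)] P.left_module_axioms inj[OF that(1)] sub]])
        (use S(2) that subset_sp[of ?G A "direct_sum n M"] in blast)
    then show ?thesis using S(3) that by blast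
  qed
  have "carrier (direct_sum n M) \<subseteq> sp A (direct_sum n M) ?G"
  proof
    fix x assume x: "x \<in> carrier (direct_sum n M)"
    have "(\<Oplus>\<^bsub>direct_sum n M\<^esub>i\<in>{..<n}. dsum_inj n M i (x i)) \<in> sp A (direct_sum n M) ?G"
      using 1 x by (intro P.is_sub_finsum[OF sub]) (auto simp: direct_sum_def)
    then show "x \<in> sp A (direct_sum n M) ?G" using dsum_decomp[OF A_ring lm x] by simp
  qed
  then have "sp A (direct_sum n M) ?G = carrier (direct_sum n M)" using sub by (auto simp: is_sub_def)
  then show ?thesis unfolding fg_module_def P.fin_gen_iff
    using S(1) Gc P.left_module_axioms by (intro conjI exI[of _ ?G]) auto
qed

text \<open>Coordinates with respect to a finite \<open>K\<close>-basis give an injection into \<open>nat \<Rightarrow> 'k\<close>.\<close>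

lemma umodule_copy:
  fixes M :: "('a, 'm) module"
  assumes "fg_module A M"
  obtains X :: "('k, 'a) umodule" and j where "fg_module A X" "lin A M X j" "bij_betw j (carrier M) (carrier X)"
proof -
  interpret U: fd_vspace K "underlying_space A M" by (rule fd_vspace_US) fact
  have M: "left_module A M" using assms by (rule fg_left_module)
  obtain S where S: "finite S" "S \<subseteq> carrier M" "sp K (underlying_space A M) S = carrier M"
    using U.spanning by auto
  let ?U = "underlying_space A M"
  obtain B st where B: "finite B" "B \<subseteq> sp K ?U S" "\<forall>b\<in>B. lin K (?U\<lparr>carrier := sp K ?U S\<rparr>) (regular K) (st b)"
    "\<forall>x\<in>sp K ?U S. x = (\<Oplus>\<^bsub>?U\<^esub>b\<in>B. st b x \<odot>\<^bsub>?U\<^esub> b)"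
    using U.dual_basis[of S, unfolded underlying_space_simps(1), OF S(1,2)] by (elim exE conjE) (rule that)
  note B = B[unfolded S(3)]
  have stc: "st b x \<in> carrier K" if "b \<in> B" "x \<in> carrier M" for b x
    using lin_closed[OF B(3)[rule_format, OF that(1)], of x] that(2) by simp
  obtain f :: "_ \<Rightarrow> nat" where f: "inj_on f B" using finite_imp_inj_to_nat_seg[OF B(1)] by (elim exE conjE) (rule that)
  \<comment> \<open>Indices outside the image of \<open>f\<close> receive arbitrary values;
    injectivity only looks at the indices in that image.\<close>
  define j where "j x i = st (inv_into B f i) x" for x i
  have "inj_on j (carrier M)"
  proof (rule inj_onI)
    fix x y assume xy: "x \<in> carrier M" "y \<in> carrier M" "j x = j y"
    have e: "st b x = st b y" if "b \<in> B" for b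
      using fun_cong[OF xy(3), of "f b"] that f by (simp add: j_def)
    have "(\<Oplus>\<^bsub>?U\<^esub>b\<in>B. st b x \<odot>\<^bsub>?U\<^esub> b) = (\<Oplus>\<^bsub>?U\<^esub>b\<in>B. st b y \<odot>\<^bsub>?U\<^esub> b)"
    proof (rule U.M.finsum_cong')
      show "(\<lambda>b. st b y \<odot>\<^bsub>?U\<^esub> b) \<in> B \<rightarrow> carrier ?U"
        using U.smult_closed[OF stc[OF _ xy(2)]] B(2) by (auto simp only: underlying_space_simps(1))
    qed (use e in auto)
    then show "x = y" using B(4)[rule_format, OF xy(1)] B(4)[rule_format, OF xy(2)] by simp
  qed
  note c = lin_copy_mod[OF M this]
  show thesis
    by (rule that[OF fg_module_image[OF assms c(1,2)] c(2,3)]) (use c(3) in \<open>simp add: bij_betw_def\<close>)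
qed

section \<open>Lifting and extension for modules on arbitrary types\<close>

text \<open>Replacing \<open>Y\<close> by the image of \<open>g\<close> makes \<open>g\<close>
  surjective, and both modules are then replaced by copies on the type of the test modules. The
  condition on images lets exactness of a complex be plugged in directly.\<close>

lemma proj_lift:
  fixes X :: "('a, 'x) module" and Y :: "('a, 'y) module"
  assumes P: "projective A P" "left_module A P" and X: "fg_module A X" and Y: "fg_module A Y"
    and g: "lin A X Y g" and f: "lin A P Y f" and im: "f ` carrier P \<subseteq> g ` carrier X"
  shows "\<exists>h. lin A P X h \<and> (\<forall>x\<in>carrier P. g (h x) = f x)"
proof -
  interpret P: left_module A P by fact
  note Xm = fg_left_module[OF X] and Ym = fg_left_module[OF Y]
  interpret Y: left_module A Y by fact
  have I: "is_sub A Y (g ` carrier X)"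
    by (rule Y.is_sub_image[OF Xm g left_module.is_sub_carrier[OF Xm]])
  let ?I = "Y\<lparr>carrier := g ` carrier X\<rparr>"
  have gI: "lin A X ?I g" and fI: "lin A P ?I f"
    using g f im I by (auto simp: lin_sub_cod is_sub_def)
  obtain X' :: "('k, 'a) umodule" and jx where X': "fg_module A X'" "lin A X X' jx" "bij_betw jx (carrier X) (carrier X')"
    by (rule umodule_copy[OF X])
  obtain Y' :: "('k, 'a) umodule" and jy where Y': "fg_module A Y'" "lin A ?I Y' jy" "bij_betw jy (carrier ?I) (carrier Y')"
    by (rule umodule_copy[OF fg_sub[OF Y I]])
  let ?ix = "inv_into (carrier X) jx"
  have ix: "lin A X' X ?ix" by (rule lin_inv_into[OF Xm X'(2,3)])
  have ixs: "?ix ` carrier X' = carrier X" using X'(3) bij_betw_inv_into bij_betw_imp_surj_on by blast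
  let ?g = "\<lambda>x. jy (g (?ix x))" and ?f = "\<lambda>x. jy (f x)"
  have g': "lin A X' Y' ?g" using lin_comp[OF lin_comp[OF ix gI] Y'(2)] .
  have f': "lin A P Y' ?f" using lin_comp[OF fI Y'(2)] .
  have gs: "restrict ?g (carrier X') ` carrier X' = carrier Y'"
  proof -
    have "restrict ?g (carrier X') ` carrier X' = jy ` g ` ?ix ` carrier X'" by (auto simp: image_iff)
    also have "\<dots> = carrier Y'" using ixs Y'(3) by (simp add: bij_betw_def)
    finally show ?thesis .
  qed
  obtain h where h: "h \<in> mod_hom A P X'" "\<forall>x\<in>carrier P. restrict ?g (carrier X') (h x) = restrict ?f (carrier P) x"
    using P(1) left_module.restrict_mod_hom[OF fg_left_module[OF X'(1)] g'] P.restrict_mod_hom[OF f'] gs X'(1) Y'(1)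
    unfolding projective_def by meson
  have hl: "lin A P X' h" using h(1) by (rule lin_of_mod_hom)
  have "g (?ix (h x)) = f x" if x: "x \<in> carrier P" for x
  proof -
    have "jy (g (?ix (h x))) = jy (f x)" using h(2) x lin_closed[OF hl x] by auto
    moreover have "g (?ix (h x)) \<in> carrier ?I" "f x \<in> carrier ?I"
      using lin_closed[OF gI lin_closed[OF ix lin_closed[OF hl x]]] lin_closed[OF fI x] by auto
    ultimately show ?thesis using Y'(3) by (meson bij_betw_def inj_on_eq_iff)
  qed
  then show ?thesis using lin_comp[OF hl ix] by blast
qed

text \<open>The kernel condition says that \<open>f\<close> factors through the image of
  \<open>g\<close>; the inclusion of this image into \<open>Y\<close> is the monomorphism to which
  injectivity is applied.\<close>

lemma inj_ext:
  fixes X :: "('a, 'x) module" and Y :: "('a, 'y) module"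
  assumes J: "injective A J" "left_module A J" and X: "fg_module A X" and Y: "fg_module A Y"
    and g: "lin A X Y g" and f: "lin A X J f" and ker: "\<And>x. x \<in> carrier X \<Longrightarrow> g x = \<zero>\<^bsub>Y\<^esub> \<Longrightarrow> f x = \<zero>\<^bsub>J\<^esub>"
  shows "\<exists>h. lin A Y J h \<and> (\<forall>x\<in>carrier X. h (g x) = f x)"
proof -
  note Xm = fg_left_module[OF X] and Ym = fg_left_module[OF Y]
  interpret X: left_module A X by fact
  interpret Y: left_module A Y by fact
  interpret J: left_module A J by fact
  have I: "is_sub A Y (g ` carrier X)"
    by (rule Y.is_sub_image[OF Xm g left_module.is_sub_carrier[OF Xm]])
  let ?I = "Y\<lparr>carrier := g ` carrier X\<rparr>"
  \<comment> \<open>A preimage under \<open>g\<close> is chosen; the kernel condition makes the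
    value independent of the choice.\<close>
  define f0 where "f0 y = f (inv_into (carrier X) g y)" for y
  have f0: "f0 (g x) = f x" if x: "x \<in> carrier X" for x
  proof -
    let ?x = "inv_into (carrier X) g (g x)"
    have x': "?x \<in> carrier X" "g ?x = g x" using x by (auto intro: inv_into_into f_inv_into_f)
    have "g (?x \<ominus>\<^bsub>X\<^esub> x) = \<zero>\<^bsub>Y\<^esub>"
      using lin_sub[OF Xm Ym g x'(1) x] x' Y.M.diff_self lin_closed[OF g x] by simp
    then have "f (?x \<ominus>\<^bsub>X\<^esub> x) = \<zero>\<^bsub>J\<^esub>" using ker x x' by simp
    then have "f ?x \<ominus>\<^bsub>J\<^esub> f x = \<zero>\<^bsub>J\<^esub>" using lin_sub[OF Xm J(2) f x'(1) x] by simp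
    then show ?thesis
      unfolding f0_def using J.M.diff_eq_zeroD[OF lin_closed[OF f x'(1)] lin_closed[OF f x]] by simp
  qed
  have f0l: "lin A ?I J f0"
  proof (rule linI)
    fix u v assume "u \<in> carrier ?I" "v \<in> carrier ?I"
    then obtain x y where xy: "x \<in> carrier X" "y \<in> carrier X" "u = g x" "v = g y" by auto
    show "f0 u \<in> carrier J" using xy f0 lin_closed[OF f] by simp
    have "f0 (u \<oplus>\<^bsub>Y\<^esub> v) = f0 (g (x \<oplus>\<^bsub>X\<^esub> y))" using xy lin_add[OF g] by simp
    also have "\<dots> = f0 u \<oplus>\<^bsub>J\<^esub> f0 v" using xy f0 lin_add[OF f] by simp
    finally show "f0 (u \<oplus>\<^bsub>?I\<^esub> v) = f0 u \<oplus>\<^bsub>J\<^esub> f0 v" by simp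
  next
    fix a u assume a: "a \<in> carrier A" and "u \<in> carrier ?I"
    then obtain x where xy: "x \<in> carrier X" "u = g x" by auto
    have "f0 (a \<odot>\<^bsub>Y\<^esub> u) = f0 (g (a \<odot>\<^bsub>X\<^esub> x))" using xy a lin_smult[OF g] by simp
    also have "\<dots> = a \<odot>\<^bsub>J\<^esub> f0 u" using xy a f0 lin_smult[OF f] X.smult_closed by simp
    finally show "f0 (a \<odot>\<^bsub>?I\<^esub> u) = a \<odot>\<^bsub>J\<^esub> f0 u" by simp
  qed
  obtain X' :: "('k, 'a) umodule" and jx where X': "fg_module A X'" "lin A ?I X' jx" "bij_betw jx (carrier ?I) (carrier X')"
    by (rule umodule_copy[OF fg_sub[OF Y I]])
  obtain Y' :: "('k, 'a) umodule" and jy where Y': "fg_module A Y'" "lin A Y Y' jy" "bij_betw jy (carrier Y) (carrier Y')"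
    by (rule umodule_copy[OF Y])
  let ?ix = "inv_into (carrier ?I) jx"
  have ix: "lin A X' ?I ?ix" by (rule lin_inv_into[OF Y.left_module_sub[OF I] X'(2,3)])
  have ixY: "lin A X' Y ?ix" using ix I unfolding lin_sub_cod[OF I[unfolded is_sub_def, THEN conjunct1]] by simp
  have ixr: "?ix (jx x) = x" if "x \<in> carrier ?I" for x
    using that X'(3) bij_betw_def inv_into_f_f by metis
  have ixi: "inj_on ?ix (carrier X')"
    using X'(3) by (metis bij_betw_inv_into bij_betw_imp_inj_on)
  let ?g = "\<lambda>x. jy (?ix x)" and ?f = "\<lambda>x. f0 (?ix x)"
  have g': "lin A X' Y' ?g" using lin_comp[OF ixY Y'(2)] .
  have f': "lin A X' J ?f" using lin_comp[OF ix f0l] .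
  have gi: "inj_on (restrict ?g (carrier X')) (carrier X')"
  proof (rule inj_onI)
    fix x y assume xy: "x \<in> carrier X'" "y \<in> carrier X'" "restrict ?g (carrier X') x = restrict ?g (carrier X') y"
    then have "jy (?ix x) = jy (?ix y)" by simp
    then have "?ix x = ?ix y" using Y'(3) lin_closed[OF ixY] xy by (meson bij_betw_def inj_on_eq_iff)
    then show "x = y" using ixi xy by (meson inj_on_eq_iff)
  qed
  interpret X': left_module A X' using X'(1) by (rule fg_left_module)
  obtain h where h: "h \<in> mod_hom A Y' J" "\<forall>x\<in>carrier X'. h (restrict ?g (carrier X') x) = restrict ?f (carrier X') x"
    using J(1) X'.restrict_mod_hom[OF g'] X'.restrict_mod_hom[OF f'] gi X'(1) Y'(1)
    unfolding injective_def by meson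
  have hl: "lin A Y' J h" using h(1) by (rule lin_of_mod_hom)
  have "h (jy (g x)) = f x" if x: "x \<in> carrier X" for x
  proof -
    have gx: "g x \<in> carrier ?I" using x by simp
    have "jx (g x) \<in> carrier X'" using lin_closed[OF X'(2) gx] .
    then have "h (jy (?ix (jx (g x)))) = f0 (?ix (jx (g x)))" using h(2) by auto
    then show ?thesis using ixr[OF gx] f0[OF x] by simp
  qed
  then show ?thesis using lin_comp[OF Y'(2) hl] by blast
qed

text \<open>Each \<open>fy \<circ> p m\<close> lifts over \<open>g\<close> because \<open>M\<close>
  is projective; composing the lifts with \<open>i m\<close> and adding gives a lift of
  \<open>fy\<close>.\<close>

lemma projective_factors:
  assumes X: "left_module A X" and M: "left_module A M" "projective A M" and f: "factors A X M"
  shows "projective A X"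
  unfolding projective_def
proof (intro allI ballI impI)
  fix X1 Y1 :: "('k, 'a) umodule" and g fy
  assume g: "g \<in> mod_hom A X1 Y1" and fy: "fy \<in> mod_hom A X Y1"
    and as: "fg_module A X1 \<and> fg_module A Y1 \<and> g ` carrier X1 = carrier Y1"
  interpret X: left_module A X by fact
  interpret X1: left_module A X1 using as fg_left_module by blast
  interpret Y1: left_module A Y1 using as fg_left_module by blast
  obtain n i p where i: "\<And>m. m < n \<Longrightarrow> lin A X M (i m)" and p: "\<And>m. m < n \<Longrightarrow> lin A M X (p m)"
    and s: "\<And>x. x \<in> carrier X \<Longrightarrow> (\<Oplus>\<^bsub>X\<^esub>m\<in>{..<n::nat}. p m (i m x)) = x" by (rule factorsE[OF f]) (rule that)
  note gl = lin_of_mod_hom[OF g] and fl = lin_of_mod_hom[OF fy]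
  have "\<exists>h. lin A M X1 h \<and> (\<forall>x\<in>carrier M. g (h x) = fy (p m x))" if "m < n" for m
    by (rule proj_lift[OF M(2,1) _ _ gl lin_comp[OF p[OF that] fl]])
      (use as lin_closed[OF fl] lin_closed[OF p[OF that]] in auto)
  then obtain h where h: "\<And>m. m < n \<Longrightarrow> lin A M X1 (h m)" "\<And>m x. m < n \<Longrightarrow> x \<in> carrier M \<Longrightarrow> g (h m x) = fy (p m x)"
    by metis
  define H where "H x = (\<Oplus>\<^bsub>X1\<^esub>m\<in>{..<n}. h m (i m x))" for x
  have H: "lin A X X1 H" unfolding H_def
    by (rule X1.lin_finsum[OF X]) (use lin_comp[OF i h(1)] in auto)
  have gH: "g (H x) = fy x" if x: "x \<in> carrier X" for x
  proof -
    have "g (H x) = (\<Oplus>\<^bsub>Y1\<^esub>m\<in>{..<n}. g (h m (i m x)))"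
      unfolding H_def using lin_closed[OF h(1) lin_closed[OF i x]]
      by (intro lin_of_finsum[OF X1.left_module_axioms Y1.left_module_axioms gl]) auto
    also have "\<dots> = (\<Oplus>\<^bsub>Y1\<^esub>m\<in>{..<n}. fy (p m (i m x)))"
      using h(2) lin_closed[OF i x] lin_closed[OF fl lin_closed[OF p lin_closed[OF i x]]]
      by (intro Y1.M.finsum_cong') auto
    also have "\<dots> = fy (\<Oplus>\<^bsub>X\<^esub>m\<in>{..<n}. p m (i m x))"
      using lin_closed[OF p lin_closed[OF i x]]
      by (intro lin_of_finsum[OF X Y1.left_module_axioms fl, symmetric]) auto
    finally show ?thesis using s[OF x] by simp
  qed
  show "\<exists>h\<in>mod_hom A X X1. \<forall>x\<in>carrier X. g (h x) = fy x"
    by (rule bexI[OF _ X.restrict_mod_hom[OF H]]) (use gH in simp)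
qed

text \<open>Each \<open>i m \<circ> fy\<close> extends along \<open>g\<close> because
  \<open>M\<close> is injective; the extensions are composed with \<open>p m\<close> and
  added.\<close>

lemma injective_factors:
  assumes X: "left_module A X" and M: "left_module A M" "injective A M" and f: "factors A X M"
  shows "injective A X"
  unfolding injective_def
proof (intro allI ballI impI)
  fix X1 Y1 :: "('k, 'a) umodule" and g fy
  assume g: "g \<in> mod_hom A X1 Y1" and fy: "fy \<in> mod_hom A X1 X"
    and as: "fg_module A X1 \<and> fg_module A Y1 \<and> inj_on g (carrier X1)"
  interpret X: left_module A X by fact
  interpret M: left_module A M by fact
  interpret X1: left_module A X1 using as fg_left_module by blast
  interpret Y1: left_module A Y1 using as fg_left_module by blast
  obtain n i p where i: "\<And>m. m < n \<Longrightarrow> lin A X M (i m)" and p: "\<And>m. m < n \<Longrightarrow> lin A M X (p m)"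
    and s: "\<And>x. x \<in> carrier X \<Longrightarrow> (\<Oplus>\<^bsub>X\<^esub>m\<in>{..<n::nat}. p m (i m x)) = x" by (rule factorsE[OF f]) (rule that)
  note gl = lin_of_mod_hom[OF g] and fl = lin_of_mod_hom[OF fy]
  have g0: "x = \<zero>\<^bsub>X1\<^esub>" if "x \<in> carrier X1" "g x = \<zero>\<^bsub>Y1\<^esub>" for x
    using as that lin_zero[OF X1.left_module_axioms Y1.left_module_axioms gl] by (metis X1.M.zero_closed inj_on_eq_iff)
  have "\<exists>h. lin A Y1 M h \<and> (\<forall>x\<in>carrier X1. h (g x) = i m (fy x))" if "m < n" for m
  proof (rule inj_ext[OF M(2,1) _ _ gl lin_comp[OF fl i[OF that]]])
    show "i m (fy x) = \<zero>\<^bsub>M\<^esub>" if "x \<in> carrier X1" "g x = \<zero>\<^bsub>Y1\<^esub>" for x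
      using g0[OF that] lin_zero[OF X1.left_module_axioms M(1) lin_comp[OF fl i[OF \<open>m < n\<close>]]] by simp
  qed (use as in auto)
  then obtain h where h: "\<And>m. m < n \<Longrightarrow> lin A Y1 M (h m)" "\<And>m x. m < n \<Longrightarrow> x \<in> carrier X1 \<Longrightarrow> h m (g x) = i m (fy x)"
    by metis
  define H where "H x = (\<Oplus>\<^bsub>X\<^esub>m\<in>{..<n}. p m (h m x))" for x
  have H: "lin A Y1 X H" unfolding H_def
    by (rule X.lin_finsum[OF Y1.left_module_axioms]) (use lin_comp[OF h(1) p] in auto)
  have gH: "H (g x) = fy x" if x: "x \<in> carrier X1" for x
  proof -
    have "H (g x) = (\<Oplus>\<^bsub>X\<^esub>m\<in>{..<n}. p m (i m (fy x)))"
      unfolding H_def using h(2) x lin_closed[OF p lin_closed[OF i lin_closed[OF fl x]]]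
      by (intro X.M.finsum_cong') auto
    then show ?thesis using s[OF lin_closed[OF fl x]] by simp
  qed
  show "\<exists>h\<in>mod_hom A Y1 X. \<forall>x\<in>carrier X1. h (g x) = fy x"
    by (rule bexI[OF _ Y1.restrict_mod_hom[OF H]]) (use gH lin_closed[OF gl] in simp)
qed

section \<open>Covers and projective resolutions\<close>

lemma lin_from_regular:
  assumes "left_module A M" "x \<in> carrier M"
  shows "lin A (regular A) M (\<lambda>a. a \<odot>\<^bsub>M\<^esub> x)"
proof -
  interpret M: left_module A M by fact
  show ?thesis by (rule linI) (use assms(2) in \<open>auto simp: M.smult_closed M.smult_l_distr M.smult_assoc1\<close>)
qed

lemma projective_regular: "projective A (regular A)"
  unfolding projective_def
proof (intro allI ballI impI)
  fix X1 Y1 :: "('k, 'a) umodule" and g fy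
  assume g: "g \<in> mod_hom A X1 Y1" and fy: "fy \<in> mod_hom A (regular A) Y1"
    and as: "fg_module A X1 \<and> fg_module A Y1 \<and> g ` carrier X1 = carrier Y1"
  note gl = lin_of_mod_hom[OF g] and fl = lin_of_mod_hom[OF fy]
  have "fy \<one>\<^bsub>A\<^esub> \<in> carrier Y1" using lin_closed[OF fl] by simp
  then obtain x where x: "x \<in> carrier X1" "g x = fy \<one>\<^bsub>A\<^esub>" using as by (metis imageE)
  have h: "lin A (regular A) X1 (\<lambda>a. a \<odot>\<^bsub>X1\<^esub> x)" using as x by (intro lin_from_regular fg_left_module) auto
  have "g (a \<odot>\<^bsub>X1\<^esub> x) = fy a" if "a \<in> carrier A" for a
    using lin_smult[OF gl that x(1)] lin_smult[OF fl that, of "\<one>\<^bsub>A\<^esub>"] x that by simp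
  then show "\<exists>h\<in>mod_hom A (regular A) X1. \<forall>x\<in>carrier (regular A). g (h x) = fy x"
    by (intro bexI[OF _ left_module.restrict_mod_hom[OF left_module_regular[OF A_ring] h]]) simp
qed

text \<open>One copy of \<open>U\<close> is added for each element of \<open>S\<close>, with
  \<open>u\<close> sent to that element. The pair of \<open>U\<close> and \<open>u\<close>
  generalizes the regular module with its unit: later it is also the first term of a tilting
  sequence with the image of \<open>1\<close>, which yields covers by injective modules.\<close>

lemma cover_finite:
  assumes M: "left_module A M" and U: "fg_module A U" "u \<in> carrier U"
    and sur: "\<And>y. y \<in> carrier M \<Longrightarrow> \<exists>w. lin A U M w \<and> w u = y" and S: "finite S" "S \<subseteq> carrier M"
  shows "\<exists>(F :: ('k, 'a) umodule) g. fg_module A F \<and> factors A F U \<and> lin A F M g \<and> S \<subseteq> g ` carrier F"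
  using S
proof (induction S)
  case empty
  interpret M: left_module A M by fact
  interpret U: left_module A U using U by (simp add: fg_module_def)
  \<comment> \<open>A zero module on the required type is obtained as a copy of the zero submodule
    of \<open>U\<close>.\<close>
  let ?Z = "U\<lparr>carrier := {\<zero>\<^bsub>U\<^esub>}\<rparr>"
  obtain F :: "('k, 'a) umodule" and j where F: "fg_module A F" "lin A ?Z F j" "bij_betw j (carrier ?Z) (carrier F)"
    by (rule umodule_copy[OF fg_sub[OF U(1) U.is_sub_zero]])
  interpret F: left_module A F using F(1) by (rule fg_left_module)
  have "carrier F = {j \<zero>\<^bsub>U\<^esub>}" using F(3) by (auto simp: bij_betw_def)
  then have "carrier F = {\<zero>\<^bsub>F\<^esub>}" using F.M.zero_closed by auto
  then have "factors A F U" by (intro factorsI[where n = 0]) auto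
  then show ?case using F(1) M.lin_const_zero[OF F.left_module_axioms] by blast
next
  case (insert s S)
  interpret M: left_module A M by fact
  have s: "s \<in> carrier M" using insert by simp
  obtain F :: "('k, 'a) umodule" and g where F: "fg_module A F" "factors A F U" "lin A F M g" "S \<subseteq> g ` carrier F"
    using insert by auto
  note Fm = fg_left_module[OF F(1)] and Um = fg_left_module[OF U(1)]
  obtain w where w: "lin A U M w" "w u = s" using sur[OF s] by blast
  obtain F' :: "('k, 'a) umodule" and j where F': "fg_module A F'" "lin A (prod_mod F U) F' j"
    "bij_betw j (carrier (prod_mod F U)) (carrier F')"
    by (rule umodule_copy[OF fg_prod[OF F(1) U(1)]])
  let ?i = "inv_into (carrier (prod_mod F U)) j"
  note PUm = left_module_prod[OF Fm Um]
  have i: "lin A F' (prod_mod F U) ?i" by (rule lin_inv_into[OF PUm F'(2,3)])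
  have ji: "j (?i x) = x" if "x \<in> carrier F'" for x using that F'(3) by (auto simp: bij_betw_def f_inv_into_f)
  have ij: "?i (j x) = x" if "x \<in> carrier (prod_mod F U)" for x using that F'(3) by (auto simp: bij_betw_def)
  have "factors A F' U"
    by (rule factors_trans_retract[OF fg_left_module[OF F'(1)] PUm Um i F'(2) ji factors_prod[OF Fm Um F(2)]])
  moreover let ?g = "\<lambda>x. g (fst (?i x)) \<oplus>\<^bsub>M\<^esub> w (snd (?i x))"
  have "lin A F' M ?g"
    by (intro M.lin_plus lin_comp[OF lin_comp[OF i lin_fst] F(3)] lin_comp[OF lin_comp[OF i lin_snd] w(1)])
  moreover have "insert s S \<subseteq> ?g ` carrier F'"
  proof -
    have img: "g a \<oplus>\<^bsub>M\<^esub> w b \<in> ?g ` carrier F'" if "a \<in> carrier F" "b \<in> carrier U" for a b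
    proof -
      have ab: "(a, b) \<in> carrier (prod_mod F U)" using that by (simp add: prod_mod_def)
      have "g a \<oplus>\<^bsub>M\<^esub> w b = ?g (j (a, b))" by (simp add: ij[OF ab])
      then show ?thesis using lin_closed[OF F'(2) ab] by blast
    qed
    have "g \<zero>\<^bsub>F\<^esub> \<oplus>\<^bsub>M\<^esub> w u = s" using lin_zero[OF Fm M F(3)] w(2) s by simp
    then have "s \<in> ?g ` carrier F'"
      using img[OF _ U(2), of "\<zero>\<^bsub>F\<^esub>"] abelian_monoid.zero_closed[OF abelian_group.axioms(1)[OF left_module.M_group[OF Fm]]] by simp
    moreover have "t \<in> ?g ` carrier F'" if "t \<in> S" for t
    proof -
      obtain a where a: "a \<in> carrier F" "t = g a" using F(4) \<open>t \<in> S\<close> by blast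
      have "g a \<oplus>\<^bsub>M\<^esub> w \<zero>\<^bsub>U\<^esub> = t" using a lin_zero[OF Um M w(1)] lin_closed[OF F(3) a(1)] by simp
      then show ?thesis
        using img[OF a(1), of "\<zero>\<^bsub>U\<^esub>"] abelian_monoid.zero_closed[OF abelian_group.axioms(1)[OF left_module.M_group[OF Um]]] by simp
    qed
    ultimately show ?thesis by blast
  qed
  ultimately show ?case using F'(1) by blast
qed

lemma cover:
  assumes M: "fg_module A M" and U: "fg_module A U" "u \<in> carrier U"
    and sur: "\<And>y. y \<in> carrier M \<Longrightarrow> \<exists>w. lin A U M w \<and> w u = y"
  obtains F :: "('k, 'a) umodule" and g where "fg_module A F" "factors A F U" "lin A F M g" "g ` carrier F = carrier M"
proof -
  interpret M: left_module A M using M by (simp add: fg_module_def)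
  obtain S where S: "finite S" "S \<subseteq> carrier M" "sp A M S = carrier M"
    using M M.fin_gen_iff by (auto simp: fg_module_def)
  obtain F :: "('k, 'a) umodule" and g where F: "fg_module A F" "factors A F U" "lin A F M g" "S \<subseteq> g ` carrier F"
    using cover_finite[OF M.left_module_axioms U sur S(1,2)] by blast
  note Fm = fg_left_module[OF F(1)]
  have I: "is_sub A M (g ` carrier F)" by (rule M.is_sub_image[OF Fm F(3) left_module.is_sub_carrier[OF Fm]])
  have "carrier M \<subseteq> g ` carrier F" using sp_subset[OF I F(4)] S(3) by simp
  then have "g ` carrier F = carrier M" using I by (auto simp: is_sub_def)
  then show thesis using that F by blast
qed

lemma projective_cover:
  assumes M: "fg_module A M"
  obtains F :: "('k, 'a) umodule" and g where "fg_module A F" "projective A F" "lin A F M g" "g ` carrier F = carrier M"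
proof -
  interpret M: left_module A M using M by (simp add: fg_module_def)
  have one: "\<one>\<^bsub>A\<^esub> \<in> carrier (regular A)" by simp
  have w: "\<exists>w. lin A (regular A) M w \<and> w \<one>\<^bsub>A\<^esub> = y" if "y \<in> carrier M" for y
    using lin_from_regular[OF M.left_module_axioms that] M.smult_one[OF that] by blast
  obtain F :: "('k, 'a) umodule" and g where "fg_module A F" "factors A F (regular A)" "lin A F M g" "g ` carrier F = carrier M"
    by (rule cover[OF M fg_regular one w])
  then show thesis
    using that projective_factors[OF fg_left_module left_module_regular[OF A_ring] projective_regular] by blast
qed

lemma a_kernel_eq: "a_kernel M N f = {x \<in> carrier M. f x = \<zero>\<^bsub>N\<^esub>}"
  by (simp add: a_kernel_def')

text \<open>\<open>ext_Suc_vanishes\<close> quantifies over projective resolutions and would say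
  nothing without one. For the cotilting module only an injective resolution is given, so a
  projective one has to be constructed.\<close>

lemma projective_resolution_exists:
  assumes M: "fg_module A M"
  obtains X d h where "projective_resolution A M X d h"
proof -
  obtain F0 :: "('k, 'a) umodule" and g0 where F0: "fg_module A F0" "projective A F0" "lin A F0 M g0" "g0 ` carrier F0 = carrier M"
    by (rule projective_cover[OF M])
  note Mm = fg_left_module[OF M]
  \<comment> \<open>A state consists of the current module, the kernel that is still to be covered,
    and the map to the previous module. In the starting state the map is a placeholder.\<close>
  define Q where "Q p q \<longleftrightarrow> (case p of (Y, L) \<Rightarrow> case q of (Y', L', e) \<Rightarrow>
      fg_module A Y' \<and> projective A Y' \<and> lin A Y' Y e \<and> e ` carrier Y' = L \<and> L' = {x \<in> carrier Y'. e x = \<zero>\<^bsub>Y\<^esub>})"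
    for p :: "('k, 'a) umodule \<times> (nat \<Rightarrow> 'k) set" and q :: "('k, 'a) umodule \<times> (nat \<Rightarrow> 'k) set \<times> ((nat \<Rightarrow> 'k) \<Rightarrow> (nat \<Rightarrow> 'k))"
  define st where "st q = (fst q, fst (snd q))" for q :: "('k, 'a) umodule \<times> (nat \<Rightarrow> 'k) set \<times> ((nat \<Rightarrow> 'k) \<Rightarrow> (nat \<Rightarrow> 'k))"
  define good where "good q \<longleftrightarrow> fg_module A (fst q) \<and> projective A (fst q) \<and> is_sub A (fst q) (fst (snd q))"
    for q :: "('k, 'a) umodule \<times> (nat \<Rightarrow> 'k) set \<times> ((nat \<Rightarrow> 'k) \<Rightarrow> (nat \<Rightarrow> 'k))"
  let ?q0 = "(F0, {x \<in> carrier F0. g0 x = \<zero>\<^bsub>M\<^esub>}, undefined)"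
  have "\<exists>f. \<forall>n. (good (f n) \<and> (n = 0 \<longrightarrow> f n = ?q0)) \<and> Q (st (f n)) (f (Suc n))"
  proof (rule dependent_nat_choice)
    show "\<exists>q. good q \<and> (0 = (0::nat) \<longrightarrow> q = ?q0)"
      using F0 left_module.is_sub_kernel[OF fg_left_module[OF F0(1)] Mm F0(3)] by (auto simp: good_def)
    fix q and n :: nat assume "good q \<and> (n = 0 \<longrightarrow> q = ?q0)"
    then have q: "fg_module A (fst q)" "is_sub A (fst q) (fst (snd q))" by (auto simp: good_def)
    obtain F :: "('k, 'a) umodule" and g where F: "fg_module A F" "projective A F"
      "lin A F ((fst q)\<lparr>carrier := fst (snd q)\<rparr>) g" "g ` carrier F = fst (snd q)"
      using projective_cover[OF fg_sub[OF q]] by auto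
    have gl: "lin A F (fst q) g" using F(3) q(2) by (subst (asm) lin_sub_cod) (auto simp: is_sub_def)
    show "\<exists>q'. (good q' \<and> (Suc n = 0 \<longrightarrow> q' = ?q0)) \<and> Q (st q) q'"
      using F gl left_module.is_sub_kernel[OF fg_left_module[OF F(1)] fg_left_module[OF q(1)] gl]
      by (intro exI[of _ "(F, {x \<in> carrier F. g x = \<zero>\<^bsub>fst q\<^esub>}, g)"]) (auto simp: good_def Q_def st_def)
  qed
  then obtain f where f: "\<And>n. good (f n)" "f 0 = ?q0" "\<And>n. Q (st (f n)) (f (Suc n))" by blast
  define X where "X n = fst (f n)" for n
  define e where "e n = snd (snd (f (Suc n)))" for n
  define L where "L n = fst (snd (f n))" for n
  have X: "fg_module A (X n)" "projective A (X n)" for n using f(1)[of n] by (auto simp: good_def X_def)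
  have el: "lin A (X (Suc n)) (X n) (e n)" "e n ` carrier (X (Suc n)) = L n"
    "L (Suc n) = {x \<in> carrier (X (Suc n)). e n x = \<zero>\<^bsub>X n\<^esub>}" for n
    using f(3)[of n] by (auto simp: Q_def st_def X_def e_def L_def split: prod.splits)
  have L0: "L 0 = {x \<in> carrier F0. g0 x = \<zero>\<^bsub>M\<^esub>}" "X 0 = F0" using f(2) by (auto simp: L_def X_def)
  note Xm = fg_left_module[OF X(1)]
  have "projective_resolution A M X (\<lambda>n. restrict (e n) (carrier (X (Suc n)))) (restrict g0 (carrier (X 0)))"
    unfolding projective_resolution_def left_resolution_def a_kernel_eq
  proof (intro conjI allI X left_module.restrict_mod_hom[OF Xm] el(1))
    show "lin A (X 0) M g0" using F0 L0 by simp
    show "restrict g0 (carrier (X 0)) ` carrier (X 0) = carrier M" using F0 L0 by simp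
    show "restrict (e 0) (carrier (X (Suc 0))) ` carrier (X 1) = {x \<in> carrier (X 0). restrict g0 (carrier (X 0)) x = \<zero>\<^bsub>M\<^esub>}"
      using el(2)[of 0] L0 by (auto simp: image_iff)
    show "restrict (e (Suc n)) (carrier (X (Suc (Suc n)))) ` carrier (X (Suc (Suc n))) =
       {x \<in> carrier (X (Suc n)). restrict (e n) (carrier (X (Suc n))) x = \<zero>\<^bsub>X n\<^esub>}" for n
      using el(2)[of "Suc n"] el(3)[of n] by (auto simp: image_iff)
  qed
  then show thesis by (rule that)
qed

end

section \<open>Duality\<close>

lemma op_alg_simps [simp]:
  "carrier (op_alg A) = carrier A" "\<one>\<^bsub>op_alg A\<^esub> = \<one>\<^bsub>A\<^esub>" "\<zero>\<^bsub>op_alg A\<^esub> = \<zero>\<^bsub>A\<^esub>"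
  "a \<oplus>\<^bsub>op_alg A\<^esub> b = a \<oplus>\<^bsub>A\<^esub> b" "a \<otimes>\<^bsub>op_alg A\<^esub> b = b \<otimes>\<^bsub>A\<^esub> a" "c \<odot>\<^bsub>op_alg A\<^esub> a = c \<odot>\<^bsub>A\<^esub> a"
  by (simp_all add: op_alg_def)

lemma op_op_alg [simp]: "op_alg (op_alg A) = A"
  by (simp add: op_alg_def)

lemma ring_op_alg: "ring A \<Longrightarrow> ring (op_alg A)"
proof -
  assume "ring A"
  then interpret A: ring A .
  show ?thesis
  proof (rule ringI)
    show "abelian_group (op_alg A)"
      by (rule abelian_groupI) (auto intro: A.a_assoc A.a_comm intro!: bexI[of _ "\<ominus>\<^bsub>A\<^esub> _"] A.l_neg)
    show "monoid (op_alg A)"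
      by (rule monoidI) (auto simp: A.m_assoc)
  qed (auto simp: A.l_distr A.r_distr)
qed

context fd_algebra
begin

lemma fd_op_alg: "fd_algebra K (op_alg A)"
proof (intro fd_algebra.intro fd_algebra_axioms.intro ring_op_alg A_ring K.field_axioms)
  have KA: "left_module K (op_alg A)"
    by (intro left_moduleI ring.is_abelian_group ring_op_alg A_ring)
      (auto simp: smult_l_distr smult_r_distr smult_assoc1 K.ring_axioms)
  show "Module.module K (op_alg A)"
    by (intro Module.module.intro Module.module_axioms.intro ring.is_abelian_group ring_op_alg A_ring)
      (auto simp: smult_l_distr smult_r_distr smult_assoc1 K.cring_axioms)
  interpret L1: left_module K A by (rule left_module_KA)
  interpret L2: left_module K "op_alg A" by (rule KA)
  have "is_sub K (op_alg A) N = is_sub K A N" for N by (auto simp: is_sub_def)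
  then show "fin_gen K (op_alg A)" using finite_dim unfolding L1.fin_gen_iff L2.fin_gen_iff sp_def by simp
qed (auto simp: smult_mult_left[symmetric] smult_mult_right[symmetric])

lemma dual_simps [simp]:
  "carrier (dual K A M) = mod_hom K (underlying_space A M) (regular K)"
  "\<zero>\<^bsub>dual K A M\<^esub> = (\<lambda>m \<in> carrier M. \<zero>\<^bsub>K\<^esub>)"
  "f \<oplus>\<^bsub>dual K A M\<^esub> g = (\<lambda>m \<in> carrier M. f m \<oplus>\<^bsub>K\<^esub> g m)"
  "a \<odot>\<^bsub>dual K A M\<^esub> f = (\<lambda>m \<in> carrier M. f (a \<odot>\<^bsub>M\<^esub> m))"
  by (simp_all add: dual_def)

lemma functional_closed: "f \<in> mod_hom K (underlying_space A M) (regular K) \<Longrightarrow> x \<in> carrier M \<Longrightarrow> f x \<in> carrier K"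
  by (auto simp: mod_hom_def)

text \<open>Elements \<open>c \<odot> \<one>\<close> are central; this makes multiplication by
  \<open>a\<close> a \<open>K\<close>-linear map, so that \<open>a\<close> acts on
  functionals.\<close>

lemma scalar_commutes:
  assumes "left_module A M" "c \<in> carrier K" "a \<in> carrier A" "x \<in> carrier M"
  shows "a \<odot>\<^bsub>M\<^esub> ((c \<odot>\<^bsub>A\<^esub> \<one>\<^bsub>A\<^esub>) \<odot>\<^bsub>M\<^esub> x) = (c \<odot>\<^bsub>A\<^esub> \<one>\<^bsub>A\<^esub>) \<odot>\<^bsub>M\<^esub> (a \<odot>\<^bsub>M\<^esub> x)"
proof -
  interpret M: left_module A M by fact
  have "a \<otimes>\<^bsub>A\<^esub> (c \<odot>\<^bsub>A\<^esub> \<one>\<^bsub>A\<^esub>) = (c \<odot>\<^bsub>A\<^esub> \<one>\<^bsub>A\<^esub>) \<otimes>\<^bsub>A\<^esub> a"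
    using assms smult_mult_left[of c "\<one>\<^bsub>A\<^esub>" a] smult_mult_right[of c a "\<one>\<^bsub>A\<^esub>"] by simp
  then show ?thesis using assms by (simp add: M.smult_assoc1[symmetric] sc_closed)
qed

lemma functional_act:
  assumes "left_module A M" "lin K (underlying_space A M) (regular K) f" "a \<in> carrier A"
  shows "lin K (underlying_space A M) (regular K) (\<lambda>m. f (a \<odot>\<^bsub>M\<^esub> m))"
proof -
  interpret M: left_module A M by fact
  have "lin K (underlying_space A M) (underlying_space A M) (\<lambda>m. a \<odot>\<^bsub>M\<^esub> m)"
    by (rule linI) (use assms scalar_commutes in \<open>auto simp: M.smult_closed M.smult_r_distr\<close>)
  then show ?thesis using assms(2) by (rule lin_comp)
qed

lemma left_module_dual:
  assumes M: "left_module A M"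
  shows "left_module (op_alg A) (dual K A M)"
proof -
  interpret M: left_module A M by fact
  interpret U: left_module K "underlying_space A M" by (rule left_module_US[OF M])
  interpret R: left_module K "regular K" by (rule left_module_regular[OF K.ring_axioms])
  let ?D = "dual K A M"
  note r = U.restrict_mod_hom[unfolded underlying_space_simps] and l = lin_of_mod_hom and cl = functional_closed[of _ M]
  have ex: "restrict f (carrier M) = f" if "f \<in> mod_hom K (underlying_space A M) (regular K)" for f
    using that by (simp add: mod_hom_iff extensional_restrict)
  have ad: "f (x \<oplus>\<^bsub>M\<^esub> y) = f x \<oplus>\<^bsub>K\<^esub> f y"
    if "f \<in> mod_hom K (underlying_space A M) (regular K)" "x \<in> carrier M" "y \<in> carrier M" for f x y
    using lin_add[OF l[OF that(1)], of x y] that by simp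
  show ?thesis
  proof (intro left_moduleI abelian_groupI ring_op_alg A_ring)
    fix f assume "f \<in> carrier ?D"
    then show "\<exists>g\<in>carrier ?D. g \<oplus>\<^bsub>?D\<^esub> f = \<zero>\<^bsub>?D\<^esub>"
      using r[OF R.lin_uminus[OF l, of f]] cl[of f] R.M.l_neg
      by (intro bexI[of _ "\<lambda>x\<in>carrier M. \<ominus>\<^bsub>regular K\<^esub> f x"]) (auto cong: restrict_cong)
  next
    fix f g assume "f \<in> carrier ?D" "g \<in> carrier ?D"
    then show "f \<oplus>\<^bsub>?D\<^esub> g \<in> carrier ?D" using r[OF R.lin_plus[OF l l], of f g] by simp
  next
    show "\<zero>\<^bsub>?D\<^esub> \<in> carrier ?D" using r[OF R.lin_const_zero[OF U.left_module_axioms]] by simp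
  qed (simp_all add: cl ex ad r[OF functional_act[OF M l]] K.add.m_ac M.smult_closed M.smult_l_distr M.smult_assoc1 M.smult_one
      cong: restrict_cong)
qed

lemma dual_finsum:
  assumes M: "left_module A M" and F: "\<And>s. s \<in> S \<Longrightarrow> F s \<in> carrier (dual K A M)" and x: "x \<in> carrier M"
  shows "(\<Oplus>\<^bsub>dual K A M\<^esub>s\<in>S. F s) x = (\<Oplus>\<^bsub>regular K\<^esub>s\<in>S. F s x)"
proof -
  interpret D: left_module "op_alg A" "dual K A M" by (rule left_module_dual[OF M])
  interpret R: left_module K "regular K" by (rule left_module_regular[OF K.ring_axioms])
  show ?thesis using F
  proof (induction S rule: infinite_finite_induct)
    case (infinite S)
    then show ?case using x by simp
  next
    case empty
    then show ?case using x by simp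
  next
    case (insert s S)
    have "F \<in> S \<rightarrow> carrier (dual K A M)" "(\<lambda>s. F s x) \<in> S \<rightarrow> carrier (regular K)"
      using insert.prems x functional_closed[of _ M x] by auto
    moreover have "F s \<in> carrier (dual K A M)" "F s x \<in> carrier (regular K)"
      using insert.prems x functional_closed[of _ M x] by auto
    ultimately show ?case using insert x
      by (subst D.M.finsum_insert, simp_all del: regular_simps(4))
  qed
qed

section \<open>Dual bases and reflexivity\<close>

lemma dual_basis_functionals:
  assumes M: "fg_module A M"
  obtains B st where "finite B" "B \<subseteq> carrier M" "\<And>b. b \<in> B \<Longrightarrow> st b \<in> mod_hom K (underlying_space A M) (regular K)"
    "\<And>x. x \<in> carrier M \<Longrightarrow> x = (\<Oplus>\<^bsub>underlying_space A M\<^esub>b\<in>B. st b x \<odot>\<^bsub>underlying_space A M\<^esub> b)"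
proof -
  interpret U: fd_vspace K "underlying_space A M" by (rule fd_vspace_US[OF M])
  obtain S where S: "finite S" "S \<subseteq> carrier M" "sp K (underlying_space A M) S = carrier M"
    using U.spanning by auto
  let ?U = "underlying_space A M"
  have e: "?U\<lparr>carrier := carrier M\<rparr> = ?U" by (simp add: underlying_space_def restrict_scalars_def)
  obtain B st where B: "finite B" "B \<subseteq> sp K ?U S" "\<forall>b\<in>B. lin K (?U\<lparr>carrier := sp K ?U S\<rparr>) (regular K) (st b)"
    "\<forall>x\<in>sp K ?U S. x = (\<Oplus>\<^bsub>?U\<^esub>b\<in>B. st b x \<odot>\<^bsub>?U\<^esub> b)"
    using U.dual_basis[of S, unfolded underlying_space_simps(1), OF S(1,2)] by (elim exE conjE) (rule that)
  note B = B[unfolded S(3) e]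
  define st' where "st' b = restrict (st b) (carrier M)" for b
  have "st' b \<in> mod_hom K ?U (regular K)" if "b \<in> B" for b
    unfolding st'_def using U.restrict_mod_hom[OF B(3)[rule_format, OF that]] by simp
  moreover have "x = (\<Oplus>\<^bsub>?U\<^esub>b\<in>B. st' b x \<odot>\<^bsub>?U\<^esub> b)" if "x \<in> carrier M" for x
    using B(4)[rule_format, OF that] that unfolding st'_def by simp
  ultimately show thesis by (rule that[OF B(1,2)])
qed

lemma functional_expand:
  assumes M: "fg_module A M" and B: "finite B" "B \<subseteq> carrier M" "\<And>b. b \<in> B \<Longrightarrow> st b \<in> mod_hom K (underlying_space A M) (regular K)"
    "x = (\<Oplus>\<^bsub>underlying_space A M\<^esub>b\<in>B. st b x \<odot>\<^bsub>underlying_space A M\<^esub> b)"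
    and f: "lin K (underlying_space A M) (regular K) f" and x: "x \<in> carrier M"
  shows "f x = (\<Oplus>\<^bsub>regular K\<^esub>b\<in>B. st b x \<otimes>\<^bsub>K\<^esub> f b)"
proof -
  let ?U = "underlying_space A M"
  interpret U: fd_vspace K ?U by (rule fd_vspace_US[OF M])
  interpret R: left_module K "regular K" by (rule left_module_regular[OF K.ring_axioms])
  have c: "(\<lambda>b. st b x \<odot>\<^bsub>?U\<^esub> b) \<in> B \<rightarrow> carrier ?U"
    using U.smult_closed[OF functional_closed[OF B(3) x]] B(2) by (auto simp only: underlying_space_simps(1))
  have "f x = f (\<Oplus>\<^bsub>?U\<^esub>b\<in>B. st b x \<odot>\<^bsub>?U\<^esub> b)" using B(4) by simp
  also have "\<dots> = (\<Oplus>\<^bsub>regular K\<^esub>b\<in>B. f (st b x \<odot>\<^bsub>?U\<^esub> b))"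
    by (rule lin_of_finsum[OF U.left_module_axioms R.left_module_axioms f c])
  also have "\<dots> = (\<Oplus>\<^bsub>regular K\<^esub>b\<in>B. st b x \<otimes>\<^bsub>K\<^esub> f b)"
  proof (rule R.M.finsum_cong')
    show "(\<lambda>b. st b x \<otimes>\<^bsub>K\<^esub> f b) \<in> B \<rightarrow> carrier (regular K)"
      using B(2) functional_closed[OF B(3) x] lin_closed[OF f] by auto
    show "f (st b x \<odot>\<^bsub>?U\<^esub> b) = st b x \<otimes>\<^bsub>K\<^esub> f b" if "b \<in> B" for b
      using lin_smult[OF f, of "st b x" b] functional_closed[OF B(3) x] B(2) that by auto
  qed simp
  finally show ?thesis .
qed

lemma dual_smult_K:
  "c \<in> carrier K \<Longrightarrow> f \<in> mod_hom K (underlying_space A M) (regular K) \<Longrightarrow>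
    c \<odot>\<^bsub>underlying_space (op_alg A) (dual K A M)\<^esub> f = (\<lambda>m \<in> carrier M. c \<otimes>\<^bsub>K\<^esub> f m)"
  using lin_smult[OF lin_of_mod_hom, of f K "underlying_space A M" "regular K" c] by (auto intro!: restrict_ext)

text \<open>The coordinate functionals span the dual, with the values of \<open>f\<close> on
  \<open>B\<close> as coefficients.\<close>

lemma dual_expand:
  assumes M: "fg_module A M" and B: "finite B" "B \<subseteq> carrier M" "\<And>b. b \<in> B \<Longrightarrow> st b \<in> mod_hom K (underlying_space A M) (regular K)"
    "\<And>x. x \<in> carrier M \<Longrightarrow> x = (\<Oplus>\<^bsub>underlying_space A M\<^esub>b\<in>B. st b x \<odot>\<^bsub>underlying_space A M\<^esub> b)"
    and f: "f \<in> mod_hom K (underlying_space A M) (regular K)"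
  shows "f = (\<Oplus>\<^bsub>underlying_space (op_alg A) (dual K A M)\<^esub>b\<in>B. f b \<odot>\<^bsub>underlying_space (op_alg A) (dual K A M)\<^esub> st b)"
proof -
  interpret O: fd_algebra K "op_alg A" by (rule fd_op_alg)
  note Mm = fg_left_module[OF M]
  note DM = left_module_dual[OF Mm]
  interpret UD: left_module K "underlying_space (op_alg A) (dual K A M)" by (rule O.left_module_US[OF DM])
  interpret R: left_module K "regular K" by (rule left_module_regular[OF K.ring_axioms])
  let ?UD = "underlying_space (op_alg A) (dual K A M)"
  have fl: "lin K (underlying_space A M) (regular K) f" using f by (rule lin_of_mod_hom)
  have fb: "f b \<in> carrier K" if "b \<in> B" for b using functional_closed[of f M b] f B(2) that by auto
  have c2: "f b \<odot>\<^bsub>?UD\<^esub> st b \<in> carrier (dual K A M)" if "b \<in> B" for b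
    using UD.smult_closed[OF fb[OF that], of "st b"] B(3)[OF that] by simp
  show ?thesis
  proof (rule mod_hom_ext[OF f])
    have "(\<Oplus>\<^bsub>?UD\<^esub>b\<in>B. f b \<odot>\<^bsub>?UD\<^esub> st b) \<in> carrier ?UD"
      using c2 by (intro UD.M.finsum_closed) auto
    then show "(\<Oplus>\<^bsub>?UD\<^esub>b\<in>B. f b \<odot>\<^bsub>?UD\<^esub> st b) \<in> mod_hom K (underlying_space A M) (regular K)" by simp
    fix x assume "x \<in> carrier (underlying_space A M)"
    then have x: "x \<in> carrier M" by simp
    \<comment> \<open>A finite sum depends only on carrier, zero and addition, which the two records
      share.\<close>
    have "(\<Oplus>\<^bsub>?UD\<^esub>b\<in>B. f b \<odot>\<^bsub>?UD\<^esub> st b) = (\<Oplus>\<^bsub>dual K A M\<^esub>b\<in>B. f b \<odot>\<^bsub>?UD\<^esub> st b)"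
      by (simp add: finsum_def finprod_def)
    then have "(\<Oplus>\<^bsub>?UD\<^esub>b\<in>B. f b \<odot>\<^bsub>?UD\<^esub> st b) x = (\<Oplus>\<^bsub>regular K\<^esub>b\<in>B. (f b \<odot>\<^bsub>?UD\<^esub> st b) x)"
      using dual_finsum[OF Mm c2 x, of B] by simp
    also have "\<dots> = (\<Oplus>\<^bsub>regular K\<^esub>b\<in>B. st b x \<otimes>\<^bsub>K\<^esub> f b)"
    proof (rule R.M.finsum_cong')
      show "(\<lambda>b. st b x \<otimes>\<^bsub>K\<^esub> f b) \<in> B \<rightarrow> carrier (regular K)"
        using fb functional_closed[OF B(3) x] by auto
      show "(f b \<odot>\<^bsub>?UD\<^esub> st b) x = st b x \<otimes>\<^bsub>K\<^esub> f b" if "b \<in> B" for b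
        using dual_smult_K[OF fb[OF that] B(3)[OF that]] x fb[OF that] functional_closed[OF B(3)[OF that] x] by (simp add: K.m_comm)
    qed simp
    also have "\<dots> = f x" by (rule functional_expand[OF M B(1-3) B(4)[OF x] fl x, symmetric])
    finally show "f x = (\<Oplus>\<^bsub>?UD\<^esub>b\<in>B. f b \<odot>\<^bsub>?UD\<^esub> st b) x" by simp
  qed
qed

lemma fg_dual:
  assumes M: "fg_module A M"
  shows "fg_module (op_alg A) (dual K A M)"
proof -
  interpret O: fd_algebra K "op_alg A" by (rule fd_op_alg)
  note Mm = fg_left_module[OF M]
  note DM = left_module_dual[OF Mm]
  interpret UD: left_module K "underlying_space (op_alg A) (dual K A M)" by (rule O.left_module_US[OF DM])
  obtain B st where B: "finite B" "B \<subseteq> carrier M" "\<And>b. b \<in> B \<Longrightarrow> st b \<in> mod_hom K (underlying_space A M) (regular K)"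
    "\<And>x. x \<in> carrier M \<Longrightarrow> x = (\<Oplus>\<^bsub>underlying_space A M\<^esub>b\<in>B. st b x \<odot>\<^bsub>underlying_space A M\<^esub> b)"
    by (rule dual_basis_functionals[OF M]) (rule that)
  let ?UD = "underlying_space (op_alg A) (dual K A M)"
  have stD: "st ` B \<subseteq> carrier ?UD" using B(3) by auto
  have N: "is_sub K ?UD (sp K ?UD (st ` B))" using stD by (rule UD.is_sub_sp)
  have "f \<in> sp K ?UD (st ` B)" if f: "f \<in> mod_hom K (underlying_space A M) (regular K)" for f
  proof -
    have fb: "f b \<in> carrier K" if "b \<in> B" for b using functional_closed[of f M b] f B(2) that by auto
    have "f b \<odot>\<^bsub>?UD\<^esub> st b \<in> sp K ?UD (st ` B)" if "b \<in> B" for b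
      using N fb[OF that] subset_sp[of "st ` B" K ?UD] that unfolding is_sub_def by blast
    then have "(\<Oplus>\<^bsub>?UD\<^esub>b\<in>B. f b \<odot>\<^bsub>?UD\<^esub> st b) \<in> sp K ?UD (st ` B)" by (intro UD.is_sub_finsum[OF N]) auto
    then show ?thesis using dual_expand[OF M B f] by simp
  qed
  then have "sp K ?UD (st ` B) = carrier ?UD" using N by (auto simp: is_sub_def)
  then have "fin_gen K ?UD" unfolding UD.fin_gen_iff using B(1) stD by blast
  then show ?thesis by (rule O.fg_of_US[OF DM])
qed

text \<open>The point is assembled from the values of \<open>L\<close> on the coordinate
  functionals; expanding \<open>f\<close> in these functionals gives
  \<open>L f = f x\<close>.\<close>

lemma dual_reflexive:
  assumes M: "fg_module A M" and L: "lin K (underlying_space (op_alg A) (dual K A M)) (regular K) L"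
  shows "\<exists>x\<in>carrier M. \<forall>f\<in>mod_hom K (underlying_space A M) (regular K). L f = f x"
proof -
  interpret O: fd_algebra K "op_alg A" by (rule fd_op_alg)
  note Mm = fg_left_module[OF M]
  interpret UD: left_module K "underlying_space (op_alg A) (dual K A M)" by (rule O.left_module_US[OF left_module_dual[OF Mm]])
  interpret U: left_module K "underlying_space A M" by (rule left_module_US[OF Mm])
  interpret R: left_module K "regular K" by (rule left_module_regular[OF K.ring_axioms])
  let ?UD = "underlying_space (op_alg A) (dual K A M)" and ?U = "underlying_space A M"
  obtain B st where B: "finite B" "B \<subseteq> carrier M" "\<And>b. b \<in> B \<Longrightarrow> st b \<in> mod_hom K ?U (regular K)"
    "\<And>x. x \<in> carrier M \<Longrightarrow> x = (\<Oplus>\<^bsub>?U\<^esub>b\<in>B. st b x \<odot>\<^bsub>?U\<^esub> b)"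
    by (rule dual_basis_functionals[OF M]) (rule that)
  have Ls: "L (st b) \<in> carrier K" if "b \<in> B" for b using lin_closed[OF L, of "st b"] B(3)[OF that] by simp
  define x where "x = (\<Oplus>\<^bsub>?U\<^esub>b\<in>B. L (st b) \<odot>\<^bsub>?U\<^esub> b)"
  have xc: "(\<lambda>b. L (st b) \<odot>\<^bsub>?U\<^esub> b) \<in> B \<rightarrow> carrier ?U"
    using U.smult_closed[OF Ls] B(2) by (auto simp only: underlying_space_simps(1))
  have "L f = f x" if f: "f \<in> mod_hom K ?U (regular K)" for f
  proof -
    have fl: "lin K ?U (regular K) f" using f by (rule lin_of_mod_hom)
    have fb: "f b \<in> carrier K" if "b \<in> B" for b using functional_closed[of f M b] f B(2) that by auto
    have stc: "st b \<in> carrier ?UD" if "b \<in> B" for b using B(3)[OF that] by simp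
    have c1: "(\<lambda>b. f b \<odot>\<^bsub>?UD\<^esub> st b) \<in> B \<rightarrow> carrier ?UD" using UD.smult_closed[OF fb stc] by blast
    have "L f = L (\<Oplus>\<^bsub>?UD\<^esub>b\<in>B. f b \<odot>\<^bsub>?UD\<^esub> st b)" using dual_expand[OF M B f] by simp
    also have "\<dots> = (\<Oplus>\<^bsub>regular K\<^esub>b\<in>B. L (f b \<odot>\<^bsub>?UD\<^esub> st b))"
      by (rule lin_of_finsum[OF UD.left_module_axioms R.left_module_axioms L c1])
    also have "\<dots> = (\<Oplus>\<^bsub>regular K\<^esub>b\<in>B. f (L (st b) \<odot>\<^bsub>?U\<^esub> b))"
    proof (rule R.M.finsum_cong'[OF refl])
      show "(\<lambda>b. f (L (st b) \<odot>\<^bsub>?U\<^esub> b)) \<in> B \<rightarrow> carrier (regular K)"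
        using lin_closed[OF fl funcset_mem[OF xc]] by blast
      show "L (f b \<odot>\<^bsub>?UD\<^esub> st b) = f (L (st b) \<odot>\<^bsub>?U\<^esub> b)" if "b \<in> B" for b
        using lin_smult[OF L fb[OF that] stc[OF that]] lin_smult[OF fl Ls[OF that], of b] B(2) that
          K.m_comm[OF Ls[OF that] fb[OF that]] by auto
    qed
    also have "\<dots> = f x" unfolding x_def
      by (rule lin_of_finsum[OF U.left_module_axioms R.left_module_axioms fl xc, symmetric])
    finally show ?thesis .
  qed
  moreover have "x \<in> carrier M" using U.M.finsum_closed[OF xc] by (simp add: x_def)
  ultimately show ?thesis by blast
qed

section \<open>Maps into the dual of the regular module\<close>

lemma fg_dual_regular: "fg_module A (dual_regular K A)"
proof -
  interpret O: fd_algebra K "op_alg A" by (rule fd_op_alg)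
  show ?thesis unfolding dual_regular_def using O.fg_dual[OF O.fg_regular] by simp
qed

lemma dual_regular_simps:
  "carrier (dual_regular K A) = mod_hom K (underlying_space (op_alg A) (regular (op_alg A))) (regular K)"
  "u \<oplus>\<^bsub>dual_regular K A\<^esub> v = (\<lambda>m\<in>carrier A. u m \<oplus>\<^bsub>K\<^esub> v m)"
  "a \<odot>\<^bsub>dual_regular K A\<^esub> u = (\<lambda>m\<in>carrier A. u (m \<otimes>\<^bsub>A\<^esub> a))"
  by (simp_all add: dual_regular_def fd_algebra.dual_simps[OF fd_op_alg])

text \<open>One direction of the adjunction \<open>Hom(Y, DA) = DY\<close>; the other,
  \<open>functional_of_lin_dual_regular\<close>, evaluates at \<open>1\<close>.\<close>

lemma lin_to_dual_regular:
  assumes Y: "left_module A Y" and L: "lin K (underlying_space A Y) (regular K) L"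
  shows "lin A Y (dual_regular K A) (\<lambda>y. \<lambda>a\<in>carrier A. L (a \<odot>\<^bsub>Y\<^esub> y))"
proof -
  interpret Y: left_module A Y by fact
  interpret O: fd_algebra K "op_alg A" by (rule fd_op_alg)
  let ?UR = "underlying_space (op_alg A) (regular (op_alg A))"
  interpret UR: left_module K ?UR by (rule O.left_module_US[OF left_module_regular[OF O.A_ring]])
  have com: "(c \<odot>\<^bsub>A\<^esub> \<one>\<^bsub>A\<^esub>) \<otimes>\<^bsub>A\<^esub> a = a \<otimes>\<^bsub>A\<^esub> (c \<odot>\<^bsub>A\<^esub> \<one>\<^bsub>A\<^esub>)" if "c \<in> carrier K" "a \<in> carrier A" for c a
    using that smult_mult_left[of c "\<one>\<^bsub>A\<^esub>" a] smult_mult_right[of c a "\<one>\<^bsub>A\<^esub>"] by simp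
  define H where "H y = (\<lambda>a\<in>carrier A. L (a \<odot>\<^bsub>Y\<^esub> y))" for y
  let ?D = "dual_regular K A"
  have Hl: "lin A Y ?D H"
  proof (rule linI)
    fix y assume y: "y \<in> carrier Y"
    have "lin K ?UR (regular K) (\<lambda>a. L (a \<odot>\<^bsub>Y\<^esub> y))"
    proof (rule linI)
      fix a assume "a \<in> carrier ?UR"
      then have a: "a \<in> carrier A" by simp
      show "L (a \<odot>\<^bsub>Y\<^esub> y) \<in> carrier (regular K)" using lin_closed[OF L, of "a \<odot>\<^bsub>Y\<^esub> y"] Y.smult_closed[OF a y] by simp
      show "L ((a \<oplus>\<^bsub>?UR\<^esub> b) \<odot>\<^bsub>Y\<^esub> y) = L (a \<odot>\<^bsub>Y\<^esub> y) \<oplus>\<^bsub>regular K\<^esub> L (b \<odot>\<^bsub>Y\<^esub> y)" if "b \<in> carrier ?UR" for b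
        using lin_add[OF L, of "a \<odot>\<^bsub>Y\<^esub> y" "b \<odot>\<^bsub>Y\<^esub> y"] that a y by (simp add: Y.smult_l_distr Y.smult_closed)
      show "L ((c \<odot>\<^bsub>?UR\<^esub> a) \<odot>\<^bsub>Y\<^esub> y) = c \<odot>\<^bsub>regular K\<^esub> L (a \<odot>\<^bsub>Y\<^esub> y)" if c: "c \<in> carrier K" for c
        using lin_smult[OF L c, of "a \<odot>\<^bsub>Y\<^esub> y"] c a y com[OF c a, symmetric] by (simp add: Y.smult_assoc1 sc_closed Y.smult_closed)
    qed
    from UR.restrict_mod_hom[OF this] show "H y \<in> carrier ?D" by (simp add: dual_regular_simps H_def)
    show "H (y \<oplus>\<^bsub>Y\<^esub> z) = H y \<oplus>\<^bsub>?D\<^esub> H z" if z: "z \<in> carrier Y" for z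
      using lin_add[OF L] y z by (auto simp: H_def dual_regular_simps Y.smult_r_distr Y.smult_closed intro!: restrict_ext)
    show "H (a \<odot>\<^bsub>Y\<^esub> y) = a \<odot>\<^bsub>?D\<^esub> H y" if "a \<in> carrier A" for a
      using that y by (auto simp: H_def dual_regular_simps Y.smult_assoc1 intro!: restrict_ext)
  qed
  then show ?thesis unfolding H_def .
qed

lemma functional_of_lin_dual_regular:
  assumes X: "left_module A X" and fl: "lin A X (dual_regular K A) f"
  shows "lin K (underlying_space A X) (regular K) (\<lambda>x. f x \<one>\<^bsub>A\<^esub>)"
proof -
  interpret X: left_module A X by fact
  let ?UX = "underlying_space A X" and ?UR = "underlying_space (op_alg A) (regular (op_alg A))"
  have fxl: "lin K ?UR (regular K) (f x)" if "x \<in> carrier X" for x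
    using lin_closed[OF fl that] lin_of_mod_hom unfolding dual_regular_simps by blast
  show ?thesis
  proof (rule linI)
    fix x assume "x \<in> carrier ?UX"
    then have x: "x \<in> carrier X" by simp
    show "f x \<one>\<^bsub>A\<^esub> \<in> carrier (regular K)" using lin_closed[OF fxl[OF x], of "\<one>\<^bsub>A\<^esub>"] by simp
    show "f (x \<oplus>\<^bsub>?UX\<^esub> y) \<one>\<^bsub>A\<^esub> = f x \<one>\<^bsub>A\<^esub> \<oplus>\<^bsub>regular K\<^esub> f y \<one>\<^bsub>A\<^esub>" if "y \<in> carrier ?UX" for y
      using lin_add[OF fl x, of y] that by (simp add: dual_regular_simps)
  next
    fix c x assume c: "c \<in> carrier K" and "x \<in> carrier ?UX"
    then have x: "x \<in> carrier X" by simp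
    have "f (c \<odot>\<^bsub>?UX\<^esub> x) \<one>\<^bsub>A\<^esub> = f x (\<one>\<^bsub>A\<^esub> \<otimes>\<^bsub>A\<^esub> (c \<odot>\<^bsub>A\<^esub> \<one>\<^bsub>A\<^esub>))"
      using lin_smult[OF fl sc_closed[OF c] x] by (simp add: dual_regular_simps)
    also have "\<dots> = c \<otimes>\<^bsub>K\<^esub> f x \<one>\<^bsub>A\<^esub>" using lin_smult[OF fxl[OF x] c, of "\<one>\<^bsub>A\<^esub>"] by simp
    finally show "f (c \<odot>\<^bsub>?UX\<^esub> x) \<one>\<^bsub>A\<^esub> = c \<odot>\<^bsub>regular K\<^esub> f x \<one>\<^bsub>A\<^esub>" by simp
  qed
qed

end

section \<open>Special tilting modules are generated and cogenerated by \<open>P\<close>\<close>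

lemma (in abelian_group) diff_of_sum: "z = x \<oplus> y \<Longrightarrow> x \<in> carrier G \<Longrightarrow> y \<in> carrier G \<Longrightarrow> z \<ominus> x = y"
  by (simp add: a_minus_def a_comm[of x y] a_assoc r_neg)

lemma factors_mono:
  assumes "left_module A X" "factors A X M" "lin A M M' j" "lin A M' M j'" "\<And>x. x \<in> carrier M \<Longrightarrow> j' (j x) = x"
  shows "factors A X M'"
proof -
  obtain n i p where i: "\<And>m. m < n \<Longrightarrow> lin A X M (i m)" and p: "\<And>m. m < n \<Longrightarrow> lin A M X (p m)"
    and s: "\<And>x. x \<in> carrier X \<Longrightarrow> (\<Oplus>\<^bsub>X\<^esub>m\<in>{..<n::nat}. p m (i m x)) = x" by (rule factorsE[OF assms(2)]) (rule that)
  interpret X: left_module A X by fact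
  show ?thesis
  proof (rule factorsI)
    show "lin A X M' (\<lambda>x. j (i m x))" if "m < n" for m using i[OF that] assms(3) by (rule lin_comp)
    show "lin A M' X (\<lambda>x. p m (j' x))" if "m < n" for m using assms(4) p[OF that] by (rule lin_comp)
    fix x assume x: "x \<in> carrier X"
    have "(\<Oplus>\<^bsub>X\<^esub>m\<in>{..<n}. p m (j' (j (i m x)))) = (\<Oplus>\<^bsub>X\<^esub>m\<in>{..<n}. p m (i m x))"
      using assms(5) lin_closed[OF i x] lin_closed[OF p lin_closed[OF i x]]
      by (intro X.M.finsum_cong') auto
    then show "(\<Oplus>\<^bsub>X\<^esub>m\<in>{..<n}. p m (j' (j (i m x)))) = x" using s[OF x] by simp
  qed
qed

text \<open>\<open>T\<close> is the trace of \<open>P\<close>, spelled out elementwise. It means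
  that a functional on \<open>T\<close> is determined by its restrictions along the maps from
  \<open>P\<close>.\<close>

definition generated_by :: "('k, 'a) module \<Rightarrow> ('a, 'p) module \<Rightarrow> ('a, 't) module \<Rightarrow> bool" where
  "generated_by A P T \<longleftrightarrow> (\<forall>y\<in>carrier T. \<exists>n g x. (\<forall>m<n. lin A P T (g m) \<and> x m \<in> carrier P) \<and>
     y = (\<Oplus>\<^bsub>T\<^esub>m\<in>{..<n::nat}. g m (x m)))"

text \<open>Cogeneration is expressed by maps to \<open>DA\<close>, which are functionals on
  \<open>T\<close> by adjunction. A functional that factors through a power of \<open>P\<close> is
  exactly a sum of functionals of the kind produced by \<zeta>.\<close>

definition cogenerated_by :: "'k ring \<Rightarrow> ('k, 'a) module \<Rightarrow> ('a, 'p) module \<Rightarrow> ('a, 't) module \<Rightarrow> bool" where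
  "cogenerated_by K A P T \<longleftrightarrow> (\<forall>f. lin A T (dual_regular K A) f \<longrightarrow>
     (\<exists>n a b. (\<forall>m<n. lin A T P (a m) \<and> lin A P (dual_regular K A) (b m)) \<and>
        (\<forall>x\<in>carrier T. f x = (\<Oplus>\<^bsub>dual_regular K A\<^esub>m\<in>{..<n::nat}. b m (a m x)))))"

context fd_algebra
begin

section \<open>Homotopies between resolutions\<close>

lemma right_resolutionD:
  assumes "right_resolution A M X d h"
  shows "fg_module A (X n)" "lin A (X n) (X (Suc n)) (d n)" "lin A M (X 0) h" "inj_on h (carrier M)"
    "h ` carrier M = {x \<in> carrier (X 0). d 0 x = \<zero>\<^bsub>X (Suc 0)\<^esub>}"
    "d n ` carrier (X n) = {x \<in> carrier (X (Suc n)). d (Suc n) x = \<zero>\<^bsub>X (Suc (Suc n))\<^esub>}"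
  using assms by (simp_all add: right_resolution_def lin_of_mod_hom a_kernel_eq)

lemma left_resolutionD:
  assumes "left_resolution A M X d h"
  shows "fg_module A (X n)" "lin A (X (Suc n)) (X n) (d n)" "lin A (X 0) M h" "h ` carrier (X 0) = carrier M"
    "d 0 ` carrier (X (Suc 0)) = {x \<in> carrier (X 0). h x = \<zero>\<^bsub>M\<^esub>}"
    "d (Suc n) ` carrier (X (Suc (Suc n))) = {x \<in> carrier (X (Suc n)). d n x = \<zero>\<^bsub>X n\<^esub>}"
  using assms by (simp_all add: left_resolution_def lin_of_mod_hom a_kernel_eq)

text \<open>
  The map \<open>A \<rightarrow> C\<close>, \<open>1 \<mapsto> y\<close>, extends to a map \<open>u\<close> of injective resolutions. As that of \<open>C\<close> has length \<open>k\<close> and the first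
  terms of \<open>I\<close> are projective, descending induction subtracts a homotopy, which moves \<open>u\<close> in degree \<open>0\<close> into \<open>C\<close>.
\<close>

lemma generated_by_first_term:
  assumes C: "fg_module A C" and idim: "idim_le A C k"
    and I: "injective_resolution A (regular A) I dI hI" "\<And>n. n \<le> k \<Longrightarrow> projective A (I n)"
    and y: "y \<in> carrier C"
  shows "\<exists>w. lin A (I 0) C w \<and> w (hI \<one>\<^bsub>A\<^esub>) = y"
proof -
  note Cm = fg_left_module[OF C]
  obtain J dJ hJ where J: "injective_resolution A C J dJ hJ" "\<And>n. n > k \<Longrightarrow> trivial_module (J n)"
    using idim unfolding idim_le_def by blast
  have Ir: "right_resolution A (regular A) I dI hI" and Jr: "right_resolution A C J dJ hJ"
    and Ji: "\<And>n. injective A (J n)" using I(1) J(1) by (auto simp: injective_resolution_def)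
  note Ifg = right_resolutionD(1)[OF Ir] and Il = right_resolutionD(2)[OF Ir] and Ih = right_resolutionD(3)[OF Ir]
  note Jfg = right_resolutionD(1)[OF Jr] and Jl = right_resolutionD(2)[OF Jr] and Jh = right_resolutionD(3)[OF Jr]
  note Im = fg_left_module[OF Ifg] and Jm = fg_left_module[OF Jfg]
  have Idd: "dI (Suc n) (dI n x) = \<zero>\<^bsub>I (Suc (Suc n))\<^esub>" if "x \<in> carrier (I n)" for n x
    using right_resolutionD(6)[OF Ir, of n] that by blast
  have Jdd: "dJ (Suc n) (dJ n x) = \<zero>\<^bsub>J (Suc (Suc n))\<^esub>" if "x \<in> carrier (J n)" for n x
    using right_resolutionD(6)[OF Jr, of n] that by blast
  have Jdiff: "lin A M (J n) (\<lambda>x. f x \<ominus>\<^bsub>J n\<^esub> g x)" if "lin A M (J n) f" "lin A M (J n) g" for M n f g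
    using left_module.lin_diff[OF Jm that] .
  have sub: "dJ n (a \<ominus>\<^bsub>J n\<^esub> b) = dJ n a \<ominus>\<^bsub>J (Suc n)\<^esub> dJ n b" if "a \<in> carrier (J n)" "b \<in> carrier (J n)" for n a b
    by (rule lin_sub[OF Jm Jm Jl that])
  \<comment> \<open>\<open>v\<close> is a component of the homotopy: subtracting
    \<open>v \<circ> dI n\<close> from \<open>u\<close> moves its values into the kernel of
    \<open>dJ n\<close>. In degree \<open>k\<close> the zero map will do, because
    \<open>J (Suc k)\<close> is zero.\<close>
  have step: "\<forall>u u'. lin A (I n) (J n) u \<longrightarrow> lin A (I (Suc n)) (J (Suc n)) u' \<longrightarrow>
      (\<forall>x\<in>carrier (I n). u' (dI n x) = dJ n (u x)) \<longrightarrow>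
      (\<exists>v. lin A (I (Suc n)) (J n) v \<and> (\<forall>x\<in>carrier (I n). dJ n (u x \<ominus>\<^bsub>J n\<^esub> v (dI n x)) = \<zero>\<^bsub>J (Suc n)\<^esub>))"
    if "n \<le> k" for n
    using that
  proof (induction n rule: inc_induct)
    case base
    show ?case
    proof (intro allI impI)
      fix u u' assume u: "lin A (I k) (J k) u"
      have t: "carrier (J (Suc k)) = {\<zero>\<^bsub>J (Suc k)\<^esub>}" using J(2)[of "Suc k"] by (simp add: trivial_module_def)
      have z: "lin A (I (Suc k)) (J k) (\<lambda>x. \<zero>\<^bsub>J k\<^esub>)" by (rule left_module.lin_const_zero[OF Jm Im])
      have "dJ k (u x \<ominus>\<^bsub>J k\<^esub> \<zero>\<^bsub>J k\<^esub>) = \<zero>\<^bsub>J (Suc k)\<^esub>" if "x \<in> carrier (I k)" for x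
        using lin_closed[OF Jl lin_closed[OF Jdiff[OF u left_module.lin_const_zero[OF Jm Im]] that]] t by auto
      then show "\<exists>v. lin A (I (Suc k)) (J k) v \<and> (\<forall>x\<in>carrier (I k). dJ k (u x \<ominus>\<^bsub>J k\<^esub> v (dI k x)) = \<zero>\<^bsub>J (Suc k)\<^esub>)"
        using z by blast
    qed
  next
    case (step n)
    show ?case
    proof (intro allI impI)
      fix u u' assume u: "lin A (I n) (J n) u" and u': "lin A (I (Suc n)) (J (Suc n)) u'"
        and uu: "\<forall>x\<in>carrier (I n). u' (dI n x) = dJ n (u x)"
      have "\<exists>h. lin A (I (Suc (Suc n))) (J (Suc (Suc n))) h \<and> (\<forall>x\<in>carrier (I (Suc n)). h (dI (Suc n) x) = dJ (Suc n) (u' x))"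
      proof (rule inj_ext[OF Ji Jm Ifg Ifg Il lin_comp[OF u' Jl]])
        fix x assume "x \<in> carrier (I (Suc n))" "dI (Suc n) x = \<zero>\<^bsub>I (Suc (Suc n))\<^esub>"
        then obtain z where z: "z \<in> carrier (I n)" "x = dI n z" using right_resolutionD(6)[OF Ir, of n] by blast
        then show "dJ (Suc n) (u' x) = \<zero>\<^bsub>J (Suc (Suc n))\<^esub>" using uu Jdd[OF lin_closed[OF u z(1)]] by simp
      qed
      then obtain u'' where u'': "lin A (I (Suc (Suc n))) (J (Suc (Suc n))) u''"
        "\<forall>x\<in>carrier (I (Suc n)). u'' (dI (Suc n) x) = dJ (Suc n) (u' x)" by blast
      obtain v'' where v'': "lin A (I (Suc (Suc n))) (J (Suc n)) v''"
        "\<forall>x\<in>carrier (I (Suc n)). dJ (Suc n) (u' x \<ominus>\<^bsub>J (Suc n)\<^esub> v'' (dI (Suc n) x)) = \<zero>\<^bsub>J (Suc (Suc n))\<^esub>"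
        using step.IH u' u'' by blast
      let ?w = "\<lambda>x. u' x \<ominus>\<^bsub>J (Suc n)\<^esub> v'' (dI (Suc n) x)"
      have w: "lin A (I (Suc n)) (J (Suc n)) ?w" by (rule Jdiff[OF u' lin_comp[OF Il v''(1)]])
      \<comment> \<open>The corrected map in degree \<open>Suc n\<close> takes values in cycles,
        which are boundaries by exactness; projectivity of \<open>I (Suc n)\<close> lifts it to
        \<open>J n\<close>.\<close>
      have "\<exists>v. lin A (I (Suc n)) (J n) v \<and> (\<forall>x\<in>carrier (I (Suc n)). dJ n (v x) = ?w x)"
      proof (rule proj_lift[OF I(2) Im Jfg Jfg Jl w])
        show "Suc n \<le> k" using step.hyps by simp
        show "?w ` carrier (I (Suc n)) \<subseteq> dJ n ` carrier (J n)"
          unfolding right_resolutionD(6)[OF Jr, of n] using v''(2) lin_closed[OF w] by auto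
      qed
      then obtain v where v: "lin A (I (Suc n)) (J n) v" "\<forall>x\<in>carrier (I (Suc n)). dJ n (v x) = ?w x" by blast
      have "dJ n (u x \<ominus>\<^bsub>J n\<^esub> v (dI n x)) = \<zero>\<^bsub>J (Suc n)\<^esub>" if x: "x \<in> carrier (I n)" for x
      proof -
        interpret JS: left_module A "J (Suc n)" by (rule Jm)
        have dx: "dI n x \<in> carrier (I (Suc n))" by (rule lin_closed[OF Il x])
        have "dJ n (v (dI n x)) = u' (dI n x) \<ominus>\<^bsub>J (Suc n)\<^esub> v'' (dI (Suc n) (dI n x))" using v(2) dx by simp
        also have "v'' (dI (Suc n) (dI n x)) = \<zero>\<^bsub>J (Suc n)\<^esub>" using Idd[OF x] lin_zero[OF Im Jm v''(1)] by simp
        also have "u' (dI n x) \<ominus>\<^bsub>J (Suc n)\<^esub> \<zero>\<^bsub>J (Suc n)\<^esub> = u' (dI n x)"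
          using lin_closed[OF u' dx] by (simp add: a_minus_def)
        finally have "dJ n (v (dI n x)) = dJ n (u x)" using uu x by simp
        then show ?thesis
          using sub[OF lin_closed[OF u x] lin_closed[OF v(1) dx]] JS.M.diff_self[OF lin_closed[OF Jl lin_closed[OF u x]]] by simp
      qed
      then show "\<exists>v. lin A (I (Suc n)) (J n) v \<and> (\<forall>x\<in>carrier (I n). dJ n (u x \<ominus>\<^bsub>J n\<^esub> v (dI n x)) = \<zero>\<^bsub>J (Suc n)\<^esub>)"
        using v(1) by blast
    qed
  qed
  have rm: "left_module A (regular A)" by (rule left_module_regular[OF A_ring])
  have yl: "lin A (regular A) (J 0) (\<lambda>a. hJ (a \<odot>\<^bsub>C\<^esub> y))" by (rule lin_comp[OF lin_from_regular[OF Cm y] Jh])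
  have I0: "x = \<zero>\<^bsub>regular A\<^esub>" if "x \<in> carrier (regular A)" "hI x = \<zero>\<^bsub>I 0\<^esub>" for x
    using right_resolutionD(4)[OF Ir] that lin_zero[OF rm Im Ih] left_module.M_group[OF rm]
    by (metis abelian_groupE(2) inj_on_eq_iff)
  have "\<exists>h. lin A (I 0) (J 0) h \<and> (\<forall>x\<in>carrier (regular A). h (hI x) = hJ (x \<odot>\<^bsub>C\<^esub> y))"
    by (rule inj_ext[OF Ji Jm fg_regular Ifg Ih yl]) (use I0 lin_zero[OF rm Jm yl] in auto)
  then obtain u where u: "lin A (I 0) (J 0) u" "\<And>x. x \<in> carrier A \<Longrightarrow> u (hI x) = hJ (x \<odot>\<^bsub>C\<^esub> y)" by auto
  have "\<exists>h. lin A (I (Suc 0)) (J (Suc 0)) h \<and> (\<forall>x\<in>carrier (I 0). h (dI 0 x) = dJ 0 (u x))"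
  proof (rule inj_ext[OF Ji Jm Ifg Ifg Il lin_comp[OF u(1) Jl]])
    fix x assume "x \<in> carrier (I 0)" "dI 0 x = \<zero>\<^bsub>I (Suc 0)\<^esub>"
    then obtain z where z: "z \<in> carrier A" "x = hI z" using right_resolutionD(5)[OF Ir] by auto
    have "hJ (z \<odot>\<^bsub>C\<^esub> y) \<in> hJ ` carrier C" using left_module.smult_closed[OF Cm z(1) y] by blast
    then show "dJ 0 (u x) = \<zero>\<^bsub>J (Suc 0)\<^esub>" using right_resolutionD(5)[OF Jr] z u(2) by auto
  qed
  then obtain u' where u': "lin A (I (Suc 0)) (J (Suc 0)) u'" "\<forall>x\<in>carrier (I 0). u' (dI 0 x) = dJ 0 (u x)" by blast
  obtain v where v: "lin A (I (Suc 0)) (J 0) v" "\<forall>x\<in>carrier (I 0). dJ 0 (u x \<ominus>\<^bsub>J 0\<^esub> v (dI 0 x)) = \<zero>\<^bsub>J (Suc 0)\<^esub>"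
    using step[of 0] u(1) u' by blast
  let ?w = "\<lambda>x. u x \<ominus>\<^bsub>J 0\<^esub> v (dI 0 x)"
  have w: "lin A (I 0) (J 0) ?w" by (rule Jdiff[OF u(1) lin_comp[OF Il v(1)]])
  have wC: "?w x \<in> hJ ` carrier C" if "x \<in> carrier (I 0)" for x
    using right_resolutionD(5)[OF Jr] v(2) lin_closed[OF w that] that by blast
  \<comment> \<open>In degree 0 the cycles are the image of \<open>C\<close>, so the corrected map
    can be composed with the inverse of \<open>hJ\<close>.\<close>
  let ?i = "inv_into (carrier C) hJ"
  let ?C' = "(J 0)\<lparr>carrier := hJ ` carrier C\<rparr>"
  have Cs: "is_sub A (J 0) (hJ ` carrier C)"
    by (rule left_module.is_sub_image[OF Jm Cm Jh left_module.is_sub_carrier[OF Cm]])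
  have hb: "lin A C ?C' hJ" "bij_betw hJ (carrier C) (carrier ?C')"
    using Jh Cs right_resolutionD(4)[OF Jr] by (auto simp: lin_sub_cod is_sub_def bij_betw_def)
  have il: "lin A ?C' C ?i" by (rule lin_inv_into[OF Cm hb])
  have wl: "lin A (I 0) ?C' ?w" using w wC Cs by (subst lin_sub_cod) (auto simp: is_sub_def)
  interpret J0: left_module A "J 0" by (rule Jm)
  \<comment> \<open>The correction factors through \<open>dI 0\<close>, which vanishes on the image
    of \<open>A\<close>; hence the value at \<open>1\<close> is still \<open>y\<close>.\<close>
  have "?i (?w (hI \<one>\<^bsub>A\<^esub>)) = y"
  proof -
    have 1: "hI \<one>\<^bsub>A\<^esub> \<in> carrier (I 0)" using lin_closed[OF Ih, of "\<one>\<^bsub>A\<^esub>"] by simp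
    have "hI \<one>\<^bsub>A\<^esub> \<in> hI ` carrier (regular A)" by simp
    then have "dI 0 (hI \<one>\<^bsub>A\<^esub>) = \<zero>\<^bsub>I (Suc 0)\<^esub>" using right_resolutionD(5)[OF Ir] by blast
    then have "v (dI 0 (hI \<one>\<^bsub>A\<^esub>)) = \<zero>\<^bsub>J 0\<^esub>" using lin_zero[OF Im Jm v(1)] by simp
    then have "?w (hI \<one>\<^bsub>A\<^esub>) = u (hI \<one>\<^bsub>A\<^esub>) \<ominus>\<^bsub>J 0\<^esub> \<zero>\<^bsub>J 0\<^esub>" by simp
    also have "\<dots> = u (hI \<one>\<^bsub>A\<^esub>)"
      using lin_closed[OF u(1) 1] by (simp add: a_minus_def)
    also have "\<dots> = hJ y" using u(2)[of "\<one>\<^bsub>A\<^esub>"] left_module.smult_one[OF Cm y] by simp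
    finally show ?thesis using right_resolutionD(4)[OF Jr] y by simp
  qed
  then show ?thesis using lin_comp[OF wl il] by blast
qed

text \<open>
  The dual argument: extend \<open>f\<close> to a map of resolutions and subtract a homotopy built from degree \<open>k\<close> downwards, where
  the hypothesis \<open>stop\<close> starts the induction.
\<close>

lemma lift_through_resolution:
  assumes M: "fg_module A M" and N: "fg_module A N"
    and Q: "projective_resolution A M Q dQ hQ" and Y: "left_resolution A N Y dY hY"
    and Yi: "\<And>n. n \<le> k \<Longrightarrow> injective A (Y n)" and Yt: "trivial_module (Y (Suc (Suc k)))"
    and stop: "\<And>u. lin A (Q (Suc k)) (Y (Suc k)) u \<Longrightarrow> (\<And>x. x \<in> carrier (Q (Suc (Suc k))) \<Longrightarrow> u (dQ (Suc k) x) = \<zero>\<^bsub>Y (Suc k)\<^esub>) \<Longrightarrow>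
      \<exists>v. lin A (Q k) (Y (Suc k)) v \<and> (\<forall>x\<in>carrier (Q (Suc k)). v (dQ k x) = u x)"
    and f: "lin A M N f"
  shows "\<exists>w. lin A M (Y 0) w \<and> (\<forall>x\<in>carrier M. hY (w x) = f x)"
proof -
  note Mm = fg_left_module[OF M] and Nm = fg_left_module[OF N]
  have Qr: "left_resolution A M Q dQ hQ" and Qp: "\<And>n. projective A (Q n)"
    using Q by (auto simp: projective_resolution_def)
  note Qfg = left_resolutionD(1)[OF Qr] and Ql = left_resolutionD(2)[OF Qr] and Qh = left_resolutionD(3)[OF Qr]
  note Yfg = left_resolutionD(1)[OF Y] and Yl = left_resolutionD(2)[OF Y] and Yh = left_resolutionD(3)[OF Y]
  note Qm = fg_left_module[OF Qfg] and Ym = fg_left_module[OF Yfg]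
  have Qdd: "dQ n (dQ (Suc n) x) = \<zero>\<^bsub>Q n\<^esub>" if "x \<in> carrier (Q (Suc (Suc n)))" for n x
    using left_resolutionD(6)[OF Qr, of n] that by blast
  have Ydd: "dY n (dY (Suc n) x) = \<zero>\<^bsub>Y n\<^esub>" if "x \<in> carrier (Y (Suc (Suc n)))" for n x
    using left_resolutionD(6)[OF Y, of n] that by blast
  \<comment> \<open>Here \<open>v\<close> is defined on all of \<open>Q n\<close>, so
    \<open>u\<close> minus \<open>dY n \<circ> v\<close> is a map that vanishes on the boundaries of
    \<open>Q\<close>.\<close>
  have step: "\<forall>u u'. lin A (Q n) (Y n) u \<longrightarrow> lin A (Q (Suc n)) (Y (Suc n)) u' \<longrightarrow>
      (\<forall>x\<in>carrier (Q (Suc n)). dY n (u' x) = u (dQ n x)) \<longrightarrow>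
      (\<exists>v. lin A (Q n) (Y (Suc n)) v \<and> (\<forall>x\<in>carrier (Q (Suc n)). u (dQ n x) = dY n (v (dQ n x))))"
    if "n \<le> k" for n
    using that
  proof (induction n rule: inc_induct)
    case base
    show ?case
    proof (intro allI impI)
      fix u u' assume u: "lin A (Q k) (Y k) u" and u': "lin A (Q (Suc k)) (Y (Suc k)) u'"
        and uu: "\<forall>x\<in>carrier (Q (Suc k)). dY k (u' x) = u (dQ k x)"
      \<comment> \<open>As \<open>Y (Suc (Suc k))\<close> is zero, \<open>dY k\<close> is injective.
        Therefore \<open>u'\<close> is a cocycle, and \<open>stop\<close> applies to it.\<close>
      have "u' (dQ (Suc k) x) = \<zero>\<^bsub>Y (Suc k)\<^esub>" if x: "x \<in> carrier (Q (Suc (Suc k)))" for x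
      proof -
        have dx: "dQ (Suc k) x \<in> carrier (Q (Suc k))" by (rule lin_closed[OF Ql x])
        have "dY k (u' (dQ (Suc k) x)) = \<zero>\<^bsub>Y k\<^esub>" using uu dx Qdd[OF x] lin_zero[OF Qm Ym u] by simp
        then have "u' (dQ (Suc k) x) \<in> dY (Suc k) ` carrier (Y (Suc (Suc k)))"
          unfolding left_resolutionD(6)[OF Y, of k] using lin_closed[OF u' dx] by simp
        then show ?thesis using Yt lin_zero[OF Ym Ym Yl[of "Suc k"]] by (simp add: trivial_module_def)
      qed
      then obtain v where "lin A (Q k) (Y (Suc k)) v" "\<forall>x\<in>carrier (Q (Suc k)). v (dQ k x) = u' x"
        using stop[OF u'] by blast
      then show "\<exists>v. lin A (Q k) (Y (Suc k)) v \<and> (\<forall>x\<in>carrier (Q (Suc k)). u (dQ k x) = dY k (v (dQ k x)))"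
        using uu by auto
    qed
  next
    case (step n)
    show ?case
    proof (intro allI impI)
      fix u u' assume u: "lin A (Q n) (Y n) u" and u': "lin A (Q (Suc n)) (Y (Suc n)) u'"
        and uu: "\<forall>x\<in>carrier (Q (Suc n)). dY n (u' x) = u (dQ n x)"
      have "\<exists>h. lin A (Q (Suc (Suc n))) (Y (Suc (Suc n))) h \<and>
          (\<forall>x\<in>carrier (Q (Suc (Suc n))). dY (Suc n) (h x) = u' (dQ (Suc n) x))"
      proof (rule proj_lift[OF Qp Qm Yfg Yfg Yl lin_comp[OF Ql u']])
        show "(\<lambda>x. u' (dQ (Suc n) x)) ` carrier (Q (Suc (Suc n))) \<subseteq> dY (Suc n) ` carrier (Y (Suc (Suc n)))"
          unfolding left_resolutionD(6)[OF Y, of n]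
          using lin_closed[OF lin_comp[OF Ql u']] uu lin_closed[OF Ql] Qdd lin_zero[OF Qm Ym u] by auto
      qed
      then obtain u'' where u'': "lin A (Q (Suc (Suc n))) (Y (Suc (Suc n))) u''"
        "\<forall>x\<in>carrier (Q (Suc (Suc n))). dY (Suc n) (u'' x) = u' (dQ (Suc n) x)" by blast
      obtain v'' where v'': "lin A (Q (Suc n)) (Y (Suc (Suc n))) v''"
        "\<forall>x\<in>carrier (Q (Suc (Suc n))). u' (dQ (Suc n) x) = dY (Suc n) (v'' (dQ (Suc n) x))"
        using step.IH u' u'' by blast
      interpret Y1: left_module A "Y (Suc n)" by (rule Ym)
      interpret Y0: left_module A "Y n" by (rule Ym)
      let ?w = "\<lambda>x. u' x \<ominus>\<^bsub>Y (Suc n)\<^esub> dY (Suc n) (v'' x)"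
      have w: "lin A (Q (Suc n)) (Y (Suc n)) ?w" by (rule Y1.lin_diff[OF u' lin_comp[OF v''(1) Yl]])
      \<comment> \<open>The corrected map vanishes on boundaries, that is on the kernel of
        \<open>dQ n\<close>, so injectivity of \<open>Y (Suc n)\<close> extends it along
        \<open>dQ n\<close>.\<close>
      have "\<exists>v. lin A (Q n) (Y (Suc n)) v \<and> (\<forall>x\<in>carrier (Q (Suc n)). v (dQ n x) = ?w x)"
      proof (rule inj_ext[OF Yi Ym Qfg Qfg Ql w])
        show "Suc n \<le> k" using step.hyps by simp
        fix x assume "x \<in> carrier (Q (Suc n))" "dQ n x = \<zero>\<^bsub>Q n\<^esub>"
        then obtain z where z: "z \<in> carrier (Q (Suc (Suc n)))" "x = dQ (Suc n) z"
          using left_resolutionD(6)[OF Qr, of n] by blast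
        then show "?w x = \<zero>\<^bsub>Y (Suc n)\<^esub>"
          using v''(2) Y1.M.diff_self[OF lin_closed[OF u' lin_closed[OF Ql z(1)]]] by simp
      qed
      then obtain v where v: "lin A (Q n) (Y (Suc n)) v" "\<forall>x\<in>carrier (Q (Suc n)). v (dQ n x) = ?w x" by blast
      have "u (dQ n x) = dY n (v (dQ n x))" if x: "x \<in> carrier (Q (Suc n))" for x
      proof -
        have v''x: "v'' x \<in> carrier (Y (Suc (Suc n)))" by (rule lin_closed[OF v''(1) x])
        have "dY n (v (dQ n x)) = dY n (u' x) \<ominus>\<^bsub>Y n\<^esub> dY n (dY (Suc n) (v'' x))"
          using v(2) x lin_sub[OF Ym Ym Yl lin_closed[OF u' x] lin_closed[OF Yl v''x]] by simp
        also have "\<dots> = dY n (u' x)"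
          using Ydd[OF v''x] lin_closed[OF Yl lin_closed[OF u' x]] by (simp add: a_minus_def)
        finally show ?thesis using uu x by simp
      qed
      then show "\<exists>v. lin A (Q n) (Y (Suc n)) v \<and> (\<forall>x\<in>carrier (Q (Suc n)). u (dQ n x) = dY n (v (dQ n x)))"
        using v(1) by blast
    qed
  qed
  have "\<exists>h. lin A (Q 0) (Y 0) h \<and> (\<forall>x\<in>carrier (Q 0). hY (h x) = f (hQ x))"
    by (rule proj_lift[OF Qp Qm Yfg N Yh lin_comp[OF Qh f]])
      (use left_resolutionD(4)[OF Y] lin_closed[OF lin_comp[OF Qh f]] in auto)
  then obtain u where u: "lin A (Q 0) (Y 0) u" "\<forall>x\<in>carrier (Q 0). hY (u x) = f (hQ x)" by blast
  have Qhd: "hQ (dQ 0 x) = \<zero>\<^bsub>M\<^esub>" if "x \<in> carrier (Q (Suc 0))" for x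
    using left_resolutionD(5)[OF Qr] that by blast
  have "\<exists>h. lin A (Q (Suc 0)) (Y (Suc 0)) h \<and> (\<forall>x\<in>carrier (Q (Suc 0)). dY 0 (h x) = u (dQ 0 x))"
  proof (rule proj_lift[OF Qp Qm Yfg Yfg Yl lin_comp[OF Ql u(1)]])
    show "(\<lambda>x. u (dQ 0 x)) ` carrier (Q (Suc 0)) \<subseteq> dY 0 ` carrier (Y (Suc 0))"
      unfolding left_resolutionD(5)[OF Y]
      using lin_closed[OF lin_comp[OF Ql u(1)]] u(2) lin_closed[OF Ql] Qhd lin_zero[OF Mm Nm f] by auto
  qed
  then obtain u' where u': "lin A (Q (Suc 0)) (Y (Suc 0)) u'" "\<forall>x\<in>carrier (Q (Suc 0)). dY 0 (u' x) = u (dQ 0 x)" by blast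
  obtain v where v: "lin A (Q 0) (Y (Suc 0)) v" "\<forall>x\<in>carrier (Q (Suc 0)). u (dQ 0 x) = dY 0 (v (dQ 0 x))"
    using step[of 0] u(1) u' by blast
  interpret Y0: left_module A "Y 0" by (rule Ym)
  interpret N: left_module A N by (rule Nm)
  let ?w = "\<lambda>x. u x \<ominus>\<^bsub>Y 0\<^esub> dY 0 (v x)"
  have w: "lin A (Q 0) (Y 0) ?w" by (rule Y0.lin_diff[OF u(1) lin_comp[OF v(1) Yl]])
  \<comment> \<open>Descent from \<open>Q 0\<close> to its quotient \<open>M\<close> is also an
    instance of \<open>inj_ext\<close>, with the kernel of \<open>hQ\<close> as the kernel to be
    checked.\<close>
  have "\<exists>g. lin A M (Y 0) g \<and> (\<forall>x\<in>carrier (Q 0). g (hQ x) = ?w x)"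
  proof (rule inj_ext[OF Yi Ym Qfg M Qh w])
    fix x assume "x \<in> carrier (Q 0)" "hQ x = \<zero>\<^bsub>M\<^esub>"
    then obtain z where z: "z \<in> carrier (Q (Suc 0))" "x = dQ 0 z" using left_resolutionD(5)[OF Qr] by blast
    then show "?w x = \<zero>\<^bsub>Y 0\<^esub>" using v(2) Y0.M.diff_self[OF lin_closed[OF u(1) lin_closed[OF Ql z(1)]]] by simp
  qed simp
  then obtain g where g: "lin A M (Y 0) g" "\<forall>x\<in>carrier (Q 0). g (hQ x) = ?w x" by blast
  have "hY (g m) = f m" if m: "m \<in> carrier M" for m
  proof -
    obtain x where x: "x \<in> carrier (Q 0)" "m = hQ x" using m left_resolutionD(4)[OF Qr] by blast
    have vx: "v x \<in> carrier (Y (Suc 0))" by (rule lin_closed[OF v(1) x(1)])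
    have "hY (dY 0 (v x)) = \<zero>\<^bsub>N\<^esub>" using left_resolutionD(5)[OF Y] vx by blast
    then have "hY (?w x) = hY (u x) \<ominus>\<^bsub>N\<^esub> \<zero>\<^bsub>N\<^esub>"
      using lin_sub[OF Ym Nm Yh lin_closed[OF u(1) x(1)] lin_closed[OF Yl vx]] by simp
    then show ?thesis using g(2) x u(2) lin_closed[OF Yh lin_closed[OF u(1) x(1)]] by (simp add: a_minus_def)
  qed
  then show ?thesis using g(1) by blast
qed

text \<open>
  The maps \<open>X 0 \<rightarrow> R 0 \<rightarrow> X 0\<close> that write the identity as a sum lift to the complexes, and the sum of the lifts is
  homotopic to the identity. At the left end of \<open>X\<close> this leaves the homotopy \<open>s\<close> only.
\<close>

lemma homotopy_summand:
  fixes X R :: "nat \<Rightarrow> ('k, 'a) umodule"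
  assumes Xfg: "\<And>n. fg_module A (X n)" and Rfg: "\<And>n. fg_module A (R n)"
    and Xl: "\<And>n. n \<le> k \<Longrightarrow> lin A (X (Suc n)) (X n) (dX n)" and Rl: "\<And>n. lin A (R (Suc n)) (R n) (dR n)"
    and Xp: "\<And>n. n \<le> k \<Longrightarrow> projective A (X (Suc n))" and Rp: "\<And>n. projective A (R (Suc n))"
    and X0: "dX 0 ` carrier (X (Suc 0)) = carrier (X 0)" and R0: "dR 0 ` carrier (R (Suc 0)) = carrier (R 0)"
    and Xe: "\<And>n. n < k \<Longrightarrow> dX (Suc n) ` carrier (X (Suc (Suc n))) = {x \<in> carrier (X (Suc n)). dX n x = \<zero>\<^bsub>X n\<^esub>}"
    and Re: "\<And>n. dR (Suc n) ` carrier (R (Suc (Suc n))) = {x \<in> carrier (R (Suc n)). dR n x = \<zero>\<^bsub>R n\<^esub>}"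
    and Xinj: "inj_on (dX k) (carrier (X (Suc k)))"
    and fac: "factors A (X 0) (R 0)"
  shows "\<exists>N a b a' b' s. (\<forall>m<N::nat. lin A (X k) (R k) (a m) \<and> lin A (R k) (X k) (b m) \<and>
      lin A (X (Suc k)) (R (Suc k)) (a' m) \<and> lin A (R (Suc k)) (X (Suc k)) (b' m) \<and>
      (\<forall>x\<in>carrier (X (Suc k)). dR k (a' m x) = a m (dX k x)) \<and>
      (\<forall>y\<in>carrier (R (Suc k)). dX k (b' m y) = b m (dR k y))) \<and>
      lin A (X k) (X (Suc k)) s \<and>
      (\<forall>x\<in>carrier (X (Suc k)). x = (\<Oplus>\<^bsub>X (Suc k)\<^esub>m\<in>{..<N}. b' m (a' m x)) \<oplus>\<^bsub>X (Suc k)\<^esub> s (dX k x))"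
proof -
  note Xm = fg_left_module[OF Xfg] and Rm = fg_left_module[OF Rfg]
  have Xdd: "dX n (dX (Suc n) x) = \<zero>\<^bsub>X n\<^esub>" if "x \<in> carrier (X (Suc (Suc n)))" "n < k" for n x
    using Xe[OF that(2)] that(1) by blast
  have Rdd: "dR n (dR (Suc n) x) = \<zero>\<^bsub>R n\<^esub>" if "x \<in> carrier (R (Suc (Suc n)))" for n x
    using Re[of n] that by blast
  obtain N i p where i: "\<And>m. m < N \<Longrightarrow> lin A (X 0) (R 0) (i m)" and p: "\<And>m. m < N \<Longrightarrow> lin A (R 0) (X 0) (p m)"
    and ip: "\<And>x. x \<in> carrier (X 0) \<Longrightarrow> (\<Oplus>\<^bsub>X 0\<^esub>m\<in>{..<N::nat}. p m (i m x)) = x" by (rule factorsE[OF fac]) (rule that)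
  \<comment> \<open>\<open>a\<close> and \<open>b\<close> are the components of the lifted maps in
    degree \<open>n\<close>, and \<open>s\<close> is the homotopy leaving that degree. Both the
    compatibility and the homotopy relation are required on boundaries only, because nothing more
    holds at an inner degree.\<close>
  define Inv where "Inv n a b s \<longleftrightarrow> (\<forall>m<N. lin A (X n) (R n) (a m) \<and> lin A (R n) (X n) (b m) \<and>
      (\<forall>x\<in>carrier (X (Suc n)). a m (dX n x) \<in> dR n ` carrier (R (Suc n))) \<and>
      (\<forall>y\<in>carrier (R (Suc n)). b m (dR n y) \<in> dX n ` carrier (X (Suc n)))) \<and>
      lin A (X n) (X (Suc n)) s \<and>
      (\<forall>x\<in>carrier (X (Suc n)). dX n x = (\<Oplus>\<^bsub>X n\<^esub>m\<in>{..<N}. b m (a m (dX n x))) \<oplus>\<^bsub>X n\<^esub> dX n (s (dX n x)))" for n a b s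
  define Lift where "Lift n a b a' b' \<longleftrightarrow> (\<forall>m<N. lin A (X (Suc n)) (R (Suc n)) (a' m) \<and> lin A (R (Suc n)) (X (Suc n)) (b' m) \<and>
      (\<forall>x\<in>carrier (X (Suc n)). dR n (a' m x) = a m (dX n x)) \<and>
      (\<forall>y\<in>carrier (R (Suc n)). dX n (b' m y) = b m (dR n y)))" for n and a b a' b' :: "nat \<Rightarrow> (nat \<Rightarrow> 'k) \<Rightarrow> (nat \<Rightarrow> 'k)"
  \<comment> \<open>The defect of the homotopy relation in degree \<open>Suc n\<close>. It takes
    values in cycles, so exactness and projectivity lift it to the next component of the
    homotopy.\<close>
  define W where "W n a' b' s x = x \<ominus>\<^bsub>X (Suc n)\<^esub> (\<Oplus>\<^bsub>X (Suc n)\<^esub>m\<in>{..<N}. b' m (a' m x)) \<ominus>\<^bsub>X (Suc n)\<^esub> s (dX n x)"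
    for n and a' b' :: "nat \<Rightarrow> (nat \<Rightarrow> 'k) \<Rightarrow> (nat \<Rightarrow> 'k)" and s x
  have lift: "\<exists>a' b'. Lift n a b a' b' \<and> lin A (X (Suc n)) (X (Suc n)) (W n a' b' s) \<and>
       (\<forall>x\<in>carrier (X (Suc n)). dX n (W n a' b' s x) = \<zero>\<^bsub>X n\<^esub>)" if inv: "Inv n a b s" and n: "n \<le> k" for n a b s
  proof -
    interpret Xn: left_module A "X n" by (rule Xm)
    interpret XS: left_module A "X (Suc n)" by (rule Xm)
    have a: "lin A (X n) (R n) (a m)" and b: "lin A (R n) (X n) (b m)" if "m < N" for m
      using inv that by (auto simp: Inv_def)
    have s: "lin A (X n) (X (Suc n)) s" using inv by (simp add: Inv_def)
    have "\<exists>h. lin A (X (Suc n)) (R (Suc n)) h \<and> (\<forall>x\<in>carrier (X (Suc n)). dR n (h x) = a m (dX n x))" if "m < N" for m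
      by (rule proj_lift[OF Xp[OF n] Xm Rfg Rfg Rl lin_comp[OF Xl[OF n] a[OF that]]])
        (use inv that in \<open>auto simp: Inv_def\<close>)
    then obtain a' where a': "\<And>m. m < N \<Longrightarrow> lin A (X (Suc n)) (R (Suc n)) (a' m)"
      "\<And>m x. m < N \<Longrightarrow> x \<in> carrier (X (Suc n)) \<Longrightarrow> dR n (a' m x) = a m (dX n x)" by metis
    have "\<exists>h. lin A (R (Suc n)) (X (Suc n)) h \<and> (\<forall>x\<in>carrier (R (Suc n)). dX n (h x) = b m (dR n x))" if "m < N" for m
      by (rule proj_lift[OF Rp Rm Xfg Xfg Xl[OF n] lin_comp[OF Rl b[OF that]]])
        (use inv that in \<open>auto simp: Inv_def\<close>)
    then obtain b' where b': "\<And>m. m < N \<Longrightarrow> lin A (R (Suc n)) (X (Suc n)) (b' m)"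
      "\<And>m x. m < N \<Longrightarrow> x \<in> carrier (R (Suc n)) \<Longrightarrow> dX n (b' m x) = b m (dR n x)" by metis
    have L: "Lift n a b a' b'" using a' b' by (simp add: Lift_def)
    have sumlin: "lin A (X (Suc n)) (X (Suc n)) (\<lambda>x. \<Oplus>\<^bsub>X (Suc n)\<^esub>m\<in>{..<N}. b' m (a' m x))"
      by (rule XS.lin_finsum[OF Xm]) (use lin_comp[OF a'(1) b'(1)] in auto)
    have Wl: "lin A (X (Suc n)) (X (Suc n)) (W n a' b' s)"
      unfolding W_def by (intro XS.lin_diff lin_id sumlin lin_comp[OF Xl[OF n] s])
    have "dX n (W n a' b' s x) = \<zero>\<^bsub>X n\<^esub>" if x: "x \<in> carrier (X (Suc n))" for x
    proof -
      note dx = lin_closed[OF Xl[OF n] x]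
      note c1 = lin_closed[OF sumlin x] and c2 = lin_closed[OF s dx]
      have aa: "a' m x \<in> carrier (R (Suc n))" if "m < N" for m using lin_closed[OF a'(1) x] that .
      have "dX n (\<Oplus>\<^bsub>X (Suc n)\<^esub>m\<in>{..<N}. b' m (a' m x)) = (\<Oplus>\<^bsub>X n\<^esub>m\<in>{..<N}. dX n (b' m (a' m x)))"
        using lin_closed[OF b'(1) aa] by (intro lin_of_finsum[OF Xm Xm Xl[OF n]]) auto
      also have "\<dots> = (\<Oplus>\<^bsub>X n\<^esub>m\<in>{..<N}. b m (a m (dX n x)))"
        using lin_closed[OF b lin_closed[OF a dx]] a'(2)[OF _ x] b'(2)[OF _ aa] by (intro Xn.M.finsum_cong') auto
      finally have e: "dX n (\<Oplus>\<^bsub>X (Suc n)\<^esub>m\<in>{..<N}. b' m (a' m x)) = (\<Oplus>\<^bsub>X n\<^esub>m\<in>{..<N}. b m (a m (dX n x)))" .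
      have "dX n (W n a' b' s x) = dX n x \<ominus>\<^bsub>X n\<^esub> dX n (\<Oplus>\<^bsub>X (Suc n)\<^esub>m\<in>{..<N}. b' m (a' m x)) \<ominus>\<^bsub>X n\<^esub> dX n (s (dX n x))"
        unfolding W_def using lin_sub[OF Xm Xm Xl[OF n]] x c1 c2 by simp
      also have "\<dots> = \<zero>\<^bsub>X n\<^esub>"
      proof -
        let ?S = "\<Oplus>\<^bsub>X n\<^esub>m\<in>{..<N}. b m (a m (dX n x))" and ?d = "dX n (s (dX n x))"
        have "?S \<in> carrier (X n)" "?d \<in> carrier (X n)"
          using lin_closed[OF Xl[OF n] c1] e lin_closed[OF Xl[OF n] c2] by auto
        moreover have "dX n x = ?S \<oplus>\<^bsub>X n\<^esub> ?d" using inv x by (simp add: Inv_def)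
        ultimately have "dX n x \<ominus>\<^bsub>X n\<^esub> ?S = ?d"
          by (intro Xn.M.diff_of_sum)
        then show ?thesis unfolding e using \<open>?d \<in> carrier (X n)\<close> Xn.M.diff_self by simp
      qed
      finally show ?thesis .
    qed
    then show ?thesis using L Wl by blast
  qed
  have "n \<le> k \<Longrightarrow> \<exists>a b s. Inv n a b s" for n
  proof (induction n)
    case 0
    interpret X0: left_module A "X 0" by (rule Xm)
    \<comment> \<open>In degree 0 the factorization of the identity is exact, so the homotopy starts
      with zero.\<close>
    have "Inv 0 i p (\<lambda>x. \<zero>\<^bsub>X (Suc 0)\<^esub>)"
      unfolding Inv_def
    proof (intro conjI allI impI ballI)
      show "lin A (X 0) (X (Suc 0)) (\<lambda>x. \<zero>\<^bsub>X (Suc 0)\<^esub>)" by (rule left_module.lin_const_zero[OF Xm Xm])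
      fix x assume x: "x \<in> carrier (X (Suc 0))"
      note dx = lin_closed[OF Xl[of 0] x]
      show "dX 0 x = (\<Oplus>\<^bsub>X 0\<^esub>m\<in>{..<N}. p m (i m (dX 0 x))) \<oplus>\<^bsub>X 0\<^esub> dX 0 \<zero>\<^bsub>X (Suc 0)\<^esub>"
        using ip[OF dx] dx lin_zero[OF Xm Xm Xl[of 0]] by simp
    qed (use i p R0 X0 lin_closed[OF i lin_closed[OF Xl[of 0]]] lin_closed[OF p lin_closed[OF Rl]] in auto)
    then show ?case by blast
  next
    case (Suc n)
    then obtain a b s where inv: "Inv n a b s" by auto
    have n: "n \<le> k" "n < k" using Suc.prems by auto
    obtain a' b' where L: "Lift n a b a' b'" "lin A (X (Suc n)) (X (Suc n)) (W n a' b' s)"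
      "\<forall>x\<in>carrier (X (Suc n)). dX n (W n a' b' s x) = \<zero>\<^bsub>X n\<^esub>" using lift[OF inv n(1)] by blast
    have ab: "lin A (X n) (R n) (a m)" "lin A (R n) (X n) (b m)" if "m < N" for m
      using inv that by (auto simp: Inv_def)
    have s: "lin A (X n) (X (Suc n)) s" using inv by (simp add: Inv_def)
    have a': "lin A (X (Suc n)) (R (Suc n)) (a' m)" "lin A (R (Suc n)) (X (Suc n)) (b' m)"
      "\<And>x. x\<in>carrier (X (Suc n)) \<Longrightarrow> dR n (a' m x) = a m (dX n x)"
      "\<And>y. y\<in>carrier (R (Suc n)) \<Longrightarrow> dX n (b' m y) = b m (dR n y)" if "m < N" for m
      using L(1) that by (auto simp: Lift_def)
    interpret XS: left_module A "X (Suc n)" by (rule Xm)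
    have "\<exists>h. lin A (X (Suc n)) (X (Suc (Suc n))) h \<and> (\<forall>x\<in>carrier (X (Suc n)). dX (Suc n) (h x) = W n a' b' s x)"
      by (rule proj_lift[OF Xp[OF n(1)] Xm Xfg Xfg Xl[OF Suc.prems] L(2)])
        (use Xe[OF n(2)] L(3) lin_closed[OF L(2)] in auto)
    then obtain s' where s': "lin A (X (Suc n)) (X (Suc (Suc n))) s'" "\<And>x. x\<in>carrier (X (Suc n)) \<Longrightarrow> dX (Suc n) (s' x) = W n a' b' s x"
      by blast
    have sumlin: "lin A (X (Suc n)) (X (Suc n)) (\<lambda>x. \<Oplus>\<^bsub>X (Suc n)\<^esub>m\<in>{..<N}. b' m (a' m x))"
      by (rule XS.lin_finsum[OF Xm]) (use lin_comp[OF a'(1) a'(2)] in auto)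
    have "Inv (Suc n) a' b' s'"
      unfolding Inv_def
    proof (intro conjI allI impI ballI a'(1,2) s'(1))
      fix m x assume m: "m < N" and x: "x \<in> carrier (X (Suc (Suc n)))"
      note dx = lin_closed[OF Xl[OF Suc.prems] x]
      have "dR n (a' m (dX (Suc n) x)) = \<zero>\<^bsub>R n\<^esub>"
        using a'(3)[OF m dx] Xdd[OF x n(2)] lin_zero[OF Xm Rm ab(1)[OF m]] by simp
      then show "a' m (dX (Suc n) x) \<in> dR (Suc n) ` carrier (R (Suc (Suc n)))"
        unfolding Re using lin_closed[OF a'(1)[OF m] dx] by simp
    next
      fix m x assume m: "m < N" and x: "x \<in> carrier (R (Suc (Suc n)))"
      note dx = lin_closed[OF Rl x]
      have "dX n (b' m (dR (Suc n) x)) = \<zero>\<^bsub>X n\<^esub>"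
        using a'(4)[OF m dx] Rdd[OF x] lin_zero[OF Rm Xm ab(2)[OF m]] by simp
      then show "b' m (dR (Suc n) x) \<in> dX (Suc n) ` carrier (X (Suc (Suc n)))"
        unfolding Xe[OF n(2)] using lin_closed[OF a'(2)[OF m] dx] by simp
    next
      fix x assume x: "x \<in> carrier (X (Suc (Suc n)))"
      let ?z = "dX (Suc n) x" and ?S = "\<Oplus>\<^bsub>X (Suc n)\<^esub>m\<in>{..<N}. b' m (a' m (dX (Suc n) x))"
      note dx = lin_closed[OF Xl[OF Suc.prems] x]
      have S: "?S \<in> carrier (X (Suc n))" by (rule lin_closed[OF sumlin dx])
      have "dX (Suc n) (s' ?z) = ?z \<ominus>\<^bsub>X (Suc n)\<^esub> ?S \<ominus>\<^bsub>X (Suc n)\<^esub> s (dX n ?z)"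
        using s'(2)[OF dx] by (simp add: W_def)
      also have "s (dX n ?z) = \<zero>\<^bsub>X (Suc n)\<^esub>" using Xdd[OF x n(2)] lin_zero[OF Xm Xm s] by simp
      finally have "dX (Suc n) (s' ?z) = ?z \<ominus>\<^bsub>X (Suc n)\<^esub> ?S" using dx S by (simp add: a_minus_def)
      then show "?z = ?S \<oplus>\<^bsub>X (Suc n)\<^esub> dX (Suc n) (s' ?z)"
        using XS.M.diff_add_cancel[OF dx S] dx S by (simp add: XS.M.a_comm)
    qed
    then show ?case by blast
  qed
  then obtain a b s where inv: "Inv k a b s" by blast
  obtain a' b' where L: "Lift k a b a' b'" "lin A (X (Suc k)) (X (Suc k)) (W k a' b' s)"
    "\<forall>x\<in>carrier (X (Suc k)). dX k (W k a' b' s x) = \<zero>\<^bsub>X k\<^esub>" using lift[OF inv] by blast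
  interpret XS: left_module A "X (Suc k)" by (rule Xm)
  have a': "lin A (X (Suc k)) (R (Suc k)) (a' m)" "lin A (R (Suc k)) (X (Suc k)) (b' m)" if "m < N" for m
    using L(1) that by (auto simp: Lift_def)
  have s: "lin A (X k) (X (Suc k)) s" using inv by (simp add: Inv_def)
  have sumlin: "lin A (X (Suc k)) (X (Suc k)) (\<lambda>x. \<Oplus>\<^bsub>X (Suc k)\<^esub>m\<in>{..<N}. b' m (a' m x))"
    by (rule XS.lin_finsum[OF Xm]) (use lin_comp[OF a'] in auto)
  have "x = (\<Oplus>\<^bsub>X (Suc k)\<^esub>m\<in>{..<N}. b' m (a' m x)) \<oplus>\<^bsub>X (Suc k)\<^esub> s (dX k x)" if x: "x \<in> carrier (X (Suc k))" for x
  proof -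
    let ?S = "\<Oplus>\<^bsub>X (Suc k)\<^esub>m\<in>{..<N}. b' m (a' m x)"
    have S: "?S \<in> carrier (X (Suc k))" by (rule lin_closed[OF sumlin x])
    have d: "s (dX k x) \<in> carrier (X (Suc k))" by (rule lin_closed[OF s lin_closed[OF Xl[of k] x]]) simp
    \<comment> \<open>The last differential is injective; here the defect is itself zero and not
      merely a cycle.\<close>
    have "dX k (W k a' b' s x) = dX k \<zero>\<^bsub>X (Suc k)\<^esub>" using L(3) x lin_zero[OF Xm Xm Xl[of k]] by simp
    then have "x \<ominus>\<^bsub>X (Suc k)\<^esub> ?S \<ominus>\<^bsub>X (Suc k)\<^esub> s (dX k x) = \<zero>\<^bsub>X (Suc k)\<^esub>"
      using inj_onD[OF Xinj _ lin_closed[OF L(2) x] XS.M.zero_closed] by (simp add: W_def)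
    then have "x \<ominus>\<^bsub>X (Suc k)\<^esub> ?S = s (dX k x)" using XS.M.diff_eq_zeroD[of "x \<ominus>\<^bsub>X (Suc k)\<^esub> ?S" "s (dX k x)"] x S d by simp
    then show ?thesis using XS.M.diff_add_cancel[OF x S] S d by (simp add: XS.M.a_comm)
  qed
  then show ?thesis
    using L(1) inv by (intro exI[of _ N] exI[of _ a] exI[of _ b] exI[of _ a'] exI[of _ b'] exI[of _ s]) (simp add: Lift_def Inv_def)
qed

text \<open>
  Let \<open>f : A \<rightarrow> T\<close>, \<open>1 \<mapsto> y\<close>. Comparing the tilting sequence with a projective resolution \<open>Q\<close> of \<open>T\<close> gives
  \<open>1 = \<Sum> b' a' + s h\<close> on \<open>A\<close>. Each \<open>f b'\<close> is a cocycle, hence a coboundary because \<open>Ext(T, T) = 0\<close>, so that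
  \<open>f\<close> factors through \<open>h\<close>.
\<close>

lemma tilting_generated_by_first_term:
  assumes T: "k_tilting A (Suc k) T" and t: "tilting_sequence A (Suc k) T t d h"
    and tp: "\<And>n. n \<le> k \<Longrightarrow> projective A (t n)" and y: "y \<in> carrier T"
  shows "\<exists>w. lin A (t 0) T w \<and> w (h \<one>\<^bsub>A\<^esub>) = y"
proof -
  \<comment> \<open>\<open>ext_Suc_vanishes A k\<close> concerns \<open>Ext\<close> in degree
    \<open>k + 1\<close>, the length of the tilting sequence.\<close>
  have Tfg: "fg_module A T" and pd: "pdim_le A T (Suc k)" and ext: "ext_Suc_vanishes A k T T"
    using T by (auto simp: k_tilting_def)
  note Tm = fg_left_module[OF Tfg]
  have tr: "right_resolution A (regular A) t d h" and tadd: "in_add A (t (Suc k)) T"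
    and tz: "trivial_module (t (Suc (Suc k)))"
    using t by (auto simp: tilting_sequence_def)
  note tfg = right_resolutionD(1)[OF tr] and tl = right_resolutionD(2)[OF tr] and th = right_resolutionD(3)[OF tr]
    and tinj = right_resolutionD(4)[OF tr] and te0 = right_resolutionD(5)[OF tr] and te = right_resolutionD(6)[OF tr]
  note tm = fg_left_module[OF tfg]
  obtain Q dQ hQ where Q: "projective_resolution A T Q dQ hQ" using pd by (auto simp: pdim_le_def)
  have Qr: "left_resolution A T Q dQ hQ" and Qp: "\<And>n. projective A (Q n)"
    using Q by (auto simp: projective_resolution_def)
  note Qfg = left_resolutionD(1)[OF Qr] and Ql = left_resolutionD(2)[OF Qr] and Qh = left_resolutionD(3)[OF Qr]
  note Qm = fg_left_module[OF Qfg]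
  obtain T' :: "('k, 'a) umodule" and j where T': "fg_module A T'" "lin A T T' j" "bij_betw j (carrier T) (carrier T')"
    by (rule umodule_copy[OF Tfg])
  have rm: "left_module A (regular A)" by (rule left_module_regular[OF A_ring])
  \<comment> \<open>The image of \<open>A\<close> in \<open>t 0\<close> stands for \<open>A\<close>,
    since all terms of the compared complexes must lie on the type
    \<open>nat \<Rightarrow> 'k\<close>. It is isomorphic to \<open>A\<close> and hence
    projective.\<close>
  let ?G = "(t 0)\<lparr>carrier := h ` carrier A\<rparr>"
  have Gs: "is_sub A (t 0) (h ` carrier A)"
    using left_module.is_sub_image[OF tm rm th left_module.is_sub_carrier[OF rm]] by simp
  have Gfg: "fg_module A ?G" by (rule fg_sub[OF tfg Gs])
  have Gh: "lin A (regular A) ?G h" "bij_betw h (carrier (regular A)) (carrier ?G)"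
    using th Gs tinj by (auto simp: lin_sub_cod is_sub_def bij_betw_def)
  let ?hi = "inv_into (carrier (regular A)) h"
  have hi: "lin A ?G (regular A) ?hi" by (rule lin_inv_into[OF rm Gh])
  have hhi: "h (?hi x) = x" if "x \<in> carrier ?G" for x using that by (auto intro: f_inv_into_f)
  have Gp: "projective A ?G"
    by (rule projective_factors[OF fg_left_module[OF Gfg] rm projective_regular factors_retract[OF fg_left_module[OF Gfg] hi Gh(1) hhi]])
  \<comment> \<open>The tilting sequence read backwards: degree 0 is \<open>t (Suc k)\<close>,
    degree \<open>Suc k\<close> is \<open>t 0\<close>, and one further degree holds the copy of
    \<open>A\<close>, with the inclusion as differential.\<close>
  define X where "X n = (if n \<le> Suc k then t (Suc k - n) else ?G)" for n
  define dX where "dX n = (if n \<le> k then d (k - n) else (\<lambda>x. x))" for n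
  \<comment> \<open>The resolution \<open>Q\<close> is shifted by one and augmented by a copy of
    \<open>T\<close>, so that the two complexes can be compared in degree 0 by
    \<open>t (Suc k) \<in> add T\<close>.\<close>
  define R where "R n = (case n of 0 \<Rightarrow> T' | Suc n \<Rightarrow> Q n)" for n
  define dR where "dR n = (case n of 0 \<Rightarrow> (\<lambda>x. j (hQ x)) | Suc n \<Rightarrow> dQ n)" for n
  have jj: "inv_into (carrier T) j (j x) = x" if "x \<in> carrier T" for x using T'(3) that by (simp add: bij_betw_def)
  have hom: "\<exists>N a b a' b' s. (\<forall>m<N::nat. lin A (X (Suc k)) (R (Suc k)) (a m) \<and> lin A (R (Suc k)) (X (Suc k)) (b m) \<and>
      lin A (X (Suc (Suc k))) (R (Suc (Suc k))) (a' m) \<and> lin A (R (Suc (Suc k))) (X (Suc (Suc k))) (b' m) \<and>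
      (\<forall>x\<in>carrier (X (Suc (Suc k))). dR (Suc k) (a' m x) = a m (dX (Suc k) x)) \<and>
      (\<forall>y\<in>carrier (R (Suc (Suc k))). dX (Suc k) (b' m y) = b m (dR (Suc k) y))) \<and>
      lin A (X (Suc k)) (X (Suc (Suc k))) s \<and>
      (\<forall>x\<in>carrier (X (Suc (Suc k))). x = (\<Oplus>\<^bsub>X (Suc (Suc k))\<^esub>m\<in>{..<N}. b' m (a' m x)) \<oplus>\<^bsub>X (Suc (Suc k))\<^esub> s (dX (Suc k) x))"
  proof (rule homotopy_summand)
    show "fg_module A (X n)" for n using tfg Gfg by (simp add: X_def)
    show "fg_module A (R n)" for n using Qfg T' by (simp add: R_def split: nat.split)
    show "lin A (R (Suc n)) (R n) (dR n)" for n
      using Ql lin_comp[OF Qh T'(2)] by (simp add: R_def dR_def split: nat.split)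
    show "projective A (R (Suc n))" for n using Qp by (simp add: R_def)
    show "lin A (X (Suc n)) (X n) (dX n)" if "n \<le> Suc k" for n
    proof (cases "n \<le> k")
      case True
      then show ?thesis using tl[of "k - n"] by (simp add: X_def dX_def Suc_diff_le)
    next
      case False
      then have "n = Suc k" using that by simp
      then show ?thesis using Gs lin_sub_dom[OF lin_id, of "h ` carrier A" "t 0" A] by (simp add: X_def dX_def is_sub_def)
    qed
    show "projective A (X (Suc n))" if "n \<le> Suc k" for n using tp Gp by (simp add: X_def)
    show "dX 0 ` carrier (X (Suc 0)) = carrier (X 0)"
    proof -
      have "d (Suc k) x = \<zero>\<^bsub>t (Suc (Suc k))\<^esub>" if "x \<in> carrier (t (Suc k))" for x
        using lin_closed[OF tl that] tz by (simp add: trivial_module_def)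
      then show ?thesis using te[of k] by (auto simp: X_def dX_def)
    qed
    show "dR 0 ` carrier (R (Suc 0)) = carrier (R 0)"
    proof -
      have "(\<lambda>x. j (hQ x)) ` carrier (Q 0) = j ` (hQ ` carrier (Q 0))" by (simp add: image_image)
      then show ?thesis using left_resolutionD(4)[OF Qr] T'(3) by (simp add: R_def dR_def bij_betw_def)
    qed
    show "dX (Suc n) ` carrier (X (Suc (Suc n))) = {x \<in> carrier (X (Suc n)). dX n x = \<zero>\<^bsub>X n\<^esub>}" if n: "n < Suc k" for n
    proof (cases "n < k")
      case True
      then obtain m where m: "k = Suc (n + m)" using less_imp_Suc_add by blast
      have "k - n = Suc m" "k - Suc n = m" "Suc k - n = Suc (Suc m)" "n \<le> k" "n \<le> Suc k" "Suc n \<le> k" "Suc n \<le> Suc k"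
        using m by simp_all
      then show ?thesis using te[of m] by (simp add: X_def dX_def)
    next
      case False
      then have "n = k" using n by simp
      then show ?thesis using te0 by (simp add: X_def dX_def)
    qed
    show "dR (Suc n) ` carrier (R (Suc (Suc n))) = {x \<in> carrier (R (Suc n)). dR n x = \<zero>\<^bsub>R n\<^esub>}" for n
    proof (cases n)
      case 0
      have "(j (hQ x) = \<zero>\<^bsub>T'\<^esub>) = (hQ x = \<zero>\<^bsub>T\<^esub>)" if "x \<in> carrier (Q 0)" for x
        using T'(3) lin_closed[OF Qh that] lin_zero[OF Tm fg_left_module[OF T'(1)] T'(2)] left_module.M_group[OF Tm]
        by (metis abelian_groupE(2) bij_betw_def inj_on_eq_iff)
      then show ?thesis using left_resolutionD(5)[OF Qr] by (auto simp: 0 R_def dR_def)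
    next
      case (Suc m)
      then show ?thesis using left_resolutionD(6)[OF Qr, of m] by (simp add: R_def dR_def)
    qed
    show "inj_on (dX (Suc k)) (carrier (X (Suc (Suc k))))" by (simp add: dX_def)
    show "factors A (X 0) (R 0)"
    proof -
      have "factors A (t (Suc k)) T'"
        by (rule factors_mono[OF tm factors_of_in_add[OF tm Tm tadd] T'(2) lin_inv_into[OF Tm T'(2,3)]]) (rule jj)
      then show ?thesis by (simp add: X_def R_def)
    qed
  qed
  have XS: "X (Suc (Suc k)) = ?G" "X (Suc k) = t 0" "R (Suc k) = Q k" "R (Suc (Suc k)) = Q (Suc k)"
    "dX (Suc k) = (\<lambda>x. x)" "dR (Suc k) = dQ k"
    by (simp_all add: X_def dX_def R_def dR_def)
  obtain N a b a' b' s where H0: "\<forall>m<N::nat. lin A (t 0) (Q k) (a m) \<and> lin A (Q k) (t 0) (b m) \<and>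
      lin A ?G (Q (Suc k)) (a' m) \<and> lin A (Q (Suc k)) ?G (b' m) \<and>
      (\<forall>x\<in>carrier ?G. dQ k (a' m x) = a m x) \<and> (\<forall>y\<in>carrier (Q (Suc k)). b' m y = b m (dQ k y))"
     "lin A (t 0) ?G s" "\<forall>x\<in>carrier ?G. x = (\<Oplus>\<^bsub>?G\<^esub>m\<in>{..<N}. b' m (a' m x)) \<oplus>\<^bsub>?G\<^esub> s x"
    using hom[unfolded XS] by (elim exE conjE) (rule that)
  have H: "\<And>m. m < N \<Longrightarrow> lin A (t 0) (Q k) (a m)" "\<And>m. m < N \<Longrightarrow> lin A (Q k) (t 0) (b m)"
     "\<And>m. m < N \<Longrightarrow> lin A ?G (Q (Suc k)) (a' m)" "\<And>m. m < N \<Longrightarrow> lin A (Q (Suc k)) ?G (b' m)"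
     "\<And>m x. m < N \<Longrightarrow> x \<in> carrier ?G \<Longrightarrow> dQ k (a' m x) = a m x"
     "\<And>m y. m < N \<Longrightarrow> y \<in> carrier (Q (Suc k)) \<Longrightarrow> b' m y = b m (dQ k y)"
     "lin A (t 0) ?G s" "\<And>x. x \<in> carrier ?G \<Longrightarrow> (\<Oplus>\<^bsub>?G\<^esub>m\<in>{..<N::nat}. b' m (a' m x)) \<oplus>\<^bsub>?G\<^esub> s x = x"
    using H0(1) H0(2) H0(3)[rule_format, symmetric] by blast+
  interpret T: left_module A T by (rule Tm)
  interpret G: left_module A ?G by (rule fg_left_module[OF Gfg])
  define f where "f x = ?hi x \<odot>\<^bsub>T\<^esub> y" for x
  have f: "lin A ?G T f" unfolding f_def by (rule lin_comp[OF hi lin_from_regular[OF Tm y]])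
  have "\<exists>g. lin A (Q k) T g \<and> (\<forall>x\<in>carrier (Q (Suc k)). g (dQ k x) = f (b' m x))" if m: "m < N" for m
  proof -
    let ?u = "restrict (\<lambda>x. f (b' m x)) (carrier (Q (Suc k)))"
    have u: "?u \<in> mod_hom A (Q (Suc k)) T"
      by (rule left_module.restrict_mod_hom[OF Qm lin_comp[OF H(4)[OF m] f]])
    moreover have "?u (dQ (Suc k) x) = \<zero>\<^bsub>T\<^esub>" if x: "x \<in> carrier (Q (Suc (Suc k)))" for x
    proof -
      have "dQ (Suc k) x \<in> carrier (Q (Suc k))" "dQ k (dQ (Suc k) x) = \<zero>\<^bsub>Q k\<^esub>"
        using left_resolutionD(6)[OF Qr, of k] x by blast+
      moreover from this have "b' m (dQ (Suc k) x) = \<zero>\<^bsub>?G\<^esub>" using H(6)[OF m] lin_zero[OF Qm tm H(2)[OF m]] by simp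
      ultimately show ?thesis using lin_zero[OF G.left_module_axioms Tm f] by simp
    qed
    ultimately have "?u \<in> {compose (carrier (Q (Suc k))) g (dQ k) | g. g \<in> mod_hom A (Q k) T}"
      using ext Q unfolding ext_Suc_vanishes_def by blast
    then obtain g where g: "g \<in> mod_hom A (Q k) T" "?u = compose (carrier (Q (Suc k))) g (dQ k)" by blast
    have "g (dQ k x) = f (b' m x)" if "x \<in> carrier (Q (Suc k))" for x
      using fun_cong[OF g(2), of x] that by (simp add: compose_def)
    then show ?thesis using g(1) lin_of_mod_hom by blast
  qed
  then obtain g where g: "\<And>m. m < N \<Longrightarrow> lin A (Q k) T (g m)" "\<And>m x. m < N \<Longrightarrow> x\<in>carrier (Q (Suc k)) \<Longrightarrow> g m (dQ k x) = f (b' m x)"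
    by metis
  \<comment> \<open>Every summand \<open>f \<circ> b' m \<circ> a' m\<close> on the copy of
    \<open>A\<close> is replaced by \<open>g m \<circ> a m\<close>, which is defined on all of
    \<open>t 0\<close>; the remaining part \<open>f \<circ> s\<close> is already defined
    there.\<close>
  define w where "w z = (\<Oplus>\<^bsub>T\<^esub>m\<in>{..<N}. g m (a m z)) \<oplus>\<^bsub>T\<^esub> f (s z)" for z
  have w: "lin A (t 0) T w" unfolding w_def
    by (intro T.lin_plus T.lin_finsum tm lin_comp[OF H(7) f]) (use lin_comp[OF H(1) g(1)] in auto)
  have "w (h \<one>\<^bsub>A\<^esub>) = y"
  proof -
    have x: "h \<one>\<^bsub>A\<^esub> \<in> carrier ?G" by simp
    have ga: "g m (a m (h \<one>\<^bsub>A\<^esub>)) = f (b' m (a' m (h \<one>\<^bsub>A\<^esub>)))" if "m < N" for m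
      using g(2)[OF that lin_closed[OF H(3)[OF that] x]] H(5)[OF that x] by simp
    have "(\<Oplus>\<^bsub>T\<^esub>m\<in>{..<N}. g m (a m (h \<one>\<^bsub>A\<^esub>))) = (\<Oplus>\<^bsub>T\<^esub>m\<in>{..<N}. f (b' m (a' m (h \<one>\<^bsub>A\<^esub>))))"
      using ga lin_closed[OF f lin_closed[OF H(4) lin_closed[OF H(3) x]]] by (intro T.M.finsum_cong') auto
    also have "\<dots> = f (\<Oplus>\<^bsub>?G\<^esub>m\<in>{..<N}. b' m (a' m (h \<one>\<^bsub>A\<^esub>)))"
      using lin_closed[OF H(4) lin_closed[OF H(3) x]]
      by (intro lin_of_finsum[OF G.left_module_axioms Tm f, symmetric]) auto
    finally have "w (h \<one>\<^bsub>A\<^esub>) = f (\<Oplus>\<^bsub>?G\<^esub>m\<in>{..<N}. b' m (a' m (h \<one>\<^bsub>A\<^esub>))) \<oplus>\<^bsub>T\<^esub> f (s (h \<one>\<^bsub>A\<^esub>))" by (simp add: w_def)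
    also have "\<dots> = f ((\<Oplus>\<^bsub>?G\<^esub>m\<in>{..<N}. b' m (a' m (h \<one>\<^bsub>A\<^esub>))) \<oplus>\<^bsub>?G\<^esub> s (h \<one>\<^bsub>A\<^esub>))"
    proof (rule lin_add[OF f, symmetric])
      show "(\<Oplus>\<^bsub>?G\<^esub>m\<in>{..<N}. b' m (a' m (h \<one>\<^bsub>A\<^esub>))) \<in> carrier ?G"
        using lin_closed[OF H(4) lin_closed[OF H(3) x]] by (intro G.M.finsum_closed) auto
      have "h \<one>\<^bsub>A\<^esub> \<in> carrier (t 0)" using x Gs unfolding is_sub_def by auto
      then show "s (h \<one>\<^bsub>A\<^esub>) \<in> carrier ?G" by (rule lin_closed[OF H(7)])
    qed
    also have "\<dots> = f (h \<one>\<^bsub>A\<^esub>)" using H(8)[OF x] by simp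
    also have "\<dots> = y"
      unfolding f_def using inv_into_f_f[OF tinj, of "\<one>\<^bsub>A\<^esub>"] T.smult_one[OF y] by simp
    finally show ?thesis .
  qed
  then show ?thesis using w by blast
qed

section \<open>Generation and cogeneration by the projective-injective module\<close>

text \<open>It is enough to write the single element \<open>x\<close>, which can be sent to every
  element of \<open>T\<close>, as a sum of values of maps from \<open>P\<close>.\<close>

lemma generated_by_of_term:
  assumes T: "left_module A T" and P: "left_module A P" and X: "left_module A X" "factors A X P" "x \<in> carrier X"
    and sur: "\<And>y. y \<in> carrier T \<Longrightarrow> \<exists>w. lin A X T w \<and> w x = y"
  shows "generated_by A P T"
  unfolding generated_by_def
proof
  fix y assume "y \<in> carrier T"
  then obtain w where w: "lin A X T w" "w x = y" using sur by blast
  obtain n i p where i: "\<And>m. m < n \<Longrightarrow> lin A X P (i m)" and p: "\<And>m. m < n \<Longrightarrow> lin A P X (p m)"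
    and s: "\<And>x. x \<in> carrier X \<Longrightarrow> (\<Oplus>\<^bsub>X\<^esub>m\<in>{..<n::nat}. p m (i m x)) = x" by (rule factorsE[OF X(2)]) (rule that)
  have "w (\<Oplus>\<^bsub>X\<^esub>m\<in>{..<n}. p m (i m x)) = (\<Oplus>\<^bsub>T\<^esub>m\<in>{..<n}. w (p m (i m x)))"
    using lin_closed[OF p lin_closed[OF i X(3)]] by (intro lin_of_finsum[OF X(1) T w(1)]) auto
  then have "y = (\<Oplus>\<^bsub>T\<^esub>m\<in>{..<n}. w (p m (i m x)))" using s[OF X(3)] w(2) by simp
  then show "\<exists>n g x. (\<forall>m<n. lin A P T (g m) \<and> x m \<in> carrier P) \<and> y = (\<Oplus>\<^bsub>T\<^esub>m\<in>{..<n::nat}. g m (x m))"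
    using lin_comp[OF p w(1)] lin_closed[OF i X(3)]
    by (intro exI[of _ n] exI[of _ "\<lambda>m x. w (p m x)"] exI[of _ "\<lambda>m. i m x"]) auto
qed

lemma cogenerated_by_of_term:
  assumes T: "left_module A T" and P: "left_module A P" and X: "left_module A X" "factors A X P"
    and h: "lin A X (dual_regular K A) h"
    and lift: "\<And>f. lin A T (dual_regular K A) f \<Longrightarrow> \<exists>w. lin A T X w \<and> (\<forall>x\<in>carrier T. h (w x) = f x)"
  shows "cogenerated_by K A P T"
  unfolding cogenerated_by_def
proof (intro allI impI)
  fix f assume f: "lin A T (dual_regular K A) f"
  have Dm: "left_module A (dual_regular K A)" by (rule fg_left_module[OF fg_dual_regular])
  obtain w where w: "lin A T X w" "\<And>x. x \<in> carrier T \<Longrightarrow> h (w x) = f x" using lift[OF f] by blast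
  obtain n i p where i: "\<And>m. m < n \<Longrightarrow> lin A X P (i m)" and p: "\<And>m. m < n \<Longrightarrow> lin A P X (p m)"
    and s: "\<And>x. x \<in> carrier X \<Longrightarrow> (\<Oplus>\<^bsub>X\<^esub>m\<in>{..<n::nat}. p m (i m x)) = x" by (rule factorsE[OF X(2)]) (rule that)
  have "f x = (\<Oplus>\<^bsub>dual_regular K A\<^esub>m\<in>{..<n}. h (p m (i m (w x))))" if x: "x \<in> carrier T" for x
  proof -
    note wx = lin_closed[OF w(1) x]
    have "h (\<Oplus>\<^bsub>X\<^esub>m\<in>{..<n}. p m (i m (w x))) = (\<Oplus>\<^bsub>dual_regular K A\<^esub>m\<in>{..<n}. h (p m (i m (w x))))"
      using lin_closed[OF p lin_closed[OF i wx]] by (intro lin_of_finsum[OF X(1) Dm h]) auto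
    then show ?thesis using s[OF wx] w(2)[OF x] by simp
  qed
  then show "\<exists>n a b. (\<forall>m<n. lin A T P (a m) \<and> lin A P (dual_regular K A) (b m)) \<and>
        (\<forall>x\<in>carrier T. f x = (\<Oplus>\<^bsub>dual_regular K A\<^esub>m\<in>{..<n::nat}. b m (a m x)))"
    using lin_comp[OF w(1) i] lin_comp[OF p h]
    by (intro exI[of _ n] exI[of _ "\<lambda>m x. i m (w x)"] exI[of _ "\<lambda>m x. h (p m x)"]) auto
qed

text \<open>Each case has its own reason: generation of \<open>T\<close> comes from
  \<open>Ext(T, T) = 0\<close>, generation of \<open>C\<close> from its injective dimension and the
  dominant dimension, cogeneration of \<open>T\<close> from its projective dimension together with
  generation of \<open>C\<close>, and cogeneration of \<open>C\<close> from
  \<open>Ext(C, C) = 0\<close>.\<close>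

theorem special_generated_cogenerated:
  assumes P: "fg_module A P" "projective A P" "injective A P"
    and T: "special_tilting A k P T" and C: "special_cotilting K A k P C"
    and k: "0 < k" "enat k < domdim A"
  shows "generated_by A P T" "cogenerated_by K A P T" "generated_by A P C" "cogenerated_by K A P C"
proof -
  obtain k' where k': "k = Suc k'" using k(1) by (cases k) auto
  note Pm = fg_left_module[OF P(1)]
  obtain t d h where t: "tilting_sequence A k T t d h" "\<And>n. n < k \<Longrightarrow> in_add A (t n) P"
    using T by (auto simp: special_tilting_def)
  obtain c e g where c: "cotilting_sequence K A k C c e g" "\<And>n. n < k \<Longrightarrow> in_add A (c n) P"
    using C by (auto simp: special_cotilting_def)
  have kT: "k_tilting A k T" and kC: "k_cotilting K A k C"
    using T C by (auto simp: special_tilting_def special_cotilting_def)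
  have Tfg: "fg_module A T" and pd: "pdim_le A T k" using kT by (auto simp: k_tilting_def)
  have Cfg: "fg_module A C" and id: "idim_le A C k" and Cext: "\<And>i. ext_Suc_vanishes A i C C"
    using kC by (auto simp: k_cotilting_def)
  note Tm = fg_left_module[OF Tfg] and Cm = fg_left_module[OF Cfg]
  have tr: "right_resolution A (regular A) t d h" using t(1) by (simp add: tilting_sequence_def)
  have cr: "left_resolution A (dual_regular K A) c e g" and cadd: "in_add A (c k) C" and ct: "\<And>n. n > k \<Longrightarrow> trivial_module (c n)"
    using c(1) by (auto simp: cotilting_sequence_def)
  note tfg = right_resolutionD(1)[OF tr] and th = right_resolutionD(3)[OF tr]
  note cfg = left_resolutionD(1)[OF cr] and cg = left_resolutionD(3)[OF cr]
  note tm = fg_left_module[OF tfg] and cm = fg_left_module[OF cfg]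
  have tf: "factors A (t n) P" if "n < k" for n by (rule factors_of_in_add[OF tm Pm t(2)[OF that]])
  have cf: "factors A (c n) P" if "n < k" for n by (rule factors_of_in_add[OF cm Pm c(2)[OF that]])
  have tp: "projective A (t n)" if "n < k" for n by (rule projective_factors[OF tm Pm P(2) tf[OF that]])
  have ti: "injective A (t n)" if "n < k" for n by (rule injective_factors[OF tm Pm P(3) tf[OF that]])
  have ci: "injective A (c n)" if "n < k" for n by (rule injective_factors[OF cm Pm P(3) cf[OF that]])
  have h1: "h \<one>\<^bsub>A\<^esub> \<in> carrier (t 0)" using lin_closed[OF th, of "\<one>\<^bsub>A\<^esub>"] by simp
  have rm: "left_module A (regular A)" by (rule left_module_regular[OF A_ring])
  have Tsur: "\<exists>w. lin A (t 0) T w \<and> w (h \<one>\<^bsub>A\<^esub>) = y" if "y \<in> carrier T" for y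
    by (rule tilting_generated_by_first_term[OF kT[unfolded k'] t(1)[unfolded k'] _ that]) (use tp k' in auto)
  show "generated_by A P T" by (rule generated_by_of_term[OF Tm Pm tm tf[OF k(1)] h1 Tsur])
  \<comment> \<open>Because of \<open>k < k2\<close> the terms \<open>I n\<close> with
    \<open>n \<le> k\<close> are projective, so \<open>C\<close> is reached from \<open>I 0\<close>.
    Injectivity of \<open>I 0\<close> gives a map from \<open>t 0\<close> compatible with the
    embeddings of \<open>A\<close>, and it carries the result over to \<open>t 0\<close>.\<close>
  have Csur: "\<exists>w. lin A (t 0) C w \<and> w (h \<one>\<^bsub>A\<^esub>) = y" if y: "y \<in> carrier C" for y
  proof -
    obtain k2 where k2: "k < k2" "domdim_ge A k2" using k(2) by (auto simp: domdim_def less_Sup_iff)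
    then obtain I dI hI where I: "injective_resolution A (regular A) I dI hI" "\<And>n. n < k2 \<Longrightarrow> projective A (I n)"
      by (auto simp: domdim_ge_def)
    obtain w where w: "lin A (I 0) C w" "w (hI \<one>\<^bsub>A\<^esub>) = y"
      using generated_by_first_term[OF Cfg id I(1) _ y] I(2) k2(1) by auto
    have Ir: "right_resolution A (regular A) I dI hI" "injective A (I 0)" using I(1) by (auto simp: injective_resolution_def)
    note Im = fg_left_module[OF right_resolutionD(1)[OF Ir(1)]]
    have "\<exists>q. lin A (t 0) (I 0) q \<and> (\<forall>x\<in>carrier (regular A). q (h x) = hI x)"
    proof (rule inj_ext[OF Ir(2) Im fg_regular tfg th right_resolutionD(3)[OF Ir(1)]])
      fix x assume x: "x \<in> carrier (regular A)" "h x = \<zero>\<^bsub>t 0\<^esub>"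
      then have "x = \<zero>\<^bsub>regular A\<^esub>"
        using right_resolutionD(4)[OF tr] lin_zero[OF rm tm th] left_module.M_group[OF rm] by (metis abelian_groupE(2) inj_on_eq_iff)
      then show "hI x = \<zero>\<^bsub>I 0\<^esub>" using lin_zero[OF rm Im right_resolutionD(3)[OF Ir(1)]] by simp
    qed
    then obtain q where q: "lin A (t 0) (I 0) q" "\<forall>x\<in>carrier (regular A). q (h x) = hI x" by blast
    have "w (q (h \<one>\<^bsub>A\<^esub>)) = y" using q(2) w(2) by simp
    then show ?thesis using lin_comp[OF q(1) w(1)] by blast
  qed
  show "generated_by A P C" by (rule generated_by_of_term[OF Cm Pm tm tf[OF k(1)] h1 Csur])
  have cfac: "factors A (c k) C" by (rule factors_of_in_add[OF cm Cm cadd])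
  obtain n i p where i: "\<And>m. m < n \<Longrightarrow> lin A (c k) C (i m)" and p: "\<And>m. m < n \<Longrightarrow> lin A C (c k) (p m)"
    and ip: "\<And>x. x \<in> carrier (c k) \<Longrightarrow> (\<Oplus>\<^bsub>c k\<^esub>m\<in>{..<n::nat}. p m (i m x)) = x" by (rule factorsE[OF cfac]) (rule that)
  interpret ck: left_module A "c k" by (rule cm)
  \<comment> \<open>\<open>c k\<close> lies in \<open>add C\<close>: the maps found for the
    components \<open>i m y\<close> are composed with \<open>p m\<close> and added.\<close>
  have cksur: "\<exists>w. lin A (t 0) (c k) w \<and> w (h \<one>\<^bsub>A\<^esub>) = y" if y: "y \<in> carrier (c k)" for y
  proof -
    have "\<exists>w. lin A (t 0) C w \<and> w (h \<one>\<^bsub>A\<^esub>) = i m y" if "m < n" for m using Csur[OF lin_closed[OF i[OF that] y]] .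
    then obtain w where w: "\<And>m. m < n \<Longrightarrow> lin A (t 0) C (w m)" "\<And>m. m < n \<Longrightarrow> w m (h \<one>\<^bsub>A\<^esub>) = i m y" by metis
    have l: "lin A (t 0) (c k) (\<lambda>x. \<Oplus>\<^bsub>c k\<^esub>m\<in>{..<n}. p m (w m x))"
      by (rule ck.lin_finsum[OF tm]) (use lin_comp[OF w(1) p] in auto)
    have "(\<Oplus>\<^bsub>c k\<^esub>m\<in>{..<n}. p m (w m (h \<one>\<^bsub>A\<^esub>))) = (\<Oplus>\<^bsub>c k\<^esub>m\<in>{..<n}. p m (i m y))"
      using w(2) lin_closed[OF p lin_closed[OF i y]] by (intro ck.M.finsum_cong') auto
    then show ?thesis using l ip[OF y] by (intro exI[of _ "\<lambda>x. \<Oplus>\<^bsub>c k\<^esub>m\<in>{..<n}. p m (w m x)"]) simp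
  qed
  have D: "fg_module A (dual_regular K A)" by (rule fg_dual_regular)
  have ct2: "trivial_module (c (Suc (Suc k')))" using ct k' by simp
  have ci2: "injective A (c n)" if "n \<le> k'" for n using ci k' that by simp
  show "cogenerated_by K A P T"
  proof (rule cogenerated_by_of_term[OF Tm Pm cm cf[OF k(1)] cg])
    fix f assume f: "lin A T (dual_regular K A) f"
    obtain Q dQ hQ where Q: "projective_resolution A T Q dQ hQ" "\<And>n. n > k \<Longrightarrow> trivial_module (Q n)"
      using pd by (auto simp: pdim_le_def)
    have Qr: "left_resolution A T Q dQ hQ" and Qp: "\<And>n. projective A (Q n)"
      using Q by (auto simp: projective_resolution_def)
    note Qfg = left_resolutionD(1)[OF Qr] and Ql = left_resolutionD(2)[OF Qr]
    note Qm = fg_left_module[OF Qfg]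
    show "\<exists>w. lin A T (c 0) w \<and> (\<forall>x\<in>carrier T. g (w x) = f x)"
    proof (rule lift_through_resolution[OF Tfg D Q(1) cr ci2 ct2 _ f])
      fix u assume u: "lin A (Q (Suc k')) (c (Suc k')) u"
      \<comment> \<open>\<open>F\<close> covers \<open>c k\<close> and lies in
        \<open>add (t 0)\<close>, hence is injective. A map from \<open>Q k\<close> to
        \<open>c k\<close> lifts to \<open>F\<close> and then extends along the differential into
        \<open>Q k'\<close>, which is injective because \<open>Q\<close> vanishes beyond
        \<open>k\<close>. The module \<open>c k\<close> itself need not be injective.\<close>
      obtain F :: "('k, 'a) umodule" and q where F: "fg_module A F" "factors A F (t 0)" "lin A F (c k) q" "q ` carrier F = carrier (c k)"
        by (rule cover[OF cfg tfg h1 cksur]) (assumption | rule that)+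
      note Fm = fg_left_module[OF F(1)]
      have Fi: "injective A F" by (rule injective_factors[OF Fm tm ti[OF k(1)] F(2)])
      have "\<exists>u'. lin A (Q (Suc k')) F u' \<and> (\<forall>x\<in>carrier (Q (Suc k')). q (u' x) = u x)"
        by (rule proj_lift[OF Qp Qm F(1) cfg F(3)[unfolded k'] u]) (use F(4) lin_closed[OF u] k' in auto)
      then obtain u' where u': "lin A (Q (Suc k')) F u'" "\<forall>x\<in>carrier (Q (Suc k')). q (u' x) = u x" by blast
      have "\<exists>v. lin A (Q k') F v \<and> (\<forall>x\<in>carrier (Q (Suc k')). v (dQ k' x) = u' x)"
      proof (rule inj_ext[OF Fi Fm Qfg Qfg Ql u'(1)])
        fix x assume "x \<in> carrier (Q (Suc k'))" "dQ k' x = \<zero>\<^bsub>Q k'\<^esub>"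
        then have "x \<in> dQ (Suc k') ` carrier (Q (Suc (Suc k')))" using left_resolutionD(6)[OF Qr, of k'] by simp
        then have "x = dQ (Suc k') \<zero>\<^bsub>Q (Suc (Suc k'))\<^esub>" using Q(2)[of "Suc (Suc k')"] k' by (simp add: trivial_module_def)
        then show "u' x = \<zero>\<^bsub>F\<^esub>" using lin_zero[OF Qm Qm Ql] lin_zero[OF Qm Fm u'(1)] by simp
      qed
      then obtain v where v: "lin A (Q k') F v" "\<forall>x\<in>carrier (Q (Suc k')). v (dQ k' x) = u' x" by blast
      show "\<exists>v. lin A (Q k') (c (Suc k')) v \<and> (\<forall>x\<in>carrier (Q (Suc k')). v (dQ k' x) = u x)"
        using lin_comp[OF v(1) F(3)[unfolded k']] v(2) u'(2) by auto
    qed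
  qed
  show "cogenerated_by K A P C"
  proof (rule cogenerated_by_of_term[OF Cm Pm cm cf[OF k(1)] cg])
    fix f assume f: "lin A C (dual_regular K A) f"
    obtain Q dQ hQ where Q: "projective_resolution A C Q dQ hQ" by (rule projective_resolution_exists[OF Cfg])
    have Qr: "left_resolution A C Q dQ hQ" using Q by (auto simp: projective_resolution_def)
    note Qfg = left_resolutionD(1)[OF Qr] and Ql = left_resolutionD(2)[OF Qr]
    note Qm = fg_left_module[OF Qfg]
    show "\<exists>w. lin A C (c 0) w \<and> (\<forall>x\<in>carrier C. g (w x) = f x)"
    proof (rule lift_through_resolution[OF Cfg D Q cr ci2 ct2 _ f])
      fix u assume u: "lin A (Q (Suc k')) (c (Suc k')) u"
        and u0: "\<And>x. x \<in> carrier (Q (Suc (Suc k'))) \<Longrightarrow> u (dQ (Suc k') x) = \<zero>\<^bsub>c (Suc k')\<^esub>"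
      have uk: "lin A (Q (Suc k')) (c k) u" using u k' by simp
      \<comment> \<open>Here \<open>Ext\<close> in degree \<open>k = Suc k'\<close> is used: the
        components of the cocycle \<open>u\<close> with respect to \<open>c k \<in> add C\<close>
        have values in \<open>C\<close> and are therefore coboundaries.\<close>
      have "\<exists>v. lin A (Q k') C v \<and> (\<forall>x\<in>carrier (Q (Suc k')). v (dQ k' x) = i m (u x))" if m: "m < n" for m
      proof -
        let ?u = "restrict (\<lambda>x. i m (u x)) (carrier (Q (Suc k')))"
        have u': "?u \<in> mod_hom A (Q (Suc k')) C"
          by (rule left_module.restrict_mod_hom[OF Qm lin_comp[OF uk i[OF m]]])
        moreover have "?u (dQ (Suc k') x) = \<zero>\<^bsub>C\<^esub>" if x: "x \<in> carrier (Q (Suc (Suc k')))" for x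
          using u0[OF x] lin_closed[OF Ql x] lin_zero[OF cm Cm i[OF m]] k' by simp
        ultimately have "?u \<in> {compose (carrier (Q (Suc k'))) g (dQ k') | g. g \<in> mod_hom A (Q k') C}"
          using Cext[of k'] Q unfolding ext_Suc_vanishes_def by blast
        then obtain v where v: "v \<in> mod_hom A (Q k') C" "?u = compose (carrier (Q (Suc k'))) v (dQ k')" by blast
        have "v (dQ k' x) = i m (u x)" if "x \<in> carrier (Q (Suc k'))" for x
          using fun_cong[OF v(2), of x] that by (simp add: compose_def)
        then show ?thesis using v(1) lin_of_mod_hom by blast
      qed
      then obtain v where v: "\<And>m. m < n \<Longrightarrow> lin A (Q k') C (v m)"
        "\<And>m x. m < n \<Longrightarrow> x\<in>carrier (Q (Suc k')) \<Longrightarrow> v m (dQ k' x) = i m (u x)" by metis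
      have l: "lin A (Q k') (c k) (\<lambda>x. \<Oplus>\<^bsub>c k\<^esub>m\<in>{..<n}. p m (v m x))"
        by (rule ck.lin_finsum[OF Qm]) (use lin_comp[OF v(1) p] in auto)
      have "(\<Oplus>\<^bsub>c k\<^esub>m\<in>{..<n}. p m (v m (dQ k' x))) = u x" if x: "x \<in> carrier (Q (Suc k'))" for x
      proof -
        note ux = lin_closed[OF uk x]
        have "(\<Oplus>\<^bsub>c k\<^esub>m\<in>{..<n}. p m (v m (dQ k' x))) = (\<Oplus>\<^bsub>c k\<^esub>m\<in>{..<n}. p m (i m (u x)))"
          using v(2)[OF _ x] lin_closed[OF p lin_closed[OF i ux]] by (intro ck.M.finsum_cong') auto
        then show ?thesis using ip[OF ux] by simp
      qed
      then show "\<exists>v. lin A (Q k') (c (Suc k')) v \<and> (\<forall>x\<in>carrier (Q (Suc k')). v (dQ k' x) = u x)"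
        using l k' by auto
    qed
  qed
qed

end

section \<open>Intermediate extensions\<close>

lemma end_op_simps [simp]:
  "carrier (end_op A M) = mod_hom A M M" "f \<otimes>\<^bsub>end_op A M\<^esub> g = compose (carrier M) g f"
  "\<one>\<^bsub>end_op A M\<^esub> = (\<lambda>m \<in> carrier M. m)" "\<zero>\<^bsub>end_op A M\<^esub> = (\<lambda>m \<in> carrier M. \<zero>\<^bsub>M\<^esub>)"
  "f \<oplus>\<^bsub>end_op A M\<^esub> g = (\<lambda>m \<in> carrier M. f m \<oplus>\<^bsub>M\<^esub> g m)"
  "c \<odot>\<^bsub>end_op A M\<^esub> f = (\<lambda>m \<in> carrier M. (c \<odot>\<^bsub>A\<^esub> \<one>\<^bsub>A\<^esub>) \<odot>\<^bsub>M\<^esub> f m)"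
  by (simp_all add: end_op_def)

lemma eval_module_simps [simp]:
  "carrier (eval_module M) = carrier M" "\<zero>\<^bsub>eval_module M\<^esub> = \<zero>\<^bsub>M\<^esub>" "x \<oplus>\<^bsub>eval_module M\<^esub> y = x \<oplus>\<^bsub>M\<^esub> y"
  "f \<odot>\<^bsub>eval_module M\<^esub> x = f x"
  by (simp_all add: eval_module_def)

text \<open>Scalars act on \<open>M\<close> in the same way through \<open>end_op A M\<close> and
  through \<open>A\<close>, so both structures have the same \<open>K\<close>-linear
  functionals.\<close>

lemma dual_over_end_simps:
  "carrier (dual_over_end K A M) = mod_hom K (underlying_space A M) (regular K)"
  "\<zero>\<^bsub>dual_over_end K A M\<^esub> = (\<lambda>m \<in> carrier M. \<zero>\<^bsub>K\<^esub>)"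
  "f \<oplus>\<^bsub>dual_over_end K A M\<^esub> g = (\<lambda>m \<in> carrier M. f m \<oplus>\<^bsub>K\<^esub> g m)"
  "a \<odot>\<^bsub>dual_over_end K A M\<^esub> f = (\<lambda>m \<in> carrier M. f (a m))"
proof -
  have "lin K (underlying_space (op_alg (end_op A M)) (eval_module M)) (regular K) f =
      lin K (underlying_space A M) (regular K) f" for f
    by (auto simp: lin_def)
  then show "carrier (dual_over_end K A M) = mod_hom K (underlying_space A M) (regular K)"
    by (auto simp: dual_over_end_def dual_def mod_hom_iff)
qed (simp_all add: dual_over_end_def dual_def)

lemma restrict_scalars_simps [simp]:
  "carrier (restrict_scalars h M) = carrier M" "\<zero>\<^bsub>restrict_scalars h M\<^esub> = \<zero>\<^bsub>M\<^esub>"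
  "x \<oplus>\<^bsub>restrict_scalars h M\<^esub> y = x \<oplus>\<^bsub>M\<^esub> y" "a \<odot>\<^bsub>restrict_scalars h M\<^esub> x = h a \<odot>\<^bsub>M\<^esub> x"
  by (simp_all add: restrict_scalars_def)

text \<open>One setting serves the tilting and the cotilting module, both under the name
  \<open>T\<close>. The map \<theta> is the identification of \<open>E\<close> with
  \<open>DP\<close>; generation and cogeneration by \<open>P\<close> are hypotheses of the
  statements that use them.\<close>

locale corner_setup = G: fd_algebra K \<Gamma> + P: left_module \<Gamma> P + T: left_module \<Gamma> T + E: left_module A E
  for K :: "'k ring" and \<Gamma> :: "('k, 'g) module" and P :: "('g, 'p) module" and T :: "('g, 't) module"
    and A :: "('k, 'a) module" and E :: "('a, 'e) module" +
  fixes i :: "'p \<Rightarrow> 't" and p :: "'t \<Rightarrow> 'p" and \<phi> :: "('p \<Rightarrow> 'p) \<Rightarrow> 'a" and \<theta> :: "'e \<Rightarrow> 'p \<Rightarrow> 'k"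
  assumes split: "splitting \<Gamma> P T i p"
    and phi: "\<And>b. b \<in> mod_hom \<Gamma> P P \<Longrightarrow> \<phi> b \<in> carrier A"
    and theta: "\<theta> \<in> mod_hom (end_op \<Gamma> P) (restrict_scalars \<phi> E) (dual_over_end K \<Gamma> P)"
      "bij_betw \<theta> (carrier E) (mod_hom K (underlying_space \<Gamma> P) (regular K))"
begin

abbreviation "B \<equiv> end_op \<Gamma> T"
abbreviation "e \<equiv> projection_idempotent T i p"
abbreviation "M \<equiv> as_corner_module P i p \<phi> E"
abbreviation "DP \<equiv> mod_hom K (underlying_space \<Gamma> P) (regular K)"
abbreviation "DT \<equiv> mod_hom K (underlying_space \<Gamma> T) (regular K)"
abbreviation "eB \<equiv> right_ideal_of B e"
abbreviation "Be \<equiv> left_ideal_of B e"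
abbreviation "XR \<equiv> ext_r B e M"

text \<open>
  With \<open>E = DP\<close> along \<open>\<theta>\<close>, a functional \<open>f\<close> on \<open>T\<close> gives \<open>Psi f = (y \<mapsto> f \<circ> y \<circ> i) \<in> Hom(eB, E)\<close>, and
  \<open>\<zeta>(x \<otimes> m)\<close> is \<open>Psi\<close> of the functional \<open>tens (x, m) = m \<circ> p \<circ> x\<close>. Thus \<open>\<zeta>\<close> has its image in that of \<open>Psi\<close>;
  cogeneration of \<open>T\<close> by \<open>P\<close> makes it all of it, and generation by \<open>P\<close> makes \<open>Psi\<close> injective.
\<close>

definition kap :: "('t \<Rightarrow> 't) \<Rightarrow> 'p \<Rightarrow> 'p" where "kap b = compose (carrier P) p (compose (carrier P) b i)"
definition eta :: "('p \<Rightarrow> 'k) \<Rightarrow> 'e" where "eta = inv_into (carrier E) \<theta>"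
definition res :: "('t \<Rightarrow> 'k) \<Rightarrow> ('t \<Rightarrow> 't) \<Rightarrow> 'p \<Rightarrow> 'k" where "res f y = (\<lambda>x \<in> carrier P. f (y (i x)))"
definition Psi :: "('t \<Rightarrow> 'k) \<Rightarrow> ('t \<Rightarrow> 't) \<Rightarrow> 'e" where "Psi f = (\<lambda>y \<in> eB. eta (res f y))"

lemma il: "lin \<Gamma> P T i" and pl: "lin \<Gamma> T P p" and pi: "x \<in> carrier P \<Longrightarrow> p (i x) = x"
  using split by (auto simp: splitting_def lin_of_mod_hom)

lemma ic: "x \<in> carrier P \<Longrightarrow> i x \<in> carrier T"
  by (rule lin_closed[OF il])

lemma pc: "t \<in> carrier T \<Longrightarrow> p t \<in> carrier P"
  by (rule lin_closed[OF pl])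

lemma e_simp: "t \<in> carrier T \<Longrightarrow> e t = i (p t)"
  by (simp add: projection_idempotent_def compose_def)

lemma endc: "b \<in> mod_hom \<Gamma> T T \<Longrightarrow> t \<in> carrier T \<Longrightarrow> b t \<in> carrier T"
  by (auto simp: mod_hom_def)

lemma e_hom: "e \<in> mod_hom \<Gamma> T T"
  unfolding projection_idempotent_def compose_def by (rule T.restrict_mod_hom[OF lin_comp[OF pl il]])

lemma comp_hom: "b \<in> mod_hom \<Gamma> T T \<Longrightarrow> c \<in> mod_hom \<Gamma> T T \<Longrightarrow> compose (carrier T) b c \<in> mod_hom \<Gamma> T T"
  unfolding compose_def by (rule T.restrict_mod_hom[OF lin_comp[OF lin_of_mod_hom lin_of_mod_hom]])

text \<open>The product of \<open>end_op\<close> is composition in reverse order, so elements of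
  \<open>eB\<close> are the endomorphisms of \<open>T\<close> unchanged by precomposition with
  \<open>i \<circ> p\<close>.\<close>

lemma eB_iff: "y \<in> eB \<longleftrightarrow> y \<in> mod_hom \<Gamma> T T \<and> (\<forall>t\<in>carrier T. y (i (p t)) = y t)"
proof
  assume "y \<in> eB"
  then obtain b where b: "b \<in> mod_hom \<Gamma> T T" "y = compose (carrier T) b e" by (auto simp: right_ideal_of_def)
  then show "y \<in> mod_hom \<Gamma> T T \<and> (\<forall>t\<in>carrier T. y (i (p t)) = y t)"
    using comp_hom[OF b(1) e_hom] by (auto simp: compose_def e_simp ic pc pi)
next
  assume y: "y \<in> mod_hom \<Gamma> T T \<and> (\<forall>t\<in>carrier T. y (i (p t)) = y t)"
  have "y = compose (carrier T) y e"
    by (rule mod_hom_ext[OF conjunct1[OF y] comp_hom[OF conjunct1[OF y] e_hom]]) (use y in \<open>simp add: compose_def e_simp\<close>)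
  then show "y \<in> eB" using y by (auto simp: right_ideal_of_def)
qed

text \<open>By the same reversal, elements of \<open>Be\<close> are the endomorphisms with values in
  the image of \<open>P\<close>.\<close>

lemma Be_iff: "x \<in> Be \<longleftrightarrow> x \<in> mod_hom \<Gamma> T T \<and> (\<forall>t\<in>carrier T. i (p (x t)) = x t)"
proof
  assume "x \<in> Be"
  then obtain b where b: "b \<in> mod_hom \<Gamma> T T" "x = compose (carrier T) e b" by (auto simp: left_ideal_of_def)
  then show "x \<in> mod_hom \<Gamma> T T \<and> (\<forall>t\<in>carrier T. i (p (x t)) = x t)"
    using comp_hom[OF e_hom b(1)] endc[OF b(1)] by (auto simp: compose_def e_simp ic pc pi)
next
  assume y: "x \<in> mod_hom \<Gamma> T T \<and> (\<forall>t\<in>carrier T. i (p (x t)) = x t)"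
  have "x = compose (carrier T) e x"
    by (rule mod_hom_ext[OF conjunct1[OF y] comp_hom[OF e_hom conjunct1[OF y]]])
      (use y endc in \<open>simp add: compose_def e_simp\<close>)
  then show "x \<in> Be" using y by (auto simp: left_ideal_of_def)
qed

lemma corner_hom: "c \<in> carrier (corner B e) \<Longrightarrow> c \<in> mod_hom \<Gamma> T T"
  by (auto simp: corner_def intro!: comp_hom e_hom)

lemma kap_simp: "r \<in> carrier P \<Longrightarrow> kap b r = p (b (i r))"
  by (simp add: kap_def compose_def)

lemma kap_hom: "b \<in> mod_hom \<Gamma> T T \<Longrightarrow> kap b \<in> mod_hom \<Gamma> P P"
proof -
  assume b: "b \<in> mod_hom \<Gamma> T T"
  have "kap b = (\<lambda>x \<in> carrier P. p (b (i x)))" by (auto simp: kap_def compose_def)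
  then show ?thesis using P.restrict_mod_hom[OF lin_comp[OF lin_comp[OF il lin_of_mod_hom[OF b]] pl]] by simp
qed

lemma M_simps: "carrier M = carrier E" "x \<oplus>\<^bsub>M\<^esub> y = x \<oplus>\<^bsub>E\<^esub> y" "\<zero>\<^bsub>M\<^esub> = \<zero>\<^bsub>E\<^esub>" "b \<odot>\<^bsub>M\<^esub> x = \<phi> (kap b) \<odot>\<^bsub>E\<^esub> x"
  by (simp_all add: as_corner_module_def kap_def)

lemma theta_closed: "x \<in> carrier E \<Longrightarrow> \<theta> x \<in> DP"
  using theta(2) by (auto simp: bij_betw_def)

lemma theta_add: "x \<in> carrier E \<Longrightarrow> y \<in> carrier E \<Longrightarrow> \<theta> (x \<oplus>\<^bsub>E\<^esub> y) = (\<lambda>r \<in> carrier P. \<theta> x r \<oplus>\<^bsub>K\<^esub> \<theta> y r)"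
  using lin_add[OF lin_of_mod_hom[OF theta(1)], of x y] by (simp add: dual_over_end_simps)

lemma theta_smult: "x \<in> carrier E \<Longrightarrow> b \<in> mod_hom \<Gamma> P P \<Longrightarrow> \<theta> (\<phi> b \<odot>\<^bsub>E\<^esub> x) = (\<lambda>r \<in> carrier P. \<theta> x (b r))"
  using lin_smult[OF lin_of_mod_hom[OF theta(1)], of b x] by (simp add: dual_over_end_simps)

lemma eta_theta: "x \<in> carrier E \<Longrightarrow> eta (\<theta> x) = x"
  using theta(2) by (simp add: bij_betw_def eta_def)

lemma theta_eta: "f \<in> DP \<Longrightarrow> \<theta> (eta f) = f" and eta_closed: "f \<in> DP \<Longrightarrow> eta f \<in> carrier E"
  using theta(2) by (auto simp: bij_betw_def eta_def f_inv_into_f inv_into_into)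

lemma eta_add: "f \<in> DP \<Longrightarrow> g \<in> DP \<Longrightarrow> eta (\<lambda>r \<in> carrier P. f r \<oplus>\<^bsub>K\<^esub> g r) = eta f \<oplus>\<^bsub>E\<^esub> eta g"
  using eta_theta[of "eta f \<oplus>\<^bsub>E\<^esub> eta g"] by (simp add: theta_add eta_closed theta_eta)

lemma eta_smult: "f \<in> DP \<Longrightarrow> b \<in> mod_hom \<Gamma> P P \<Longrightarrow> eta (\<lambda>r \<in> carrier P. f (b r)) = \<phi> b \<odot>\<^bsub>E\<^esub> eta f"
  using eta_theta[of "\<phi> b \<odot>\<^bsub>E\<^esub> eta f"] by (simp add: theta_smult eta_closed theta_eta E.smult_closed phi)

lemma DT_lin: "f \<in> DT \<Longrightarrow> lin K (underlying_space \<Gamma> T) (regular K) f"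
  by (rule lin_of_mod_hom)

lemma res_closed:
  assumes "f \<in> DT" "y \<in> mod_hom \<Gamma> T T"
  shows "res f y \<in> DP"
  using left_module.restrict_mod_hom[OF G.left_module_US[OF P.left_module_axioms]
      lin_comp[OF G.lin_US[OF lin_comp[OF il lin_of_mod_hom[OF assms(2)]]] DT_lin[OF assms(1)]]]
  by (simp add: res_def)

lemma eB_add: "y \<in> eB \<Longrightarrow> y' \<in> eB \<Longrightarrow> (\<lambda>t \<in> carrier T. y t \<oplus>\<^bsub>T\<^esub> y' t) \<in> eB"
proof -
  assume y: "y \<in> eB" "y' \<in> eB"
  then have h: "y \<in> mod_hom \<Gamma> T T" "y' \<in> mod_hom \<Gamma> T T" by (auto simp: eB_iff)
  show ?thesis
    using T.restrict_mod_hom[OF T.lin_plus[OF lin_of_mod_hom[OF h(1)] lin_of_mod_hom[OF h(2)]]] y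
    by (auto simp: eB_iff ic pc)
qed

lemma eB_comp: "y \<in> eB \<Longrightarrow> b \<in> mod_hom \<Gamma> T T \<Longrightarrow> compose (carrier T) b y \<in> eB"
  using comp_hom[of b y] by (auto simp: eB_iff compose_def ic pc)

lemma eB_corner: "y \<in> eB \<Longrightarrow> c \<in> carrier (corner B e) \<Longrightarrow> compose (carrier T) y c \<in> eB"
proof -
  assume y: "y \<in> eB" and c: "c \<in> carrier (corner B e)"
  obtain b where b: "b \<in> mod_hom \<Gamma> T T" "c = compose (carrier T) e (compose (carrier T) b e)"
    using c by (auto simp: corner_def)
  show "compose (carrier T) y c \<in> eB"
    using comp_hom[OF _ corner_hom[OF c], of y] y b endc[OF b(1)]
    by (auto simp: eB_iff compose_def ic pc e_simp pi)
qed

lemma Psi_closed: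
  assumes f: "f \<in> DT"
  shows "Psi f \<in> carrier XR"
proof -
  have fl: "f (a \<oplus>\<^bsub>T\<^esub> b) = f a \<oplus>\<^bsub>K\<^esub> f b" if "a \<in> carrier T" "b \<in> carrier T" for a b
    using lin_add[OF DT_lin[OF f], of a b] that by simp
  have hom: "y \<in> mod_hom \<Gamma> T T" if "y \<in> eB" for y using that by (simp add: eB_iff)
  have "Psi f \<in> mod_hom (corner B e) (eB_left B e) M"
    unfolding mod_hom_def
  proof (intro CollectI conjI ballI PiE_I)
    fix y assume "y \<in> carrier (eB_left B e)"
    then have y: "y \<in> eB" by (simp add: eB_left_def)
    show "Psi f y \<in> carrier M" using y eta_closed[OF res_closed[OF f hom[OF y]]] by (simp add: Psi_def M_simps)
    fix y' assume "y' \<in> carrier (eB_left B e)"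
    then have y': "y' \<in> eB" by (simp add: eB_left_def)
    have "res f (\<lambda>t \<in> carrier T. y t \<oplus>\<^bsub>T\<^esub> y' t) = (\<lambda>r \<in> carrier P. res f y r \<oplus>\<^bsub>K\<^esub> res f y' r)"
      using endc[OF hom[OF y]] endc[OF hom[OF y']] by (auto simp: res_def ic fl)
    then show "Psi f (y \<oplus>\<^bsub>eB_left B e\<^esub> y') = Psi f y \<oplus>\<^bsub>M\<^esub> Psi f y'"
      using y y' eB_add[OF y y'] eta_add[OF res_closed[OF f hom[OF y]] res_closed[OF f hom[OF y']]]
      by (simp add: Psi_def M_simps eB_left_def)
  next
    fix c y assume c: "c \<in> carrier (corner B e)" and "y \<in> carrier (eB_left B e)"
    then have y: "y \<in> eB" by (simp add: eB_left_def)
    note ch = corner_hom[OF c]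
    \<comment> \<open>Since \<open>y\<close> is unchanged by precomposition with
      \<open>i \<circ> p\<close>, acting by \<open>c\<close> on \<open>y\<close> amounts to acting
      by \<open>kap c\<close> on \<open>P\<close>.\<close>
    have "res f (compose (carrier T) y c) = (\<lambda>r \<in> carrier P. res f y (kap c r))"
      using y endc[OF ch] pc by (auto simp: res_def compose_def ic kap_simp eB_iff)
    then show "Psi f (c \<odot>\<^bsub>eB_left B e\<^esub> y) = c \<odot>\<^bsub>M\<^esub> Psi f y"
      using y eB_corner[OF y c] eta_smult[OF res_closed[OF f hom[OF y]] kap_hom[OF ch]]
      by (simp add: Psi_def M_simps eB_left_def)
  next
    fix y assume "y \<notin> carrier (eB_left B e)"
    then show "Psi f y = undefined" by (simp add: Psi_def eB_left_def)
  qed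
  then show ?thesis by (simp add: ext_r_def)
qed

lemma Psi_add: "f \<in> DT \<Longrightarrow> g \<in> DT \<Longrightarrow> Psi (\<lambda>t \<in> carrier T. f t \<oplus>\<^bsub>K\<^esub> g t) = Psi f \<oplus>\<^bsub>XR\<^esub> Psi g"
proof -
  assume f: "f \<in> DT" and g: "g \<in> DT"
  have "eta (res (\<lambda>t \<in> carrier T. f t \<oplus>\<^bsub>K\<^esub> g t) y) = eta (res f y) \<oplus>\<^bsub>E\<^esub> eta (res g y)" if y: "y \<in> eB" for y
  proof -
    have yh: "y \<in> mod_hom \<Gamma> T T" using y by (simp add: eB_iff)
    have "res (\<lambda>t \<in> carrier T. f t \<oplus>\<^bsub>K\<^esub> g t) y = (\<lambda>r \<in> carrier P. res f y r \<oplus>\<^bsub>K\<^esub> res g y r)"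
      using endc[OF yh] by (auto simp: res_def ic)
    then show ?thesis using eta_add[OF res_closed[OF f yh] res_closed[OF g yh]] by simp
  qed
  then show ?thesis by (auto simp: Psi_def ext_r_def M_simps intro!: restrict_ext)
qed

lemma Psi_smult: "f \<in> DT \<Longrightarrow> b \<in> mod_hom \<Gamma> T T \<Longrightarrow> Psi (\<lambda>t \<in> carrier T. f (b t)) = b \<odot>\<^bsub>XR\<^esub> Psi f"
proof -
  assume f: "f \<in> DT" and b: "b \<in> mod_hom \<Gamma> T T"
  have "res (\<lambda>t \<in> carrier T. f (b t)) y = res f (compose (carrier T) b y)" if y: "y \<in> eB" for y
    using that endc[of y] by (auto simp: res_def compose_def eB_iff ic)
  then show ?thesis using eB_comp[OF _ b] by (auto simp: Psi_def ext_r_def intro!: restrict_ext)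
qed

lemma XR_simps: "f \<oplus>\<^bsub>XR\<^esub> g = (\<lambda>y \<in> eB. f y \<oplus>\<^bsub>E\<^esub> g y)" "\<zero>\<^bsub>XR\<^esub> = (\<lambda>y \<in> eB. \<zero>\<^bsub>E\<^esub>)"
  by (simp_all add: ext_r_def M_simps)

text \<open>\<open>zeta_free\<close> is a sum in the additive group of \<open>ext_r\<close>. The
  group axioms are checked pointwise on an explicit description of the carrier.\<close>

lemma XR_group: "abelian_group XR"
proof -
  have car: "f \<in> carrier XR \<longleftrightarrow> f \<in> extensional eB \<and> (\<forall>y\<in>eB. f y \<in> carrier E) \<and>
     (\<forall>y\<in>eB. \<forall>y'\<in>eB. f (\<lambda>t \<in> carrier T. y t \<oplus>\<^bsub>T\<^esub> y' t) = f y \<oplus>\<^bsub>E\<^esub> f y') \<and>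
     (\<forall>c\<in>carrier (corner B e). \<forall>y\<in>eB. f (compose (carrier T) y c) = \<phi> (kap c) \<odot>\<^bsub>E\<^esub> f y)" for f
    by (auto simp: ext_r_def mod_hom_def eB_left_def M_simps PiE_iff)
  have ph: "\<phi> (kap c) \<in> carrier A" if "c \<in> carrier (corner B e)" for c
    by (rule phi[OF kap_hom[OF corner_hom[OF that]]])
  show ?thesis
  proof (intro abelian_groupI)
    fix f assume f: "f \<in> carrier XR"
    then have "(\<lambda>y \<in> eB. \<ominus>\<^bsub>E\<^esub> f y) \<in> carrier XR"
      unfolding car using eB_add eB_corner ph by (auto simp: E.smult_r_minus E.M.minus_add E.smult_closed)
    then show "\<exists>g\<in>carrier XR. g \<oplus>\<^bsub>XR\<^esub> f = \<zero>\<^bsub>XR\<^esub>"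
      using f by (intro bexI[of _ "\<lambda>y \<in> eB. \<ominus>\<^bsub>E\<^esub> f y"]) (auto simp: car XR_simps E.M.l_neg cong: restrict_cong)
  qed (simp_all add: car XR_simps eB_add eB_corner ph E.smult_r_null E.smult_r_distr E.M.a_ac extensional_restrict cong: restrict_cong)
qed

section \<open>The map zeta and its image\<close>

definition tens :: "('t \<Rightarrow> 't) \<times> 'e \<Rightarrow> 't \<Rightarrow> 'k" where
  "tens q = (\<lambda>s \<in> carrier T. \<theta> (snd q) (p (fst q s)))"

abbreviation "S \<equiv> Be \<times> carrier E"
abbreviation "F \<equiv> free_Abelian_group S"
abbreviation "zf \<equiv> zeta_free B e M"
abbreviation "XG \<equiv> add_monoid XR"

lemma tens_closed: "q \<in> S \<Longrightarrow> tens q \<in> DT"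
proof -
  assume q: "q \<in> S"
  have "lin \<Gamma> T P (\<lambda>s. p (fst q s))" using q lin_comp[OF lin_of_mod_hom pl] by (auto simp: Be_iff)
  then show ?thesis
    using left_module.restrict_mod_hom[OF G.left_module_US[OF T.left_module_axioms]
        lin_comp[OF G.lin_US lin_of_mod_hom[OF theta_closed]]] q
    by (auto simp: tens_def)
qed

text \<open>Under \<theta> the action of the corner element formed from \<open>y\<close> and
  \<open>x = fst q\<close> becomes precomposition with its \<open>kap\<close>, which is the
  restriction of \<open>tens q\<close> along \<open>y \<circ> i\<close>.\<close>

lemma tens_Psi: "q \<in> S \<Longrightarrow> (\<lambda>y \<in> eB. (y \<otimes>\<^bsub>B\<^esub> fst q) \<odot>\<^bsub>M\<^esub> snd q) = Psi (tens q)"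
  unfolding Psi_def
proof (rule restrict_ext)
  fix y assume q: "q \<in> S" and y: "y \<in> eB"
  have h: "fst q \<in> mod_hom \<Gamma> T T" "y \<in> mod_hom \<Gamma> T T" "snd q \<in> carrier E" using q y by (auto simp: Be_iff eB_iff)
  note c = comp_hom[OF h(1,2)]
  have "res (tens q) y = \<theta> (\<phi> (kap (compose (carrier T) (fst q) y)) \<odot>\<^bsub>E\<^esub> snd q)"
    unfolding theta_smult[OF h(3) kap_hom[OF c]]
    using endc[OF h(2)] by (auto simp: res_def tens_def kap_simp compose_def ic intro!: restrict_ext)
  then show "(y \<otimes>\<^bsub>B\<^esub> fst q) \<odot>\<^bsub>M\<^esub> snd q = eta (res (tens q) y)"
    using h eta_theta E.smult_closed phi kap_hom[OF c] by (simp add: M_simps)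
qed

lemma zf_hom: "zf \<in> hom F XG" and zf_frag: "q \<in> S \<Longrightarrow> zf (frag_of q) = Psi (tens q)"
proof -
  interpret X: abelian_group XR by (rule XR_group)
  note cm = comm_group.axioms(1)[OF X.a_comm_group] and gr = comm_group.axioms(2)[OF X.a_comm_group]
  define t where "t q = (\<lambda>y \<in> eB. (y \<otimes>\<^bsub>B\<^esub> fst q) \<odot>\<^bsub>M\<^esub> snd q)" for q :: "('t \<Rightarrow> 't) \<times> 'e"
  have tP: "t q = Psi (tens q)" if "q \<in> S" for q using tens_Psi[OF that] by (simp add: t_def)
  have tc: "t q \<in> carrier XG" if "q \<in> S" for q using tP[OF that] Psi_closed[OF tens_closed[OF that]] by simp
  have tpow: "t q [^]\<^bsub>XG\<^esub> (n :: int) \<in> carrier XG" if "q \<in> S" for q n by (rule group.int_pow_closed[OF gr tc[OF that]])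
  have zf: "zf z = finprod XG (\<lambda>q. t q [^]\<^bsub>XG\<^esub> Poly_Mapping.lookup z q) (Poly_Mapping.keys z)" for z
    by (simp add: zeta_free_def finsum_def add_pow_def t_def)
  have pm: "(\<lambda>q. t q [^]\<^bsub>XG\<^esub> Poly_Mapping.lookup z q) \<in> L \<rightarrow> carrier XG" if "L \<subseteq> S"
    for z :: "('t \<Rightarrow> 't) \<times> 'e \<Rightarrow>\<^sub>0 int" and L
    by (rule Pi_I) (rule tpow, rule subsetD[OF that])
  \<comment> \<open>The sum over the support is extended to any finite set containing it, since zero
    exponents contribute the neutral element. Two elements with different supports are then compared
    on the union.\<close>
  have ext: "zf z = finprod XG (\<lambda>q. t q [^]\<^bsub>XG\<^esub> Poly_Mapping.lookup z q) L"
    if "finite L" "Poly_Mapping.keys z \<subseteq> L" "L \<subseteq> S" for z L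
    unfolding zf
  proof (rule comm_monoid.finprod_mono_neutral_cong_left[OF cm that(1,2)])
    show "t q [^]\<^bsub>XG\<^esub> Poly_Mapping.lookup z q = \<one>\<^bsub>XG\<^esub>" if "q \<in> L - Poly_Mapping.keys z" for q
      using that by (simp add: in_keys_iff)
  qed (use pm[OF that(3)] in auto)
  show "zf \<in> hom F XG"
  proof (rule homI)
    fix a assume a: "a \<in> carrier F"
    then show "zf a \<in> carrier XG" unfolding zf using pm by (intro comm_monoid.finprod_closed[OF cm]) simp
    fix b assume b: "b \<in> carrier F"
    let ?L = "Poly_Mapping.keys a \<union> Poly_Mapping.keys b"
    have L: "finite ?L" "?L \<subseteq> S" using a b by auto
    have "zf (a + b) = finprod XG (\<lambda>q. t q [^]\<^bsub>XG\<^esub> Poly_Mapping.lookup (a + b) q) ?L"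
      by (rule ext[OF L(1) keys_add L(2)])
    also have "\<dots> = finprod XG (\<lambda>q. t q [^]\<^bsub>XG\<^esub> Poly_Mapping.lookup a q \<otimes>\<^bsub>XG\<^esub> t q [^]\<^bsub>XG\<^esub> Poly_Mapping.lookup b q) ?L"
    proof (rule comm_monoid.finprod_cong'[OF cm refl])
      show "(\<lambda>q. t q [^]\<^bsub>XG\<^esub> Poly_Mapping.lookup a q \<otimes>\<^bsub>XG\<^esub> t q [^]\<^bsub>XG\<^esub> Poly_Mapping.lookup b q) \<in> ?L \<rightarrow> carrier XG"
        using monoid.m_closed[OF group.is_monoid[OF gr] tpow tpow] L(2) by blast
      show "t q [^]\<^bsub>XG\<^esub> Poly_Mapping.lookup (a + b) q = t q [^]\<^bsub>XG\<^esub> Poly_Mapping.lookup a q \<otimes>\<^bsub>XG\<^esub> t q [^]\<^bsub>XG\<^esub> Poly_Mapping.lookup b q"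
        if "q \<in> ?L" for q
        using group.int_pow_mult[OF gr tc] L(2) that by (simp only: Poly_Mapping.lookup_add subset_iff)
    qed
    also have "\<dots> = zf a \<otimes>\<^bsub>XG\<^esub> zf b"
      unfolding ext[OF L(1) Un_upper1 L(2)] ext[OF L(1) Un_upper2 L(2)]
      by (rule comm_monoid.finprod_multf[OF cm pm[OF L(2)] pm[OF L(2)]])
    finally show "zf (a \<otimes>\<^bsub>F\<^esub> b) = zf a \<otimes>\<^bsub>XG\<^esub> zf b" by simp
  qed
  show "zf (frag_of q) = Psi (tens q)" if q: "q \<in> S" for q
  proof -
    let ?f = "\<lambda>r. t r [^]\<^bsub>XG\<^esub> Poly_Mapping.lookup (frag_of q) r"
    have "zf (frag_of q) = finprod XG ?f {q}" unfolding zf by simp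
    also have "\<dots> = ?f q \<otimes>\<^bsub>XG\<^esub> finprod XG ?f {}"
      by (rule comm_monoid.finprod_insert[OF cm]) (simp_all only: tpow[OF q] finite.emptyI empty_iff not_False_eq_True Pi_empty UNIV_I)
    also have "\<dots> = ?f q"
      using monoid.r_one[OF group.is_monoid[OF gr] tpow[OF q]] by (simp only: comm_monoid.finprod_empty[OF cm])
    also have "?f q = t q" using group.int_pow_1[OF gr tc[OF q]] by (simp only: lookup_single_eq)
    finally show ?thesis using tP[OF q] by simp
  qed
qed

lemma F_eq: "tensor_free (Be_right B e) M = F"
  by (simp add: tensor_free_def Be_right_def M_simps)

text \<open>This makes \<zeta> well defined on the tensor product. Each defining relation becomes an
  identity between functionals of the form \<open>tens\<close>, and \<open>Psi\<close> is additive
  on these.\<close>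

lemma zf_relations:
  assumes "h \<in> tensor_relations (corner B e) (Be_right B e) M"
  shows "h \<in> carrier F \<and> zf h = \<zero>\<^bsub>XR\<^esub>"
proof -
  interpret X: abelian_group XR by (rule XR_group)
  note gr = comm_group.axioms(2)[OF X.a_comm_group]
  interpret gh: group_hom F XG zf
    by (intro group_hom.intro group_hom_axioms.intro zf_hom group_free_Abelian_group gr)
  have fr: "frag_of q \<in> carrier F" if "q \<in> S" for q using that by simp
  have df: "a - b \<in> carrier F" "zf (a - b) = zf a \<ominus>\<^bsub>XR\<^esub> zf b" if "a \<in> carrier F" "b \<in> carrier F" for a b
  proof -
    show ab: "a - b \<in> carrier F" using that by (auto dest: subsetD[OF keys_diff])
    have "zf a = zf b \<oplus>\<^bsub>XR\<^esub> zf (a - b)"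
      using gh.hom_mult[OF that(2) ab] by simp
    then show "zf (a - b) = zf a \<ominus>\<^bsub>XR\<^esub> zf b"
      using X.diff_of_sum[OF _ _ _] gh.hom_closed[OF that(2)] gh.hom_closed[OF ab] by simp
  qed
  have Psi3: "frag_of u - frag_of v - frag_of w \<in> carrier F \<and> zf (frag_of u - frag_of v - frag_of w) = \<zero>\<^bsub>XR\<^esub>"
    if q: "u \<in> S" "v \<in> S" "w \<in> S" and s: "tens u = (\<lambda>s \<in> carrier T. tens v s \<oplus>\<^bsub>K\<^esub> tens w s)" for u v w
  proof -
    have "Psi (tens u) = Psi (tens v) \<oplus>\<^bsub>XR\<^esub> Psi (tens w)"
      unfolding s by (rule Psi_add[OF tens_closed[OF q(2)] tens_closed[OF q(3)]])
    then have "Psi (tens u) \<ominus>\<^bsub>XR\<^esub> Psi (tens v) = Psi (tens w)"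
      by (rule X.diff_of_sum) (use Psi_closed tens_closed q in auto)
    then have "zf (frag_of u - frag_of v - frag_of w) = Psi (tens w) \<ominus>\<^bsub>XR\<^esub> Psi (tens w)"
      using df fr q zf_frag by simp
    then show ?thesis using df fr q X.diff_self[OF Psi_closed[OF tens_closed[OF q(3)]]] by simp
  qed
  have Psi2: "frag_of u - frag_of v \<in> carrier F \<and> zf (frag_of u - frag_of v) = \<zero>\<^bsub>XR\<^esub>"
    if q: "u \<in> S" "v \<in> S" and s: "tens u = tens v" for u v
    using df fr q zf_frag s X.diff_self[OF Psi_closed[OF tens_closed[OF q(2)]]] by simp
  have Bec: "carrier (Be_right B e) = Be" by (simp add: Be_right_def)
  have bes: "a \<odot>\<^bsub>Be_right B e\<^esub> x = compose (carrier T) a x" "x \<oplus>\<^bsub>Be_right B e\<^esub> x' = (\<lambda>t \<in> carrier T. x t \<oplus>\<^bsub>T\<^esub> x' t)" for a x x'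
    by (simp_all add: Be_right_def)
  have addBe: "(\<lambda>t \<in> carrier T. x t \<oplus>\<^bsub>T\<^esub> x' t) \<in> Be" if "x \<in> Be" "x' \<in> Be" for x x'
  proof -
    have h: "x \<in> mod_hom \<Gamma> T T" "x' \<in> mod_hom \<Gamma> T T" using that by (auto simp: Be_iff)
    have "i (p (x t \<oplus>\<^bsub>T\<^esub> x' t)) = x t \<oplus>\<^bsub>T\<^esub> x' t" if "t \<in> carrier T" for t
      using that \<open>x \<in> Be\<close> \<open>x' \<in> Be\<close> endc[OF h(1) that] endc[OF h(2) that]
      by (simp add: lin_add[OF pl] lin_add[OF il] pc Be_iff)
    then show ?thesis using T.restrict_mod_hom[OF T.lin_plus[OF lin_of_mod_hom[OF h(1)] lin_of_mod_hom[OF h(2)]]]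
      by (simp add: Be_iff)
  qed
  have cornerBe: "compose (carrier T) a x \<in> Be" if a: "a \<in> carrier (corner B e)" and x: "x \<in> Be" for a x
  proof -
    obtain b where b: "b \<in> mod_hom \<Gamma> T T" "a = compose (carrier T) e (compose (carrier T) b e)"
      using a by (auto simp: corner_def)
    have xh: "x \<in> mod_hom \<Gamma> T T" using x by (simp add: Be_iff)
    show ?thesis using comp_hom[OF corner_hom[OF a] xh] endc[OF xh] endc[OF b(1)] unfolding Be_iff
      by (auto simp: b(2) compose_def e_simp ic pc pi)
  qed
  have gens: "r \<in> carrier F \<and> zf r = \<zero>\<^bsub>XR\<^esub>" if r0: "r \<in>
    {frag_of (x \<oplus>\<^bsub>Be_right B e\<^esub> y, m) - frag_of (x, m) - frag_of (y, m) | x y m.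
        x \<in> carrier (Be_right B e) \<and> y \<in> carrier (Be_right B e) \<and> m \<in> carrier M} \<union>
     {frag_of (x, m \<oplus>\<^bsub>M\<^esub> n) - frag_of (x, m) - frag_of (x, n) | x m n.
        x \<in> carrier (Be_right B e) \<and> m \<in> carrier M \<and> n \<in> carrier M} \<union>
     {frag_of (a \<odot>\<^bsub>Be_right B e\<^esub> x, m) - frag_of (x, a \<odot>\<^bsub>M\<^esub> m) | a x m.
        a \<in> carrier (corner B e) \<and> x \<in> carrier (Be_right B e) \<and> m \<in> carrier M}" (is "_ \<in> ?A \<union> ?B \<union> ?C") for r
  proof -
    have "r \<in> ?A \<or> r \<in> ?B \<or> r \<in> ?C" using r0 by (simp only: Un_iff disj_assoc)
    then consider "r \<in> ?A" | "r \<in> ?B" | "r \<in> ?C" by (elim disjE) simp_all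
    then show ?thesis
    proof cases
      case 1
      then obtain x y m where r: "r = frag_of (x \<oplus>\<^bsub>Be_right B e\<^esub> y, m) - frag_of (x, m) - frag_of (y, m)"
        and x: "x \<in> Be" "y \<in> Be" "m \<in> carrier E" by (auto simp: Bec M_simps)
      have h: "x \<in> mod_hom \<Gamma> T T" "y \<in> mod_hom \<Gamma> T T" using x by (auto simp: Be_iff)
      show ?thesis unfolding r
      proof (rule Psi3)
        show "tens (x \<oplus>\<^bsub>Be_right B e\<^esub> y, m) = (\<lambda>s \<in> carrier T. tens (x, m) s \<oplus>\<^bsub>K\<^esub> tens (y, m) s)"
          using endc[OF h(1)] endc[OF h(2)] lin_add[OF lin_of_mod_hom[OF theta_closed[OF x(3)]]]
          by (auto simp: tens_def bes lin_add[OF pl] pc intro!: restrict_ext)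
      qed (use x addBe[OF x(1,2)] in \<open>auto simp: bes\<close>)
    next
      case 2
      then obtain x m n where r: "r = frag_of (x, m \<oplus>\<^bsub>M\<^esub> n) - frag_of (x, m) - frag_of (x, n)"
        and x: "x \<in> Be" "m \<in> carrier E" "n \<in> carrier E" by (auto simp: Bec M_simps)
      have h: "x \<in> mod_hom \<Gamma> T T" using x by (auto simp: Be_iff)
      show ?thesis unfolding r
      proof (rule Psi3)
        show "tens (x, m \<oplus>\<^bsub>M\<^esub> n) = (\<lambda>s \<in> carrier T. tens (x, m) s \<oplus>\<^bsub>K\<^esub> tens (x, n) s)"
          unfolding tens_def fst_conv snd_conv M_simps theta_add[OF x(2,3)]
          by (rule restrict_ext) (simp add: pc endc[OF h])
      qed (use x in \<open>auto simp: M_simps\<close>)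
    next
      case 3
      then obtain a x m where r: "r = frag_of (a \<odot>\<^bsub>Be_right B e\<^esub> x, m) - frag_of (x, a \<odot>\<^bsub>M\<^esub> m)"
        and x: "a \<in> carrier (corner B e)" "x \<in> Be" "m \<in> carrier E" by (auto simp: Bec M_simps)
      have h: "x \<in> mod_hom \<Gamma> T T" using x by (auto simp: Be_iff)
      note k = kap_hom[OF corner_hom[OF x(1)]]
      show ?thesis unfolding r
      proof (rule Psi2)
        \<comment> \<open>Both sides are \<open>\<theta> m \<circ> p \<circ> a \<circ> x\<close>:
          the composite \<open>i \<circ> p\<close> hidden in \<open>kap a\<close> has no effect on
          values of \<open>x\<close>, which lie in the image of \<open>P\<close>.\<close>
        show "tens (a \<odot>\<^bsub>Be_right B e\<^esub> x, m) = tens (x, a \<odot>\<^bsub>M\<^esub> m)"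
          using endc[OF h] x k by (auto simp: tens_def theta_smult pc M_simps bes compose_def kap_simp Be_iff intro!: restrict_ext)
      qed (use x cornerBe[OF x(1,2)] k in \<open>auto simp: M_simps bes phi E.smult_closed\<close>)
    qed
  qed
  show ?thesis
    using assms unfolding tensor_relations_def F_eq
  proof (induction rule: generate.induct)
    case one
    then show ?case using gh.hom_one by simp
  next
    case (incl h)
    then show ?case by (rule gens)
  next
    case (inv h)
    have h: "h \<in> carrier F \<and> zf h = \<zero>\<^bsub>XR\<^esub>" by (rule gens[OF inv])
    have "inv\<^bsub>XG\<^esub> zf h = \<zero>\<^bsub>XR\<^esub>"
      using h monoid.inv_one[OF group.is_monoid[OF gr]] by simp
    show ?case
    proof
      show "inv\<^bsub>F\<^esub> h \<in> carrier F" by (rule group.inv_closed[OF group_free_Abelian_group conjunct1[OF h]])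
      show "zf (inv\<^bsub>F\<^esub> h) = \<zero>\<^bsub>XR\<^esub>"
        using gh.hom_inv[OF conjunct1[OF h]] \<open>inv\<^bsub>XG\<^esub> zf h = \<zero>\<^bsub>XR\<^esub>\<close> by (rule trans)
    qed
  next
    case (eng h1 h2)
    then show ?case using gh.hom_mult[of h1 h2]
        monoid.m_closed[OF group.is_monoid[OF group_free_Abelian_group[of S]], of h1 h2] X.zero_closed X.l_zero by simp
  qed
qed

text \<open>The map on the free group is constant on each coset, so \<open>the_elem\<close> in
  \<open>zeta\<close> picks that constant; no module structure on the tensor product is
  involved.\<close>

lemma zeta_image: "zeta B e M ` carrier (ext_l B e M) = zf ` carrier F"
proof -
  interpret X: abelian_group XR by (rule XR_group)
  let ?H = "tensor_relations (corner B e) (Be_right B e) M"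
  have H0: "0 \<in> ?H" using generate.one[of "tensor_free (Be_right B e) M"]
    unfolding tensor_relations_def by (simp add: F_eq)
  have car: "carrier (ext_l B e M) = rcosets\<^bsub>F\<^esub> ?H" by (simp add: ext_l_def F_eq Let_def)
  have zz: "zeta B e M (?H #>\<^bsub>F\<^esub> z) = zf z" if z: "z \<in> carrier F" for z
  proof -
    have "zf (h + z) = zf z" if "h \<in> ?H" for h
    proof -
      have h: "h \<in> carrier F" "zf h = \<zero>\<^bsub>XR\<^esub>" using zf_relations[OF that] by auto
      show ?thesis using hom_mult[OF zf_hom h(1) z] h(2) hom_in_carrier[OF zf_hom z] by simp
    qed
    moreover have "?H #>\<^bsub>F\<^esub> z = (\<lambda>h. h + z) ` ?H" by (auto simp: r_coset_def)
    ultimately have "zf ` (?H #>\<^bsub>F\<^esub> z) = {zf z}" using H0 by (auto simp: image_image)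
    then show ?thesis by (simp add: zeta_def)
  qed
  have "rcosets\<^bsub>F\<^esub> ?H = (\<lambda>z. ?H #>\<^bsub>F\<^esub> z) ` carrier F" by (auto simp: RCOSETS_def)
  then show ?thesis unfolding car by (simp only: image_image zz cong: image_cong)
qed

text \<open>The image of \<open>Psi\<close> contains the values on generators and is closed under
  differences, as the induction rule for free abelian groups requires.\<close>

lemma zf_image_subset: "zf ` carrier F \<subseteq> Psi ` DT"
proof clarify
  interpret X: abelian_group XR by (rule XR_group)
  note gr = comm_group.axioms(2)[OF X.a_comm_group]
  interpret gh: group_hom F XG zf
    by (intro group_hom.intro group_hom_axioms.intro zf_hom group_free_Abelian_group gr)
  interpret D: left_module "op_alg \<Gamma>" "dual K \<Gamma> T" by (rule G.left_module_dual[OF T.left_module_axioms])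
  have D: "carrier (dual K \<Gamma> T) = DT" by (rule G.dual_simps)
  have Padd: "Psi (f \<oplus>\<^bsub>dual K \<Gamma> T\<^esub> g) = Psi f \<oplus>\<^bsub>XR\<^esub> Psi g" if "f \<in> DT" "g \<in> DT" for f g
    using Psi_add that by simp
  fix z assume z: "z \<in> carrier F"
  then have "Poly_Mapping.keys z \<subseteq> S" by simp
  then show "zf z \<in> Psi ` DT"
  proof (rule free_Abelian_group_induct)
    have "Psi \<zero>\<^bsub>dual K \<Gamma> T\<^esub> \<oplus>\<^bsub>XR\<^esub> Psi \<zero>\<^bsub>dual K \<Gamma> T\<^esub> = Psi \<zero>\<^bsub>dual K \<Gamma> T\<^esub>"
      using Padd[of "\<zero>\<^bsub>dual K \<Gamma> T\<^esub>" "\<zero>\<^bsub>dual K \<Gamma> T\<^esub>"] D.M.zero_closed D D.M.l_zero by metis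
    moreover have "Psi \<zero>\<^bsub>dual K \<Gamma> T\<^esub> \<in> carrier XR" using Psi_closed D.M.zero_closed D by metis
    ultimately have "Psi \<zero>\<^bsub>dual K \<Gamma> T\<^esub> = \<zero>\<^bsub>XR\<^esub>" by (metis X.add.l_cancel_one' X.zero_closed)
    moreover have "zf 0 = \<zero>\<^bsub>XR\<^esub>" by (simp add: zeta_free_def)
    ultimately show "zf 0 \<in> Psi ` DT" using D.M.zero_closed unfolding D by (metis imageI)
  next
    fix x y assume 2: "Poly_Mapping.keys x \<subseteq> S" "Poly_Mapping.keys y \<subseteq> S" "zf x \<in> Psi ` DT" "zf y \<in> Psi ` DT"
    then obtain f g where f: "f \<in> DT" "zf x = Psi f" and g: "g \<in> DT" "zf y = Psi g" by blast
    have fg: "f \<ominus>\<^bsub>dual K \<Gamma> T\<^esub> g \<in> DT" using D.M.minus_closed f g D by metis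
    have "(f \<ominus>\<^bsub>dual K \<Gamma> T\<^esub> g) \<oplus>\<^bsub>dual K \<Gamma> T\<^esub> g = f" using D.M.diff_add_cancel f g D by metis
    then have "Psi f = Psi (f \<ominus>\<^bsub>dual K \<Gamma> T\<^esub> g) \<oplus>\<^bsub>XR\<^esub> Psi g" using Padd[OF fg g(1)] by simp
    moreover have "zf x = zf (x - y) \<oplus>\<^bsub>XR\<^esub> zf y"
    proof -
      have "x - y \<in> carrier F" "y \<in> carrier F" using 2 by (auto dest: subsetD[OF keys_diff])
      then show ?thesis using gh.hom_mult[of "x - y" y] by simp
    qed
    moreover have "zf (x - y) \<in> carrier XR" 
      using hom_in_carrier[OF zf_hom, of "x - y"] 2 by (auto dest: subsetD[OF keys_diff])
    ultimately have "zf (x - y) = Psi (f \<ominus>\<^bsub>dual K \<Gamma> T\<^esub> g)"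
      using f g Psi_closed[OF fg] Psi_closed[OF g(1)] by (metis X.add.right_cancel)
    then show "zf (x - y) \<in> Psi ` DT" using fg by blast
  next
    fix q assume "q \<in> S"
    then show "zf (frag_of q) \<in> Psi ` DT" using zf_frag[of q] tens_closed[of q] by blast
  qed
qed

text \<open>Turn \<open>f\<close> into a map to \<open>D\<Gamma>\<close>, factor it through
  \<open>P\<close> by cogeneration, and evaluate at \<open>1\<close>: this writes \<open>f\<close>
  as a finite sum of functionals \<open>tens q\<close>.\<close>

lemma Psi_image_subset:
  assumes cog: "cogenerated_by K \<Gamma> P T" and f: "f \<in> DT"
  shows "Psi f \<in> zf ` carrier F"
proof -
  interpret X: abelian_group XR by (rule XR_group)
  let ?D = "dual K \<Gamma> T"
  interpret D: left_module "op_alg \<Gamma>" ?D by (rule G.left_module_dual[OF T.left_module_axioms])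
  interpret OG: fd_algebra K "op_alg \<Gamma>" by (rule G.fd_op_alg)
  interpret R: left_module K "regular K" by (rule left_module_regular[OF G.K.ring_axioms])
  have D: "carrier (?D) = DT" by (rule G.dual_simps)
  let ?DG = "dual_regular K \<Gamma>"
  have orm: "left_module (op_alg \<Gamma>) (regular (op_alg \<Gamma>))" by (rule left_module_regular[OF OG.A_ring])
  define fh where "fh t = (\<lambda>g \<in> carrier \<Gamma>. f (g \<odot>\<^bsub>T\<^esub> t))" for t
  have fhl: "lin \<Gamma> T ?DG fh" unfolding fh_def by (rule G.lin_to_dual_regular[OF T.left_module_axioms DT_lin[OF f]])
  obtain n a b where ab: "\<And>m. m < n \<Longrightarrow> lin \<Gamma> T P (a m)" "\<And>m. m < n \<Longrightarrow> lin \<Gamma> P ?DG (b m)"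
    "\<And>x. x \<in> carrier T \<Longrightarrow> fh x = (\<Oplus>\<^bsub>?DG\<^esub>m\<in>{..<n::nat}. b m (a m x))"
  proof -
    obtain n a b where "\<forall>m<n. lin \<Gamma> T P (a m) \<and> lin \<Gamma> P ?DG (b m)"
      "\<forall>x\<in>carrier T. fh x = (\<Oplus>\<^bsub>?DG\<^esub>m\<in>{..<n::nat}. b m (a m x))"
      using cog[unfolded cogenerated_by_def, rule_format, OF fhl] by (elim exE conjE) (rule that)
    then show thesis using that[of n a b] by blast
  qed
  define be where "be m = (\<lambda>r \<in> carrier P. b m r \<one>\<^bsub>\<Gamma>\<^esub>)" for m
  have bDP: "be m \<in> DP" if m: "m < n" for m
    using left_module.restrict_mod_hom[OF G.left_module_US[OF P.left_module_axioms]
        G.functional_of_lin_dual_regular[OF P.left_module_axioms ab(2)[OF m]]] by (simp add: be_def)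
  \<comment> \<open>The first component has values in the image of \<open>P\<close> and so lies in
    \<open>Be\<close>; the second is the functional \<open>be m\<close> on \<open>P\<close>, read as
    an element of \<open>E\<close>.\<close>
  define q where "q m = ((\<lambda>t \<in> carrier T. i (a m t)), eta (be m))" for m
  have qS: "q m \<in> S" if m: "m < n" for m
    using T.restrict_mod_hom[OF lin_comp[OF ab(1)[OF m] il]] lin_closed[OF ab(1)[OF m]] eta_closed[OF bDP[OF m]]
    by (auto simp: q_def Be_iff pi)
  have tq: "tens (q m) s = b m (a m s) \<one>\<^bsub>\<Gamma>\<^esub>" if "m < n" "s \<in> carrier T" for m s
  proof -
    have "tens (q m) s = \<theta> (eta (be m)) (p (i (a m s)))" using that by (simp add: tens_def q_def)
    also have "\<dots> = be m (a m s)" using theta_eta[OF bDP] pi lin_closed[OF ab(1)] that by simp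
    finally show ?thesis using lin_closed[OF ab(1)] that by (simp add: be_def)
  qed
  have part: "\<exists>z\<in>carrier F. zf z = Psi (\<Oplus>\<^bsub>?D\<^esub>m\<in>{..<N}. tens (q m))" if "N \<le> n" for N
    using that
  proof (induction N)
    case 0
    have "Psi \<zero>\<^bsub>?D\<^esub> \<oplus>\<^bsub>XR\<^esub> Psi \<zero>\<^bsub>?D\<^esub> = Psi (\<zero>\<^bsub>?D\<^esub> \<oplus>\<^bsub>?D\<^esub> \<zero>\<^bsub>?D\<^esub>)"
      using Psi_add[of "\<zero>\<^bsub>?D\<^esub>" "\<zero>\<^bsub>?D\<^esub>"] D.M.zero_closed unfolding D by simp
    then have "Psi \<zero>\<^bsub>?D\<^esub> \<oplus>\<^bsub>XR\<^esub> Psi \<zero>\<^bsub>?D\<^esub> = Psi \<zero>\<^bsub>?D\<^esub>"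
      using D.M.l_zero[OF D.M.zero_closed] by metis
    moreover have "Psi \<zero>\<^bsub>?D\<^esub> \<in> carrier XR" using Psi_closed D.M.zero_closed D by metis
    ultimately have "Psi \<zero>\<^bsub>?D\<^esub> = \<zero>\<^bsub>XR\<^esub>" by (metis X.add.l_cancel_one' X.zero_closed)
    moreover have "zf 0 = \<zero>\<^bsub>XR\<^esub>" by (simp add: zeta_free_def)
    ultimately have "zf 0 = Psi (\<Oplus>\<^bsub>?D\<^esub>m\<in>{..<0}. tens (q m))"
      by (simp only: lessThan_0 D.M.finsum_empty)
    then show ?case by (rule bexI) simp
  next
    case (Suc N)
    then obtain z where z: "z \<in> carrier F" "zf z = Psi (\<Oplus>\<^bsub>?D\<^esub>m\<in>{..<N}. tens (q m))" by auto
    have tc: "tens (q m) \<in> carrier (?D)" if "m < n" for m using tens_closed[OF qS[OF that]] D by simp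
    have sc: "(\<Oplus>\<^bsub>?D\<^esub>m\<in>{..<N}. tens (q m)) \<in> carrier (?D)"
      using tc Suc.prems by (intro D.M.finsum_closed) auto
    have "(\<Oplus>\<^bsub>?D\<^esub>m\<in>{..<Suc N}. tens (q m)) = tens (q N) \<oplus>\<^bsub>?D\<^esub> (\<Oplus>\<^bsub>?D\<^esub>m\<in>{..<N}. tens (q m))"
      unfolding lessThan_Suc by (rule D.M.finsum_insert) (use tc Suc.prems in auto)
    then have "Psi (\<Oplus>\<^bsub>?D\<^esub>m\<in>{..<Suc N}. tens (q m)) = Psi (tens (q N)) \<oplus>\<^bsub>XR\<^esub> zf z"
      using Psi_add[of "tens (q N)" "\<Oplus>\<^bsub>?D\<^esub>m\<in>{..<N}. tens (q m)"] tc[of N] sc Suc.prems z(2) by simp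
    also have "Psi (tens (q N)) = zf (frag_of (q N))" using zf_frag[OF qS[of N]] Suc.prems by simp
    also have "zf (frag_of (q N)) \<oplus>\<^bsub>XR\<^esub> zf z = zf (frag_of (q N) + z)"
      using hom_mult[OF zf_hom, of "frag_of (q N)" z] qS[of N] Suc.prems z(1) by simp
    finally show ?case
      using qS[of N] Suc.prems z(1) keys_add[of "frag_of (q N)" z] by (intro bexI[of _ "frag_of (q N) + z"]) auto
  qed
  have "f = (\<Oplus>\<^bsub>?D\<^esub>m\<in>{..<n}. tens (q m))"
  proof (rule mod_hom_ext[OF f])
    have tc: "tens (q m) \<in> carrier (?D)" if "m \<in> {..<n}" for m using tens_closed[OF qS] that D by simp
    have "(\<Oplus>\<^bsub>?D\<^esub>m\<in>{..<n}. tens (q m)) \<in> carrier (?D)" using tc by (intro D.M.finsum_closed) auto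
    then show "(\<Oplus>\<^bsub>?D\<^esub>m\<in>{..<n}. tens (q m)) \<in> DT" by simp
    fix x assume "x \<in> carrier (underlying_space \<Gamma> T)"
    then have x: "x \<in> carrier T" by simp
    have "f x = fh x \<one>\<^bsub>\<Gamma>\<^esub>" using x by (simp add: fh_def T.smult_one)
    also have "\<dots> = (\<Oplus>\<^bsub>dual K (op_alg \<Gamma>) (regular (op_alg \<Gamma>))\<^esub>m\<in>{..<n}. b m (a m x)) \<one>\<^bsub>\<Gamma>\<^esub>"
      using ab(3)[OF x] by (simp add: dual_regular_def)
    also have "\<dots> = (\<Oplus>\<^bsub>regular K\<^esub>m\<in>{..<n}. b m (a m x) \<one>\<^bsub>\<Gamma>\<^esub>)"
      using lin_closed[OF ab(2) lin_closed[OF ab(1) x]]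
      by (intro OG.dual_finsum[OF orm]) (auto simp: dual_regular_def)
    also have "\<dots> = (\<Oplus>\<^bsub>regular K\<^esub>m\<in>{..<n}. tens (q m) x)"
    proof (rule R.M.finsum_cong'[symmetric])
      show "(\<lambda>m. b m (a m x) \<one>\<^bsub>\<Gamma>\<^esub>) \<in> {..<n} \<rightarrow> carrier (regular K)"
        using G.functional_closed[OF tens_closed[OF qS] x] tq[OF _ x] by auto
    qed (use tq x in auto)
    also have "\<dots> = (\<Oplus>\<^bsub>?D\<^esub>m\<in>{..<n}. tens (q m)) x"
      by (rule G.dual_finsum[OF T.left_module_axioms _ x, symmetric]) (rule tc)
    finally show "f x = (\<Oplus>\<^bsub>?D\<^esub>m\<in>{..<n}. tens (q m)) x" .
  qed
  then show ?thesis using part[of n] by (metis image_eqI order_refl)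
qed

theorem intermediate_extension_iso:
  assumes gen: "generated_by \<Gamma> P T" and cog: "cogenerated_by K \<Gamma> P T"
  shows "mod_iso B (shifted_extension \<Gamma> P T i p \<phi> E) (dual_over_end K \<Gamma> T)"
proof -
  let ?IE = "shifted_extension \<Gamma> P T i p \<phi> E" and ?D = "dual_over_end K \<Gamma> T"
  interpret R: left_module K "regular K" by (rule left_module_regular[OF G.K.ring_axioms])
  interpret UT: left_module K "underlying_space \<Gamma> T" by (rule G.left_module_US[OF T.left_module_axioms])
  have IE: "?IE = XR\<lparr>carrier := Psi ` DT\<rparr>"
  proof -
    have "zf ` carrier F = Psi ` DT"
      by (rule subset_antisym[OF zf_image_subset]) (rule image_subsetI, rule Psi_image_subset[OF cog])
    then show ?thesis unfolding shifted_extension_def intermediate_extension_def zeta_image by (simp only:)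
  qed
  have Dc: "carrier ?D = DT" by (rule dual_over_end_simps)
  have cl1: "f \<oplus>\<^bsub>?D\<^esub> g \<in> carrier ?D" if "f \<in> carrier ?D" "g \<in> carrier ?D" for f g
    using UT.restrict_mod_hom[OF R.lin_plus[OF DT_lin DT_lin], of f g] that unfolding dual_over_end_simps by simp
  have cl2: "b \<odot>\<^bsub>?D\<^esub> f \<in> carrier ?D" if "b \<in> carrier B" "f \<in> carrier ?D" for b f
    using UT.restrict_mod_hom[OF lin_comp[OF G.lin_US[OF lin_of_mod_hom] DT_lin], of b f] that
    unfolding dual_over_end_simps by simp
  have lin: "lin B ?D ?IE Psi"
    by (rule linI) (auto simp: IE dual_over_end_simps Psi_add Psi_smult)
  have inj: "inj_on Psi DT"
  proof (rule inj_onI)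
    fix f g assume f: "f \<in> DT" and g: "g \<in> DT" and fg: "Psi f = Psi g"
    \<comment> \<open>The test element \<open>h \<circ> p\<close> of \<open>eB\<close> restricts to
      \<open>h\<close> on \<open>P\<close>, so \<open>Psi f\<close> determines
      \<open>f \<circ> h\<close> for every \<open>h\<close> from \<open>P\<close> to
      \<open>T\<close>.\<close>
    have fgh: "f (h r) = g (h r)" if h: "lin \<Gamma> P T h" and r: "r \<in> carrier P" for h r
    proof -
      let ?y = "\<lambda>t \<in> carrier T. h (p t)"
      have y: "?y \<in> mod_hom \<Gamma> T T" by (rule T.restrict_mod_hom[OF lin_comp[OF pl h]])
      then have yB: "?y \<in> eB" by (simp add: eB_iff ic pc pi)
      have "eta (res f ?y) = eta (res g ?y)" using fun_cong[OF fg, of ?y] yB by (simp add: Psi_def)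
      then have "res f ?y = res g ?y" using theta_eta[OF res_closed[OF f y]] theta_eta[OF res_closed[OF g y]] by metis
      from fun_cong[OF this, of r] show ?thesis using r by (simp add: res_def ic pi)
    qed
    show "f = g"
    proof (rule mod_hom_ext[OF f g])
      fix t assume "t \<in> carrier (underlying_space \<Gamma> T)"
      then obtain n h x where h: "\<And>m. m < n \<Longrightarrow> lin \<Gamma> P T (h m) \<and> x m \<in> carrier P" "t = (\<Oplus>\<^bsub>T\<^esub>m\<in>{..<n::nat}. h m (x m))"
        using gen unfolding generated_by_def by fastforce
      have hc: "(\<lambda>m. h m (x m)) \<in> {..<n} \<rightarrow> carrier (underlying_space \<Gamma> T)" using h(1) lin_closed by fastforce
      have tU: "t = (\<Oplus>\<^bsub>underlying_space \<Gamma> T\<^esub>m\<in>{..<n}. h m (x m))"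
        unfolding h(2) by (simp add: finsum_def finprod_def)
      have "f t = (\<Oplus>\<^bsub>regular K\<^esub>m\<in>{..<n}. f (h m (x m)))"
        unfolding tU by (rule lin_of_finsum[OF UT.left_module_axioms R.left_module_axioms DT_lin[OF f] hc])
      also have "\<dots> = (\<Oplus>\<^bsub>regular K\<^esub>m\<in>{..<n}. g (h m (x m)))"
        using fgh h(1) lin_closed[OF DT_lin[OF g] funcset_mem[OF hc]] by (intro R.M.finsum_cong') auto
      also have "\<dots> = g t"
        unfolding tU by (rule lin_of_finsum[OF UT.left_module_axioms R.left_module_axioms DT_lin[OF g] hc, symmetric])
      finally show "f t = g t" .
    qed
  qed
  have bij: "bij_betw Psi (carrier ?D) (carrier ?IE)" using inj by (simp add: bij_betw_def Dc IE)
  \<comment> \<open>The isomorphism has to start at the extension, so \<open>Psi\<close> is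
    inverted. Restricting the inverse to the image keeps it linear because the image is closed under
    the operations.\<close>
  have inv: "lin B ?IE ?D (inv_into (carrier ?D) Psi)" by (rule lin_inv_into_closed[OF cl1 cl2 lin bij])
  have "restrict (inv_into (carrier ?D) Psi) (carrier ?IE) \<in> mod_hom B ?IE ?D"
  proof -
    have c1: "u \<oplus>\<^bsub>?IE\<^esub> v \<in> carrier ?IE" if uv: "u \<in> carrier ?IE" "v \<in> carrier ?IE" for u v
    proof -
      obtain f g where "f \<in> carrier ?D" "g \<in> carrier ?D" "u = Psi f" "v = Psi g" using uv by (auto simp: IE Dc)
      then show ?thesis using lin_add[OF lin, of f g] lin_closed[OF lin cl1, of f g] by simp
    qed
    have c2: "b \<odot>\<^bsub>?IE\<^esub> u \<in> carrier ?IE" if bu: "b \<in> carrier B" "u \<in> carrier ?IE" for b u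
    proof -
      obtain f where "f \<in> carrier ?D" "u = Psi f" using bu by (auto simp: IE Dc)
      then show ?thesis using lin_smult[OF lin bu(1), of f] lin_closed[OF lin cl2[OF bu(1)], of f] by simp
    qed
    have "lin B ?IE ?D (restrict (inv_into (carrier ?D) Psi) (carrier ?IE))"
      by (rule linI) (simp_all only: restrict_apply' c1 c2 lin_closed[OF inv] lin_add[OF inv] lin_smult[OF inv])
    then show ?thesis unfolding mod_hom_iff by (intro conjI restrict_extensional)
  qed
  moreover have "bij_betw (restrict (inv_into (carrier ?D) Psi) (carrier ?IE)) (carrier ?IE) (carrier ?D)"
    using bij_betw_inv_into[OF bij] by (simp add: bij_betw_restrict_eq)
  ultimately show ?thesis unfolding mod_iso_def by blast
qed

end

section \<open>Local idempotents and the Krull--Schmidt argument\<close>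

lemma ring_end_op:
  assumes "left_module A M"
  shows "ring (end_op A M)"
proof -
  interpret M: left_module A M by fact
  have cl: "f x \<in> carrier M" if "f \<in> mod_hom A M M" "x \<in> carrier M" for f x
    using lin_closed[OF lin_of_mod_hom[OF that(1)] that(2)] .
  have ex: "restrict f (carrier M) = f" if "f \<in> mod_hom A M M" for f
    using that by (simp add: mod_hom_iff extensional_restrict)
  note r = M.restrict_mod_hom and l = lin_of_mod_hom
  show ?thesis
  proof (intro ringI abelian_groupI monoidI)
    fix f assume "f \<in> carrier (end_op A M)"
    then show "\<exists>g\<in>carrier (end_op A M). g \<oplus>\<^bsub>end_op A M\<^esub> f = \<zero>\<^bsub>end_op A M\<^esub>"
      using r[OF M.lin_uminus[OF l, of f]] cl[of f] M.M.l_neg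
      by (intro bexI[of _ "\<lambda>x\<in>carrier M. \<ominus>\<^bsub>M\<^esub> f x"]) (auto cong: restrict_cong)
  qed (simp_all add: compose_def cl ex r[OF lin_comp[OF l l]] r[OF M.lin_plus[OF l l]] r[OF lin_id] r[OF M.lin_const_zero[OF assms]]
      lin_add[OF l] M.M.a_ac cong: restrict_cong)
qed

text \<open>Invertibility in the corner ring \<open>eSe\<close>; the inverse is required to lie in
  the corner.\<close>

definition unit_at :: "('a, 'm) ring_scheme \<Rightarrow> 'a \<Rightarrow> 'a \<Rightarrow> bool" where
  "unit_at S e x \<longleftrightarrow> (\<exists>y\<in>carrier S. e \<otimes>\<^bsub>S\<^esub> y = y \<and> y \<otimes>\<^bsub>S\<^esub> e = y \<and> x \<otimes>\<^bsub>S\<^esub> y = e \<and> y \<otimes>\<^bsub>S\<^esub> x = e)"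

text \<open>What a decomposition into pairwise non-isomorphic indecomposables says about the
  endomorphism ring: a complete orthogonal family of idempotents with local corner rings, no two of
  them equivalent. Being purely ring-theoretic, it passes between modules with isomorphic
  endomorphism rings.\<close>

definition local_idems :: "('a, 'm) ring_scheme \<Rightarrow> nat \<Rightarrow> (nat \<Rightarrow> 'a) \<Rightarrow> bool" where
  "local_idems S n e \<longleftrightarrow>
     (\<forall>i<n. e i \<in> carrier S \<and> e i \<otimes>\<^bsub>S\<^esub> e i = e i \<and> e i \<noteq> \<zero>\<^bsub>S\<^esub>) \<and>
     (\<forall>i<n. \<forall>j<n. i \<noteq> j \<longrightarrow> e i \<otimes>\<^bsub>S\<^esub> e j = \<zero>\<^bsub>S\<^esub>) \<and>
     (\<Oplus>\<^bsub>S\<^esub>i\<in>{..<n}. e i) = \<one>\<^bsub>S\<^esub> \<and>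
     (\<forall>i<n. \<forall>x\<in>carrier S. e i \<otimes>\<^bsub>S\<^esub> x = x \<longrightarrow> x \<otimes>\<^bsub>S\<^esub> e i = x \<longrightarrow> unit_at S (e i) x \<or> unit_at S (e i) (e i \<ominus>\<^bsub>S\<^esub> x)) \<and>
     (\<forall>i<n. \<forall>j<n. i \<noteq> j \<longrightarrow> \<not> (\<exists>x\<in>carrier S. \<exists>y\<in>carrier S. e i \<otimes>\<^bsub>S\<^esub> x = x \<and> x \<otimes>\<^bsub>S\<^esub> e j = x \<and>
        e j \<otimes>\<^bsub>S\<^esub> y = y \<and> y \<otimes>\<^bsub>S\<^esub> e i = y \<and> x \<otimes>\<^bsub>S\<^esub> y = e i \<and> y \<otimes>\<^bsub>S\<^esub> x = e j))"

text \<open>Multiplying by the inverse \<open>z\<close> of \<open>a \<oplus> b\<close> makes the two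
  summands add up to \<open>e\<close>, where locality decides. The fact \<open>key\<close> then
  removes the factor \<open>z\<close>; that the inverse so obtained is also a left inverse follows
  from \<open>z \<otimes> (a \<oplus> b) = e\<close>.\<close>

lemma (in ring) unit_at_sum:
  assumes e: "e \<in> carrier R" "e \<otimes> e = e"
    and loc: "\<And>x. x \<in> carrier R \<Longrightarrow> e \<otimes> x = x \<Longrightarrow> x \<otimes> e = x \<Longrightarrow> unit_at R e x \<or> unit_at R e (e \<ominus> x)"
    and a: "a \<in> carrier R" "e \<otimes> a = a" "a \<otimes> e = a" and b: "b \<in> carrier R" "e \<otimes> b = b" "b \<otimes> e = b"
    and u: "unit_at R e (a \<oplus> b)"
  shows "unit_at R e a \<or> unit_at R e b"
proof -
  obtain z where z: "z \<in> carrier R" "e \<otimes> z = z" "z \<otimes> e = z" "(a \<oplus> b) \<otimes> z = e" "z \<otimes> (a \<oplus> b) = e"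
    using u by (auto simp: unit_at_def)
  have key: "unit_at R e c" if c: "c \<in> carrier R" "e \<otimes> c = c" "c \<otimes> e = c" and uc: "unit_at R e (c \<otimes> z)" for c
  proof -
    obtain w where w: "w \<in> carrier R" "e \<otimes> w = w" "w \<otimes> e = w" "c \<otimes> z \<otimes> w = e" "w \<otimes> (c \<otimes> z) = e"
      using uc by (auto simp: unit_at_def)
    have "z \<otimes> w \<otimes> c = e"
    proof -
      have "z \<otimes> w \<otimes> c = z \<otimes> w \<otimes> (c \<otimes> e)" using c by simp
      also have "\<dots> = z \<otimes> w \<otimes> (c \<otimes> (z \<otimes> (a \<oplus> b)))" by (simp only: z(5))
      also have "\<dots> = z \<otimes> (w \<otimes> (c \<otimes> z)) \<otimes> (a \<oplus> b)" using z(1) w(1) c(1) a(1) b(1) by (simp add: m_assoc)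
      also have "\<dots> = z \<otimes> (a \<oplus> b)" by (simp only: w(5) z(3))
      finally show ?thesis by (simp only: z(5))
    qed
    moreover have "c \<otimes> (z \<otimes> w) = e" using w z c by (simp add: m_assoc)
    moreover have "e \<otimes> (z \<otimes> w) = z \<otimes> w" "z \<otimes> w \<otimes> e = z \<otimes> w" using z w e by (simp_all add: m_assoc[symmetric]) (simp add: m_assoc)
    ultimately show ?thesis unfolding unit_at_def using z w by (intro bexI[of _ "z \<otimes> w"]) auto
  qed
  have az: "a \<otimes> z \<in> carrier R" "e \<otimes> (a \<otimes> z) = a \<otimes> z" "a \<otimes> z \<otimes> e = a \<otimes> z"
    using a z e by (simp_all add: m_assoc[symmetric]) (simp add: m_assoc)
  have "a \<otimes> z \<oplus> b \<otimes> z = e" using z(4) a b z(1) by (simp add: l_distr)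
  then have "e \<ominus> a \<otimes> z = b \<otimes> z" using diff_of_sum[of e "a \<otimes> z" "b \<otimes> z"] a b z by simp
  then show ?thesis using loc[OF az] key[OF a] key[OF b] by auto
qed

locale local_ring_idems = ring R for R (structure) and n :: nat and e :: "nat \<Rightarrow> 'a" +
  assumes li: "local_idems R n e"
begin

lemma e_closed: "i < n \<Longrightarrow> e i \<in> carrier R" and e_idem: "i < n \<Longrightarrow> e i \<otimes> e i = e i" and e_nz: "i < n \<Longrightarrow> e i \<noteq> \<zero>"
  and e_orth: "i < n \<Longrightarrow> j < n \<Longrightarrow> i \<noteq> j \<Longrightarrow> e i \<otimes> e j = \<zero>"
  and e_sum: "(\<Oplus>i\<in>{..<n}. e i) = \<one>"
  and e_local: "i < n \<Longrightarrow> x \<in> carrier R \<Longrightarrow> e i \<otimes> x = x \<Longrightarrow> x \<otimes> e i = x \<Longrightarrow> unit_at R (e i) x \<or> unit_at R (e i) (e i \<ominus> x)"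
  using li unfolding local_idems_def by blast+

lemma e_ineq:
  assumes "i < n" "j < n" "i \<noteq> j" "x \<in> carrier R" "y \<in> carrier R" "e i \<otimes> x = x" "x \<otimes> e j = x"
    "e j \<otimes> y = y" "y \<otimes> e i = y" "x \<otimes> y = e i" "y \<otimes> x = e j"
  shows False
  using li assms unfolding local_idems_def by blast

lemma e_sum_unit: 
  assumes "j < n" "a \<in> carrier R" "e j \<otimes> a = a" "a \<otimes> e j = a" "b \<in> carrier R" "e j \<otimes> b = b" "b \<otimes> e j = b"
    "unit_at R (e j) (a \<oplus> b)"
  shows "unit_at R (e j) a \<or> unit_at R (e j) b"
  by (rule unit_at_sum[OF e_closed[OF assms(1)] e_idem[OF assms(1)] e_local[OF assms(1)] assms(2-8)])

lemma e_unit_self: "j < n \<Longrightarrow> unit_at R (e j) (e j)"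
  unfolding unit_at_def using e_closed e_idem by (intro bexI[of _ "e j"]) auto

lemma not_unit_zero: "j < n \<Longrightarrow> \<not> unit_at R (e j) \<zero>"
proof
  assume j: "j < n" and "unit_at R (e j) \<zero>"
  then obtain y where "y \<in> carrier R" "\<zero> \<otimes> y = e j" by (auto simp: unit_at_def)
  then show False using e_nz[OF j] by simp
qed

lemma sum_closed: "I \<subseteq> {..<n} \<Longrightarrow> (\<Oplus>i\<in>I. e i) \<in> carrier R"
  using e_closed by (intro finsum_closed) auto

lemma sum_mult:
  assumes "I \<subseteq> {..<n}" "i < n"
  shows "(\<Oplus>k\<in>I. e k) \<otimes> e i = (if i \<in> I then e i else \<zero>)" "e i \<otimes> (\<Oplus>k\<in>I. e k) = (if i \<in> I then e i else \<zero>)"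
proof -
  have fin: "finite I" using assms finite_subset by blast
  have "(\<Oplus>k\<in>I. e k) \<otimes> e i = (if i \<in> I then e i else \<zero>) \<and> e i \<otimes> (\<Oplus>k\<in>I. e k) = (if i \<in> I then e i else \<zero>)"
    using fin assms(1)
  proof (induction I)
    case empty then show ?case using e_closed[OF assms(2)] by simp
  next
    case (insert k I)
    then have k: "k < n" "I \<subseteq> {..<n}" by auto
    have "(\<Oplus>k\<in>insert k I. e k) = e k \<oplus> (\<Oplus>k\<in>I. e k)"
      using insert k e_closed by (intro finsum_insert) auto
    then show ?case
      using insert k assms(2) e_closed[OF k(1)] e_closed[OF assms(2)] sum_closed[OF k(2)]
        e_idem[OF assms(2)] e_orth[OF k(1) assms(2)] e_orth[OF assms(2) k(1)]
      by (auto simp: l_distr r_distr)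
  qed
  then show "(\<Oplus>k\<in>I. e k) \<otimes> e i = (if i \<in> I then e i else \<zero>)" "e i \<otimes> (\<Oplus>k\<in>I. e k) = (if i \<in> I then e i else \<zero>)" by auto
qed

text \<open>If such a product were a unit, then \<open>e j = x \<otimes> y\<close> with
  \<open>x\<close> and \<open>y\<close> in the two mixed corners. The element
  \<open>y \<otimes> x\<close> is then a nonzero idempotent of the local corner at
  \<open>e i\<close>, hence equals \<open>e i\<close>, and \<open>e i\<close> and \<open>e j\<close>
  would be equivalent.\<close>

lemma nonunit_single:
  assumes ij: "i < n" "j < n" "i \<noteq> j" and v: "v \<in> carrier R" "e j \<otimes> v = v" and u: "u \<in> carrier R" "u \<otimes> e j = u"
  shows "\<not> unit_at R (e j) (v \<otimes> e i \<otimes> u)"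
proof
  note ei = e_closed[OF ij(1)] e_idem[OF ij(1)] and ej = e_closed[OF ij(2)] e_idem[OF ij(2)]
  assume "unit_at R (e j) (v \<otimes> e i \<otimes> u)"
  then obtain z where z: "z \<in> carrier R" "e j \<otimes> z = z" "z \<otimes> e j = z" "v \<otimes> e i \<otimes> u \<otimes> z = e j" "z \<otimes> (v \<otimes> e i \<otimes> u) = e j"
    by (auto simp: unit_at_def)
  define x where "x = v \<otimes> e i"
  define y where "y = e i \<otimes> u \<otimes> z"
  have x: "x \<in> carrier R" "e j \<otimes> x = x" "x \<otimes> e i = x"
    using v ei ej by (simp_all add: x_def m_assoc) (simp add: m_assoc[symmetric])
  have y: "y \<in> carrier R" "e i \<otimes> y = y" "y \<otimes> e j = y"
    using u ei z ej by (simp_all add: y_def m_assoc) (simp add: m_assoc[symmetric])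
  have xy: "x \<otimes> y = e j"
  proof -
    have "x \<otimes> y = v \<otimes> (e i \<otimes> e i) \<otimes> u \<otimes> z" using v u ei(1) z(1) by (simp add: x_def y_def m_assoc)
    then show ?thesis using z ei by simp
  qed
  define t where "t = y \<otimes> x"
  have t: "t \<in> carrier R" "e i \<otimes> t = t" "t \<otimes> e i = t"
    using x y ei by (simp_all add: t_def m_assoc) (simp add: m_assoc[symmetric])
  have tt: "t \<otimes> t = t"
  proof -
    have "t \<otimes> t = y \<otimes> (x \<otimes> y) \<otimes> x" using x y by (simp add: t_def m_assoc)
    also have "\<dots> = y \<otimes> x" using xy y x ej by simp
    finally show ?thesis by (simp add: t_def)
  qed
  consider "unit_at R (e i) t" | "unit_at R (e i) (e i \<ominus> t)" using e_local[OF ij(1) t] by blast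
  then show False
  proof cases
    case 1
    then obtain w where w: "w \<in> carrier R" "t \<otimes> w = e i" by (auto simp: unit_at_def)
    have "t = t \<otimes> (t \<otimes> w)" using w t by simp
    also have "\<dots> = (t \<otimes> t) \<otimes> w" using w t by (simp add: m_assoc)
    also have "\<dots> = e i" using tt w by simp
    finally have "y \<otimes> x = e i" by (simp add: t_def)
    then show False using e_ineq[OF ij(2,1) ij(3)[symmetric] x(1) y(1) x(2,3) y(2,3) xy] by simp
  next
    case 2
    then obtain w where w: "w \<in> carrier R" "(e i \<ominus> t) \<otimes> w = e i" by (auto simp: unit_at_def)
    have "t = t \<otimes> ((e i \<ominus> t) \<otimes> w)" using w t by simp
    also have "\<dots> = (t \<otimes> (e i \<ominus> t)) \<otimes> w" using w t ei by (simp add: m_assoc)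
    also have "t \<otimes> (e i \<ominus> t) = \<zero>" using t ei tt by (simp add: a_minus_def r_distr r_minus r_neg)
    finally have t0: "t = \<zero>" using w by simp
    have "e j = (x \<otimes> y) \<otimes> (x \<otimes> y)" using xy ej by simp
    also have "\<dots> = x \<otimes> t \<otimes> y" using x y by (simp add: t_def m_assoc)
    also have "\<dots> = \<zero>" using t0 x y by simp
    finally show False using e_nz[OF ij(2)] by simp
  qed
qed

text \<open>In a local corner a sum of non-units is not a unit, so \<open>nonunit_single\<close>
  extends to sums of idempotents other than \<open>e j\<close>.\<close>

lemma nonunit_sum:
  assumes I: "I \<subseteq> {..<n}" and j: "j < n" "j \<notin> I" and v: "v \<in> carrier R" "e j \<otimes> v = v" and u: "u \<in> carrier R" "u \<otimes> e j = u"
  shows "\<not> unit_at R (e j) (v \<otimes> (\<Oplus>i\<in>I. e i) \<otimes> u)"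
proof -
  have "finite I" using I finite_subset by blast
  then show ?thesis using I j(2)
  proof (induction I)
    case empty then show ?case using not_unit_zero[OF j(1)] v u by simp
  next
    case (insert i I)
    then have i: "i < n" "I \<subseteq> {..<n}" "i \<noteq> j" "j \<notin> I" by auto
    note ej = e_closed[OF j(1)] and ei = e_closed[OF i(1)] and eI = sum_closed[OF i(2)]
    have s: "(\<Oplus>k\<in>insert i I. e k) = e i \<oplus> (\<Oplus>k\<in>I. e k)"
      using insert i e_closed by (intro finsum_insert) auto
    show ?case
    proof
      assume "unit_at R (e j) (v \<otimes> (\<Oplus>k\<in>insert i I. e k) \<otimes> u)"
      then have "unit_at R (e j) (v \<otimes> e i \<otimes> u \<oplus> v \<otimes> (\<Oplus>k\<in>I. e k) \<otimes> u)"
        unfolding s using v u ei eI by (simp add: l_distr r_distr)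
      moreover have "e j \<otimes> (v \<otimes> w \<otimes> u) = v \<otimes> w \<otimes> u" "v \<otimes> w \<otimes> u \<otimes> e j = v \<otimes> w \<otimes> u" if "w \<in> carrier R" for w
        using v u ej that by (simp_all add: m_assoc[symmetric]) (simp add: m_assoc)
      ultimately have "unit_at R (e j) (v \<otimes> e i \<otimes> u) \<or> unit_at R (e j) (v \<otimes> (\<Oplus>k\<in>I. e k) \<otimes> u)"
        using v u ei eI by (intro e_sum_unit[OF j(1)]) auto
      then show False using nonunit_single[OF i(1) j(1) i(3) v u] insert.IH i by auto
    qed
  qed
qed

end

lemma end_op_apply: "x \<in> carrier M \<Longrightarrow> (f \<otimes>\<^bsub>end_op A M\<^esub> g) x = g (f x)"
  "x \<in> carrier M \<Longrightarrow> (f \<oplus>\<^bsub>end_op A M\<^esub> g) x = f x \<oplus>\<^bsub>M\<^esub> g x"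
  by (simp_all add: compose_def)

lemma end_op_finsum_apply:
  assumes M: "left_module A M" and X: "\<And>m. m < k \<Longrightarrow> X m \<in> mod_hom A M M" and y: "y \<in> carrier M"
  shows "(\<Oplus>\<^bsub>end_op A M\<^esub>m\<in>{..<k::nat}. X m) y = (\<Oplus>\<^bsub>M\<^esub>m\<in>{..<k}. X m y)"
proof -
  let ?S = "end_op A M"
  interpret M: left_module A M by fact
  interpret S: ring ?S by (rule ring_end_op[OF M])
  show ?thesis using X
  proof (induction k)
    case 0 then show ?case using y by simp
  next
    case (Suc k)
    have c: "(\<lambda>m. X m y) \<in> {..<k} \<rightarrow> carrier M" "X k y \<in> carrier M"
      using lin_closed[OF lin_of_mod_hom[OF Suc.prems] y] by auto
    have "(\<Oplus>\<^bsub>?S\<^esub>m\<in>{..<Suc k}. X m) = X k \<oplus>\<^bsub>?S\<^esub> (\<Oplus>\<^bsub>?S\<^esub>m\<in>{..<k}. X m)"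
      unfolding lessThan_Suc using Suc.prems by (intro S.finsum_insert) auto
    then have "(\<Oplus>\<^bsub>?S\<^esub>m\<in>{..<Suc k}. X m) y = X k y \<oplus>\<^bsub>M\<^esub> (\<Oplus>\<^bsub>M\<^esub>m\<in>{..<k}. X m y)"
      using Suc.IH Suc.prems by (simp only: end_op_apply[OF y] less_SucI)
    also have "\<dots> = (\<Oplus>\<^bsub>M\<^esub>m\<in>{..<Suc k}. X m y)"
      unfolding lessThan_Suc using c by (intro M.M.finsum_insert[symmetric]) auto
    finally show ?case .
  qed
qed

text \<open>
  A unit of \<open>e\<^sub>i End(M) e\<^sub>i\<close> that is a sum of maps factoring through \<open>N\<close> has a summand that is a unit,
  by locality; hence the summand of \<open>M\<close> cut out by \<open>e\<^sub>i\<close> splits off \<open>N\<close>.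
\<close>

lemma local_factor:
  assumes M: "left_module A M" and N: "left_module A N" and li: "local_idems (end_op A M) n e" and i: "i < n"
    and ab: "\<And>m. m < r \<Longrightarrow> lin A M N (a m)" "\<And>m. m < r \<Longrightarrow> lin A N M (b m)"
    and x: "x \<in> carrier (end_op A M)" "\<And>y. y \<in> carrier M \<Longrightarrow> x y = (\<Oplus>\<^bsub>M\<^esub>m\<in>{..<r::nat}. b m (a m y))"
    and u: "unit_at (end_op A M) (e i) (e i \<otimes>\<^bsub>end_op A M\<^esub> x \<otimes>\<^bsub>end_op A M\<^esub> e i)"
  shows "\<exists>al be. lin A M N al \<and> lin A N M be \<and> (\<forall>y\<in>carrier M. be (al y) = e i y)"
proof -
  let ?S = "end_op A M"
  interpret M: left_module A M by fact
  interpret S: ring ?S by (rule ring_end_op[OF M])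
  interpret L: local_ring_idems ?S n e by unfold_locales (rule li)
  note ei = L.e_closed[OF i]
  have eh: "e i \<in> mod_hom A M M" using ei by simp
  have el: "lin A M M (e i)" using eh by (rule lin_of_mod_hom)
  define X where "X m = restrict (\<lambda>y. b m (a m y)) (carrier M)" for m
  have X: "X m \<in> carrier ?S" if "m < r" for m
    using M.restrict_mod_hom[OF lin_comp[OF ab[OF that]]] by (simp add: X_def)
  have red: "e i \<otimes>\<^bsub>?S\<^esub> (e i \<otimes>\<^bsub>?S\<^esub> w \<otimes>\<^bsub>?S\<^esub> e i) = e i \<otimes>\<^bsub>?S\<^esub> w \<otimes>\<^bsub>?S\<^esub> e i"
    "e i \<otimes>\<^bsub>?S\<^esub> w \<otimes>\<^bsub>?S\<^esub> e i \<otimes>\<^bsub>?S\<^esub> e i = e i \<otimes>\<^bsub>?S\<^esub> w \<otimes>\<^bsub>?S\<^esub> e i" if "w \<in> carrier ?S" for w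
    using that ei L.e_idem[OF i] by (simp_all add: S.m_assoc del: end_op_simps) (simp add: S.m_assoc[symmetric] del: end_op_simps)
  have fs: "(\<Oplus>\<^bsub>?S\<^esub>m\<in>{..<k}. X m) \<in> carrier ?S" if "k \<le> r" for k
    using X that by (intro S.finsum_closed) auto
  have fin: "(\<Oplus>\<^bsub>?S\<^esub>m\<in>{..<r}. X m) y = (\<Oplus>\<^bsub>M\<^esub>m\<in>{..<r}. b m (a m y))" if "y \<in> carrier M" for y
    using end_op_finsum_apply[OF M _ that, of r X] X that by (simp add: X_def del: end_op_simps(2-))
  have "x = (\<Oplus>\<^bsub>?S\<^esub>m\<in>{..<r}. X m)"
    by (rule mod_hom_ext[of _ A M M]) (use x fs[of r] fin in auto)
  then have u': "unit_at ?S (e i) (e i \<otimes>\<^bsub>?S\<^esub> (\<Oplus>\<^bsub>?S\<^esub>m\<in>{..<r}. X m) \<otimes>\<^bsub>?S\<^esub> e i)" using u by simp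
  \<comment> \<open>Summands are split off one at a time; by locality either the one split off or
    the remaining sum is a unit.\<close>
  have "k \<le> r \<Longrightarrow> unit_at ?S (e i) (e i \<otimes>\<^bsub>?S\<^esub> (\<Oplus>\<^bsub>?S\<^esub>m\<in>{..<k}. X m) \<otimes>\<^bsub>?S\<^esub> e i) \<Longrightarrow>
      \<exists>m<r. unit_at ?S (e i) (e i \<otimes>\<^bsub>?S\<^esub> X m \<otimes>\<^bsub>?S\<^esub> e i)" for k
  proof (induction k)
    case 0
    then have "unit_at ?S (e i) \<zero>\<^bsub>?S\<^esub>" using ei by (simp del: end_op_simps add: S.l_null S.r_null)
    then show ?case using L.not_unit_zero[OF i] by blast
  next
    case (Suc k)
    have k: "k \<le> r" "k < r" using Suc.prems by auto
    have "(\<Oplus>\<^bsub>?S\<^esub>m\<in>{..<Suc k}. X m) = X k \<oplus>\<^bsub>?S\<^esub> (\<Oplus>\<^bsub>?S\<^esub>m\<in>{..<k}. X m)"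
      unfolding lessThan_Suc using X Suc.prems by (intro S.finsum_insert) auto
    then have "unit_at ?S (e i) (e i \<otimes>\<^bsub>?S\<^esub> X k \<otimes>\<^bsub>?S\<^esub> e i \<oplus>\<^bsub>?S\<^esub> e i \<otimes>\<^bsub>?S\<^esub> (\<Oplus>\<^bsub>?S\<^esub>m\<in>{..<k}. X m) \<otimes>\<^bsub>?S\<^esub> e i)"
      using Suc.prems(2) ei X[OF k(2)] fs[OF k(1)] by (simp del: end_op_simps add: S.l_distr S.r_distr)
    then have "unit_at ?S (e i) (e i \<otimes>\<^bsub>?S\<^esub> X k \<otimes>\<^bsub>?S\<^esub> e i) \<or> unit_at ?S (e i) (e i \<otimes>\<^bsub>?S\<^esub> (\<Oplus>\<^bsub>?S\<^esub>m\<in>{..<k}. X m) \<otimes>\<^bsub>?S\<^esub> e i)"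
      using red[OF X[OF k(2)]] red[OF fs[OF k(1)]] ei X[OF k(2)] fs[OF k(1)]
      by (intro L.e_sum_unit[OF i]) (simp_all del: end_op_simps)
    then show ?case using Suc.IH k by blast
  qed
  from this[OF order_refl u'] obtain m where m: "m < r" "unit_at ?S (e i) (e i \<otimes>\<^bsub>?S\<^esub> X m \<otimes>\<^bsub>?S\<^esub> e i)" by blast
  then obtain z where z: "z \<in> carrier ?S" "e i \<otimes>\<^bsub>?S\<^esub> z = z" "z \<otimes>\<^bsub>?S\<^esub> e i = z" "e i \<otimes>\<^bsub>?S\<^esub> X m \<otimes>\<^bsub>?S\<^esub> e i \<otimes>\<^bsub>?S\<^esub> z = e i"
    by (auto simp: unit_at_def simp del: end_op_simps)
  have zl: "lin A M M z" using z(1) lin_of_mod_hom by simp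
  have "z (e i (b m (a m (e i y)))) = e i y" if y: "y \<in> carrier M" for y
  proof -
    have "e i y = (e i \<otimes>\<^bsub>?S\<^esub> X m \<otimes>\<^bsub>?S\<^esub> e i \<otimes>\<^bsub>?S\<^esub> z) y" using z(4) by simp
    also have "\<dots> = z (e i (X m (e i y)))" using y by (simp only: end_op_apply)
    also have "X m (e i y) = b m (a m (e i y))" using lin_closed[OF el y] by (simp add: X_def)
    finally show ?thesis by simp
  qed
  then show ?thesis
    using lin_comp[OF el ab(1)[OF m(1)]] lin_comp[OF lin_comp[OF ab(2)[OF m(1)] el] zl]
    by (intro exI[of _ "\<lambda>y. a m (e i y)"] exI[of _ "\<lambda>w. z (e i (b m w))"]) simp
qed

text \<open>Idempotents that split off \<open>N\<close> one by one do so simultaneously. This rests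
  on inequivalence: the part of \<open>e j\<close> that passes through the summand already split off
  is not a unit by \<open>nonunit_sum\<close>, so the part through its complement is one.\<close>

lemma krull_schmidt_embed:
  assumes M: "left_module A M" and N: "left_module A N" and li: "local_idems (end_op A M) n e" and I: "I \<subseteq> {..<n}"
    and loc: "\<And>i. i \<in> I \<Longrightarrow> \<exists>al be. lin A M N al \<and> lin A N M be \<and> (\<forall>y\<in>carrier M. be (al y) = e i y)"
  shows "\<exists>al be. lin A M N al \<and> lin A N M be \<and> (\<forall>y\<in>carrier M. be (al y) = (\<Oplus>\<^bsub>end_op A M\<^esub>i\<in>I. e i) y)"
proof -
  let ?S = "end_op A M"
  interpret M: left_module A M by fact
  interpret N: left_module A N by fact
  interpret S: ring ?S by (rule ring_end_op[OF M])
  interpret L: local_ring_idems ?S n e by unfold_locales (rule li)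
  have hom: "f \<in> mod_hom A M M \<longleftrightarrow> f \<in> carrier ?S" for f by simp
  have "finite I" using I finite_subset by blast
  \<comment> \<open>The two added conjuncts normalize the maps to the part of \<open>M\<close> cut
    out by \<open>I\<close>. They make the old and the new maps orthogonal in the induction
    step.\<close>
  then have "\<exists>al be. lin A M N al \<and> lin A N M be \<and> (\<forall>y\<in>carrier M. be (al y) = (\<Oplus>\<^bsub>?S\<^esub>i\<in>I. e i) y) \<and>
     (\<forall>y\<in>carrier M. al ((\<Oplus>\<^bsub>?S\<^esub>i\<in>I. e i) y) = al y) \<and> (\<forall>z\<in>carrier N. (\<Oplus>\<^bsub>?S\<^esub>i\<in>I. e i) (be z) = be z)"
    using I loc
  proof (induction I)
    case empty
    then show ?case
      using N.lin_const_zero[OF M] M.lin_const_zero[OF N]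
      by (intro exI[of _ "\<lambda>_. \<zero>\<^bsub>N\<^esub>"] exI[of _ "\<lambda>_. \<zero>\<^bsub>M\<^esub>"]) auto
  next
    case (insert j I)
    have j: "j < n" "I \<subseteq> {..<n}" "j \<notin> I" using insert by auto
    let ?eI = "\<Oplus>\<^bsub>?S\<^esub>i\<in>I. e i"
    obtain al be where ab: "lin A M N al" "lin A N M be" "\<And>y. y\<in>carrier M \<Longrightarrow> be (al y) = ?eI y"
      "\<And>y. y\<in>carrier M \<Longrightarrow> al (?eI y) = al y" "\<And>z. z\<in>carrier N \<Longrightarrow> ?eI (be z) = be z"
      using insert.IH[OF j(2) insert.prems(2)] by blast
    obtain a0 b0 where ab0: "lin A M N a0" "lin A N M b0" "\<And>y. y\<in>carrier M \<Longrightarrow> b0 (a0 y) = e j y"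
      using insert.prems(2)[of j] by blast
    note ej = L.e_closed[OF j(1)] and eI = L.sum_closed[OF j(2)]
    have ejl: "lin A M M (e j)" using ej lin_of_mod_hom by simp
    have eIl: "lin A M M ?eI" using eI lin_of_mod_hom by simp
    define a where "a y = a0 (e j y)" for y
    define b where "b z = e j (b0 z)" for z
    have a: "lin A M N a" unfolding a_def by (rule lin_comp[OF ejl ab0(1)])
    have b: "lin A N M b" unfolding b_def by (rule lin_comp[OF ab0(2) ejl])
    have eje: "e j (e j y) = e j y" if "y \<in> carrier M" for y
      using L.e_idem[OF j(1)] end_op_apply(1)[OF that, where f = "e j" and A = A and g = "e j"] by simp
    have eIj: "e j (?eI y) = \<zero>\<^bsub>M\<^esub>" "?eI (e j y) = \<zero>\<^bsub>M\<^esub>" if "y \<in> carrier M" for y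
      using L.sum_mult[OF j(2,1)] j(3) end_op_apply(1)[OF that, where f = ?eI and A = A and g = "e j"] end_op_apply(1)[OF that, where f = "e j" and A = A and g = ?eI] that
      by simp_all
    have ba: "b (a y) = e j y" if "y \<in> carrier M" for y
      using ab0(3)[OF lin_closed[OF ejl that]] eje that lin_closed[OF ejl that] by (simp add: a_def b_def)
    \<comment> \<open>\<open>g\<close> is the projection of \<open>N\<close> onto the kernel of
      \<open>be\<close>, a complement of the part already used.\<close>
    define g where "g z = z \<ominus>\<^bsub>N\<^esub> al (be z)" for z
    have g: "lin A N N g" unfolding g_def by (intro N.lin_diff lin_id lin_comp[OF ab(2) ab(1)])
    have gal: "g (al y) = \<zero>\<^bsub>N\<^esub>" if "y \<in> carrier M" for y
      using ab(3,4) that lin_closed[OF ab(1) that] N.M.diff_self by (simp add: g_def)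
    have beg: "be (g z) = \<zero>\<^bsub>M\<^esub>" if z: "z \<in> carrier N" for z
    proof -
      note bz = lin_closed[OF ab(2) z]
      have "be (g z) = be z \<ominus>\<^bsub>M\<^esub> be (al (be z))"
        unfolding g_def by (rule lin_sub[OF N M ab(2) z lin_closed[OF ab(1) bz]])
      then show ?thesis using ab(3)[OF bz] ab(5)[OF z] M.M.diff_self[OF bz] by simp
    qed
    have gg: "g (g z) = g z" if z: "z \<in> carrier N" for z
    proof -
      note gz = lin_closed[OF g z]
      have "g (g z) = g z \<ominus>\<^bsub>N\<^esub> al (be (g z))" by (simp add: g_def)
      also have "\<dots> = g z \<ominus>\<^bsub>N\<^esub> \<zero>\<^bsub>N\<^esub>" using beg[OF z] lin_zero[OF M N ab(1)] by simp
      finally show ?thesis using gz by (simp add: a_minus_def)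
    qed
    define u where "u = restrict (\<lambda>y. b (al y)) (carrier M)"
    define v where "v = restrict (\<lambda>y. be (a y)) (carrier M)"
    define c where "c = restrict (\<lambda>y. b (g (a y))) (carrier M)"
    have uS: "u \<in> carrier ?S" and vS: "v \<in> carrier ?S" and cS: "c \<in> carrier ?S"
      unfolding u_def v_def c_def
      using M.restrict_mod_hom[OF lin_comp[OF ab(1) b]] M.restrict_mod_hom[OF lin_comp[OF a ab(2)]]
        M.restrict_mod_hom[OF lin_comp[OF lin_comp[OF a g] b]] by simp_all
    have ejv: "e j \<otimes>\<^bsub>?S\<^esub> v = v" "e j \<otimes>\<^bsub>?S\<^esub> c = c" "c \<otimes>\<^bsub>?S\<^esub> e j = c" and uej: "u \<otimes>\<^bsub>?S\<^esub> e j = u" and veI: "v \<otimes>\<^bsub>?S\<^esub> ?eI = v"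
    proof -
      have eq: "f = g" if "f \<in> carrier ?S" "g \<in> carrier ?S" "\<And>x. x \<in> carrier M \<Longrightarrow> f x = g x" for f g
        using mod_hom_ext[of f A M M g] that by simp
      have 1: "a (e j y) = a y" if "y \<in> carrier M" for y using eje that by (simp add: a_def)
      have 2: "e j (b z) = b z" if "z \<in> carrier N" for z using eje that lin_closed[OF ab0(2)] by (simp add: b_def)
      show "e j \<otimes>\<^bsub>?S\<^esub> v = v" "e j \<otimes>\<^bsub>?S\<^esub> c = c" "c \<otimes>\<^bsub>?S\<^esub> e j = c" "u \<otimes>\<^bsub>?S\<^esub> e j = u" "v \<otimes>\<^bsub>?S\<^esub> ?eI = v"
        by (intro eq S.m_closed ej eI uS vS cS; simp add: end_op_apply 1 2 ab(5) lin_closed[OF ejl] lin_closed[OF g]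
            lin_closed[OF a] lin_closed[OF ab(1)] u_def v_def c_def del: end_op_simps)+
    qed
    \<comment> \<open>\<open>e j\<close> is written as its part through the summand already split
      off plus its part \<open>c\<close> through the complement.\<close>
    have sum: "v \<otimes>\<^bsub>?S\<^esub> u \<oplus>\<^bsub>?S\<^esub> c = e j"
    proof (rule mod_hom_ext)
      show "v \<otimes>\<^bsub>?S\<^esub> u \<oplus>\<^bsub>?S\<^esub> c \<in> mod_hom A M M" "e j \<in> mod_hom A M M"
        unfolding hom using S.a_closed[OF S.m_closed[OF vS uS] cS] ej .
      fix y assume y: "y \<in> carrier M"
      note ay = lin_closed[OF a y]
      note bey = lin_closed[OF ab(2) ay]
      have "(v \<otimes>\<^bsub>?S\<^esub> u \<oplus>\<^bsub>?S\<^esub> c) y = u (v y) \<oplus>\<^bsub>M\<^esub> c y" using y by (simp only: end_op_apply)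
      also have "\<dots> = b (al (be (a y))) \<oplus>\<^bsub>M\<^esub> b (g (a y))" using y bey by (simp add: u_def v_def c_def)
      also have "b (g (a y)) = b (a y) \<ominus>\<^bsub>M\<^esub> b (al (be (a y)))"
        unfolding g_def by (rule lin_sub[OF N M b ay lin_closed[OF ab(1) bey]])
      also have "b (al (be (a y))) \<oplus>\<^bsub>M\<^esub> (b (a y) \<ominus>\<^bsub>M\<^esub> b (al (be (a y)))) = b (a y)"
        using M.M.diff_add_cancel[OF lin_closed[OF b ay] lin_closed[OF b lin_closed[OF ab(1) bey]]]
          lin_closed[OF b ay] lin_closed[OF b lin_closed[OF ab(1) bey]] by (simp add: M.M.a_comm)
      finally show "(v \<otimes>\<^bsub>?S\<^esub> u \<oplus>\<^bsub>?S\<^esub> c) y = e j y" using ba[OF y] by simp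
    qed
    have nu: "\<not> unit_at ?S (e j) (v \<otimes>\<^bsub>?S\<^esub> u)"
      using L.nonunit_sum[OF j(2,1,3) vS ejv(1) uS uej] unfolding veI .
    have vu: "v \<otimes>\<^bsub>?S\<^esub> u \<in> carrier ?S" "e j \<otimes>\<^bsub>?S\<^esub> (v \<otimes>\<^bsub>?S\<^esub> u) = v \<otimes>\<^bsub>?S\<^esub> u" "v \<otimes>\<^bsub>?S\<^esub> u \<otimes>\<^bsub>?S\<^esub> e j = v \<otimes>\<^bsub>?S\<^esub> u"
      using S.m_closed[OF vS uS] S.m_assoc[OF ej vS uS] S.m_assoc[OF vS uS ej] ejv(1) uej by (simp_all del: end_op_simps)
    have "unit_at ?S (e j) (v \<otimes>\<^bsub>?S\<^esub> u \<oplus>\<^bsub>?S\<^esub> c)" unfolding sum by (rule L.e_unit_self[OF j(1)])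
    then have "unit_at ?S (e j) c"
      using L.e_sum_unit[OF j(1) vu cS ejv(2,3)] nu by blast
    then obtain z where z: "z \<in> carrier ?S" "z \<otimes>\<^bsub>?S\<^esub> e j = z" "c \<otimes>\<^bsub>?S\<^esub> z = e j" by (auto simp: unit_at_def simp del: end_op_simps)
    have zl: "lin A M M z" using z(1) lin_of_mod_hom by simp
    define a1 where "a1 y = g (a y)" for y
    \<comment> \<open>\<open>z\<close> inverts \<open>c\<close> in the corner, so composing with it
      turns the passage through the complement into a splitting of \<open>e j\<close>.\<close>
    define b1 where "b1 w = z (b (g w))" for w
    have a1: "lin A M N a1" unfolding a1_def by (rule lin_comp[OF a g])
    have b1: "lin A N M b1" unfolding b1_def by (rule lin_comp[OF lin_comp[OF g b] zl])
    have ba1: "b1 (a1 y) = e j y" if y: "y \<in> carrier M" for y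
    proof -
      have "b1 (a1 y) = z (c y)" using gg[OF lin_closed[OF a y]] y by (simp add: a1_def b1_def c_def)
      also have "\<dots> = (c \<otimes>\<^bsub>?S\<^esub> z) y" using y by (simp only: end_op_apply)
      finally show ?thesis using z(3) by simp
    qed
    have ea1: "a1 (e j y) = a1 y" if "y \<in> carrier M" for y using eje[OF that] by (simp add: a1_def a_def)
    have eb1: "e j (b1 w) = b1 w" if w: "w \<in> carrier N" for w
    proof -
      have "(z \<otimes>\<^bsub>?S\<^esub> e j) (b (g w)) = e j (z (b (g w)))"
        using lin_closed[OF b lin_closed[OF g w]] by (simp only: end_op_apply)
      then show ?thesis using z(2) by (simp add: b1_def)
    qed
    have z1: "be (a1 y) = \<zero>\<^bsub>M\<^esub>" "b1 (al y) = \<zero>\<^bsub>M\<^esub>" if y: "y \<in> carrier M" for y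
      using beg[OF lin_closed[OF a y]] gal[OF y] lin_zero[OF N M b] lin_zero[OF M M zl] by (simp_all add: a1_def b1_def)
    have sI: "(\<Oplus>\<^bsub>?S\<^esub>i\<in>insert j I. e i) = e j \<oplus>\<^bsub>?S\<^esub> ?eI"
      using insert j L.e_closed by (intro S.finsum_insert) auto
    have al1: "al (e j y) = \<zero>\<^bsub>N\<^esub>" if y: "y \<in> carrier M" for y
      using ab(4)[OF lin_closed[OF ejl y]] eIj(2)[OF y] lin_zero[OF M N ab(1)] by simp
    have a1I: "a1 (?eI y) = \<zero>\<^bsub>N\<^esub>" if y: "y \<in> carrier M" for y
      using ea1[OF lin_closed[OF eIl y]] eIj(1)[OF y] lin_zero[OF M N a1] by simp
    have be1: "e j (be w) = \<zero>\<^bsub>M\<^esub>" if w: "w \<in> carrier N" for w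
      using ab(5)[OF w] eIj(1)[OF lin_closed[OF ab(2) w]] by simp
    have b1I: "?eI (b1 w) = \<zero>\<^bsub>M\<^esub>" if w: "w \<in> carrier N" for w
      using eb1[OF w] eIj(2)[OF lin_closed[OF b1 w]] by simp
    let ?al = "\<lambda>y. a1 y \<oplus>\<^bsub>N\<^esub> al y" and ?be = "\<lambda>w. b1 w \<oplus>\<^bsub>M\<^esub> be w"
    have l: "lin A M N ?al" "lin A N M ?be" by (intro N.lin_plus M.lin_plus a1 ab b1)+
    have "?be (?al y) = (e j \<oplus>\<^bsub>?S\<^esub> ?eI) y" "?al ((e j \<oplus>\<^bsub>?S\<^esub> ?eI) y) = ?al y" if y: "y \<in> carrier M" for y
    proof -
      note c1 = lin_closed[OF a1 y] and c2 = lin_closed[OF ab(1) y]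
      have e: "(e j \<oplus>\<^bsub>?S\<^esub> ?eI) y = e j y \<oplus>\<^bsub>M\<^esub> ?eI y" using y by (simp only: end_op_apply)
      show "?be (?al y) = (e j \<oplus>\<^bsub>?S\<^esub> ?eI) y"
        unfolding e lin_add[OF b1 c1 c2] lin_add[OF ab(2) c1 c2] z1[OF y] ba1[OF y] ab(3)[OF y]
        using lin_closed[OF ejl y] lin_closed[OF eIl y] by simp
      show "?al ((e j \<oplus>\<^bsub>?S\<^esub> ?eI) y) = ?al y"
        unfolding e lin_add[OF a1 lin_closed[OF ejl y] lin_closed[OF eIl y]] lin_add[OF ab(1) lin_closed[OF ejl y] lin_closed[OF eIl y]]
          ea1[OF y] a1I[OF y] al1[OF y] ab(4)[OF y]
        using c1 c2 by simp
    qed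
    moreover have "(e j \<oplus>\<^bsub>?S\<^esub> ?eI) (?be w) = ?be w" if w: "w \<in> carrier N" for w
    proof -
      note c1 = lin_closed[OF b1 w] and c2 = lin_closed[OF ab(2) w]
      have e: "(e j \<oplus>\<^bsub>?S\<^esub> ?eI) y = e j y \<oplus>\<^bsub>M\<^esub> ?eI y" if "y \<in> carrier M" for y using that by (simp only: end_op_apply)
      show ?thesis
        unfolding e[OF M.M.a_closed[OF c1 c2]] lin_add[OF ejl c1 c2] lin_add[OF eIl c1 c2] eb1[OF w] be1[OF w] b1I[OF w] ab(5)[OF w]
        using c1 c2 by simp
    qed
    ultimately show ?case unfolding sI using l by blast
  qed
  then show ?thesis by blast
qed

text \<open>All clauses are equations and inequations in the ring. This carries the effect of
  basicness from one module to another with the same endomorphism ring.\<close>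

lemma local_idems_iso:
  assumes S: "ring S" and T: "ring T" and h: "h \<in> ring_iso S T" and li: "local_idems S n e"
  shows "local_idems T n (\<lambda>i. h (e i))"
proof -
  interpret S: ring S by fact
  interpret T: ring T by fact
  interpret L: local_ring_idems S n e by unfold_locales (rule li)
  have hh: "h \<in> ring_hom S T" and bij: "bij_betw h (carrier S) (carrier T)" using h by (auto simp: ring_iso_def)
  interpret H: ring_hom_ring S T h by (rule ring_hom_ringI2[OF S T hh])
  have sur: "\<exists>x\<in>carrier S. t = h x" if "t \<in> carrier T" for t using bij that by (auto simp: bij_betw_def)
  have eq: "h x = h y \<longleftrightarrow> x = y" if "x \<in> carrier S" "y \<in> carrier S" for x y
    using bij that by (auto simp: bij_betw_def inj_on_eq_iff)
  have unit: "unit_at T (h a) (h x)" if "unit_at S a x" "a \<in> carrier S" "x \<in> carrier S" for a x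
  proof -
    obtain y where "y \<in> carrier S" "a \<otimes>\<^bsub>S\<^esub> y = y" "y \<otimes>\<^bsub>S\<^esub> a = y" "x \<otimes>\<^bsub>S\<^esub> y = a" "y \<otimes>\<^bsub>S\<^esub> x = a"
      using \<open>unit_at S a x\<close> by (auto simp: unit_at_def)
    then show ?thesis unfolding unit_at_def
      using that by (intro bexI[of _ "h y"] conjI) (simp_all flip: H.hom_mult)
  qed
  show ?thesis
    unfolding local_idems_def
  proof (intro conjI allI impI ballI)
    fix i assume i: "i < n"
    note ei = L.e_closed[OF i]
    show "h (e i) \<in> carrier T" using ei by simp
    show "h (e i) \<otimes>\<^bsub>T\<^esub> h (e i) = h (e i)" using L.e_idem[OF i] ei by (simp flip: H.hom_mult)
    show "h (e i) \<noteq> \<zero>\<^bsub>T\<^esub>" using L.e_nz[OF i] eq[OF ei S.zero_closed] by simp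
    fix t assume t: "t \<in> carrier T" "h (e i) \<otimes>\<^bsub>T\<^esub> t = t" "t \<otimes>\<^bsub>T\<^esub> h (e i) = t"
    obtain x where x: "x \<in> carrier S" "t = h x" using sur[OF t(1)] by blast
    have "e i \<otimes>\<^bsub>S\<^esub> x = x" "x \<otimes>\<^bsub>S\<^esub> e i = x"
      using t(2,3) x ei eq[of "e i \<otimes>\<^bsub>S\<^esub> x" x] eq[of "x \<otimes>\<^bsub>S\<^esub> e i" x] by simp_all
    then have "unit_at S (e i) x \<or> unit_at S (e i) (e i \<ominus>\<^bsub>S\<^esub> x)" by (rule L.e_local[OF i x(1)])
    moreover have "h (e i \<ominus>\<^bsub>S\<^esub> x) = h (e i) \<ominus>\<^bsub>T\<^esub> t" using ei x by (simp add: a_minus_def)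
    ultimately show "unit_at T (h (e i)) t \<or> unit_at T (h (e i)) (h (e i) \<ominus>\<^bsub>T\<^esub> t)"
      using unit[OF _ ei x(1)] unit[OF _ ei S.minus_closed[OF ei x(1)]] x(2) by auto
  next
    fix i j assume i: "i < n" and j: "j < n" and ij: "i \<noteq> j"
    note ei = L.e_closed[OF i] and ej = L.e_closed[OF j]
    show "h (e i) \<otimes>\<^bsub>T\<^esub> h (e j) = \<zero>\<^bsub>T\<^esub>" using L.e_orth[OF i j ij] ei ej by (simp flip: H.hom_mult)
    show "\<not> (\<exists>x\<in>carrier T. \<exists>y\<in>carrier T. h (e i) \<otimes>\<^bsub>T\<^esub> x = x \<and> x \<otimes>\<^bsub>T\<^esub> h (e j) = x \<and>
        h (e j) \<otimes>\<^bsub>T\<^esub> y = y \<and> y \<otimes>\<^bsub>T\<^esub> h (e i) = y \<and> x \<otimes>\<^bsub>T\<^esub> y = h (e i) \<and> y \<otimes>\<^bsub>T\<^esub> x = h (e j))"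
    proof clarify
      fix x y assume xy: "x \<in> carrier T" "y \<in> carrier T" "h (e i) \<otimes>\<^bsub>T\<^esub> x = x" "x \<otimes>\<^bsub>T\<^esub> h (e j) = x"
        "h (e j) \<otimes>\<^bsub>T\<^esub> y = y" "y \<otimes>\<^bsub>T\<^esub> h (e i) = y" "x \<otimes>\<^bsub>T\<^esub> y = h (e i)" "y \<otimes>\<^bsub>T\<^esub> x = h (e j)"
      obtain u v where u: "u \<in> carrier S" "x = h u" and v: "v \<in> carrier S" "y = h v" using sur xy(1,2) by blast
      have "e i \<otimes>\<^bsub>S\<^esub> u = u" "u \<otimes>\<^bsub>S\<^esub> e j = u" "e j \<otimes>\<^bsub>S\<^esub> v = v" "v \<otimes>\<^bsub>S\<^esub> e i = v" "u \<otimes>\<^bsub>S\<^esub> v = e i" "v \<otimes>\<^bsub>S\<^esub> u = e j"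
        using xy(3-8) u v ei ej eq[of "e i \<otimes>\<^bsub>S\<^esub> u" u] eq[of "u \<otimes>\<^bsub>S\<^esub> e j" u] eq[of "e j \<otimes>\<^bsub>S\<^esub> v" v]
          eq[of "v \<otimes>\<^bsub>S\<^esub> e i" v] eq[of "u \<otimes>\<^bsub>S\<^esub> v" "e i"] eq[of "v \<otimes>\<^bsub>S\<^esub> u" "e j"] by simp_all
      then show False by (rule L.e_ineq[OF i j ij u(1) v(1)])
    qed
  next
    have "h (\<Oplus>\<^bsub>S\<^esub>i\<in>{..<k}. e i) = (\<Oplus>\<^bsub>T\<^esub>i\<in>{..<k}. h (e i))" if "k \<le> n" for k
      using that
    proof (induction k)
      case (Suc k)
      then have c: "e \<in> {..<k} \<rightarrow> carrier S" "e k \<in> carrier S" using L.e_closed by auto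
      then have "(\<lambda>i. h (e i)) \<in> {..<k} \<rightarrow> carrier T" "h (e k) \<in> carrier T" using H.hom_closed[OF funcset_mem[OF c(1)]] by auto
      then show ?case using Suc c by (simp add: lessThan_Suc)
    qed simp
    then show "(\<Oplus>\<^bsub>T\<^esub>i\<in>{..<n}. h (e i)) = \<one>\<^bsub>T\<^esub>" using L.e_sum by (metis H.hom_one order_refl)
  qed
qed

section \<open>Endomorphism rings of basic modules\<close>

context fd_algebra
begin

text \<open>The record \<open>end_op\<close> gives a formula for addition but none for negation, so
  the difference is recovered from the sum.\<close>

lemma end_op_minus_apply:
  assumes M: "left_module A M" and f: "f \<in> mod_hom A M M" and g: "g \<in> mod_hom A M M" and x: "x \<in> carrier M"
  shows "(f \<ominus>\<^bsub>end_op A M\<^esub> g) x = f x \<ominus>\<^bsub>M\<^esub> g x"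
proof -
  interpret M: left_module A M by fact
  interpret S: ring "end_op A M" by (rule ring_end_op[OF M])
  have fg: "f \<in> carrier (end_op A M)" "g \<in> carrier (end_op A M)" using f g by simp_all
  have d: "f \<ominus>\<^bsub>end_op A M\<^esub> g \<in> carrier (end_op A M)" using S.minus_closed[OF fg] .
  have "(g \<oplus>\<^bsub>end_op A M\<^esub> (f \<ominus>\<^bsub>end_op A M\<^esub> g)) x = f x"
    using S.diff_add_cancel[OF fg] S.a_comm[OF fg(2) d] by simp
  then have "f x = g x \<oplus>\<^bsub>M\<^esub> (f \<ominus>\<^bsub>end_op A M\<^esub> g) x" using end_op_apply(2)[OF x] by metis
  then show ?thesis
    by (rule M.M.diff_of_sum[symmetric])
      (use d g x lin_closed[OF lin_of_mod_hom] in auto)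
qed

lemma inj_endo_bij:
  fixes M :: "('a, 'm) module"
  assumes M: "fg_module A M" and f: "lin A M M f" and inj: "inj_on f (carrier M)"
  shows "bij_betw f (carrier M) (carrier M)"
proof -
  interpret U: fd_vspace K "underlying_space A M" by (rule fd_vspace_US[OF M])
  show ?thesis using U.inj_endo_surj[OF lin_US[OF f]] inj by (simp add: bij_betw_def)
qed

lemma is_sub_submodule:
  assumes M: "left_module A M" and N: "is_sub A M N"
  shows "submodule N A M"
proof -
  interpret M: left_module A M by fact
  show ?thesis
  proof (intro submodule.intro subgroup.intro submodule_axioms.intro)
    fix x assume "x \<in> N"
    then show "inv\<^bsub>add_monoid M\<^esub> x \<in> N" using M.is_sub_minus[OF N, of x] by (simp add: a_inv_def)
  qed (use N in \<open>auto simp: is_sub_def\<close>)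
qed

text \<open>Kernel and image of a power of \<open>g\<close> decompose \<open>X\<close>, so one of
  them is zero. If it is the kernel, \<open>g\<close> is injective; if it is the image,
  \<open>g\<close> is nilpotent and \<open>x = g x\<close> forces \<open>x = 0\<close>. By dimension
  injective endomorphisms are bijective.\<close>

lemma fitting_indecomposable:
  fixes X :: "('a, 'm) module"
  assumes X: "fg_module A X" and ind: "indecomposable A X" and g: "lin A X X g"
  shows "bij_betw g (carrier X) (carrier X) \<or> bij_betw (\<lambda>x. x \<ominus>\<^bsub>X\<^esub> g x) (carrier X) (carrier X)"
proof -
  note Xm = fg_left_module[OF X]
  interpret X: left_module A X by fact
  interpret U: fd_vspace K "underlying_space A X" by (rule fd_vspace_US[OF X])
  obtain n where n: "n > 0" "{x \<in> carrier X. (g ^^ n) x = \<zero>\<^bsub>X\<^esub>} \<inter> (g ^^ n) ` carrier X = {\<zero>\<^bsub>X\<^esub>}"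
    "\<forall>x\<in>carrier X. \<exists>y\<in>carrier X. (g ^^ n) (x \<ominus>\<^bsub>underlying_space A X\<^esub> (g ^^ n) y) = \<zero>\<^bsub>X\<^esub>"
    using U.fitting[OF lin_US[OF g]] by auto
  \<comment> \<open>Subtraction only involves the additive group, which the two records
    share.\<close>
  have mi: "x \<ominus>\<^bsub>underlying_space A X\<^esub> y = x \<ominus>\<^bsub>X\<^esub> y" for x y
    by (simp add: a_minus_def a_inv_def m_inv_def)
  have pw: "lin A X X (g ^^ m)" for m
  proof (induction m)
    case 0 then show ?case using lin_id by (simp add: id_def)
  next
    case (Suc m) then show ?case using lin_comp[OF Suc.IH g] by (simp add: comp_def)
  qed
  let ?Ke = "{x \<in> carrier X. (g ^^ n) x = \<zero>\<^bsub>X\<^esub>}" and ?Im = "(g ^^ n) ` carrier X"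
  have ke: "is_sub A X ?Ke" by (rule X.is_sub_kernel[OF Xm pw])
  have im: "is_sub A X ?Im" by (rule X.is_sub_image[OF Xm pw X.is_sub_carrier])
  have "?Ke <+>\<^bsub>X\<^esub> ?Im = carrier X"
  proof
    show "?Ke <+>\<^bsub>X\<^esub> ?Im \<subseteq> carrier X" using lin_closed[OF pw] by (auto simp: set_add_def')
    show "carrier X \<subseteq> ?Ke <+>\<^bsub>X\<^esub> ?Im"
    proof
      fix x assume x: "x \<in> carrier X"
      then obtain y where y: "y \<in> carrier X" "(g ^^ n) (x \<ominus>\<^bsub>X\<^esub> (g ^^ n) y) = \<zero>\<^bsub>X\<^esub>" using n(3) mi by auto
      have "x \<ominus>\<^bsub>X\<^esub> (g ^^ n) y \<in> ?Ke" using y x lin_closed[OF pw y(1)] by simp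
      moreover have "x = (x \<ominus>\<^bsub>X\<^esub> (g ^^ n) y) \<oplus>\<^bsub>X\<^esub> (g ^^ n) y" using X.M.diff_add_cancel[OF x lin_closed[OF pw y(1)]] by simp
      ultimately show "x \<in> ?Ke <+>\<^bsub>X\<^esub> ?Im" using y(1) unfolding set_add_def' by blast
    qed
  qed
  then have "?Ke = {\<zero>\<^bsub>X\<^esub>} \<or> ?Im = {\<zero>\<^bsub>X\<^esub>}"
    using ind is_sub_submodule[OF Xm ke] is_sub_submodule[OF Xm im] n(2) unfolding indecomposable_def by blast
  then show ?thesis
  proof
    assume k: "?Ke = {\<zero>\<^bsub>X\<^esub>}"
    obtain n' where n': "n = Suc n'" using n(1) by (cases n) auto
    have "x = \<zero>\<^bsub>X\<^esub>" if x: "x \<in> carrier X" "g x = \<zero>\<^bsub>X\<^esub>" for x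
    proof -
      have "(g ^^ n) x = \<zero>\<^bsub>X\<^esub>" using x(2) lin_zero[OF Xm Xm pw[of n']] by (simp add: n' funpow_swap1)
      then show ?thesis using k x(1) by blast
    qed
    then have "inj_on g (carrier X)" by (rule lin_inj_onI[OF Xm Xm g])
    then show ?thesis using inj_endo_bij[OF X g] by blast
  next
    assume i: "?Im = {\<zero>\<^bsub>X\<^esub>}"
    have l: "lin A X X (\<lambda>x. x \<ominus>\<^bsub>X\<^esub> g x)" by (intro X.lin_diff lin_id g)
    have "x = \<zero>\<^bsub>X\<^esub>" if x: "x \<in> carrier X" "x \<ominus>\<^bsub>X\<^esub> g x = \<zero>\<^bsub>X\<^esub>" for x
    proof -
      have "x = g x" by (rule X.M.diff_eq_zeroD[OF x(1) lin_closed[OF g x(1)] x(2)])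
      then have "(g ^^ m) x = x" for m by (induction m) auto
      then show ?thesis using i x(1) by (metis imageI singletonD)
    qed
    then have "inj_on (\<lambda>x. x \<ominus>\<^bsub>X\<^esub> g x) (carrier X)" by (rule lin_inj_onI[OF Xm Xm l])
    then show ?thesis using inj_endo_bij[OF X l] by blast
  qed
qed

text \<open>The idempotents are the projections onto the indecomposable summands: Fitting's lemma
  makes their corners local, and pairwise non-isomorphic summands make them inequivalent.\<close>

lemma basic_local_idems:
  fixes M :: "('a, 'm) module"
  assumes M: "fg_module A M" and bas: "basic_module A M"
  shows "\<exists>n e. local_idems (end_op A M) n e"
proof -
  note Mm = fg_left_module[OF M]
  interpret M: left_module A M by (rule Mm)
  let ?S = "end_op A M"
  interpret S: ring ?S by (rule ring_end_op[OF Mm])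
  obtain n and X :: "nat \<Rightarrow> ('a, 'm) module" where X: "\<And>i. i < n \<Longrightarrow> fg_module A (X i)" "\<And>i. i < n \<Longrightarrow> indecomposable A (X i)"
    "\<And>i j. i < n \<Longrightarrow> j < n \<Longrightarrow> i \<noteq> j \<Longrightarrow> \<not> mod_iso A (X i) (X j)" and iso: "mod_iso A M (direct_sum n X)"
    using bas unfolding basic_module_def by blast
  note Xm = fg_left_module[OF X(1)]
  obtain f where f: "f \<in> mod_hom A M (direct_sum n X)" "bij_betw f (carrier M) (carrier (direct_sum n X))"
    using iso by (auto simp: mod_iso_def)
  note fl = lin_of_mod_hom[OF f(1)]
  have Dm: "left_module A (direct_sum n X)" by (rule left_module_direct_sum[OF A_ring Xm])
  define fi where "fi = inv_into (carrier M) f"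
  have fi: "lin A (direct_sum n X) M fi" unfolding fi_def by (rule lin_inv_into[OF Mm fl f(2)])
  have ffi: "f (fi y) = y" if "y \<in> carrier (direct_sum n X)" for y
    using that f(2) by (auto simp: fi_def bij_betw_def f_inv_into_f)
  have fif: "fi (f x) = x" if "x \<in> carrier M" for x using that f(2) by (auto simp: fi_def bij_betw_def)
  have inj: "lin A (X i) (direct_sum n X) (dsum_inj n X i)" if "i < n" for i
    by (rule lin_dsum_inj[where M = X, OF _ that]) (rule Xm)
  define P where "P i x = f x i" for i x
  define J where "J i y = fi (dsum_inj n X i y)" for i y
  have P: "lin A M (X i) (P i)" if "i < n" for i
    unfolding P_def by (rule lin_comp[OF fl lin_dsum_proj[OF that]])
  have J: "lin A (X i) M (J i)" if "i < n" for i
    unfolding J_def by (rule lin_comp[OF inj[OF that] fi])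
  have PJ: "P i (J j y) = (if i = j then y else \<zero>\<^bsub>X i\<^esub>)" if "i < n" "j < n" "y \<in> carrier (X j)" for i j y
  proof -
    have "dsum_inj n X j y \<in> carrier (direct_sum n X)"
      by (rule lin_closed[OF inj[OF that(2)] that(3)])
    then show ?thesis using that by (simp add: P_def J_def ffi dsum_inj_def)
  qed
  have JP: "(\<Oplus>\<^bsub>M\<^esub>i\<in>{..<n}. J i (P i x)) = x" if x: "x \<in> carrier M" for x
  proof -
    have fx: "f x \<in> carrier (direct_sum n X)" by (rule lin_closed[OF fl x])
    have c: "dsum_inj n X i (f x i) \<in> carrier (direct_sum n X)" if "i < n" for i
      using lin_closed[OF inj[OF that]] lin_closed[OF P[OF that] x] by (simp add: P_def)
    have "fi (\<Oplus>\<^bsub>direct_sum n X\<^esub>i\<in>{..<n}. dsum_inj n X i (f x i)) = (\<Oplus>\<^bsub>M\<^esub>i\<in>{..<n}. fi (dsum_inj n X i (f x i)))"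
      using c by (intro lin_of_finsum[OF Dm Mm fi]) auto
    then show ?thesis using dsum_decomp[OF A_ring Xm fx] fif[OF x] by (simp add: J_def P_def)
  qed
  define e where "e i = restrict (\<lambda>x. J i (P i x)) (carrier M)" for i
  have eS: "e i \<in> carrier ?S" if "i < n" for i
    using M.restrict_mod_hom[OF lin_comp[OF P[OF that] J[OF that]]] by (simp add: e_def)
  have ea: "e i x = J i (P i x)" if "x \<in> carrier M" for i x using that by (simp add: e_def)
  have eqS: "g = h" if "g \<in> carrier ?S" "h \<in> carrier ?S" "\<And>x. x \<in> carrier M \<Longrightarrow> g x = h x" for g h
    using mod_hom_ext[of g A M M h] that by simp
  have lS: "lin A M M g" if "g \<in> carrier ?S" for g using that lin_of_mod_hom by simp
  note Pc = lin_closed[OF P] and Jc = lin_closed[OF J]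
  \<comment> \<open>An element of the corner is a unit as soon as it is bijective on the summand
    \<open>X i\<close>: its inverse there, composed with projection and injection, lies in the
    corner.\<close>
  have unit: "unit_at ?S (e i) w" if i: "i < n" and w: "w \<in> carrier ?S" "e i \<otimes>\<^bsub>?S\<^esub> w = w" "w \<otimes>\<^bsub>?S\<^esub> e i = w"
    and bij: "bij_betw (\<lambda>y. P i (w (J i y))) (carrier (X i)) (carrier (X i))" for i w
  proof -
    let ?g = "\<lambda>y. P i (w (J i y))"
    have gl: "lin A (X i) (X i) ?g" by (rule lin_comp[OF lin_comp[OF J[OF i] lS[OF w(1)]] P[OF i]])
    let ?h = "inv_into (carrier (X i)) ?g"
    have hl: "lin A (X i) (X i) ?h" by (rule lin_inv_into[OF Xm[OF i] gl bij])
    have hg: "?h (?g y) = y" if "y \<in> carrier (X i)" for y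
      using inv_into_f_f[of ?g "carrier (X i)" y] that bij by (simp add: bij_betw_def)
    have gh: "?g (?h y) = y" if "y \<in> carrier (X i)" for y
      using that bij f_inv_into_f[of y ?g "carrier (X i)"] by (auto simp: bij_betw_def)
    define z where "z = restrict (\<lambda>x. J i (?h (P i x))) (carrier M)"
    have zS: "z \<in> carrier ?S"
      using M.restrict_mod_hom[OF lin_comp[OF lin_comp[OF P[OF i] hl] J[OF i]]] by (simp add: z_def)
    have za: "z x = J i (?h (P i x))" if "x \<in> carrier M" for x using that by (simp add: z_def)
    note wc = lin_closed[OF lS[OF w(1)]] and hc = lin_closed[OF hl] and Pi = Pc[OF i] and Ji = Jc[OF i]
    have w1: "w (J i (P i x)) = w x" "J i (P i (w x)) = w x" if x: "x \<in> carrier M" for x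
      using end_op_apply(1)[OF x, of A "e i" w] end_op_apply(1)[OF x, of A w "e i"] ea[OF x] ea[OF wc[OF x]] w(2,3) by simp_all
    have wh: "?h (P i (w x)) = P i x" "w (J i (?h (P i x))) = J i (P i x)" if x: "x \<in> carrier M" for x
      using hg[OF Pi[OF x]] gh[OF Pi[OF x]] w1(1)[OF x] w1(2)[OF Ji[OF hc[OF Pi[OF x]]]] by simp_all
    have "e i \<otimes>\<^bsub>?S\<^esub> z = z" "z \<otimes>\<^bsub>?S\<^esub> e i = z" "w \<otimes>\<^bsub>?S\<^esub> z = e i" "z \<otimes>\<^bsub>?S\<^esub> w = e i"
      by (intro eqS S.m_closed eS[OF i] zS w(1);
          simp add: end_op_apply ea za wh PJ[OF i i] Ji Pi hc wc del: end_op_simps)+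
    then show ?thesis unfolding unit_at_def using zS by blast
  qed
  have "local_idems ?S n e"
    unfolding local_idems_def
  proof (intro conjI allI impI ballI)
    fix i assume i: "i < n"
    show "e i \<in> carrier ?S" by (rule eS[OF i])
    show "e i \<otimes>\<^bsub>?S\<^esub> e i = e i"
    proof (rule eqS[OF S.m_closed[OF eS[OF i] eS[OF i]] eS[OF i]])
      fix x assume x: "x \<in> carrier M"
      show "(e i \<otimes>\<^bsub>?S\<^esub> e i) x = e i x"
        unfolding end_op_apply(1)[OF x] ea[OF x] ea[OF Jc[OF i Pc[OF i x]]] using PJ[OF i i Pc[OF i x]] by simp
    qed
    show "e i \<noteq> \<zero>\<^bsub>?S\<^esub>"
    proof
      assume z: "e i = \<zero>\<^bsub>?S\<^esub>"
      have "y = \<zero>\<^bsub>X i\<^esub>" if y: "y \<in> carrier (X i)" for y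
      proof -
        have "e i (J i y) = \<zero>\<^bsub>M\<^esub>" using z Jc[OF i y] by simp
        then have "J i y = \<zero>\<^bsub>M\<^esub>" using ea[OF Jc[OF i y]] PJ[OF i i y] by simp
        then have "P i (J i y) = \<zero>\<^bsub>X i\<^esub>" using lin_zero[OF Mm Xm[OF i] P[OF i]] by simp
        then show ?thesis using PJ[OF i i y] by simp
      qed
      then have "trivial_module (X i)"
        using abelian_groupE(2)[OF left_module.M_group[OF Xm[OF i]]] unfolding trivial_module_def by blast
      then show False using X(2)[OF i] by (simp add: indecomposable_def)
    qed
    fix x assume x: "x \<in> carrier ?S" "e i \<otimes>\<^bsub>?S\<^esub> x = x" "x \<otimes>\<^bsub>?S\<^esub> e i = x"
    let ?g = "\<lambda>y. P i (x (J i y))"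
    have gl: "lin A (X i) (X i) ?g" by (rule lin_comp[OF lin_comp[OF J[OF i] lS[OF x(1)]] P[OF i]])
    have d: "e i \<ominus>\<^bsub>?S\<^esub> x \<in> carrier ?S" by (rule S.minus_closed[OF eS[OF i] x(1)])
    have ee: "e i \<otimes>\<^bsub>?S\<^esub> e i = e i" by fact
    have d1: "e i \<otimes>\<^bsub>?S\<^esub> (e i \<ominus>\<^bsub>?S\<^esub> x) = e i \<ominus>\<^bsub>?S\<^esub> x" "(e i \<ominus>\<^bsub>?S\<^esub> x) \<otimes>\<^bsub>?S\<^esub> e i = e i \<ominus>\<^bsub>?S\<^esub> x"
      using eS[OF i] x ee by (simp_all add: a_minus_def S.r_distr S.l_distr S.r_minus S.l_minus del: end_op_simps)
    have dg: "P i ((e i \<ominus>\<^bsub>?S\<^esub> x) (J i y)) = y \<ominus>\<^bsub>X i\<^esub> ?g y" if y: "y \<in> carrier (X i)" for y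
    proof -
      have "(e i \<ominus>\<^bsub>?S\<^esub> x) (J i y) = e i (J i y) \<ominus>\<^bsub>M\<^esub> x (J i y)"
        using end_op_minus_apply[OF Mm _ _ Jc[OF i y]] eS[OF i] x(1) by simp
      also have "e i (J i y) = J i y" using ea[OF Jc[OF i y]] PJ[OF i i y] by simp
      finally have "P i ((e i \<ominus>\<^bsub>?S\<^esub> x) (J i y)) = P i (J i y) \<ominus>\<^bsub>X i\<^esub> ?g y"
        using lin_sub[OF Mm Xm[OF i] P[OF i] Jc[OF i y] lin_closed[OF lS[OF x(1)] Jc[OF i y]]] by simp
      then show ?thesis using PJ[OF i i y] by simp
    qed
    have "bij_betw ?g (carrier (X i)) (carrier (X i)) \<or> bij_betw (\<lambda>y. y \<ominus>\<^bsub>X i\<^esub> ?g y) (carrier (X i)) (carrier (X i))"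
      by (rule fitting_indecomposable[OF X(1)[OF i] X(2)[OF i] gl])
    then show "unit_at ?S (e i) x \<or> unit_at ?S (e i) (e i \<ominus>\<^bsub>?S\<^esub> x)"
    proof
      assume "bij_betw ?g (carrier (X i)) (carrier (X i))"
      then show ?thesis using unit[OF i x] by blast
    next
      assume "bij_betw (\<lambda>y. y \<ominus>\<^bsub>X i\<^esub> ?g y) (carrier (X i)) (carrier (X i))"
      then have "bij_betw (\<lambda>y. P i ((e i \<ominus>\<^bsub>?S\<^esub> x) (J i y))) (carrier (X i)) (carrier (X i))"
        using dg by (subst bij_betw_cong[of _ _ "\<lambda>y. y \<ominus>\<^bsub>X i\<^esub> ?g y"]) auto
      then show ?thesis using unit[OF i d d1] by blast
    qed
  next
    fix i j assume i: "i < n" and j: "j < n" and ij: "i \<noteq> j"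
    show "e i \<otimes>\<^bsub>?S\<^esub> e j = \<zero>\<^bsub>?S\<^esub>"
    proof (rule eqS[OF S.m_closed[OF eS[OF i] eS[OF j]] S.zero_closed])
      fix x assume x: "x \<in> carrier M"
      show "(e i \<otimes>\<^bsub>?S\<^esub> e j) x = \<zero>\<^bsub>?S\<^esub> x"
        unfolding end_op_apply(1)[OF x] ea[OF x] ea[OF Jc[OF i Pc[OF i x]]]
        using PJ[OF j i Pc[OF i x]] ij lin_zero[OF Xm[OF j] Mm J[OF j]] x by simp
    qed
    show "\<not> (\<exists>x\<in>carrier ?S. \<exists>y\<in>carrier ?S. e i \<otimes>\<^bsub>?S\<^esub> x = x \<and> x \<otimes>\<^bsub>?S\<^esub> e j = x \<and>
        e j \<otimes>\<^bsub>?S\<^esub> y = y \<and> y \<otimes>\<^bsub>?S\<^esub> e i = y \<and> x \<otimes>\<^bsub>?S\<^esub> y = e i \<and> y \<otimes>\<^bsub>?S\<^esub> x = e j)"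
    proof (intro notI, elim bexE conjE)
      fix x y assume xS: "x \<in> carrier ?S" and yS: "y \<in> carrier ?S" and xj: "x \<otimes>\<^bsub>?S\<^esub> e j = x" and yi: "y \<otimes>\<^bsub>?S\<^esub> e i = y"
        and xy: "x \<otimes>\<^bsub>?S\<^esub> y = e i" and yx: "y \<otimes>\<^bsub>?S\<^esub> x = e j"
      let ?u = "\<lambda>r. P j (x (J i r))" and ?v = "\<lambda>r. P i (y (J j r))"
      have u: "lin A (X i) (X j) ?u" by (rule lin_comp[OF lin_comp[OF J[OF i] lS[OF xS]] P[OF j]])
      have v: "lin A (X j) (X i) ?v" by (rule lin_comp[OF lin_comp[OF J[OF j] lS[OF yS]] P[OF i]])
      note xc = lin_closed[OF lS[OF xS]] and yc = lin_closed[OF lS[OF yS]]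
      have x1: "J j (P j (x m)) = x m" if m: "m \<in> carrier M" for m
        using xj end_op_apply(1)[OF m, where f = x and g = "e j" and A = A] ea[OF xc[OF m]] by simp
      have y1: "J i (P i (y m)) = y m" if m: "m \<in> carrier M" for m
        using yi end_op_apply(1)[OF m, where f = y and g = "e i" and A = A] ea[OF yc[OF m]] by simp
      have vu: "?v (?u r) = r" if r: "r \<in> carrier (X i)" for r
      proof -
        note Jr = Jc[OF i r]
        have "?v (?u r) = P i (y (x (J i r)))" using x1[OF Jr] by simp
        also have "y (x (J i r)) = e i (J i r)" using xy end_op_apply(1)[OF Jr, where f = x and g = y and A = A] by simp
        finally show ?thesis using ea[OF Jr] PJ[OF i i r] PJ[OF i i] by simp
      qed
      have uv: "?u (?v r) = r" if r: "r \<in> carrier (X j)" for r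
      proof -
        note Jr = Jc[OF j r]
        have "?u (?v r) = P j (x (y (J j r)))" using y1[OF Jr] by simp
        also have "x (y (J j r)) = e j (J j r)" using yx end_op_apply(1)[OF Jr, where f = y and g = x and A = A] by simp
        finally show ?thesis using ea[OF Jr] PJ[OF j j r] PJ[OF j j] by simp
      qed
      \<comment> \<open>Equivalent idempotents would give mutually inverse maps between two of the
        summands.\<close>
      have "bij_betw ?u (carrier (X i)) (carrier (X j))"
        by (rule bij_betw_byWitness[where f' = ?v]) (use vu uv lin_closed[OF u] lin_closed[OF v] in auto)
      then have "mod_iso A (X i) (X j)" by (rule mod_isoI[OF Xm[OF i] u])
      then show False using X(3)[OF i j ij] by blast
    qed
  next
    show "(\<Oplus>\<^bsub>?S\<^esub>i\<in>{..<n}. e i) = \<one>\<^bsub>?S\<^esub>"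
    proof (rule eqS[OF _ S.one_closed])
      show "(\<Oplus>\<^bsub>?S\<^esub>i\<in>{..<n}. e i) \<in> carrier ?S" using eS by (intro S.finsum_closed) auto
      fix x assume x: "x \<in> carrier M"
      show "(\<Oplus>\<^bsub>?S\<^esub>i\<in>{..<n}. e i) x = \<one>\<^bsub>?S\<^esub> x" using end_op_finsum_apply[OF Mm _ x, of n e] eS ea[OF x] JP[OF x] x by simp
    qed
  qed
  then show ?thesis by blast
qed

text \<open>A map to \<open>DA\<close> is the same as a functional, and a functional on a subspace
  extends over a field. The extended functional is turned back into a map to
  \<open>DA\<close>.\<close>

lemma injective_dual_regular: "injective A (dual_regular K A)"
  unfolding injective_def
proof (intro allI ballI impI)
  fix X Y :: "('k, 'a) umodule" and g f
  assume g: "g \<in> mod_hom A X Y" and f: "f \<in> mod_hom A X (dual_regular K A)"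
    and as: "fg_module A X \<and> fg_module A Y \<and> inj_on g (carrier X)"
  interpret O: fd_algebra K "op_alg A" by (rule fd_op_alg)
  note gl = lin_of_mod_hom[OF g] and fl = lin_of_mod_hom[OF f]
  interpret X: left_module A X using as fg_left_module by blast
  interpret Y: left_module A Y using as fg_left_module by blast
  let ?D = "dual_regular K A" and ?UR = "underlying_space (op_alg A) (regular (op_alg A))"
  have orm: "left_module (op_alg A) (regular (op_alg A))" by (rule left_module_regular[OF O.A_ring])
  interpret UR: left_module K ?UR by (rule O.left_module_US[OF orm])
  note Dc = dual_regular_simps(1) and Da = dual_regular_simps(2,3)
  interpret UY: fd_vspace K "underlying_space A Y" using as by (intro fd_vspace_US) auto
  let ?UX = "underlying_space A X" and ?UY = "underlying_space A Y"
  interpret R: left_module K "regular K" by (rule left_module_regular[OF K.ring_axioms])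
  define ph where "ph x = f x \<one>\<^bsub>A\<^esub>" for x
  have phl: "lin K ?UX (regular K) ph"
    unfolding ph_def by (rule functional_of_lin_dual_regular[OF X.left_module_axioms fl])
  let ?W = "g ` carrier X"
  have W: "is_sub A Y ?W" by (rule Y.is_sub_image[OF X.left_module_axioms gl X.is_sub_carrier])
  let ?gi = "inv_into (carrier X) g"
  have gb: "lin A X (Y\<lparr>carrier := ?W\<rparr>) g" "bij_betw g (carrier X) (carrier (Y\<lparr>carrier := ?W\<rparr>))"
    using gl W as by (auto simp: lin_sub_cod is_sub_def bij_betw_def)
  have gil: "lin A (Y\<lparr>carrier := ?W\<rparr>) X ?gi" by (rule lin_inv_into[OF X.left_module_axioms gb])
  have "lin K (?UY\<lparr>carrier := ?W\<rparr>) (regular K) (\<lambda>y. ph (?gi y))"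
    using lin_comp[OF lin_US[OF gil] phl] by (simp add: US_sub)
  then obtain L where L: "lin K ?UY (regular K) L" "\<forall>y\<in>?W. L y = ph (?gi y)"
    using UY.extend_functional[OF R.left_module_axioms is_sub_US[OF W]] by blast
  have Lg: "L (g x) = f x \<one>\<^bsub>A\<^esub>" if "x \<in> carrier X" for x
    using L(2) that as by (simp add: ph_def)
  define H where "H y = (\<lambda>a\<in>carrier A. L (a \<odot>\<^bsub>Y\<^esub> y))" for y
  have Hl: "lin A Y ?D H" unfolding H_def by (rule lin_to_dual_regular[OF Y.left_module_axioms L(1)])
  have "H (g x) = f x" if x: "x \<in> carrier X" for x
  proof (rule mod_hom_ext)
    show "H (g x) \<in> mod_hom K ?UR (regular K)" "f x \<in> mod_hom K ?UR (regular K)"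
      using lin_closed[OF Hl lin_closed[OF gl x]] lin_closed[OF fl x] unfolding Dc by auto
    fix a assume "a \<in> carrier ?UR"
    then have a: "a \<in> carrier A" by simp
    have "H (g x) a = L (g (a \<odot>\<^bsub>X\<^esub> x))" using a lin_smult[OF gl a x] by (simp add: H_def)
    also have "\<dots> = f x (\<one>\<^bsub>A\<^esub> \<otimes>\<^bsub>A\<^esub> a)" using Lg[OF X.smult_closed[OF a x]] lin_smult[OF fl a x] by (simp add: Da)
    finally show "H (g x) a = f x a" using a by simp
  qed
  then show "\<exists>h\<in>mod_hom A Y ?D. \<forall>x\<in>carrier X. h (g x) = f x"
    by (intro bexI[OF _ Y.restrict_mod_hom[OF Hl]]) (use lin_closed[OF gl] in simp)
qed

text \<open>Endomorphisms of the left regular module are right multiplications. They reverse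
  products, which the reversed product of \<open>end_op\<close> compensates.\<close>

lemma ring_iso_end_op_regular:
  "(\<lambda>a. \<lambda>x\<in>carrier A. x \<otimes>\<^bsub>A\<^esub> a) \<in> ring_iso A (end_op A (regular A))"
proof (rule ring_iso_memI)
  interpret R: left_module A "regular A" by (rule left_module_regular[OF A_ring])
  note ap = end_op_apply[of _ "regular A", unfolded regular_simps(1)]
  interpret S: ring "end_op A (regular A)" by (rule ring_end_op[OF R.left_module_axioms])
  have ext: "f = g" if "f \<in> carrier (end_op A (regular A))" "g \<in> carrier (end_op A (regular A))"
    "\<And>x. x \<in> carrier A \<Longrightarrow> f x = g x" for f g
    using mod_hom_ext[of f A "regular A" "regular A" g] that by simp
  show c: "(\<lambda>x\<in>carrier A. x \<otimes>\<^bsub>A\<^esub> a) \<in> carrier (end_op A (regular A))" if a: "a \<in> carrier A" for a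
    using R.restrict_mod_hom[OF lin_from_regular[OF R.left_module_axioms, of a]] a by simp
  show "(\<lambda>x\<in>carrier A. x \<otimes>\<^bsub>A\<^esub> (a \<otimes>\<^bsub>A\<^esub> b)) =
    (\<lambda>x\<in>carrier A. x \<otimes>\<^bsub>A\<^esub> a) \<otimes>\<^bsub>end_op A (regular A)\<^esub> (\<lambda>x\<in>carrier A. x \<otimes>\<^bsub>A\<^esub> b)" if "a \<in> carrier A" "b \<in> carrier A" for a b
    using that by (intro ext c S.m_closed A.m_closed) (simp_all add: ap A.m_assoc del: end_op_simps)
  show "(\<lambda>x\<in>carrier A. x \<otimes>\<^bsub>A\<^esub> (a \<oplus>\<^bsub>A\<^esub> b)) =
    (\<lambda>x\<in>carrier A. x \<otimes>\<^bsub>A\<^esub> a) \<oplus>\<^bsub>end_op A (regular A)\<^esub> (\<lambda>x\<in>carrier A. x \<otimes>\<^bsub>A\<^esub> b)" if "a \<in> carrier A" "b \<in> carrier A" for a b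
    using that by (intro ext c S.a_closed A.a_closed) (simp_all add: ap A.r_distr del: end_op_simps)
  show "(\<lambda>x\<in>carrier A. x \<otimes>\<^bsub>A\<^esub> \<one>\<^bsub>A\<^esub>) = \<one>\<^bsub>end_op A (regular A)\<^esub>" by (simp cong: restrict_cong)
  show "bij_betw (\<lambda>a. \<lambda>x\<in>carrier A. x \<otimes>\<^bsub>A\<^esub> a) (carrier A) (carrier (end_op A (regular A)))"
  proof (rule bij_betw_byWitness[where f' = "\<lambda>f. f \<one>\<^bsub>A\<^esub>"])
    show "(\<lambda>a. \<lambda>x\<in>carrier A. x \<otimes>\<^bsub>A\<^esub> a) ` carrier A \<subseteq> carrier (end_op A (regular A))" using c by blast
    show "\<forall>a\<in>carrier A. (\<lambda>x\<in>carrier A. x \<otimes>\<^bsub>A\<^esub> a) \<one>\<^bsub>A\<^esub> = a" by simp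
    show "(\<lambda>f. f \<one>\<^bsub>A\<^esub>) ` carrier (end_op A (regular A)) \<subseteq> carrier A"
      using lin_closed[OF lin_of_mod_hom, of _ A "regular A" "regular A" "\<one>\<^bsub>A\<^esub>"] by auto
    show "\<forall>f\<in>carrier (end_op A (regular A)). (\<lambda>x\<in>carrier A. x \<otimes>\<^bsub>A\<^esub> f \<one>\<^bsub>A\<^esub>) = f"
    proof
      fix f assume f: "f \<in> carrier (end_op A (regular A))"
      then have fl: "lin A (regular A) (regular A) f" using lin_of_mod_hom by simp
      have f1: "f \<one>\<^bsub>A\<^esub> \<in> carrier A" using lin_closed[OF fl, of "\<one>\<^bsub>A\<^esub>"] by simp
      have e: "x \<otimes>\<^bsub>A\<^esub> f \<one>\<^bsub>A\<^esub> = f x" if "x \<in> carrier A" for x using lin_smult[OF fl, of x "\<one>\<^bsub>A\<^esub>"] that by simp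
      show "(\<lambda>x\<in>carrier A. x \<otimes>\<^bsub>A\<^esub> f \<one>\<^bsub>A\<^esub>) = f" by (intro ext c f f1) (simp add: e)
    qed
  qed
qed

text \<open>Exchange: sorting the primitive idempotents \<open>e j\<close> of \<open>M\<close> by whether they survive in the summand \<open>P\<close>
  or in its complement embeds \<open>M\<close> into \<open>P \<oplus> Q\<close> summand by summand, so \<open>P\<close> is the sum of the first sort,
  each of which is a summand of \<open>N\<close>.\<close>

lemma summand_exchange:
  fixes P :: "('a, 'p) module" and M :: "('a, 'm) module" and N :: "('a, 'n) module"
  assumes M: "fg_module A M" and P: "left_module A P" and N: "left_module A N"
    and li: "local_idems (end_op A M) n e"
    and i: "lin A P M i" and p: "lin A M P p" and pi: "\<And>y. y \<in> carrier P \<Longrightarrow> p (i y) = y" and f: "factors A P N"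
  shows "\<exists>u v. lin A P N u \<and> lin A N P v \<and> (\<forall>y\<in>carrier P. v (u y) = y)"
proof -
  note Mm = fg_left_module[OF M]
  interpret M: left_module A M by (rule Mm)
  interpret P: left_module A P by (rule P)
  let ?S = "end_op A M"
  interpret S: ring ?S by (rule ring_end_op[OF Mm])
  interpret I: local_ring_idems ?S n e by unfold_locales (rule li)
  note Pc = lin_closed[OF p] and Ic = lin_closed[OF i]
  define \<epsilon> where "\<epsilon> = restrict (\<lambda>x. i (p x)) (carrier M)"
  have \<epsilon>S: "\<epsilon> \<in> carrier ?S" using M.restrict_mod_hom[OF lin_comp[OF p i]] by (simp add: \<epsilon>_def)
  have \<epsilon>a: "\<epsilon> x = i (p x)" if "x \<in> carrier M" for x using that by (simp add: \<epsilon>_def)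
  define Q where "Q = {x \<in> carrier M. p x = \<zero>\<^bsub>P\<^esub>}"
  have Q: "is_sub A M Q" unfolding Q_def by (rule M.is_sub_kernel[OF P p])
  have Qm: "left_module A (M\<lparr>carrier := Q\<rparr>)" by (rule M.left_module_sub[OF Q])
  have Qin: "lin A (M\<lparr>carrier := Q\<rparr>) M (\<lambda>x. x)" using Q lin_id[of A M] by (intro lin_sub_dom) (auto simp: is_sub_def)
  have Qpr: "lin A M (M\<lparr>carrier := Q\<rparr>) (\<lambda>x. x \<ominus>\<^bsub>M\<^esub> i (p x))"
    using Q M.lin_diff[OF lin_id lin_comp[OF p i]] lin_sub[OF Mm P p _ Ic[OF Pc]] pi[OF Pc] P.M.diff_self Pc Ic
    by (subst lin_sub_cod) (auto simp: is_sub_def Q_def)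
  define S1 where "S1 = {j \<in> {..<n}. unit_at ?S (e j) (e j \<otimes>\<^bsub>?S\<^esub> \<epsilon> \<otimes>\<^bsub>?S\<^esub> e j)}"
  define S2 where "S2 = {..<n} - S1"
  have sub: "S1 \<subseteq> {..<n}" "S2 \<subseteq> {..<n}" by (auto simp: S1_def S2_def)
  have "\<exists>\<alpha> \<beta>. lin A M P \<alpha> \<and> lin A P M \<beta> \<and> (\<forall>x\<in>carrier M. \<beta> (\<alpha> x) = (\<Oplus>\<^bsub>?S\<^esub>j\<in>S1. e j) x)"
  proof (rule krull_schmidt_embed[OF Mm P li sub(1)])
    fix j assume j: "j \<in> S1"
    show "\<exists>al be. lin A M P al \<and> lin A P M be \<and> (\<forall>y\<in>carrier M. be (al y) = e j y)"
      by (rule local_factor[OF Mm P li, where r = 1 and a = "\<lambda>_. p" and b = "\<lambda>_. i" and x = \<epsilon>])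
        (use j p i \<epsilon>S Ic[OF Pc] in \<open>auto simp: S1_def \<epsilon>a lessThan_Suc simp del: end_op_simps\<close>)
  qed
  then obtain \<alpha>1 \<beta>1 where 1: "lin A M P \<alpha>1" "lin A P M \<beta>1" "\<forall>x\<in>carrier M. \<beta>1 (\<alpha>1 x) = (\<Oplus>\<^bsub>?S\<^esub>j\<in>S1. e j) x" by blast
  have "\<exists>\<alpha> \<beta>. lin A M (M\<lparr>carrier := Q\<rparr>) \<alpha> \<and> lin A (M\<lparr>carrier := Q\<rparr>) M \<beta> \<and> (\<forall>x\<in>carrier M. \<beta> (\<alpha> x) = (\<Oplus>\<^bsub>?S\<^esub>j\<in>S2. e j) x)"
  proof (rule krull_schmidt_embed[OF Mm Qm li sub(2)])
    fix j assume j: "j \<in> S2"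
    then have jn: "j < n" and nu: "\<not> unit_at ?S (e j) (e j \<otimes>\<^bsub>?S\<^esub> \<epsilon> \<otimes>\<^bsub>?S\<^esub> e j)" by (auto simp: S1_def S2_def)
    note ej = I.e_closed[OF jn] I.e_idem[OF jn]
    let ?x = "\<one>\<^bsub>?S\<^esub> \<ominus>\<^bsub>?S\<^esub> \<epsilon>"
    have xS: "?x \<in> carrier ?S" by (rule S.minus_closed[OF S.one_closed \<epsilon>S])
    have id: "e j \<otimes>\<^bsub>?S\<^esub> (e j \<otimes>\<^bsub>?S\<^esub> y \<otimes>\<^bsub>?S\<^esub> e j) = e j \<otimes>\<^bsub>?S\<^esub> y \<otimes>\<^bsub>?S\<^esub> e j"
      "(e j \<otimes>\<^bsub>?S\<^esub> y \<otimes>\<^bsub>?S\<^esub> e j) \<otimes>\<^bsub>?S\<^esub> e j = e j \<otimes>\<^bsub>?S\<^esub> y \<otimes>\<^bsub>?S\<^esub> e j" if y: "y \<in> carrier ?S" for y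
    proof -
      show "e j \<otimes>\<^bsub>?S\<^esub> (e j \<otimes>\<^bsub>?S\<^esub> y \<otimes>\<^bsub>?S\<^esub> e j) = e j \<otimes>\<^bsub>?S\<^esub> y \<otimes>\<^bsub>?S\<^esub> e j"
        using S.m_assoc[OF ej(1) ej(1) S.m_closed[OF y ej(1)]] S.m_assoc[OF ej(1) y ej(1)] ej(2) by (simp del: end_op_simps)
      show "(e j \<otimes>\<^bsub>?S\<^esub> y \<otimes>\<^bsub>?S\<^esub> e j) \<otimes>\<^bsub>?S\<^esub> e j = e j \<otimes>\<^bsub>?S\<^esub> y \<otimes>\<^bsub>?S\<^esub> e j"
        using S.m_assoc[OF S.m_closed[OF ej(1) y] ej(1) ej(1)] ej(2) by (simp del: end_op_simps)
    qed
    have "\<epsilon> \<oplus>\<^bsub>?S\<^esub> ?x = \<one>\<^bsub>?S\<^esub>"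
      using S.diff_add_cancel[OF S.one_closed \<epsilon>S] S.a_comm[OF xS \<epsilon>S] by (simp del: end_op_simps)
    then have "e j \<otimes>\<^bsub>?S\<^esub> \<epsilon> \<otimes>\<^bsub>?S\<^esub> e j \<oplus>\<^bsub>?S\<^esub> e j \<otimes>\<^bsub>?S\<^esub> ?x \<otimes>\<^bsub>?S\<^esub> e j = e j"
      using ej \<epsilon>S xS S.r_distr[OF \<epsilon>S xS ej(1)] S.l_distr[OF S.m_closed[OF ej(1) \<epsilon>S] S.m_closed[OF ej(1) xS] ej(1)]
      by (simp del: end_op_simps)
    then have "unit_at ?S (e j) (e j \<otimes>\<^bsub>?S\<^esub> \<epsilon> \<otimes>\<^bsub>?S\<^esub> e j \<oplus>\<^bsub>?S\<^esub> e j \<otimes>\<^bsub>?S\<^esub> ?x \<otimes>\<^bsub>?S\<^esub> e j)"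
      using I.e_unit_self[OF jn] by (simp only:)
    from I.e_sum_unit[OF jn _ _ _ _ _ _ this] have u: "unit_at ?S (e j) (e j \<otimes>\<^bsub>?S\<^esub> ?x \<otimes>\<^bsub>?S\<^esub> e j)"
      using nu id[OF \<epsilon>S] id[OF xS] S.m_closed[OF S.m_closed[OF ej(1) \<epsilon>S] ej(1)] S.m_closed[OF S.m_closed[OF ej(1) xS] ej(1)]
      by blast
    show "\<exists>al be. lin A M (M\<lparr>carrier := Q\<rparr>) al \<and> lin A (M\<lparr>carrier := Q\<rparr>) M be \<and> (\<forall>y\<in>carrier M. be (al y) = e j y)"
    proof (rule local_factor[OF Mm Qm li jn, where r = 1 and a = "\<lambda>_ x. x \<ominus>\<^bsub>M\<^esub> i (p x)" and b = "\<lambda>_ x. x" and x = ?x])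
      fix y assume y: "y \<in> carrier M"
      have "?x y = y \<ominus>\<^bsub>M\<^esub> i (p y)"
        using end_op_minus_apply[OF Mm, of "\<one>\<^bsub>?S\<^esub>" \<epsilon>, OF _ _ y] S.one_closed \<epsilon>S y by (simp add: \<epsilon>a)
      then show "?x y = (\<Oplus>\<^bsub>M\<^esub>m\<in>{..<1::nat}. y \<ominus>\<^bsub>M\<^esub> i (p y))" using y Ic[OF Pc] by (simp add: lessThan_Suc)
    qed (use Qin Qpr xS u in auto)
  qed
  then obtain \<alpha>2 \<beta>2 where 2: "lin A M (M\<lparr>carrier := Q\<rparr>) \<alpha>2" "lin A (M\<lparr>carrier := Q\<rparr>) M \<beta>2"
    "\<forall>x\<in>carrier M. \<beta>2 (\<alpha>2 x) = (\<Oplus>\<^bsub>?S\<^esub>j\<in>S2. e j) x" by blast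
  have "\<exists>\<alpha> \<beta>. lin A M N \<alpha> \<and> lin A N M \<beta> \<and> (\<forall>x\<in>carrier M. \<beta> (\<alpha> x) = (\<Oplus>\<^bsub>?S\<^esub>j\<in>S1. e j) x)"
  proof (rule krull_schmidt_embed[OF Mm N li sub(1)])
    fix j assume j: "j \<in> S1"
    obtain r a b where a: "\<And>m. m < r \<Longrightarrow> lin A P N (a m)" and b: "\<And>m. m < r \<Longrightarrow> lin A N P (b m)"
      and s: "\<And>y. y \<in> carrier P \<Longrightarrow> (\<Oplus>\<^bsub>P\<^esub>m\<in>{..<r::nat}. b m (a m y)) = y" by (rule factorsE[OF f]) (rule that)
    show "\<exists>al be. lin A M N al \<and> lin A N M be \<and> (\<forall>y\<in>carrier M. be (al y) = e j y)"
    proof (rule local_factor[OF Mm N li, where r = r and a = "\<lambda>m x. a m (p x)" and b = "\<lambda>m x. i (b m x)" and x = \<epsilon>])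
      fix y assume y: "y \<in> carrier M"
      have "i (\<Oplus>\<^bsub>P\<^esub>m\<in>{..<r}. b m (a m (p y))) = (\<Oplus>\<^bsub>M\<^esub>m\<in>{..<r}. i (b m (a m (p y))))"
        using lin_closed[OF b lin_closed[OF a Pc[OF y]]] by (intro lin_of_finsum[OF P Mm i]) auto
      then show "\<epsilon> y = (\<Oplus>\<^bsub>M\<^esub>m\<in>{..<r}. i (b m (a m (p y))))" using s[OF Pc[OF y]] \<epsilon>a[OF y] by simp
    qed (use j lin_comp[OF p a] lin_comp[OF b i] \<epsilon>S in \<open>auto simp: S1_def simp del: end_op_simps\<close>)
  qed
  then obtain \<alpha>3 \<beta>3 where 3: "lin A M N \<alpha>3" "lin A N M \<beta>3" "\<forall>x\<in>carrier M. \<beta>3 (\<alpha>3 x) = (\<Oplus>\<^bsub>?S\<^esub>j\<in>S1. e j) x" by blast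
  have ec: "e \<in> S1 \<rightarrow> carrier ?S" "e \<in> S2 \<rightarrow> carrier ?S" using sub I.e_closed by blast+
  have "(\<Oplus>\<^bsub>?S\<^esub>j\<in>S1 \<union> S2. e j) = (\<Oplus>\<^bsub>?S\<^esub>j\<in>S1. e j) \<oplus>\<^bsub>?S\<^esub> (\<Oplus>\<^bsub>?S\<^esub>j\<in>S2. e j)"
    using ec sub by (intro S.finsum_Un_disjoint) (auto simp: S2_def intro: finite_subset)
  moreover have "S1 \<union> S2 = {..<n}" using sub by (auto simp: S2_def)
  ultimately have "(\<Oplus>\<^bsub>?S\<^esub>j\<in>S1. e j) \<oplus>\<^bsub>?S\<^esub> (\<Oplus>\<^bsub>?S\<^esub>j\<in>S2. e j) = \<one>\<^bsub>?S\<^esub>" using I.e_sum by simp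
  then have sum: "\<beta>1 (\<alpha>1 x) \<oplus>\<^bsub>M\<^esub> \<beta>2 (\<alpha>2 x) = x" if "x \<in> carrier M" for x
    using 1(3) 2(3) that end_op_apply(2)[OF that, where A = A and f = "\<Oplus>\<^bsub>?S\<^esub>j\<in>S1. e j" and g = "\<Oplus>\<^bsub>?S\<^esub>j\<in>S2. e j"]
    by (simp add: end_op_simps(3) del: end_op_simps(1,2,4,5,6))
  note \<alpha>1 = lin_closed[OF 1(1)] and \<beta>1 = lin_closed[OF 1(2)]
  have \<alpha>2: "\<alpha>2 x \<in> Q" if "x \<in> carrier M" for x using lin_closed[OF 2(1) that] by simp
  have Qp: "p y = \<zero>\<^bsub>P\<^esub>" "y \<in> carrier M" if "y \<in> Q" for y using that by (simp_all add: Q_def)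
  \<comment> \<open>\<open>F\<close> sends \<open>M\<close> to \<open>P \<oplus> Q = M\<close> by
    the two embeddings, and \<open>G\<close> is a left inverse of it. Finite dimension makes
    \<open>G\<close> a two-sided inverse.\<close>
  define F where "F x = i (\<alpha>1 x) \<oplus>\<^bsub>M\<^esub> \<alpha>2 x" for x
  define G where "G y = \<beta>1 (p y) \<oplus>\<^bsub>M\<^esub> \<beta>2 (y \<ominus>\<^bsub>M\<^esub> i (p y))" for y
  have Fl: "lin A M M F" unfolding F_def by (intro M.lin_plus lin_comp[OF 1(1) i] lin_comp[OF 2(1) Qin])
  have Gl: "lin A M M G" unfolding G_def by (intro M.lin_plus lin_comp[OF p 1(2)] lin_comp[OF Qpr 2(2)])
  have pF: "p (F x) = \<alpha>1 x" if x: "x \<in> carrier M" for x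
    using lin_add[OF p Ic[OF \<alpha>1[OF x]] Qp(2)[OF \<alpha>2[OF x]]] pi[OF \<alpha>1[OF x]] Qp(1)[OF \<alpha>2[OF x]] \<alpha>1[OF x] by (simp add: F_def)
  have GF: "G (F x) = x" if x: "x \<in> carrier M" for x
  proof -
    have "F x \<ominus>\<^bsub>M\<^esub> i (p (F x)) = \<alpha>2 x"
      unfolding pF[OF x] by (rule M.M.diff_of_sum[OF F_def Ic[OF \<alpha>1[OF x]] Qp(2)[OF \<alpha>2[OF x]]])
    then show ?thesis using sum[OF x] pF[OF x] by (simp add: G_def)
  qed
  have "inj_on F (carrier M)" by (rule inj_on_inverseI[of _ G]) (rule GF)
  then have "F ` carrier M = carrier M" using inj_endo_bij[OF M Fl] by (simp add: bij_betw_def)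
  then have FG: "F (G y) = y" if "y \<in> carrier M" for y using that GF by (metis imageE)
  \<comment> \<open>Bijectivity of \<open>F\<close> shows that \<alpha>1 reaches all of
    \<open>P\<close>, so \<open>P\<close> is isomorphic to the part of \<open>M\<close> cut out by
    \<open>S1\<close>.\<close>
  have ab: "\<alpha>1 (\<beta>1 y) = y" if y: "y \<in> carrier P" for y
  proof -
    have z: "i y \<ominus>\<^bsub>M\<^esub> i (p (i y)) = \<zero>\<^bsub>M\<^esub>" using pi[OF y] Ic[OF y] M.M.diff_self by simp
    have "G (i y) = \<beta>1 y" unfolding G_def z
      using pi[OF y] lin_zero[OF Qm Mm 2(2)] \<beta>1[OF y] by simp
    then show ?thesis using pF[OF lin_closed[OF Gl Ic[OF y]]] FG[OF Ic[OF y]] pi[OF y] by simp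
  qed
  show ?thesis
  proof (intro exI conjI ballI)
    show "lin A P N (\<lambda>y. \<alpha>3 (\<beta>1 y))" "lin A N P (\<lambda>x. \<alpha>1 (\<beta>3 x))"
      by (rule lin_comp[OF 1(2) 3(1)], rule lin_comp[OF 3(2) 1(1)])
    fix y assume y: "y \<in> carrier P"
    \<comment> \<open>Both \<beta>1 \<circ> \<alpha>1 and \<beta>3 \<circ> \<alpha>3 are the
      idempotent belonging to \<open>S1\<close>, so the passage through \<open>P\<close> may be
      replaced by one through \<open>N\<close>.\<close>
    have "\<beta>3 (\<alpha>3 (\<beta>1 y)) = \<beta>1 (\<alpha>1 (\<beta>1 y))" using 1(3) 3(3) \<beta>1[OF y] by simp
    then show "\<alpha>1 (\<beta>3 (\<alpha>3 (\<beta>1 y))) = y" using ab[OF y] by simp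
  qed
qed

end

section \<open>The Morita--Tachikawa identification\<close>

text \<open>For \<open>\<Gamma> = End\<^sub>A(E)\<^sup>o\<^sup>p\<close> the \<open>\<Gamma>\<close>-module \<open>H\<close> below is \<open>DE\<close>.\<close>

locale end_algebra = A: fd_algebra K A + G: fd_algebra K \<Gamma>
  for K :: "'k ring" and A :: "('k, 'a) module" and \<Gamma> :: "('k, 'g) module" +
  fixes E :: "('a, 'e) module" and \<psi> :: "'g \<Rightarrow> 'e \<Rightarrow> 'e"
  assumes E: "fg_module A E" and psi: "\<psi> \<in> alg_iso K \<Gamma> (end_op A E)"
begin

abbreviation "DE \<equiv> mod_hom K (underlying_space A E) (regular K)"

definition H :: "('g, 'e \<Rightarrow> 'k) module" where "H = restrict_scalars \<psi> (dual_over_end K A E)"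

text \<open>The map is restricted first because elements of \<open>end_op\<close> are
  extensional.\<close>

definition pinv :: "('e \<Rightarrow> 'e) \<Rightarrow> 'g" where "pinv f = inv_into (carrier \<Gamma>) \<psi> (restrict f (carrier E))"

sublocale E: left_module A E by (rule A.fg_left_module[OF E])

lemma H_simps [simp]: "carrier H = DE" "\<zero>\<^bsub>H\<^esub> = (\<lambda>z\<in>carrier E. \<zero>\<^bsub>K\<^esub>)" "f \<oplus>\<^bsub>H\<^esub> g = (\<lambda>z\<in>carrier E. f z \<oplus>\<^bsub>K\<^esub> g z)"
  "\<gamma> \<odot>\<^bsub>H\<^esub> f = (\<lambda>z\<in>carrier E. f (\<psi> \<gamma> z))"
  by (simp_all add: H_def dual_over_end_simps)

lemma psi_iso: "\<psi> \<in> ring_iso \<Gamma> (end_op A E)" using psi by (simp add: alg_iso_def)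

lemma psi_hom: "\<gamma> \<in> carrier \<Gamma> \<Longrightarrow> \<psi> \<gamma> \<in> mod_hom A E E"
  using ring_iso_memE(1)[OF psi_iso] by simp

lemma psi_lin: "\<gamma> \<in> carrier \<Gamma> \<Longrightarrow> lin A E E (\<psi> \<gamma>)" using psi_hom lin_of_mod_hom by blast

lemmas psi_closed = lin_closed[OF psi_lin]

lemma psi_simps:
  assumes "\<gamma> \<in> carrier \<Gamma>" "\<delta> \<in> carrier \<Gamma>" "z \<in> carrier E"
  shows "\<psi> (\<gamma> \<otimes>\<^bsub>\<Gamma>\<^esub> \<delta>) z = \<psi> \<delta> (\<psi> \<gamma> z)" "\<psi> (\<gamma> \<oplus>\<^bsub>\<Gamma>\<^esub> \<delta>) z = \<psi> \<gamma> z \<oplus>\<^bsub>E\<^esub> \<psi> \<delta> z"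
  using assms ring_iso_memE(2,3)[OF psi_iso, of \<gamma> \<delta>] by (simp_all add: end_op_apply[of _ E] compose_def)

lemma psi_one: "z \<in> carrier E \<Longrightarrow> \<psi> \<one>\<^bsub>\<Gamma>\<^esub> z = z" using ring_iso_memE(4)[OF psi_iso] by simp

lemma psi_smult: "c \<in> carrier K \<Longrightarrow> \<gamma> \<in> carrier \<Gamma> \<Longrightarrow> z \<in> carrier E \<Longrightarrow> \<psi> (c \<odot>\<^bsub>\<Gamma>\<^esub> \<gamma>) z = (c \<odot>\<^bsub>A\<^esub> \<one>\<^bsub>A\<^esub>) \<odot>\<^bsub>E\<^esub> \<psi> \<gamma> z"
  using psi by (simp add: alg_iso_def)

lemma psi_ext:
  assumes "\<gamma> \<in> carrier \<Gamma>" "\<delta> \<in> carrier \<Gamma>" "\<And>z. z \<in> carrier E \<Longrightarrow> \<psi> \<gamma> z = \<psi> \<delta> z"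
  shows "\<gamma> = \<delta>"
  using inj_onD[OF bij_betw_imp_inj_on[OF ring_iso_memE(5)[OF psi_iso]] mod_hom_ext[OF psi_hom psi_hom]] assms by blast

lemma pinv:
  assumes "lin A E E f"
  shows "pinv f \<in> carrier \<Gamma>" "z \<in> carrier E \<Longrightarrow> \<psi> (pinv f) z = f z"
proof -
  have "restrict f (carrier E) \<in> \<psi> ` carrier \<Gamma>"
    using E.restrict_mod_hom[OF assms] bij_betw_imp_surj_on[OF ring_iso_memE(5)[OF psi_iso]] by simp
  then show "pinv f \<in> carrier \<Gamma>" "z \<in> carrier E \<Longrightarrow> \<psi> (pinv f) z = f z"
    unfolding pinv_def by (auto simp: inv_into_into f_inv_into_f)
qed

lemma DE_lin: "f \<in> DE \<Longrightarrow> lin K (underlying_space A E) (regular K) f" by (rule lin_of_mod_hom)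

lemma DE_apply:
  assumes "f \<in> DE"
  shows "z \<in> carrier E \<Longrightarrow> f z \<in> carrier K" "z \<in> carrier E \<Longrightarrow> w \<in> carrier E \<Longrightarrow> f (z \<oplus>\<^bsub>E\<^esub> w) = f z \<oplus>\<^bsub>K\<^esub> f w"
    "c \<in> carrier K \<Longrightarrow> z \<in> carrier E \<Longrightarrow> f ((c \<odot>\<^bsub>A\<^esub> \<one>\<^bsub>A\<^esub>) \<odot>\<^bsub>E\<^esub> z) = c \<otimes>\<^bsub>K\<^esub> f z"
  using lin_closed[OF DE_lin[OF assms]] lin_add[OF DE_lin[OF assms]] lin_smult[OF DE_lin[OF assms]] by simp_all

lemma DE_ext: "f \<in> DE \<Longrightarrow> g \<in> DE \<Longrightarrow> (\<And>z. z \<in> carrier E \<Longrightarrow> f z = g z) \<Longrightarrow> f = g"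
  using mod_hom_ext[of f K "underlying_space A E" "regular K" g] by simp

lemma DE_restrict: "lin K (underlying_space A E) (regular K) f \<Longrightarrow> restrict f (carrier E) \<in> DE"
  using left_module.restrict_mod_hom[OF A.left_module_US[OF E.left_module_axioms], of "regular K" f] by simp

lemma DE_comp: "f \<in> DE \<Longrightarrow> lin A E E g \<Longrightarrow> (\<lambda>z\<in>carrier E. f (g z)) \<in> DE"
  by (rule DE_restrict[OF lin_comp[OF A.lin_US DE_lin]])

text \<open>A vector is determined by its coordinates, and these are functionals in
  \<open>DE\<close>.\<close>

lemma separates:
  assumes "x \<in> carrier E" "y \<in> carrier E" "\<And>f. f \<in> DE \<Longrightarrow> f x = f y"
  shows "x = y"
proof -
  obtain B st where B: "\<And>b. b \<in> B \<Longrightarrow> st b \<in> DE" "B \<subseteq> carrier E"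
    "\<And>x. x \<in> carrier E \<Longrightarrow> x = (\<Oplus>\<^bsub>underlying_space A E\<^esub>b\<in>B. st b x \<odot>\<^bsub>underlying_space A E\<^esub> b)"
    by (rule A.dual_basis_functionals[OF E]) (rule that)
  interpret U: left_module K "underlying_space A E" by (rule A.left_module_US[OF E.left_module_axioms])
  have e: "st b x = st b y" if "b \<in> B" for b using assms(3)[OF B(1)[OF that]] .
  have "(\<Oplus>\<^bsub>underlying_space A E\<^esub>b\<in>B. st b x \<odot>\<^bsub>underlying_space A E\<^esub> b) = (\<Oplus>\<^bsub>underlying_space A E\<^esub>b\<in>B. st b y \<odot>\<^bsub>underlying_space A E\<^esub> b)"
    using assms(2) B(2) U.smult_closed DE_apply(1)[OF B(1)] e by (intro U.M.finsum_cong') (auto simp del: underlying_space_simps(4))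
  then show ?thesis
    by (rule trans[OF B(3)[OF assms(1)] trans[OF _ B(3)[OF assms(2), symmetric]]])
qed

lemma H_dual: "carrier H = carrier (dual K A E)" "ring.zero H = ring.zero (dual K A E)" "ring.add H = ring.add (dual K A E)"
  by (simp, simp, intro ext, simp)

lemma H_module: "left_module \<Gamma> H"
proof (rule left_moduleI)
  show "ring \<Gamma>" by (rule G.A_ring)
  show "abelian_group H"
    by (rule abelian_group_cong[OF left_module.M_group[OF A.left_module_dual[OF E.left_module_axioms]]])
      (rule H_dual)+
  show "\<one>\<^bsub>\<Gamma>\<^esub> \<odot>\<^bsub>H\<^esub> f = f" if "f \<in> carrier H" for f
    using that DE_comp[OF _ psi_lin[OF G.A.one_closed], of f] by (intro DE_ext) (simp_all add: psi_one)
qed (auto simp: DE_comp[OF _ psi_lin] psi_simps psi_closed DE_apply intro!: restrict_ext)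

sublocale H: left_module \<Gamma> H by (rule H_module)

lemma H_sum:
  assumes "\<And>s. s \<in> S \<Longrightarrow> F s \<in> DE" "z \<in> carrier E"
  shows "(\<Oplus>\<^bsub>H\<^esub>s\<in>S. F s) z = (\<Oplus>\<^bsub>regular K\<^esub>s\<in>S. F s z)"
proof -
  interpret R: left_module K "regular K" by (rule left_module_regular[OF A.K.ring_axioms])
  show ?thesis using assms(1)
  proof (induction S rule: infinite_finite_induct)
    case (infinite S) then show ?case using assms(2) by simp
  next
    case empty then show ?case using assms(2) by simp
  next
    case (insert s S)
    have "F \<in> S \<rightarrow> carrier H" "(\<lambda>s. F s z) \<in> S \<rightarrow> carrier (regular K)" "F s \<in> carrier H" "F s z \<in> carrier (regular K)"
      using insert.prems DE_apply(1)[OF _ assms(2)] by auto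
    then show ?case using insert assms(2) by (subst H.M.finsum_insert, simp_all del: regular_simps(4))
  qed
qed

text \<open>The same functions carry a module structure over \<open>op_alg A\<close> and one over
  \<Gamma>; they agree over \<open>K\<close> because \<psi> respects scalars. Finite generation and
  reflexivity pass from the first to the second in this way.\<close>

lemma lin_US_H: "lin K (underlying_space (op_alg A) (dual K A E)) (underlying_space \<Gamma> H) (\<lambda>f. f)"
  by (rule linI) (simp_all add: psi_smult psi_one psi_closed restrict_def cong: if_cong)

lemma H_fg: "fg_module \<Gamma> H"
proof (rule G.fg_of_US[OF H_module])
  interpret O: fd_algebra K "op_alg A" by (rule A.fd_op_alg)
  have "fg_module K (underlying_space (op_alg A) (dual K A E))"
    using O.fin_gen_US[OF A.fg_dual[OF E]] O.left_module_US[OF A.left_module_dual[OF E.left_module_axioms]]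
    by (simp add: fg_module_def)
  then show "fin_gen K (underlying_space \<Gamma> H)"
    using fg_module_image[OF _ G.left_module_US[OF H_module] lin_US_H] by (simp add: fg_module_def)
qed

section \<open>The module \<open>DE\<close> as a Hom-space over \<open>A\<close>\<close>

text \<open>The map \<open>E \<rightarrow> DA\<close> that corresponds to the functional
  \<open>f\<close> by adjunction.\<close>

definition hat :: "('e \<Rightarrow> 'k) \<Rightarrow> 'e \<Rightarrow> 'a \<Rightarrow> 'k" where "hat f z = (\<lambda>a\<in>carrier A. f (a \<odot>\<^bsub>E\<^esub> z))"

text \<open>\<open>Hom(E, j)\<close> from \<open>Hom(E, DA) = DE\<close> to
  \<open>Hom(E, E) = \<Gamma>\<close>.\<close>

definition to_regular :: "(('a \<Rightarrow> 'k) \<Rightarrow> 'e) \<Rightarrow> ('e \<Rightarrow> 'k) \<Rightarrow> 'g" where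
  "to_regular j f = pinv (\<lambda>z. j (hat f z))"

text \<open>\<open>Hom(E, q)\<close> from \<Gamma> to \<open>Hom(E, DA)\<close>, followed by
  evaluation at \<open>1\<close>, which returns to functionals.\<close>

definition of_regular :: "('e \<Rightarrow> 'a \<Rightarrow> 'k) \<Rightarrow> 'g \<Rightarrow> 'e \<Rightarrow> 'k" where
  "of_regular q \<gamma> = (\<lambda>z\<in>carrier E. q (\<psi> \<gamma> z) \<one>\<^bsub>A\<^esub>)"

text \<open>The right action of \<open>A\<close> on \<open>DE\<close>; it commutes with \<Gamma>
  because \<Gamma> acts on \<open>E\<close> by \<open>A\<close>-linear maps.\<close>

definition rmult :: "'a \<Rightarrow> ('e \<Rightarrow> 'k) \<Rightarrow> 'e \<Rightarrow> 'k" where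
  "rmult a f = (\<lambda>z\<in>carrier E. f (a \<odot>\<^bsub>E\<^esub> z))"

lemma lin_hat: "f \<in> DE \<Longrightarrow> lin A E (dual_regular K A) (hat f)"
  unfolding hat_def by (rule A.lin_to_dual_regular[OF E.left_module_axioms DE_lin])

lemma to_regular:
  assumes j: "lin A (dual_regular K A) E j"
  shows "f \<in> DE \<Longrightarrow> to_regular j f \<in> carrier \<Gamma>" "f \<in> DE \<Longrightarrow> z \<in> carrier E \<Longrightarrow> \<psi> (to_regular j f) z = j (hat f z)"
    "lin \<Gamma> H (regular \<Gamma>) (to_regular j)"
proof -
  show c: "f \<in> DE \<Longrightarrow> to_regular j f \<in> carrier \<Gamma>" and a: "f \<in> DE \<Longrightarrow> z \<in> carrier E \<Longrightarrow> \<psi> (to_regular j f) z = j (hat f z)" for f z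
    unfolding to_regular_def using pinv[OF lin_comp[OF lin_hat j], of f] by blast+
  note hc = lin_closed[OF lin_hat]
  show "lin \<Gamma> H (regular \<Gamma>) (to_regular j)"
  proof (rule linI)
    fix f assume "f \<in> carrier H"
    then have f: "f \<in> DE" by simp
    show "to_regular j f \<in> carrier (regular \<Gamma>)" using c[OF f] by simp
    show "to_regular j (f \<oplus>\<^bsub>H\<^esub> g) = to_regular j f \<oplus>\<^bsub>regular \<Gamma>\<^esub> to_regular j g" if "g \<in> carrier H" for g
    proof -
      have g: "g \<in> DE" "f \<oplus>\<^bsub>H\<^esub> g \<in> DE" using that H.M.a_closed[of f g] f by simp_all
      have "\<psi> (to_regular j (f \<oplus>\<^bsub>H\<^esub> g)) z = \<psi> (to_regular j f \<oplus>\<^bsub>\<Gamma>\<^esub> to_regular j g) z" if z: "z \<in> carrier E" for z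
      proof -
        have "hat (f \<oplus>\<^bsub>H\<^esub> g) z = hat f z \<oplus>\<^bsub>dual_regular K A\<^esub> hat g z"
          using z E.smult_closed by (auto simp: hat_def A.dual_regular_simps intro!: restrict_ext)
        then show ?thesis
          using a[OF f z] a[OF g(1) z] a[OF g(2) z] lin_add[OF j hc[OF f z] hc[OF g(1) z]] psi_simps(2)[OF c[OF f] c[OF g(1)] z]
          by (simp del: H_simps)
      qed
      then show ?thesis using c[OF f] c[OF g(1)] c[OF g(2)] by (simp del: H_simps) (rule psi_ext, auto)
    qed
    show "to_regular j (\<gamma> \<odot>\<^bsub>H\<^esub> f) = \<gamma> \<odot>\<^bsub>regular \<Gamma>\<^esub> to_regular j f" if \<gamma>: "\<gamma> \<in> carrier \<Gamma>" for \<gamma>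
    proof -
      have g: "\<gamma> \<odot>\<^bsub>H\<^esub> f \<in> DE" using H.smult_closed[OF \<gamma>, of f] f by simp
      have "\<psi> (to_regular j (\<gamma> \<odot>\<^bsub>H\<^esub> f)) z = \<psi> (\<gamma> \<otimes>\<^bsub>\<Gamma>\<^esub> to_regular j f) z" if z: "z \<in> carrier E" for z
      proof -
        have "hat (\<gamma> \<odot>\<^bsub>H\<^esub> f) z = hat f (\<psi> \<gamma> z)"
          using z \<gamma> E.smult_closed lin_smult[OF psi_lin[OF \<gamma>]] by (auto simp: hat_def intro!: restrict_ext)
        then show ?thesis
          using a[OF f psi_closed[OF \<gamma> z]] a[OF g z] psi_simps(1)[OF \<gamma> c[OF f] z] by (simp del: H_simps)
      qed
      then show ?thesis using c[OF f] c[OF g] \<gamma> by (simp del: H_simps) (rule psi_ext, auto)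
    qed
  qed
qed

lemma of_regular:
  assumes q: "lin A E (dual_regular K A) q"
  shows "lin \<Gamma> (regular \<Gamma>) H (of_regular q)"
proof (rule linI)
  note ql = A.functional_of_lin_dual_regular[OF E.left_module_axioms q]
  fix \<gamma> assume "\<gamma> \<in> carrier (regular \<Gamma>)"
  then have \<gamma>: "\<gamma> \<in> carrier \<Gamma>" by simp
  have "of_regular q \<gamma> \<in> DE"
    unfolding of_regular_def by (rule DE_restrict[OF lin_comp[OF A.lin_US[OF psi_lin[OF \<gamma>]] ql]])
  then show "of_regular q \<gamma> \<in> carrier H" by simp
  show "of_regular q (\<gamma> \<oplus>\<^bsub>regular \<Gamma>\<^esub> \<delta>) = of_regular q \<gamma> \<oplus>\<^bsub>H\<^esub> of_regular q \<delta>" if "\<delta> \<in> carrier (regular \<Gamma>)" for \<delta>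
    using that \<gamma> lin_add[OF ql, simplified] psi_closed
    by (auto simp: of_regular_def psi_simps intro!: restrict_ext)
  show "of_regular q (\<delta> \<odot>\<^bsub>regular \<Gamma>\<^esub> \<gamma>) = \<delta> \<odot>\<^bsub>H\<^esub> of_regular q \<gamma>" if "\<delta> \<in> carrier \<Gamma>" for \<delta>
    using that \<gamma> psi_closed by (auto simp: of_regular_def psi_simps intro!: restrict_ext)
qed

text \<open>The functor \<open>Hom(E, -)\<close> applied to the identity of \<open>DA\<close>,
  written as a sum of maps through \<open>E\<close>.\<close>

lemma H_coordinates:
  assumes f: "f \<in> DE"
    and j: "\<And>m. m < n \<Longrightarrow> lin A (dual_regular K A) E (j m)" and q: "\<And>m. m < n \<Longrightarrow> lin A E (dual_regular K A) (q m)"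
    and s: "\<And>x. x \<in> carrier (dual_regular K A) \<Longrightarrow> (\<Oplus>\<^bsub>dual_regular K A\<^esub>m\<in>{..<n::nat}. q m (j m x)) = x"
  shows "(\<Oplus>\<^bsub>H\<^esub>m\<in>{..<n}. of_regular (q m) (to_regular (j m) f)) = f"
proof (rule DE_ext[OF _ f])
  have c: "of_regular (q m) (to_regular (j m) f) \<in> DE" if "m < n" for m
    using lin_closed[OF of_regular[OF q[OF that]]] to_regular(1)[OF j[OF that] f] by simp
  then have "(\<Oplus>\<^bsub>H\<^esub>m\<in>{..<n}. of_regular (q m) (to_regular (j m) f)) \<in> carrier H" by (intro H.M.finsum_closed) auto
  then show "(\<Oplus>\<^bsub>H\<^esub>m\<in>{..<n}. of_regular (q m) (to_regular (j m) f)) \<in> DE" by simp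
  fix z assume z: "z \<in> carrier E"
  interpret O: fd_algebra K "op_alg A" by (rule A.fd_op_alg)
  interpret R: left_module K "regular K" by (rule left_module_regular[OF A.K.ring_axioms])
  note hz = lin_closed[OF lin_hat[OF f] z]
  have qj: "q m (j m (hat f z)) \<in> carrier (dual_regular K A)" if "m < n" for m
    by (rule lin_closed[OF q[OF that] lin_closed[OF j[OF that] hz]])
  have "(\<Oplus>\<^bsub>H\<^esub>m\<in>{..<n}. of_regular (q m) (to_regular (j m) f)) z = (\<Oplus>\<^bsub>regular K\<^esub>m\<in>{..<n}. of_regular (q m) (to_regular (j m) f) z)"
    using c z by (intro H_sum) auto
  also have "\<dots> = (\<Oplus>\<^bsub>regular K\<^esub>m\<in>{..<n}. q m (j m (hat f z)) \<one>\<^bsub>A\<^esub>)"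
    using qj z to_regular(2)[OF j f z] O.functional_closed[of _ "regular (op_alg A)" "\<one>\<^bsub>A\<^esub>"]
    by (intro R.M.finsum_cong') (auto simp: of_regular_def A.dual_regular_simps)
  also have "\<dots> = (\<Oplus>\<^bsub>dual_regular K A\<^esub>m\<in>{..<n}. q m (j m (hat f z))) \<one>\<^bsub>A\<^esub>"
    unfolding dual_regular_def using qj
    by (intro O.dual_finsum[symmetric] left_module_regular O.A_ring) (auto simp: dual_regular_def)
  also have "\<dots> = f z" unfolding s[OF hz] using z by (simp add: hat_def E.smult_one)
  finally show "(\<Oplus>\<^bsub>H\<^esub>m\<in>{..<n}. of_regular (q m) (to_regular (j m) f)) z = f z" .
qed

text \<open>From \<open>DA \<in> add E\<close> it follows that \<open>DE = Hom(E, DA)\<close> lies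
  in \<open>add Hom(E, E)\<close>, which is the additive closure of the regular module.\<close>

lemma H_factors_regular:
  assumes "factors A (dual_regular K A) E"
  shows "factors \<Gamma> H (regular \<Gamma>)"
proof -
  obtain n j q where j: "\<And>m. m < n \<Longrightarrow> lin A (dual_regular K A) E (j m)" and q: "\<And>m. m < n \<Longrightarrow> lin A E (dual_regular K A) (q m)"
    and s: "\<And>x. x \<in> carrier (dual_regular K A) \<Longrightarrow> (\<Oplus>\<^bsub>dual_regular K A\<^esub>m\<in>{..<n::nat}. q m (j m x)) = x"
    by (rule factorsE[OF assms]) (rule that)
  show ?thesis
    by (rule factorsI[OF to_regular(3)[OF j] of_regular[OF q]]) (use H_coordinates[OF _ j q s] in auto)
qed

lemma rmult_lin: "a \<in> carrier A \<Longrightarrow> lin \<Gamma> H H (rmult a)"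
proof (rule linI)
  assume a: "a \<in> carrier A"
  fix f assume "f \<in> carrier H"
  then have f: "f \<in> DE" by simp
  show "rmult a f \<in> carrier H"
    unfolding rmult_def H_simps using A.functional_act[OF E.left_module_axioms DE_lin[OF f] a] by (rule DE_restrict)
  show "rmult a (f \<oplus>\<^bsub>H\<^esub> g) = rmult a f \<oplus>\<^bsub>H\<^esub> rmult a g" for g
    using a E.smult_closed by (auto simp: rmult_def intro!: restrict_ext)
  show "rmult a (\<gamma> \<odot>\<^bsub>H\<^esub> f) = \<gamma> \<odot>\<^bsub>H\<^esub> rmult a f" if "\<gamma> \<in> carrier \<Gamma>" for \<gamma>
    using a that E.smult_closed psi_closed lin_smult[OF psi_lin] by (auto simp: rmult_def intro!: restrict_ext)
qed

text \<open>\<open>A \<in> add E\<close> makes \<open>E\<close> faithful, and functionals separate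
  the points of \<open>E\<close>.\<close>

lemma rmult_inj:
  assumes reg: "factors A (regular A) E" and ab: "a \<in> carrier A" "b \<in> carrier A" and eq: "\<And>f. f \<in> DE \<Longrightarrow> rmult a f = rmult b f"
  shows "a = b"
proof -
  obtain n i p where i: "\<And>m. m < n \<Longrightarrow> lin A (regular A) E (i m)" and p: "\<And>m. m < n \<Longrightarrow> lin A E (regular A) (p m)"
    and s: "\<And>x. x \<in> carrier (regular A) \<Longrightarrow> (\<Oplus>\<^bsub>regular A\<^esub>m\<in>{..<n::nat}. p m (i m x)) = x"
    by (rule factorsE[OF reg]) (rule that)
  interpret R: left_module A "regular A" by (rule left_module_regular[OF A.A_ring])
  have az: "a \<odot>\<^bsub>E\<^esub> z = b \<odot>\<^bsub>E\<^esub> z" if z: "z \<in> carrier E" for z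
  proof (rule separates)
    show "f (a \<odot>\<^bsub>E\<^esub> z) = f (b \<odot>\<^bsub>E\<^esub> z)" if "f \<in> DE" for f
      using fun_cong[OF eq[OF that], of z] z by (simp add: rmult_def)
  qed (use ab z E.smult_closed in auto)
  have i1: "i m c = c \<odot>\<^bsub>E\<^esub> i m \<one>\<^bsub>A\<^esub>" "i m \<one>\<^bsub>A\<^esub> \<in> carrier E" if "m < n" "c \<in> carrier A" for m c
    using lin_smult[OF i[OF that(1)] that(2), of "\<one>\<^bsub>A\<^esub>"] lin_closed[OF i[OF that(1)], of "\<one>\<^bsub>A\<^esub>"] that by simp_all
  have "i m a = i m b" if "m < n" for m using i1[OF that ab(1)] i1[OF that ab(2)] az by simp
  then have "(\<Oplus>\<^bsub>regular A\<^esub>m\<in>{..<n}. p m (i m a)) = (\<Oplus>\<^bsub>regular A\<^esub>m\<in>{..<n}. p m (i m b))"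
    using lin_closed[OF p lin_closed[OF i]] ab by (intro R.M.finsum_cong') auto
  then show ?thesis using s ab by simp
qed

text \<open>A \<open>\<Gamma>\<close>-endomorphism of \<open>DE\<close> has the form \<open>f \<mapsto> \<Lambda> \<circ> hat f\<close> for a functional \<open>\<Lambda>\<close> on \<open>DA\<close>,
  and \<open>\<Lambda>\<close> is evaluation at an element of \<open>A\<close>.\<close>

lemma rmult_surj:
  assumes dr: "factors A (dual_regular K A) E" and \<chi>: "lin \<Gamma> H H \<chi>"
  shows "\<exists>a\<in>carrier A. \<forall>f\<in>DE. \<chi> f = rmult a f"
proof -
  obtain n j q where j: "\<And>m. m < n \<Longrightarrow> lin A (dual_regular K A) E (j m)" and q: "\<And>m. m < n \<Longrightarrow> lin A E (dual_regular K A) (q m)"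
    and s: "\<And>x. x \<in> carrier (dual_regular K A) \<Longrightarrow> (\<Oplus>\<^bsub>dual_regular K A\<^esub>m\<in>{..<n::nat}. q m (j m x)) = x"
    by (rule factorsE[OF dr]) (rule that)
  interpret O: fd_algebra K "op_alg A" by (rule A.fd_op_alg)
  interpret R: left_module K "regular K" by (rule left_module_regular[OF A.K.ring_axioms])
  let ?UD = "underlying_space A (dual_regular K A)"
  have DA: "left_module A (dual_regular K A)" using A.fg_left_module[OF A.fg_dual_regular] .
  interpret UD: left_module K ?UD by (rule A.left_module_US[OF DA])
  define h where "h m = \<chi> (of_regular (q m) \<one>\<^bsub>\<Gamma>\<^esub>)" for m
  have one: "of_regular (q m) \<one>\<^bsub>\<Gamma>\<^esub> \<in> carrier H" if "m < n" for m
    by (rule lin_closed[OF of_regular[OF q[OF that]]]) simp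
  have h: "h m \<in> DE" if "m < n" for m using lin_closed[OF \<chi> one[OF that]] by (simp add: h_def)
  \<comment> \<open>By \<open>H_coordinates\<close> and linearity over \<Gamma>, the map \<chi> is
    determined by its values \<open>h m\<close> at the images of \<open>1\<close>; these are
    collected into one functional on \<open>DA\<close>.\<close>
  define \<Lambda> where "\<Lambda> g = (\<Oplus>\<^bsub>regular K\<^esub>m\<in>{..<n}. h m (j m g))" for g
  have \<Lambda>l: "lin K ?UD (regular K) \<Lambda>"
    unfolding \<Lambda>_def
    by (rule R.lin_finsum[OF UD.left_module_axioms]) (use lin_comp[OF A.lin_US[OF j] DE_lin[OF h]] in auto)
  have \<Lambda>: "\<chi> f z = \<Lambda> (hat f z)" if f: "f \<in> DE" and z: "z \<in> carrier E" for f z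
  proof -
    have t: "to_regular (j m) f \<in> carrier \<Gamma>" if "m < n" for m by (rule to_regular(1)[OF j[OF that] f])
    have e: "of_regular (q m) (to_regular (j m) f) = to_regular (j m) f \<odot>\<^bsub>H\<^esub> of_regular (q m) \<one>\<^bsub>\<Gamma>\<^esub>" if "m < n" for m
      using lin_smult[OF of_regular[OF q[OF that]] t[OF that], of "\<one>\<^bsub>\<Gamma>\<^esub>"] t[OF that] by (simp del: H_simps)
    have c: "of_regular (q m) (to_regular (j m) f) \<in> carrier H" if "m < n" for m
      using e[OF that] H.smult_closed[OF t[OF that] one[OF that]] by (simp only:)
    have "\<chi> f = (\<Oplus>\<^bsub>H\<^esub>m\<in>{..<n}. \<chi> (of_regular (q m) (to_regular (j m) f)))"
      using lin_of_finsum[OF H_module H_module \<chi>, of "\<lambda>m. of_regular (q m) (to_regular (j m) f)" "{..<n}"]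
        H_coordinates[OF f j q s] c by auto
    also have "\<dots> = (\<Oplus>\<^bsub>H\<^esub>m\<in>{..<n}. to_regular (j m) f \<odot>\<^bsub>H\<^esub> h m)"
      using e lin_smult[OF \<chi> t one] H.smult_closed[OF t] h by (intro H.M.finsum_cong') (auto simp: h_def simp del: H_simps(2-))
    finally have "\<chi> f z = (\<Oplus>\<^bsub>regular K\<^esub>m\<in>{..<n}. (to_regular (j m) f \<odot>\<^bsub>H\<^esub> h m) z)"
      using H_sum[of "{..<n}" "\<lambda>m. to_regular (j m) f \<odot>\<^bsub>H\<^esub> h m" z] H.smult_closed[OF t] h z by (auto simp del: H_simps(2-))
    also have "\<dots> = \<Lambda> (hat f z)"
      unfolding \<Lambda>_def using to_regular(2)[OF j f z] z lin_closed[OF j lin_closed[OF lin_hat[OF f] z]] DE_apply(1)[OF h]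
      by (intro R.M.finsum_cong') auto
    finally show ?thesis .
  qed
  have "lin K (underlying_space (op_alg (op_alg A)) (dual K (op_alg A) (regular (op_alg A)))) (regular K) \<Lambda>"
    using \<Lambda>l by (simp add: dual_regular_def)
  from O.dual_reflexive[OF O.fg_regular this]
  obtain a where a: "a \<in> carrier A" "\<And>g. g \<in> carrier (dual_regular K A) \<Longrightarrow> \<Lambda> g = g a"
    by (auto simp: A.dual_regular_simps)
  have "\<chi> f = rmult a f" if f: "f \<in> DE" for f
  proof (rule DE_ext)
    show "\<chi> f \<in> DE" "rmult a f \<in> DE" using lin_closed[OF \<chi>, of f] lin_closed[OF rmult_lin[OF a(1)], of f] f by simp_all
    show "\<chi> f z = rmult a f z" if z: "z \<in> carrier E" for z
      using \<Lambda>[OF f z] a(2)[OF lin_closed[OF lin_hat[OF f] z]] a(1) z by (simp add: hat_def rmult_def)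
  qed
  then show ?thesis using a(1) by blast
qed

text \<open>\<open>A \<in> add E\<close> puts \<open>E = Hom(A, E)\<close> into the additive closure
  of \<Gamma> as a right \<Gamma>-module, and dualizing puts \<open>DE\<close> into
  \<open>add D\<Gamma>\<close>. The maps \<open>I m\<close> and \<open>P m\<close> are the duals of
  evaluation at \<open>i m \<one>\<close> and of \<open>w m\<close>.\<close>

lemma H_factors_dual_regular:
  assumes "factors A (regular A) E"
  shows "factors \<Gamma> H (dual_regular K \<Gamma>)"
proof -
  obtain n i p where i: "\<And>m. m < n \<Longrightarrow> lin A (regular A) E (i m)" and p: "\<And>m. m < n \<Longrightarrow> lin A E (regular A) (p m)"
    and s: "\<And>x. x \<in> carrier (regular A) \<Longrightarrow> (\<Oplus>\<^bsub>regular A\<^esub>m\<in>{..<n::nat}. p m (i m x)) = x"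
    by (rule factorsE[OF assms]) (rule that)
  interpret R: left_module A "regular A" by (rule left_module_regular[OF A.A_ring])
  let ?D = "dual_regular K \<Gamma>"
  have i1: "i m \<one>\<^bsub>A\<^esub> \<in> carrier E" if "m < n" for m using lin_closed[OF i[OF that], of "\<one>\<^bsub>A\<^esub>"] by simp
  define I where "I m f = (\<lambda>\<gamma>\<in>carrier \<Gamma>. f (\<psi> \<gamma> (i m \<one>\<^bsub>A\<^esub>)))" for m and f :: "'e \<Rightarrow> 'k"
  define w where "w m z = pinv (\<lambda>x. p m x \<odot>\<^bsub>E\<^esub> z)" for m z
  define P where "P m u = (\<lambda>z\<in>carrier E. u (w m z))" for m and u :: "'g \<Rightarrow> 'k"
  have wl: "lin A E E (\<lambda>x. p m x \<odot>\<^bsub>E\<^esub> z)" if "m < n" "z \<in> carrier E" for m z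
    using lin_comp[OF p[OF that(1)] A.lin_from_regular[OF E.left_module_axioms that(2)]] .
  have w: "w m z \<in> carrier \<Gamma>" "x \<in> carrier E \<Longrightarrow> \<psi> (w m z) x = p m x \<odot>\<^bsub>E\<^esub> z" if "m < n" "z \<in> carrier E" for m z x
    unfolding w_def using pinv[OF wl[OF that]] by blast+
  have pc: "p m x \<in> carrier A" if "m < n" "x \<in> carrier E" for m x using lin_closed[OF p[OF that(1)] that(2)] by simp
  have Il: "lin \<Gamma> H ?D (I m)" if m: "m < n" for m
    proof -
      have "lin K (underlying_space \<Gamma> H) (regular K) (\<lambda>f. f (i m \<one>\<^bsub>A\<^esub>))"
        using i1[OF m] by (intro linI) (auto simp: DE_apply psi_smult psi_one G.A.one_closed)
      then show ?thesis
        by (rule left_module.lin_cong[OF H_module G.lin_to_dual_regular[OF H_module]])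
          (use i1[OF m] in \<open>auto simp: I_def intro!: restrict_ext\<close>)
    qed
  have Pl: "lin \<Gamma> ?D H (P m)" if m: "m < n" for m
    proof (rule linI)
      fix u assume u: "u \<in> carrier ?D"
      then have ul: "lin K (underlying_space (op_alg \<Gamma>) (regular (op_alg \<Gamma>))) (regular K) u"
        by (simp add: G.dual_regular_simps lin_of_mod_hom)
      have wlin: "lin K (underlying_space A E) (underlying_space (op_alg \<Gamma>) (regular (op_alg \<Gamma>))) (w m)"
      proof (rule linI)
        fix z assume "z \<in> carrier (underlying_space A E)"
        then have z: "z \<in> carrier E" by simp
        show "w m z \<in> carrier (underlying_space (op_alg \<Gamma>) (regular (op_alg \<Gamma>)))" using w[OF m z] by simp
        show "w m (z \<oplus>\<^bsub>underlying_space A E\<^esub> y) = w m z \<oplus>\<^bsub>underlying_space (op_alg \<Gamma>) (regular (op_alg \<Gamma>))\<^esub> w m y"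
          if "y \<in> carrier (underlying_space A E)" for y
        proof -
          have y: "y \<in> carrier E" "z \<oplus>\<^bsub>E\<^esub> y \<in> carrier E" using that z by simp_all
          have "w m (z \<oplus>\<^bsub>E\<^esub> y) = w m z \<oplus>\<^bsub>\<Gamma>\<^esub> w m y"
            using w[OF m z] w[OF m y(1)] w[OF m y(2)] pc[OF m] z y
            by (intro psi_ext) (auto simp: psi_simps E.smult_r_distr)
          then show ?thesis by simp
        qed
        show "w m (c \<odot>\<^bsub>underlying_space A E\<^esub> z) = c \<odot>\<^bsub>underlying_space (op_alg \<Gamma>) (regular (op_alg \<Gamma>))\<^esub> w m z"
          if c: "c \<in> carrier K" for c
        proof -
          have cz: "(c \<odot>\<^bsub>A\<^esub> \<one>\<^bsub>A\<^esub>) \<odot>\<^bsub>E\<^esub> z \<in> carrier E" using z A.sc_closed[OF c] E.smult_closed by simp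
          have "w m ((c \<odot>\<^bsub>A\<^esub> \<one>\<^bsub>A\<^esub>) \<odot>\<^bsub>E\<^esub> z) = w m z \<otimes>\<^bsub>\<Gamma>\<^esub> (c \<odot>\<^bsub>\<Gamma>\<^esub> \<one>\<^bsub>\<Gamma>\<^esub>)"
            using w[OF m z] w[OF m cz] pc[OF m] z E.smult_closed
            by (intro psi_ext)
              (auto simp: psi_simps psi_smult psi_one c G.sc_closed G.A.one_closed A.scalar_commutes[OF E.left_module_axioms])
          then show ?thesis by simp
        qed
      qed
      show "P m u \<in> carrier H" unfolding P_def H_simps by (rule DE_restrict[OF lin_comp[OF wlin ul]])
      show "P m (u \<oplus>\<^bsub>?D\<^esub> v) = P m u \<oplus>\<^bsub>H\<^esub> P m v" if "v \<in> carrier ?D" for v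
        using w[OF m] by (auto simp: P_def G.dual_regular_simps intro!: restrict_ext)
      show "P m (\<delta> \<odot>\<^bsub>?D\<^esub> u) = \<delta> \<odot>\<^bsub>H\<^esub> P m u" if \<delta>: "\<delta> \<in> carrier \<Gamma>" for \<delta>
      proof -
        have "w m (\<psi> \<delta> z) = w m z \<otimes>\<^bsub>\<Gamma>\<^esub> \<delta>" if z: "z \<in> carrier E" for z
          using w[OF m z] w[OF m psi_closed[OF \<delta> z]] \<delta> z pc[OF m] lin_smult[OF psi_lin[OF \<delta>]]
          by (intro psi_ext) (auto simp: psi_simps)
        then show ?thesis using w[OF m] \<delta> psi_closed by (auto simp: P_def G.dual_regular_simps intro!: restrict_ext)
      qed
    qed
  show ?thesis
  proof (rule factorsI[OF Il Pl])
    fix f assume "f \<in> carrier H"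
    then have f: "f \<in> DE" by simp
    have PI: "P m (I m f) \<in> DE" if "m < n" for m
      using lin_closed[OF Pl[OF that] lin_closed[OF Il[OF that], of f]] f by simp
    show "(\<Oplus>\<^bsub>H\<^esub>m\<in>{..<n}. P m (I m f)) = f"
    proof (rule DE_ext[OF _ f])
      have "(\<Oplus>\<^bsub>H\<^esub>m\<in>{..<n}. P m (I m f)) \<in> carrier H" using PI by (intro H.M.finsum_closed) auto
      then show "(\<Oplus>\<^bsub>H\<^esub>m\<in>{..<n}. P m (I m f)) \<in> DE" by simp
      fix z assume z: "z \<in> carrier E"
      interpret RK: left_module K "regular K" by (rule left_module_regular[OF A.K.ring_axioms])
      interpret OA: fd_algebra K "op_alg A" by (rule A.fd_op_alg)
      have pi1: "p m (i m \<one>\<^bsub>A\<^esub>) \<in> carrier A" if "m < n" for m using pc[OF that i1[OF that]] .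
      have "(\<Oplus>\<^bsub>H\<^esub>m\<in>{..<n}. P m (I m f)) z = (\<Oplus>\<^bsub>regular K\<^esub>m\<in>{..<n}. P m (I m f) z)"
        using PI z by (intro H_sum) auto
      also have "\<dots> = (\<Oplus>\<^bsub>regular K\<^esub>m\<in>{..<n}. f (p m (i m \<one>\<^bsub>A\<^esub>) \<odot>\<^bsub>E\<^esub> z))"
        using w(1)[OF _ z] w(2)[OF _ z i1] z DE_apply(1)[OF f E.smult_closed[OF pi1 z]]
        by (intro RK.M.finsum_cong') (auto simp: P_def I_def)
      also have "\<dots> = (\<Oplus>\<^bsub>regular K\<^esub>m\<in>{..<n}. hat f (p m (i m \<one>\<^bsub>A\<^esub>) \<odot>\<^bsub>E\<^esub> z) \<one>\<^bsub>A\<^esub>)"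
        using E.smult_closed[OF pi1 z] DE_apply(1)[OF f E.smult_closed[OF pi1 z]]
        by (intro RK.M.finsum_cong') (auto simp: hat_def E.smult_one)
      also have "\<dots> = (\<Oplus>\<^bsub>dual_regular K A\<^esub>m\<in>{..<n}. hat f (p m (i m \<one>\<^bsub>A\<^esub>) \<odot>\<^bsub>E\<^esub> z)) \<one>\<^bsub>A\<^esub>"
        unfolding dual_regular_def using lin_closed[OF lin_hat[OF f] E.smult_closed[OF pi1 z]]
        by (intro OA.dual_finsum[symmetric] left_module_regular OA.A_ring) (auto simp: dual_regular_def)
      also have "\<dots> = hat f ((\<Oplus>\<^bsub>regular A\<^esub>m\<in>{..<n}. p m (i m \<one>\<^bsub>A\<^esub>)) \<odot>\<^bsub>E\<^esub> z) \<one>\<^bsub>A\<^esub>"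
        using pi1 lin_of_finsum[OF R.left_module_axioms A.fg_left_module[OF A.fg_dual_regular]
            lin_comp[OF A.lin_from_regular[OF E.left_module_axioms z] lin_hat[OF f]], of "\<lambda>m. p m (i m \<one>\<^bsub>A\<^esub>)" "{..<n}"]
        by auto
      also have "\<dots> = f z" using s[of "\<one>\<^bsub>A\<^esub>"] z by (simp add: hat_def E.smult_one)
      finally show "(\<Oplus>\<^bsub>H\<^esub>m\<in>{..<n}. P m (I m f)) z = f z" .
    qed
  qed
qed

text \<open>A \<open>K\<close>-basis of \<open>E\<close> embeds \<open>\<Gamma>\<close> into a power of \<open>DE\<close>.\<close>

lemma injective_factors_H:
  fixes P :: "('g, 'p) module"
  assumes P: "fg_module \<Gamma> P" "injective \<Gamma> P" and ip: "splitting \<Gamma> P (regular \<Gamma>) i p"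
  shows "factors \<Gamma> P H"
proof -
  note Pm = G.fg_left_module[OF P(1)]
  obtain B st where B: "finite B" "B \<subseteq> carrier E" "\<And>b. b \<in> B \<Longrightarrow> st b \<in> DE"
    "\<And>x. x \<in> carrier E \<Longrightarrow> x = (\<Oplus>\<^bsub>underlying_space A E\<^esub>b\<in>B. st b x \<odot>\<^bsub>underlying_space A E\<^esub> b)"
    by (rule A.dual_basis_functionals[OF E]) (rule that)
  obtain N and b :: "nat \<Rightarrow> 'e" where b: "B = b ` {l. l < N}" using finite_imp_nat_seg_image_inj_on[OF B(1)] by blast
  interpret U: left_module K "underlying_space A E" by (rule A.left_module_US[OF E.left_module_axioms])
  let ?Y = "direct_sum N (\<lambda>_. H)"
  have Y: "fg_module \<Gamma> ?Y" by (rule G.fg_direct_sum) (rule H_fg)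
  define g where "g \<gamma> = (\<lambda>l\<in>{..<N}. \<gamma> \<odot>\<^bsub>H\<^esub> st (b l))" for \<gamma>
  have stH: "st (b l) \<in> carrier H" if "l < N" for l using B(3) b that by auto
  have gl: "lin \<Gamma> (regular \<Gamma>) ?Y g"
  proof (rule linI)
    show "g \<gamma> \<in> carrier ?Y" if "\<gamma> \<in> carrier (regular \<Gamma>)" for \<gamma>
      using that H.smult_closed[OF _ stH] by (auto simp: g_def direct_sum_def simp del: H_simps)
    show "g (\<gamma> \<oplus>\<^bsub>regular \<Gamma>\<^esub> \<delta>) = g \<gamma> \<oplus>\<^bsub>?Y\<^esub> g \<delta>" if "\<gamma> \<in> carrier (regular \<Gamma>)" "\<delta> \<in> carrier (regular \<Gamma>)" for \<gamma> \<delta>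
      using that H.smult_l_distr[OF _ _ stH] by (auto simp: g_def direct_sum_def simp del: H_simps intro!: restrict_ext)
    show "g (\<gamma> \<odot>\<^bsub>regular \<Gamma>\<^esub> \<delta>) = \<gamma> \<odot>\<^bsub>?Y\<^esub> g \<delta>" if "\<gamma> \<in> carrier \<Gamma>" "\<delta> \<in> carrier (regular \<Gamma>)" for \<gamma> \<delta>
      using that H.smult_assoc1[OF _ _ stH] by (auto simp: g_def direct_sum_def simp del: H_simps intro!: restrict_ext)
  qed
  have gz: "\<gamma> = \<zero>\<^bsub>\<Gamma>\<^esub>" if \<gamma>: "\<gamma> \<in> carrier \<Gamma>" and z: "g \<gamma> = \<zero>\<^bsub>?Y\<^esub>" for \<gamma>
  proof (rule psi_ext[OF \<gamma> G.A.zero_closed])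
    fix z assume z': "z \<in> carrier E"
    have "st c (\<psi> \<gamma> z) = \<zero>\<^bsub>K\<^esub>" if cB: "c \<in> B" for c
    proof -
      obtain l where l: "l < N" "c = b l" using cB b by auto
      have "\<gamma> \<odot>\<^bsub>H\<^esub> st c = \<zero>\<^bsub>H\<^esub>" using fun_cong[OF z, of l] l by (simp add: g_def direct_sum_def del: H_simps)
      from fun_cong[OF this, of z] show ?thesis using z' by simp
    qed
    then have "(\<Oplus>\<^bsub>underlying_space A E\<^esub>c\<in>B. st c (\<psi> \<gamma> z) \<odot>\<^bsub>underlying_space A E\<^esub> c) = (\<Oplus>\<^bsub>underlying_space A E\<^esub>c\<in>B. \<zero>\<^bsub>underlying_space A E\<^esub>)"
      using B(2) U.smult_l_null by (intro U.M.finsum_cong') (auto simp del: underlying_space_simps(4))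
    then have "\<psi> \<gamma> z = \<zero>\<^bsub>E\<^esub>" using B(4)[OF psi_closed[OF \<gamma> z']] U.M.finsum_zero by simp
    moreover have "\<psi> \<zero>\<^bsub>\<Gamma>\<^esub> z = \<zero>\<^bsub>E\<^esub>"
      using psi_simps(2)[of "\<zero>\<^bsub>\<Gamma>\<^esub>" "\<zero>\<^bsub>\<Gamma>\<^esub>" z] psi_closed[OF G.A.zero_closed z'] z' by simp
    ultimately show "\<psi> \<gamma> z = \<psi> \<zero>\<^bsub>\<Gamma>\<^esub> z" by simp
  qed
  have il: "lin \<Gamma> P (regular \<Gamma>) i" and pl: "lin \<Gamma> (regular \<Gamma>) P p" and pi: "\<And>x. x \<in> carrier P \<Longrightarrow> p (i x) = x"
    using ip by (auto simp: splitting_def lin_of_mod_hom)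
  have "x = \<zero>\<^bsub>P\<^esub>" if "x \<in> carrier P" "g (i x) = \<zero>\<^bsub>?Y\<^esub>" for x
    using gz[OF _ that(2)] lin_closed[OF il that(1)] pi[OF that(1)]
      lin_zero[OF left_module_regular[OF G.A_ring] Pm pl] by simp
  \<comment> \<open>The embedding into a power of \<open>H\<close>, restricted to \<open>P\<close>,
    splits because \<open>P\<close> is injective.\<close>
  then obtain h where h: "lin \<Gamma> ?Y P h" "\<forall>x\<in>carrier P. h (g (i x)) = x"
    using G.inj_ext[OF P(2) Pm P(1) Y lin_comp[OF il gl] lin_id] by blast
  show ?thesis
    by (rule factors_trans_retract[OF Pm G.fg_left_module[OF Y] H_module lin_comp[OF il gl] h(1) _ factors_direct_sum[OF H_module]])
      (use h(2) in blast)
qed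

section \<open>From the endomorphisms of \<open>DE\<close> to the identification\<close>

text \<open>Stated for any copy \<open>Y\<close> of \<open>H\<close>: with \<open>H\<close> itself
  it transports idempotents of \<open>A\<close>, with \<open>P\<close> it provides the inverse of
  \<phi>. Multiplicativity holds because \<open>rmult\<close> and the product of
  \<open>end_op\<close> both reverse the order.\<close>

lemma endo_iso:
  assumes fac: "factors A (regular A) E" "factors A (dual_regular K A) E"
    and Y: "left_module \<Gamma> Y" and v: "lin \<Gamma> Y H v" and u: "lin \<Gamma> H Y u"
    and uv: "\<And>y. y \<in> carrier Y \<Longrightarrow> u (v y) = y" and vu: "\<And>f. f \<in> DE \<Longrightarrow> v (u f) = f"
  shows "(\<lambda>a. \<lambda>y\<in>carrier Y. u (rmult a (v y))) \<in> alg_iso K A (end_op \<Gamma> Y)"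
proof -
  interpret Y: left_module \<Gamma> Y by fact
  let ?S = "end_op \<Gamma> Y"
  interpret S: ring ?S by (rule ring_end_op[OF Y])
  define \<theta> where "\<theta> a = (\<lambda>y\<in>carrier Y. u (rmult a (v y)))" for a
  have ext: "f = g" if "f \<in> carrier ?S" "g \<in> carrier ?S" "\<And>y. y \<in> carrier Y \<Longrightarrow> f y = g y" for f g
    using mod_hom_ext[of f \<Gamma> Y Y g] that by simp
  have c: "\<theta> a \<in> carrier ?S" if "a \<in> carrier A" for a
    using Y.restrict_mod_hom[OF lin_comp[OF lin_comp[OF v rmult_lin[OF that]] u]] by (simp add: \<theta>_def)
  have vc: "v y \<in> DE" if "y \<in> carrier Y" for y using lin_closed[OF v that] by simp
  have uc: "u f \<in> carrier Y" if "f \<in> DE" for f using lin_closed[OF u, of f] that by simp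
  have rc: "rmult a f \<in> DE" if "a \<in> carrier A" "f \<in> DE" for a f using lin_closed[OF rmult_lin[OF that(1)], of f] that by simp
  have ap: "\<theta> a y = u (rmult a (v y))" if "y \<in> carrier Y" for a y using that by (simp add: \<theta>_def)
  have "\<theta> \<in> ring_iso A ?S"
  proof (rule ring_iso_memI)
    fix a b assume ab: "a \<in> carrier A" "b \<in> carrier A"
    show "\<theta> (a \<otimes>\<^bsub>A\<^esub> b) = \<theta> a \<otimes>\<^bsub>?S\<^esub> \<theta> b"
    proof (rule ext[OF c[OF A.A.m_closed[OF ab]] S.m_closed[OF c c]])
      fix y assume y: "y \<in> carrier Y"
      have "rmult (a \<otimes>\<^bsub>A\<^esub> b) (v y) = rmult b (rmult a (v y))"
        using ab E.smult_closed by (auto simp: rmult_def E.smult_assoc1 intro!: restrict_ext)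
      then show "\<theta> (a \<otimes>\<^bsub>A\<^esub> b) y = (\<theta> a \<otimes>\<^bsub>?S\<^esub> \<theta> b) y"
        using y ab vu[OF rc[OF ab(1) vc[OF y]]] uc[OF rc[OF ab(1) vc[OF y]]] by (simp add: ap end_op_apply del: end_op_simps)
    qed (use ab in auto)
    show "\<theta> (a \<oplus>\<^bsub>A\<^esub> b) = \<theta> a \<oplus>\<^bsub>?S\<^esub> \<theta> b"
    proof (rule ext[OF c[OF A.A.a_closed[OF ab]] S.a_closed[OF c c]])
      fix y assume y: "y \<in> carrier Y"
      have "rmult (a \<oplus>\<^bsub>A\<^esub> b) (v y) = rmult a (v y) \<oplus>\<^bsub>H\<^esub> rmult b (v y)"
        using ab E.smult_closed DE_apply(2)[OF vc[OF y]] by (auto simp: rmult_def E.smult_l_distr intro!: restrict_ext)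
      then show "\<theta> (a \<oplus>\<^bsub>A\<^esub> b) y = (\<theta> a \<oplus>\<^bsub>?S\<^esub> \<theta> b) y"
        using y lin_add[OF u] rc[OF ab(1) vc[OF y]] rc[OF ab(2) vc[OF y]] by (simp add: ap end_op_apply del: end_op_simps H_simps(2-))
    qed (use ab in auto)
  next
    have "rmult \<one>\<^bsub>A\<^esub> f = f" if f: "f \<in> DE" for f
      by (rule DE_ext[OF rc[OF A.A.one_closed f] f]) (simp add: rmult_def E.smult_one)
    then show "\<theta> \<one>\<^bsub>A\<^esub> = \<one>\<^bsub>?S\<^esub>" using vc uv by (intro ext c A.A.one_closed S.one_closed) (simp add: ap)
    have "inj_on \<theta> (carrier A)"
    proof (rule inj_onI)
      fix a b assume ab: "a \<in> carrier A" "b \<in> carrier A" and eq: "\<theta> a = \<theta> b"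
      have "rmult a f = rmult b f" if f: "f \<in> DE" for f
        using arg_cong[OF fun_cong[OF eq, of "u f"], of v] vu[OF f] vu[OF rc[OF ab(1) f]] vu[OF rc[OF ab(2) f]] uc[OF f]
        by (simp add: ap)
      then show "a = b" by (rule rmult_inj[OF fac(1) ab])
    qed
    moreover have "\<theta> ` carrier A = carrier ?S"
    proof (intro equalityI subsetI)
      fix b assume b: "b \<in> carrier ?S"
      then have bl: "lin \<Gamma> Y Y b" using lin_of_mod_hom by simp
      obtain a where a: "a \<in> carrier A" "\<forall>f\<in>DE. v (b (u f)) = rmult a f"
        using rmult_surj[OF fac(2) lin_comp[OF lin_comp[OF u bl] v]] by blast
      have "\<theta> a y = b y" if y: "y \<in> carrier Y" for y
        using bspec[OF a(2) vc[OF y], symmetric] y uv[OF y] uv[OF lin_closed[OF bl y]] by (simp add: ap)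
      then have "b = \<theta> a" by (intro ext[OF b c[OF a(1)]]) simp
      then show "b \<in> \<theta> ` carrier A" using a(1) by blast
    qed (use c in blast)
    ultimately show "bij_betw \<theta> (carrier A) (carrier ?S)" by (simp add: bij_betw_def)
  qed (rule c)
  moreover have "\<theta> (k \<odot>\<^bsub>A\<^esub> a) = k \<odot>\<^bsub>?S\<^esub> \<theta> a" if k: "k \<in> carrier K" and a: "a \<in> carrier A" for k a
  proof -
    have "\<theta> (k \<odot>\<^bsub>A\<^esub> a) y = (k \<odot>\<^bsub>\<Gamma>\<^esub> \<one>\<^bsub>\<Gamma>\<^esub>) \<odot>\<^bsub>Y\<^esub> \<theta> a y" if y: "y \<in> carrier Y" for y
    proof -
      have "(k \<odot>\<^bsub>A\<^esub> a) \<odot>\<^bsub>E\<^esub> z = a \<odot>\<^bsub>E\<^esub> ((k \<odot>\<^bsub>A\<^esub> \<one>\<^bsub>A\<^esub>) \<odot>\<^bsub>E\<^esub> z)" if z: "z \<in> carrier E" for z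
        using A.scalar_commutes[OF E.left_module_axioms k a z] E.smult_assoc1[OF A.sc_closed[OF k] a z]
          A.smult_mult_left[of k "\<one>\<^bsub>A\<^esub>" a] k a by simp
      then have "rmult (k \<odot>\<^bsub>A\<^esub> a) (v y) = (k \<odot>\<^bsub>\<Gamma>\<^esub> \<one>\<^bsub>\<Gamma>\<^esub>) \<odot>\<^bsub>H\<^esub> rmult a (v y)"
        using k a A.sc_closed E.smult_closed by (auto simp: rmult_def psi_smult psi_one G.A.one_closed intro!: restrict_ext)
      then show ?thesis using lin_smult[OF u G.sc_closed[OF k]] rc[OF a vc[OF y]] y by (simp add: ap del: H_simps(2-))
    qed
    then show ?thesis by (auto simp: \<theta>_def intro!: restrict_ext)
  qed
  ultimately show ?thesis unfolding \<theta>_def[abs_def] alg_iso_def by blast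
qed

text \<open>If \<open>P\<close> is a copy of \<open>DE\<close>, then \<open>DP\<close> is the double
  dual of \<open>E\<close>. The identification is therefore biduality, and its surjectivity is
  \<open>dual_reflexive\<close>.\<close>

lemma identification_of_iso:
  fixes P :: "('g, 'p) module"
  assumes fac: "factors A (regular A) E" "factors A (dual_regular K A) E" and P: "left_module \<Gamma> P"
    and v: "lin \<Gamma> P H v" and u: "lin \<Gamma> H P u"
    and uv: "\<And>y. y \<in> carrier P \<Longrightarrow> u (v y) = y" and vu: "\<And>f. f \<in> DE \<Longrightarrow> v (u f) = f"
  shows "\<exists>\<phi>. morita_tachikawa_identification K \<Gamma> P A E \<phi>"
proof -
  interpret P: left_module \<Gamma> P by fact
  let ?S = "end_op \<Gamma> P" and ?UP = "underlying_space \<Gamma> P"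
  interpret UP: left_module K ?UP by (rule G.left_module_US[OF P])
  define \<theta> where "\<theta> = (\<lambda>a. \<lambda>y\<in>carrier P. u (rmult a (v y)))"
  have \<theta>: "\<theta> \<in> alg_iso K A ?S" unfolding \<theta>_def by (rule endo_iso[OF fac P v u uv vu])
  then have \<theta>r: "\<theta> \<in> ring_iso A ?S" by (simp add: alg_iso_def)
  note bij = ring_iso_memE(5)[OF \<theta>r]
  define \<phi> where "\<phi> = inv_into (carrier A) \<theta>"
  have \<phi>\<theta>: "\<phi> (\<theta> a) = a" if "a \<in> carrier A" for a
    using that bij by (simp add: \<phi>_def bij_betw_def)
  have \<theta>\<phi>: "\<theta> (\<phi> b) = b" "\<phi> b \<in> carrier A" if "b \<in> carrier ?S" for b
    using that bij by (auto simp: \<phi>_def bij_betw_def f_inv_into_f inv_into_into simp del: end_op_simps)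
  have vc: "v y \<in> DE" if "y \<in> carrier P" for y using lin_closed[OF v that] by simp
  have uc: "u f \<in> carrier P" if "f \<in> DE" for f using lin_closed[OF u, of f] that by simp
  have "\<phi> \<in> alg_iso K ?S A"
    unfolding alg_iso_def
  proof (intro CollectI conjI ballI)
    show "\<phi> \<in> ring_iso ?S A" unfolding \<phi>_def by (rule ring_iso_set_sym[OF A.A_ring \<theta>r])
    fix c b assume c: "c \<in> carrier K" and b: "b \<in> carrier ?S"
    have "\<theta> (c \<odot>\<^bsub>A\<^esub> \<phi> b) = c \<odot>\<^bsub>?S\<^esub> b" using \<theta> c \<theta>\<phi>[OF b] by (simp add: alg_iso_def)
    then show "\<phi> (c \<odot>\<^bsub>?S\<^esub> b) = c \<odot>\<^bsub>A\<^esub> \<phi> b" using \<phi>\<theta>[OF A.smult_closed[OF c \<theta>\<phi>(2)[OF b]]] by simp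
  qed
  \<comment> \<open>Evaluation at \<open>x\<close>, with elements of \<open>P\<close> read as
    functionals on \<open>E\<close> through \<open>v\<close>.\<close>
  define \<tau> where "\<tau> x = (\<lambda>y\<in>carrier P. v y x)" for x
  have \<tau>c: "\<tau> x \<in> mod_hom K ?UP (regular K)" if x: "x \<in> carrier E" for x
  proof -
    have "lin K ?UP (regular K) (\<lambda>y. v y x)"
      using lin_add[OF v] lin_smult[OF v G.sc_closed] x DE_apply[OF vc] E.smult_closed
      by (intro linI) (auto simp: psi_smult psi_one G.A.one_closed)
    then show ?thesis using UP.restrict_mod_hom by (simp add: \<tau>_def)
  qed
  have \<tau>l: "lin ?S (restrict_scalars \<phi> E) (dual_over_end K \<Gamma> P) \<tau>"
  proof (rule linI)
    fix x assume "x \<in> carrier (restrict_scalars \<phi> E)"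
    then have x: "x \<in> carrier E" by simp
    show "\<tau> x \<in> carrier (dual_over_end K \<Gamma> P)" using \<tau>c[OF x] by (simp add: dual_over_end_simps)
    show "\<tau> (x \<oplus>\<^bsub>restrict_scalars \<phi> E\<^esub> y) = \<tau> x \<oplus>\<^bsub>dual_over_end K \<Gamma> P\<^esub> \<tau> y" if "y \<in> carrier (restrict_scalars \<phi> E)" for y
      using x that DE_apply(2)[OF vc] by (auto simp: \<tau>_def dual_over_end_simps intro!: restrict_ext)
    fix b assume b: "b \<in> carrier ?S"
    then have bl: "lin \<Gamma> P P b" using lin_of_mod_hom by simp
    have "v (b y) x = v y (\<phi> b \<odot>\<^bsub>E\<^esub> x)" if y: "y \<in> carrier P" for y
    proof -
      have "b y = u (rmult (\<phi> b) (v y))" using fun_cong[OF \<theta>\<phi>(1)[OF b], of y] y by (simp add: \<theta>_def)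
      then show ?thesis using vu[of "rmult (\<phi> b) (v y)"] lin_closed[OF rmult_lin[OF \<theta>\<phi>(2)[OF b]], of "v y"] vc[OF y] x
        by (simp add: rmult_def)
    qed
    then show "\<tau> (b \<odot>\<^bsub>restrict_scalars \<phi> E\<^esub> x) = b \<odot>\<^bsub>dual_over_end K \<Gamma> P\<^esub> \<tau> x"
      using lin_closed[OF bl] by (auto simp: \<tau>_def dual_over_end_simps intro!: restrict_ext)
  qed
  have "bij_betw \<tau> (carrier E) (carrier (dual_over_end K \<Gamma> P))"
    unfolding bij_betw_def dual_over_end_simps
  proof (intro conjI equalityI subsetI)
    show "inj_on \<tau> (carrier E)"
    proof (rule inj_onI)
      fix x y assume xy: "x \<in> carrier E" "y \<in> carrier E" "\<tau> x = \<tau> y"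
      have "f x = f y" if "f \<in> DE" for f
        using fun_cong[OF xy(3), of "u f"] vu[OF that] uc[OF that] by (simp add: \<tau>_def)
      then show "x = y" by (rule separates[OF xy(1,2)])
    qed
    fix g assume g: "g \<in> mod_hom K ?UP (regular K)"
    obtain x where x: "x \<in> carrier E" "\<forall>f\<in>DE. g (u f) = f x"
      using A.dual_reflexive[OF E lin_comp[OF lin_comp[OF lin_US_H G.lin_US[OF u]] lin_of_mod_hom[OF g]]] by blast
    have "g = \<tau> x"
    proof (rule mod_hom_ext[OF g \<tau>c[OF x(1)]])
      fix y assume "y \<in> carrier ?UP"
      then have y: "y \<in> carrier P" by simp
      show "g y = \<tau> x y" using bspec[OF x(2) vc[OF y]] uv[OF y] y by (simp add: \<tau>_def)
    qed
    then show "g \<in> \<tau> ` carrier E" using x(1) by blast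
  qed (use \<tau>c in blast)
  then have "bij_betw (restrict \<tau> (carrier E)) (carrier (restrict_scalars \<phi> E)) (carrier (dual_over_end K \<Gamma> P))"
    by simp
  moreover have "restrict \<tau> (carrier E) \<in> mod_hom ?S (restrict_scalars \<phi> E) (dual_over_end K \<Gamma> P)"
    using \<tau>l E.smult_closed \<theta>\<phi>(2) by (auto simp: mod_hom_iff lin_def E.M.a_closed simp del: end_op_simps)
  ultimately have "mod_iso ?S (restrict_scalars \<phi> E) (dual_over_end K \<Gamma> P)" unfolding mod_iso_def by blast
  with \<open>\<phi> \<in> alg_iso K ?S A\<close> show ?thesis unfolding morita_tachikawa_identification_def by blast
qed

text \<open>\<open>DE\<close> is projective-injective, and it is a summand of \<open>\<Gamma>\<close> because \<open>A\<close> is basic; hence it is a summand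
  of \<open>P\<close>. Conversely \<open>P\<close> is a summand of \<open>DE\<close> because \<open>E\<close> is basic.\<close>

theorem identification_exists:
  fixes P :: "('g, 'p) module"
  assumes bA: "basic_algebra A" and bE: "basic_module A E" and gc: "generating_cogenerating K A E"
    and P: "maximal_proj_inj_summand \<Gamma> P"
  shows "\<exists>\<phi>. morita_tachikawa_identification K \<Gamma> P A E \<phi>"
proof -
  have Pfg: "fg_module \<Gamma> P" "injective \<Gamma> P" and Ps: "is_summand \<Gamma> P (regular \<Gamma>)"
    and Pmax: "\<And>X :: ('g, 'g) module. fg_module \<Gamma> X \<Longrightarrow> is_summand \<Gamma> X (regular \<Gamma>) \<Longrightarrow> projective \<Gamma> X \<Longrightarrow> injective \<Gamma> X \<Longrightarrow> is_summand \<Gamma> X P"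
    using P unfolding maximal_proj_inj_summand_def by blast+
  note Pm = G.fg_left_module[OF Pfg(1)]
  have Rm: "left_module \<Gamma> (regular \<Gamma>)" by (rule left_module_regular[OF G.A_ring])
  have fac: "factors A (regular A) E" "factors A (dual_regular K A) E"
    using gc left_module_regular[OF A.A_ring] A.fg_left_module[OF A.fg_dual_regular] E.left_module_axioms
    by (auto simp: generating_cogenerating_def intro!: factors_of_in_add)
  note HR = H_factors_regular[OF fac(2)]
  have Hi: "injective \<Gamma> H"
    by (rule G.injective_factors[OF H_module G.fg_left_module[OF G.fg_dual_regular] G.injective_dual_regular
          H_factors_dual_regular[OF fac(1)]])
  \<comment> \<open>The idempotents of the basic module \<open>regular A\<close> are moved to the
    ring \<open>A\<close> and from there, by \<open>endo_iso\<close>, to the endomorphism ring of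
    \<open>H\<close>.\<close>
  obtain n e where "local_idems (end_op A (regular A)) n e"
    using A.basic_local_idems[OF A.fg_regular] bA unfolding basic_algebra_def by blast
  note liA = local_idems_iso[OF ring_end_op[OF left_module_regular[OF A.A_ring]] A.A_ring
      ring_iso_set_sym[OF A.A_ring A.ring_iso_end_op_regular] this]
  have "(\<lambda>a. \<lambda>f\<in>carrier H. rmult a f) \<in> ring_iso A (end_op \<Gamma> H)"
    using endo_iso[OF fac H_module lin_id lin_id] by (simp add: alg_iso_def)
  note liH = local_idems_iso[OF A.A_ring ring_end_op[OF H_module] this liA]
  obtain \<alpha> \<beta> where \<alpha>: "lin \<Gamma> H (regular \<Gamma>) \<alpha>" and \<beta>: "lin \<Gamma> (regular \<Gamma>) H \<beta>" and \<beta>\<alpha>: "\<forall>f\<in>carrier H. \<beta> (\<alpha> f) = f"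
    using G.summand_exchange[OF H_fg H_module Rm liH lin_id lin_id _ HR] by blast
  \<comment> \<open>Maximality of \<open>P\<close> speaks about modules on the type of \<Gamma>
    only, so \<open>H\<close> is replaced by its image in the regular module.\<close>
  let ?X = "(regular \<Gamma>)\<lparr>carrier := \<alpha> ` carrier H\<rparr>"
  have sub: "is_sub \<Gamma> (regular \<Gamma>) (\<alpha> ` carrier H)" by (rule left_module.is_sub_image[OF Rm H_module \<alpha> H.is_sub_carrier])
  have Xfg: "fg_module \<Gamma> ?X" by (rule G.fg_sub[OF G.fg_regular sub])
  have sc: "\<alpha> ` carrier H \<subseteq> carrier (regular \<Gamma>)" using sub by (simp add: is_sub_def)
  have \<alpha>X: "lin \<Gamma> H ?X \<alpha>" using \<alpha> sc by (simp add: lin_sub_cod)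
  have \<beta>X: "lin \<Gamma> ?X H \<beta>" by (rule lin_sub_dom[OF \<beta> sc])
  have \<alpha>\<beta>: "\<alpha> (\<beta> x) = x" if "x \<in> carrier ?X" for x using that \<beta>\<alpha> by auto
  note Xm = G.fg_left_module[OF Xfg]
  have inX: "lin \<Gamma> ?X (regular \<Gamma>) (\<lambda>x. x)" by (rule lin_sub_dom[OF lin_id sc])
  have prX: "lin \<Gamma> (regular \<Gamma>) ?X (\<lambda>x. \<alpha> (\<beta> x))" by (rule lin_comp[OF \<beta> \<alpha>X])
  have "is_summand \<Gamma> ?X (regular \<Gamma>)"
    unfolding is_summand_def splitting_def
  proof (intro exI conjI ballI)
    show "restrict (\<lambda>x. x) (carrier ?X) \<in> mod_hom \<Gamma> ?X (regular \<Gamma>)" by (rule left_module.restrict_mod_hom[OF Xm inX])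
    show "restrict (\<lambda>x. \<alpha> (\<beta> x)) (carrier (regular \<Gamma>)) \<in> mod_hom \<Gamma> (regular \<Gamma>) ?X" by (rule left_module.restrict_mod_hom[OF Rm prX])
    show "restrict (\<lambda>x. \<alpha> (\<beta> x)) (carrier (regular \<Gamma>)) (restrict (\<lambda>x. x) (carrier ?X) x) = x" if "x \<in> carrier ?X" for x
      using that \<alpha>\<beta>[OF that] sc by auto
  qed
  moreover have "projective \<Gamma> ?X"
    by (rule G.projective_factors[OF Xm Rm G.projective_regular factors_retract[OF Xm inX prX \<alpha>\<beta>]])
  moreover have "injective \<Gamma> ?X"
    by (rule G.injective_factors[OF Xm H_module Hi factors_retract[where i = \<beta> and p = \<alpha>, OF Xm \<beta>X \<alpha>X \<alpha>\<beta>]])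
  ultimately have "is_summand \<Gamma> ?X P" by (rule Pmax[OF Xfg])
  then obtain i p where "splitting \<Gamma> ?X P i p" by (auto simp: is_summand_def)
  then have i: "lin \<Gamma> ?X P i" and p: "lin \<Gamma> P ?X p" and pi: "\<And>x. x \<in> carrier ?X \<Longrightarrow> p (i x) = x"
    by (auto simp: splitting_def lin_of_mod_hom)
  define u where "u f = i (\<alpha> f)" for f
  define v where "v y = \<beta> (p y)" for y
  have u: "lin \<Gamma> H P u" and v: "lin \<Gamma> P H v"
    unfolding u_def v_def by (rule lin_comp[OF \<alpha>X i], rule lin_comp[OF p \<beta>X])
  have vu: "v (u f) = f" if "f \<in> DE" for f using that \<beta>\<alpha> pi[of "\<alpha> f"] by (simp add: u_def v_def)
  \<comment> \<open>\<Gamma> is the endomorphism ring of the basic module \<open>E\<close> and also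
    that of its own regular module, so idempotents found for \<open>E\<close> decompose
    \<open>regular \<Gamma>\<close>.\<close>
  obtain n' e' where "local_idems (end_op A E) n' e'" using A.basic_local_idems[OF E bE] by blast
  note liE = local_idems_iso[OF ring_end_op[OF E.left_module_axioms] G.A_ring ring_iso_set_sym[OF G.A_ring psi_iso] this]
  note liR = local_idems_iso[OF G.A_ring ring_end_op[OF Rm] G.ring_iso_end_op_regular liE]
  obtain j q where jq: "splitting \<Gamma> P (regular \<Gamma>) j q" using Ps by (auto simp: is_summand_def)
  then have j: "lin \<Gamma> P (regular \<Gamma>) j" and q: "lin \<Gamma> (regular \<Gamma>) P q" and qj: "\<And>x. x \<in> carrier P \<Longrightarrow> q (j x) = x"
    by (auto simp: splitting_def lin_of_mod_hom)
  obtain u' v' where u': "lin \<Gamma> P H u'" and v': "lin \<Gamma> H P v'" and vu': "\<forall>y\<in>carrier P. v' (u' y) = y"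
    using G.summand_exchange[OF G.fg_regular Pm H_module liR j q qj injective_factors_H[OF Pfg jq]] by blast
  \<comment> \<open>\<open>P\<close> and \<open>H\<close> are retracts of each other. The composite
    \<open>u \<circ> u'\<close> is an injective endomorphism of \<open>P\<close>, hence bijective by
    dimension, so \<open>u\<close> is surjective and \<open>v\<close> is its inverse.\<close>
  have "inj_on (\<lambda>y. u (u' y)) (carrier P)"
  proof (rule inj_on_inverseI[of _ "\<lambda>y. v' (v y)"])
    show "v' (v (u (u' y))) = y" if "y \<in> carrier P" for y
      using vu[of "u' y"] vu' lin_closed[OF u' that] that by simp
  qed
  then have "(\<lambda>y. u (u' y)) ` carrier P = carrier P"
    using G.inj_endo_bij[OF Pfg(1) lin_comp[OF u' u]] by (simp add: bij_betw_def)
  then have uv: "u (v y) = y" if y: "y \<in> carrier P" for y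
  proof -
    obtain z where z: "z \<in> carrier P" "y = u (u' z)" using y \<open>_ = carrier P\<close> by (metis imageE)
    then show ?thesis using vu[of "u' z"] lin_closed[OF u' z(1)] by simp
  qed
  show ?thesis by (rule identification_of_iso[OF fac Pm v u uv vu])
qed

end

section \<open>The intermediate extensions of \<open>E\<close>\<close>

text \<open>Existence of an identification belongs to the conclusion, so that the claim about all
  \<phi> is not vacuous. The isomorphisms hold for every \<phi>, since each comes with some
  isomorphism of \<open>E\<close> with \<open>DP\<close>.\<close>

theorem theorem3:
  fixes K :: "'k ring"
    and A :: "('k, 'a) module" and E :: "('a, 'e) module"
    and \<Gamma> :: "('k, 'g) module" and P :: "('g, 'p) module"
    and T :: "('g, 't) module" and C :: "('g, 'c) module"
    and k :: nat
  assumes "fd_algebra K A" and "basic_algebra A"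
    and "fg_module A E" and "basic_module A E" and "generating_cogenerating K A E"
    and "fd_algebra K \<Gamma>" and "alg_iso K \<Gamma> (end_op A E) \<noteq> {}"
    and "0 < k" and "enat k < domdim \<Gamma>"
    and "maximal_proj_inj_summand \<Gamma> P"
    and "shifted_module \<Gamma> k P T" and "splitting \<Gamma> P T i p"
    and "coshifted_module K \<Gamma> k P C" and "splitting \<Gamma> P C j q"
  shows "(\<exists>\<phi>. morita_tachikawa_identification K \<Gamma> P A E \<phi>) \<and>
    (\<forall>\<phi>. morita_tachikawa_identification K \<Gamma> P A E \<phi> \<longrightarrow>
       mod_iso (end_op \<Gamma> T) (shifted_extension \<Gamma> P T i p \<phi> E) (dual_over_end K \<Gamma> T) \<and>
       mod_iso (end_op \<Gamma> C) (shifted_extension \<Gamma> P C j q \<phi> E) (dual_over_end K \<Gamma> C))"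
proof (intro conjI allI impI)
  obtain \<psi> where "\<psi> \<in> alg_iso K \<Gamma> (end_op A E)" using assms(7) by blast
  then interpret end_algebra K A \<Gamma> E \<psi>
    using assms by (intro end_algebra.intro end_algebra_axioms.intro)
  show "\<exists>\<phi>. morita_tachikawa_identification K \<Gamma> P A E \<phi>" by (rule identification_exists) fact+
  have P: "fg_module \<Gamma> P" "projective \<Gamma> P" "injective \<Gamma> P"
    using assms(10) by (auto simp: maximal_proj_inj_summand_def)
  have T: "special_tilting \<Gamma> k P T" and C: "special_cotilting K \<Gamma> k P C"
    using assms(11,13) by (auto simp: shifted_module_def coshifted_module_def)
  note gc = G.special_generated_cogenerated[OF P T C assms(8,9)]
  have Tm: "left_module \<Gamma> T" and Cm: "left_module \<Gamma> C"
    using T C G.fg_left_module by (auto simp: special_tilting_def special_cotilting_def k_tilting_def k_cotilting_def)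
  fix \<phi> assume id: "morita_tachikawa_identification K \<Gamma> P A E \<phi>"
  then obtain \<theta> where \<theta>: "\<theta> \<in> mod_hom (end_op \<Gamma> P) (restrict_scalars \<phi> E) (dual_over_end K \<Gamma> P)"
    "bij_betw \<theta> (carrier E) (mod_hom K (underlying_space \<Gamma> P) (regular K))"
    by (auto simp: morita_tachikawa_identification_def mod_iso_def dual_over_end_simps)
  have \<phi>: "\<phi> b \<in> carrier A" if "b \<in> mod_hom \<Gamma> P P" for b
    using id ring_iso_memE(1)[of \<phi> "end_op \<Gamma> P" A b] that by (simp add: morita_tachikawa_identification_def alg_iso_def)
  \<comment> \<open>The corner argument is set up once for a variable module and splitting, and then
    applied to \<open>T\<close> and to \<open>C\<close>.\<close>
  note crn = corner_setup.intro[OF assms(6) G.fg_left_module[OF P(1)] _ E.left_module_axioms corner_setup_axioms.intro[OF _ \<phi> \<theta>]]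
  show "mod_iso (end_op \<Gamma> T) (shifted_extension \<Gamma> P T i p \<phi> E) (dual_over_end K \<Gamma> T)"
    by (rule corner_setup.intermediate_extension_iso[OF crn[OF Tm assms(12)] gc(1,2)])
  show "mod_iso (end_op \<Gamma> C) (shifted_extension \<Gamma> P C j q \<phi> E) (dual_over_end K \<Gamma> C)"
    by (rule corner_setup.intermediate_extension_iso[OF crn[OF Cm assms(14)] gc(3,4)])
qed

end
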